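(* Let $k$ be an algebraically closed field, and let $R$ be a commutative affine (i.e. finitely generated) $k$-algebra, graded by an abelian group $G$. Let $c: G\times G\to k^\times$ be an alternating bicharacter, and let $A=R'$ be the twist of $R$ by $c$, with twist map $r\mapsto r'$. Assume that either $-1\notin\langle \operatorname{im} c\rangle$ (the subgroup of $k^\times$ generated by the image of $c$) or $\operatorname{char} k=2$. Choose homogeneous $k$-algebra generators $r_1,\dots,r_n$ of $R$, and let $H=\operatorname{Hom}(G,k^\times)$, and $\operatorname{spec}_w R$, $\max_w R$, $\operatorname{prim}_w A$, $c_w$, $\operatorname{rad}(c_w)^\perp$ (for $w\subseteq\{1,\dots,n\}$) be as defined in the context. Then there exist $H$-equivariant topological quotient maps $$\phi_s:\operatorname{spec} R\twoheadrightarrow \operatorname{spec} A\qquad\text{and}\qquad \phi_m:\max R\twoheadrightarrow \operatorname{prim} A$$ such that, for every $w\subseteq\{1,\dots,n\}$, both maps are given by $P\mapsto (P:\operatorname{rad}(c_w)^\perp)'$ for $P\in\operatorname{spec}_w R$ (respectively $P\in \max_w R$). Alternatively, for every $P\in\operatorname{spec}R$, $\phi_s(P)$ is the largest ideal of $A$ contained in $P'=\{r'\mid r\in P\}$. Moreover, for every $w\subseteq\{1,\dots,n\}$, the fibres of $\phi_m$ over points in $\operatorname{prim}_w A$ are precisely the $\operatorname{rad}(c_w)^\perp$-orbits in $\max_w R$.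
   Context: Alternating bicharacter: a map $c:G\times G\to k^\times$ that is multiplicative in each variable and satisfies $c(x,x)=1$ (hence $c(y,x)=c(x,y)^{-1}$) for all $x,y\in G$. Twist: $R'$ is a $G$-graded vector space copy of $R$, with a $G$-graded $k$-linear isomorphism $R\to R'$, $r\mapsto r'$ (the twist map), made into a $G$-graded associative $k$-algebra by $r's'=c(\alpha,\beta)(rs)'$ for $r\in R_\alpha$, $s\in R_\beta$, $\alpha,\beta\in G$. For a subset $X\subseteq R$, $X'=\{r'\mid r\in X\}$. Strata: with $r_1,\dots,r_n$ homogeneous $k$-algebra generators of $R$ and $a_i=r_i'\in A$, for $w\subseteq\{1,\dots,n\}$ set $\operatorname{spec}_w R=\{P\in\operatorname{spec}R\mid r_i\in P\iff i\in w\}$, $\operatorname{spec}_w A=\{P\in\operatorname{spec}A\mid a_i\in P\iff i\in w\}$, $\max_w R=\max R\cap\operatorname{spec}_w R$, $\operatorname{prim}_w A=\operatorname{prim}A\cap\operatorname{spec}_w A$ (some of these may be empty). Group action: $H=\operatorname{Hom}(G,k^\times)$, an abelian group under pointwise multiplication, acts on $R$ and on $A$ by $k$-algebra automorphisms via $h.r=h(x)r$ and $h.a=h(x)a$ for $h\in H$, $r\in R_x$, $a\in A_x$, $x\in G$; this induces actions on $\operatorname{spec}R$, $\operatorname{spec}A$, $\max R$, $\operatorname{prim}A$. Radicals and orthogonals: let $\delta_i\in G$ be the degree of $r_i$, $G_w=\sum_{i\notin w}\mathbb{Z}\delta_i$, and $c_w$ the restriction of $c$ to $G_w\times G_w$.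 Then $\operatorname{rad}(c_w)=\{x\in G_w\mid c(x,y)=1\text{ for all }y\in G_w\}$, and for $S\subseteq G$, $S^\perp=\{h\in H\mid h(s)=1\text{ for all }s\in S\}$, a subgroup of $H$. For an ideal $P$ and a group $T$ of automorphisms, $(P:T)=\bigcap_{t\in T}t(P)$. Here $\operatorname{spec}$, $\max$, $\operatorname{prim}$ denote the sets of prime, maximal, and primitive ideals (annihilators of irreducible modules), with Zariski topologies: closed sets in $\operatorname{spec}A$ are those of the form $\{P\mid P\supseteq I\}$ for ideals $I$, and $\max$, $\operatorname{prim}$ carry the relative topologies. A topological quotient map is a surjective map $\phi:X\to Y$ such that $C\subseteq Y$ is closed if and only if $\phi^{-1}(C)$ is closed in $X$. *)

theory Defs
  imports
    "HOL-Analysis.Abstract_Topology"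
    "HOL-Algebra.Algebra"
begin

section \<open>Prime and primitive ideals of a possibly noncommutative ring\<close>

definition prime_ideal :: "'a set \<Rightarrow> ('a, 'b) ring_scheme \<Rightarrow> bool" where
  "prime_ideal P A \<longleftrightarrow> ideal P A \<and> P \<noteq> carrier A \<and>
     (\<forall>I J. ideal I A \<longrightarrow> ideal J A \<longrightarrow> ideal_prod A I J \<subseteq> P \<longrightarrow> I \<subseteq> P \<or> J \<subseteq> P)"

definition spec :: "('a, 'b) ring_scheme \<Rightarrow> 'a set set" where
  "spec A = {P. prime_ideal P A}"

definition max_spec :: "('a, 'b) ring_scheme \<Rightarrow> 'a set set" where
  "max_spec A = {P. maximalideal P A}"

text \<open>
  The library locale \<open>module\<close> only covers commutative rings of scalars. Its
  companion \<open>submodule\<close> has no such restriction and is used below as it is.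
\<close>

locale left_module = A?: ring A + M?: abelian_group M
    for A :: "('a, 'b) ring_scheme" (structure) and M :: "('a, 'm, 'd) module_scheme" (structure) +
  assumes smult_closed:
      "\<lbrakk>a \<in> carrier A; x \<in> carrier M\<rbrakk> \<Longrightarrow> a \<odot>\<^bsub>M\<^esub> x \<in> carrier M"
    and smult_l_distr:
      "\<lbrakk>a \<in> carrier A; b \<in> carrier A; x \<in> carrier M\<rbrakk> \<Longrightarrow>
        (a \<oplus>\<^bsub>A\<^esub> b) \<odot>\<^bsub>M\<^esub> x = a \<odot>\<^bsub>M\<^esub> x \<oplus>\<^bsub>M\<^esub> b \<odot>\<^bsub>M\<^esub> x"
    and smult_r_distr:
      "\<lbrakk>a \<in> carrier A; x \<in> carrier M; y \<in> carrier M\<rbrakk> \<Longrightarrow>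
        a \<odot>\<^bsub>M\<^esub> (x \<oplus>\<^bsub>M\<^esub> y) = a \<odot>\<^bsub>M\<^esub> x \<oplus>\<^bsub>M\<^esub> a \<odot>\<^bsub>M\<^esub> y"
    and smult_assoc:
      "\<lbrakk>a \<in> carrier A; b \<in> carrier A; x \<in> carrier M\<rbrakk> \<Longrightarrow>
        (a \<otimes>\<^bsub>A\<^esub> b) \<odot>\<^bsub>M\<^esub> x = a \<odot>\<^bsub>M\<^esub> (b \<odot>\<^bsub>M\<^esub> x)"
    and smult_one:
      "x \<in> carrier M \<Longrightarrow> \<one>\<^bsub>A\<^esub> \<odot>\<^bsub>M\<^esub> x = x"

definition irreducible_module ::
    "('a, 'b) ring_scheme \<Rightarrow> ('a, 'm, 'd) module_scheme \<Rightarrow> bool" where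
  "irreducible_module A M \<longleftrightarrow> left_module A M \<and> carrier M \<noteq> {\<zero>\<^bsub>M\<^esub>} \<and>
     (\<forall>N. submodule N A M \<longrightarrow> N = {\<zero>\<^bsub>M\<^esub>} \<or> N = carrier M)"

definition annihilator ::
    "('a, 'b) ring_scheme \<Rightarrow> ('a, 'm, 'd) module_scheme \<Rightarrow> 'a set" where
  "annihilator A M = {a \<in> carrier A. \<forall>x\<in>carrier M. a \<odot>\<^bsub>M\<^esub> x = \<zero>\<^bsub>M\<^esub>}"

text \<open>
  A definition cannot quantify over all types, so the irreducible module ranges over modules
  whose elements have type \<^typ>\<open>'a set\<close>. This is no restriction: every irreducible module is
  cyclic, hence isomorphic to one of that kind (lemma \<open>annihilator_in_prim\<close>).
\<close>

definition prim :: "('a, 'b) ring_scheme \<Rightarrow> 'a set set" where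
  "prim A = {P. \<exists>M :: ('a, 'a set) module. irreducible_module A M \<and> P = annihilator A M}"

text \<open>
  The open sets are the complements in \<^term>\<open>spec A\<close> of the sets of primes containing a given
  ideal; lemma \<open>closedin_zariski\<close> confirms that this is a topology.
\<close>

definition zariski :: "('a, 'b) ring_scheme \<Rightarrow> 'a set topology" where
  "zariski A = topology (\<lambda>U. \<exists>I. ideal I A \<and> U = {P \<in> spec A. \<not> I \<subseteq> P})"

definition zariski_max :: "('a, 'b) ring_scheme \<Rightarrow> 'a set topology" where
  "zariski_max A = subtopology (zariski A) (max_spec A)"

definition zariski_prim :: "('a, 'b) ring_scheme \<Rightarrow> 'a set topology" where
  "zariski_prim A = subtopology (zariski A) (prim A)"


section \<open>Algebras, gradings, bicharacters and twists\<close>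

text \<open>The library locale \<open>algebra\<close> is restricted to commutative algebras.\<close>

locale assoc_algebra = module K A + ring A
    for K :: "('k, 'l) ring_scheme" (structure) and A :: "('k, 'a, 'd) module_scheme" (structure) +
  assumes smult_mult_left:
      "\<lbrakk>k \<in> carrier K; a \<in> carrier A; b \<in> carrier A\<rbrakk> \<Longrightarrow>
        (k \<odot>\<^bsub>A\<^esub> a) \<otimes>\<^bsub>A\<^esub> b = k \<odot>\<^bsub>A\<^esub> (a \<otimes>\<^bsub>A\<^esub> b)"
    and smult_mult_right:
      "\<lbrakk>k \<in> carrier K; a \<in> carrier A; b \<in> carrier A\<rbrakk> \<Longrightarrow>
        a \<otimes>\<^bsub>A\<^esub> (k \<odot>\<^bsub>A\<^esub> b) = k \<odot>\<^bsub>A\<^esub> (a \<otimes>\<^bsub>A\<^esub> b)"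

definition algebra_generated ::
    "('k, 'l) ring_scheme \<Rightarrow> ('k, 'r, 'd) module_scheme \<Rightarrow> 'r set \<Rightarrow> 'r set" where
  "algebra_generated K R Z = \<Inter>{S. subring S R \<and> submodule S K R \<and> Z \<subseteq> S}"

text \<open>
  A family \<open>f\<close> of homogeneous elements, finitely many of them nonzero, with sum \<open>m\<close>. Outside
  the carrier of the grading group \<open>f\<close> vanishes, so that \<open>\<exists>!f\<close> is meaningful.
\<close>

definition homogeneous_decomposition ::
    "('g, 'h) monoid_scheme \<Rightarrow> ('r, 'd) ring_scheme \<Rightarrow> ('g \<Rightarrow> 'r set) \<Rightarrow> 'r \<Rightarrow> ('g \<Rightarrow> 'r) \<Rightarrow> bool"
  where
  "homogeneous_decomposition G R \<G> m f \<longleftrightarrow>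
     (\<forall>x\<in>carrier G. f x \<in> \<G> x) \<and> (\<forall>x. x \<notin> carrier G \<longrightarrow> f x = \<zero>\<^bsub>R\<^esub>) \<and>
     finite {x. f x \<noteq> \<zero>\<^bsub>R\<^esub>} \<and> m = finsum R f {x. f x \<noteq> \<zero>\<^bsub>R\<^esub>}"

definition graded_by ::
    "('g, 'h) monoid_scheme \<Rightarrow> ('k, 'l) ring_scheme \<Rightarrow> ('k, 'r, 'd) module_scheme
      \<Rightarrow> ('g \<Rightarrow> 'r set) \<Rightarrow> bool" where
  "graded_by G K R \<G> \<longleftrightarrow>
     (\<forall>x\<in>carrier G. submodule (\<G> x) K R) \<and>
     (\<forall>m\<in>carrier R. \<exists>!f. homogeneous_decomposition G R \<G> m f) \<and>
     (\<forall>x\<in>carrier G. \<forall>y\<in>carrier G. \<forall>a\<in>\<G> x. \<forall>b\<in>\<G> y. a \<otimes>\<^bsub>R\<^esub> b \<in> \<G> (x \<otimes>\<^bsub>G\<^esub> y))"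

definition component ::
    "('g, 'h) monoid_scheme \<Rightarrow> ('r, 'd) ring_scheme \<Rightarrow> ('g \<Rightarrow> 'r set) \<Rightarrow> 'r \<Rightarrow> 'g \<Rightarrow> 'r" where
  "component G R \<G> m = (THE f. homogeneous_decomposition G R \<G> m f)"

definition alternating_bicharacter ::
    "('g, 'h) monoid_scheme \<Rightarrow> ('k, 'l) ring_scheme \<Rightarrow> ('g \<Rightarrow> 'g \<Rightarrow> 'k) \<Rightarrow> bool" where
  "alternating_bicharacter G K c \<longleftrightarrow>
     (\<forall>x\<in>carrier G. \<forall>y\<in>carrier G. c x y \<in> Units K) \<and>
     (\<forall>x\<in>carrier G. \<forall>y\<in>carrier G. \<forall>z\<in>carrier G.
        c (x \<otimes>\<^bsub>G\<^esub> y) z = c x z \<otimes>\<^bsub>K\<^esub> c y z \<and> c x (y \<otimes>\<^bsub>G\<^esub> z) = c x y \<otimes>\<^bsub>K\<^esub> c x z) \<and>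
     (\<forall>x\<in>carrier G. c x x = \<one>\<^bsub>K\<^esub>)"

text \<open>
  \<open>A\<close> is the twist of \<open>R\<close> by \<open>c\<close>, and \<open>\<tau>\<close> is the twist map \<open>r \<mapsto> r'\<close>. The algebra \<open>A\<close> is
  graded by the subspaces \<open>\<tau> ` \<G> x\<close>.
\<close>

definition is_twist ::
    "('g, 'h) monoid_scheme \<Rightarrow> ('k, 'l) ring_scheme \<Rightarrow> ('k, 'r, 'd) module_scheme
      \<Rightarrow> ('g \<Rightarrow> 'r set) \<Rightarrow> ('g \<Rightarrow> 'g \<Rightarrow> 'k) \<Rightarrow> ('k, 'a, 'e) module_scheme \<Rightarrow> ('r \<Rightarrow> 'a) \<Rightarrow> bool"
  where
  "is_twist G K R \<G> c A \<tau> \<longleftrightarrow> assoc_algebra K A \<and>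
     bij_betw \<tau> (carrier R) (carrier A) \<and>
     (\<forall>r\<in>carrier R. \<forall>s\<in>carrier R. \<tau> (r \<oplus>\<^bsub>R\<^esub> s) = \<tau> r \<oplus>\<^bsub>A\<^esub> \<tau> s) \<and>
     (\<forall>k\<in>carrier K. \<forall>r\<in>carrier R. \<tau> (k \<odot>\<^bsub>R\<^esub> r) = k \<odot>\<^bsub>A\<^esub> \<tau> r) \<and>
     (\<forall>x\<in>carrier G. \<forall>y\<in>carrier G. \<forall>r\<in>\<G> x. \<forall>s\<in>\<G> y.
        \<tau> r \<otimes>\<^bsub>A\<^esub> \<tau> s = c x y \<odot>\<^bsub>A\<^esub> \<tau> (r \<otimes>\<^bsub>R\<^esub> s))"

text \<open>The library's \<open>ord\<close> of an element of infinite order is \<open>0\<close>.\<close>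

definition ring_char :: "('k, 'l) ring_scheme \<Rightarrow> nat" where
  "ring_char K = group.ord (add_monoid K) \<one>\<^bsub>K\<^esub>"


section \<open>Characters and their action\<close>

definition chars :: "('g, 'h) monoid_scheme \<Rightarrow> ('k, 'l) ring_scheme \<Rightarrow> ('g \<Rightarrow> 'k) set" where
  "chars G K = hom G (units_of K)"

text \<open>\<open>m = \<Sum>\<^sub>x m\<^sub>x\<close> is sent to \<open>\<Sum>\<^sub>x h(x) m\<^sub>x\<close>.\<close>

definition char_act ::
    "('g, 'h) monoid_scheme \<Rightarrow> ('k, 'r, 'd) module_scheme \<Rightarrow> ('g \<Rightarrow> 'r set)
      \<Rightarrow> ('g \<Rightarrow> 'k) \<Rightarrow> 'r \<Rightarrow> 'r" where
  "char_act G R \<G> h m =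
     finsum R (\<lambda>x. h x \<odot>\<^bsub>R\<^esub> component G R \<G> m x) {x. component G R \<G> m x \<noteq> \<zero>\<^bsub>R\<^esub>}"

definition char_orbit ::
    "('g, 'h) monoid_scheme \<Rightarrow> ('k, 'r, 'd) module_scheme \<Rightarrow> ('g \<Rightarrow> 'r set)
      \<Rightarrow> ('g \<Rightarrow> 'k) set \<Rightarrow> 'r set \<Rightarrow> 'r set set" where
  "char_orbit G R \<G> T P = {char_act G R \<G> h ` P | h. h \<in> T}"

text \<open>The ideal \<open>(P : T)\<close>.\<close>

definition char_core ::
    "('g, 'h) monoid_scheme \<Rightarrow> ('k, 'r, 'd) module_scheme \<Rightarrow> ('g \<Rightarrow> 'r set)
      \<Rightarrow> 'r set \<Rightarrow> ('g \<Rightarrow> 'k) set \<Rightarrow> 'r set" where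
  "char_core G R \<G> P T = (\<Inter>h\<in>T. char_act G R \<G> h ` P)"

definition perp ::
    "('g, 'h) monoid_scheme \<Rightarrow> ('k, 'l) ring_scheme \<Rightarrow> 'g set \<Rightarrow> ('g \<Rightarrow> 'k) set" where
  "perp G K S = {h \<in> chars G K. \<forall>s\<in>S. h s = \<one>\<^bsub>K\<^esub>}"


section \<open>Strata\<close>

definition spec_stratum ::
    "('a, 'b) ring_scheme \<Rightarrow> nat \<Rightarrow> (nat \<Rightarrow> 'a) \<Rightarrow> nat set \<Rightarrow> 'a set set" where
  "spec_stratum A n a w = {P \<in> spec A. \<forall>i\<in>{1..n}. a i \<in> P \<longleftrightarrow> i \<in> w}"

definition max_stratum ::
    "('a, 'b) ring_scheme \<Rightarrow> nat \<Rightarrow> (nat \<Rightarrow> 'a) \<Rightarrow> nat set \<Rightarrow> 'a set set" where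
  "max_stratum A n a w = max_spec A \<inter> spec_stratum A n a w"

definition prim_stratum ::
    "('a, 'b) ring_scheme \<Rightarrow> nat \<Rightarrow> (nat \<Rightarrow> 'a) \<Rightarrow> nat set \<Rightarrow> 'a set set" where
  "prim_stratum A n a w = prim A \<inter> spec_stratum A n a w"

text \<open>The subgroup \<open>G\<^sub>w\<close>, and the radical of the restriction of \<open>c\<close> to it.\<close>

definition stratum_group ::
    "('g, 'h) monoid_scheme \<Rightarrow> nat \<Rightarrow> (nat \<Rightarrow> 'g) \<Rightarrow> nat set \<Rightarrow> 'g set" where
  "stratum_group G n \<delta> w = generate G (\<delta> ` ({1..n} - w))"

definition stratum_rad ::
    "('g, 'h) monoid_scheme \<Rightarrow> ('k, 'l) ring_scheme \<Rightarrow> ('g \<Rightarrow> 'g \<Rightarrow> 'k)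
      \<Rightarrow> nat \<Rightarrow> (nat \<Rightarrow> 'g) \<Rightarrow> nat set \<Rightarrow> 'g set" where
  "stratum_rad G K c n \<delta> w =
     {x \<in> stratum_group G n \<delta> w. \<forall>y\<in>stratum_group G n \<delta> w. c x y = \<one>\<^bsub>K\<^esub>}"


section \<open>The definitions agree with the usual descriptions\<close>

lemma (in cring) prime_ideal_iff: "prime_ideal P R \<longleftrightarrow> primeideal P R"
proof
  assume P: "prime_ideal P R"
  then have id: "ideal P R" and ne: "carrier R \<noteq> P"
    and pr: "\<And>I J. ideal I R \<Longrightarrow> ideal J R \<Longrightarrow> ideal_prod R I J \<subseteq> P \<Longrightarrow> I \<subseteq> P \<or> J \<subseteq> P"
    unfolding prime_ideal_def by auto
  interpret P: ideal P R by (rule id)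
  show "primeideal P R"
  proof (rule primeidealI[OF id cring_axioms ne])
    fix a b assume ab: "a \<in> carrier R" "b \<in> carrier R" "a \<otimes> b \<in> P"
    have "ideal_prod R (PIdl a) (PIdl b) \<subseteq> P"
    proof
      fix s assume "s \<in> ideal_prod R (PIdl a) (PIdl b)"
      then show "s \<in> P"
      proof induction
        case (prod i j)
        then obtain x y where xy: "x \<in> carrier R" "y \<in> carrier R" "i = x \<otimes> a" "j = y \<otimes> b"
          unfolding cgenideal_def by auto
        have "i \<otimes> j = (x \<otimes> y) \<otimes> (a \<otimes> b)"
          using xy ab by (simp add: m_ac)
        then show ?case using xy ab by (simp add: P.I_l_closed)
      qed (rule P.a_closed)
    qed
    then have "PIdl a \<subseteq> P \<or> PIdl b \<subseteq> P"
      by (rule pr[OF cgenideal_ideal[OF ab(1)] cgenideal_ideal[OF ab(2)]])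
    then show "a \<in> P \<or> b \<in> P"
      using cgenideal_self ab by blast
  qed
next
  assume "primeideal P R"
  then interpret P: primeideal P R .
  show "prime_ideal P R"
    unfolding prime_ideal_def
  proof (intro conjI allI impI)
    show "P \<noteq> carrier R" using P.I_notcarr by blast
    fix I J assume I: "ideal I R" and J: "ideal J R" and sub: "ideal_prod R I J \<subseteq> P"
    show "I \<subseteq> P \<or> J \<subseteq> P"
    proof (rule ccontr)
      assume "\<not> (I \<subseteq> P \<or> J \<subseteq> P)"
      then obtain i j where ij: "i \<in> I" "i \<notin> P" "j \<in> J" "j \<notin> P" by blast
      then have "i \<otimes> j \<in> P" using sub ideal_prod.prod[of i I j J R] by blast
      then show False
        using P.I_prime ij ideal.Icarr[OF I] ideal.Icarr[OF J] by blast
    qed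
  qed (rule P.ideal_axioms)
qed

lemma (in cring) spec_commutative: "spec R = {P. primeideal P R}"
  unfolding spec_def by (simp add: prime_ideal_iff)

lemma (in ring) istopology_zariski:
  "istopology (\<lambda>U. \<exists>I. ideal I R \<and> U = {P \<in> spec R. \<not> I \<subseteq> P})"
  unfolding istopology_def
proof (intro conjI allI impI)
  fix S T
  assume "\<exists>I. ideal I R \<and> S = {P \<in> spec R. \<not> I \<subseteq> P}"
    and "\<exists>I. ideal I R \<and> T = {P \<in> spec R. \<not> I \<subseteq> P}"
  then obtain I J where I: "ideal I R" "S = {P \<in> spec R. \<not> I \<subseteq> P}"
    and J: "ideal J R" "T = {P \<in> spec R. \<not> J \<subseteq> P}" by auto
  have iff: "ideal_prod R I J \<subseteq> P \<longleftrightarrow> I \<subseteq> P \<or> J \<subseteq> P" if P: "P \<in> spec R" for P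
  proof
    assume "ideal_prod R I J \<subseteq> P"
    then show "I \<subseteq> P \<or> J \<subseteq> P"
      using P I(1) J(1) unfolding spec_def prime_ideal_def by simp
  next
    assume "I \<subseteq> P \<or> J \<subseteq> P"
    then have "I \<inter> J \<subseteq> P" by auto
    then show "ideal_prod R I J \<subseteq> P"
      using ideal_prod_inter[OF I(1) J(1)] by (rule subset_trans[rotated])
  qed
  have "S \<inter> T = {P \<in> spec R. \<not> ideal_prod R I J \<subseteq> P}"
    unfolding I(2) J(2) using iff by auto
  with ideal_prod_is_ideal[OF I(1) J(1)]
  have "ideal (ideal_prod R I J) R \<and> S \<inter> T = {P \<in> spec R. \<not> ideal_prod R I J \<subseteq> P}" ..
  then show "\<exists>I. ideal I R \<and> S \<inter> T = {P \<in> spec R. \<not> I \<subseteq> P}" by (rule exI)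
next
  fix \<U> assume "\<forall>U\<in>\<U>. \<exists>I. ideal I R \<and> U = {P \<in> spec R. \<not> I \<subseteq> P}"
  from bchoice[OF this] obtain F
    where F: "\<forall>U\<in>\<U>. ideal (F U) R \<and> U = {P \<in> spec R. \<not> F U \<subseteq> P}" ..
  have mem: "P \<in> U \<longleftrightarrow> P \<in> spec R \<and> \<not> F U \<subseteq> P" if "U \<in> \<U>" for U P
  proof -
    have "U = {P \<in> spec R. \<not> F U \<subseteq> P}" using F that by simp
    from arg_cong[OF this, of "(\<in>) P"] show ?thesis by simp
  qed
  let ?J = "\<Union>U\<in>\<U>. F U"
  have sub: "?J \<subseteq> carrier R"
  proof
    fix a assume "a \<in> ?J"
    then obtain U where "U \<in> \<U>" "a \<in> F U" by blast
    then show "a \<in> carrier R" using F ideal.Icarr by metis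
  qed
  have Idl: "Idl ?J \<subseteq> P \<longleftrightarrow> ?J \<subseteq> P" if "P \<in> spec R" for P
    using that Idl_subset_ideal[OF _ sub] unfolding spec_def prime_ideal_def by simp
  have "\<Union>\<U> = {P \<in> spec R. \<not> Idl ?J \<subseteq> P}"
  proof (rule Set.set_eqI)
    fix P
    have "P \<in> \<Union>\<U> \<longleftrightarrow> (\<exists>U\<in>\<U>. P \<in> spec R \<and> \<not> F U \<subseteq> P)"
      using mem by (simp add: Union_iff)
    also have "\<dots> \<longleftrightarrow> P \<in> spec R \<and> \<not> ?J \<subseteq> P"
      by (simp add: UN_subset_iff)
    also have "\<dots> \<longleftrightarrow> P \<in> {P \<in> spec R. \<not> Idl ?J \<subseteq> P}"
      using Idl by auto
    finally show "P \<in> \<Union>\<U> \<longleftrightarrow> P \<in> {P \<in> spec R. \<not> Idl ?J \<subseteq> P}" .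
  qed
  then show "\<exists>I. ideal I R \<and> \<Union>\<U> = {P \<in> spec R. \<not> I \<subseteq> P}"
    using genideal_ideal[OF sub] by (intro exI[of _ "Idl ?J"]) simp
qed

lemma (in ring) openin_zariski:
  "openin (zariski R) U \<longleftrightarrow> (\<exists>I. ideal I R \<and> U = {P \<in> spec R. \<not> I \<subseteq> P})"
  unfolding zariski_def by (simp add: topology_inverse'[OF istopology_zariski])

lemma (in ring) topspace_zariski: "topspace (zariski R) = spec R"
proof
  show "topspace (zariski R) \<subseteq> spec R"
    unfolding topspace_def openin_zariski by auto
  have ncarr: "\<not> carrier R \<subseteq> P" if P: "P \<in> spec R" for P
  proof
    assume "carrier R \<subseteq> P"
    moreover have id: "ideal P R" and ne: "P \<noteq> carrier R"
      using P unfolding spec_def prime_ideal_def by auto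
    moreover have "P \<subseteq> carrier R"
      using additive_subgroup.a_subset[OF ideal.axioms(1)[OF id]] .
    ultimately show False by simp
  qed
  have "spec R = {P \<in> spec R. \<not> carrier R \<subseteq> P}"
    using ncarr by auto
  with oneideal have "ideal (carrier R) R \<and> spec R = {P \<in> spec R. \<not> carrier R \<subseteq> P}" ..
  then have "openin (zariski R) (spec R)"
    unfolding openin_zariski by (rule exI)
  then show "spec R \<subseteq> topspace (zariski R)" by (rule openin_subset)
qed

lemma (in ring) closedin_zariski:
  "closedin (zariski R) C \<longleftrightarrow> (\<exists>I. ideal I R \<and> C = {P \<in> spec R. I \<subseteq> P})"
proof
  assume "closedin (zariski R) C"
  then obtain I where sub: "C \<subseteq> spec R" and I: "ideal I R"
    and eq: "spec R - C = {P \<in> spec R. \<not> I \<subseteq> P}"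
    unfolding closedin_def topspace_zariski openin_zariski by auto
  have "C = spec R - (spec R - C)" using sub by (simp add: double_diff)
  also have "\<dots> = {P \<in> spec R. I \<subseteq> P}" unfolding eq by auto
  finally show "\<exists>I. ideal I R \<and> C = {P \<in> spec R. I \<subseteq> P}" using I by (intro exI conjI)
next
  assume "\<exists>I. ideal I R \<and> C = {P \<in> spec R. I \<subseteq> P}"
  then obtain I where I: "ideal I R" and C: "C = {P \<in> spec R. I \<subseteq> P}" by auto
  have "spec R - C = {P \<in> spec R. \<not> I \<subseteq> P}" unfolding C by auto
  with I have "ideal I R \<and> spec R - C = {P \<in> spec R. \<not> I \<subseteq> P}" ..
  then have "openin (zariski R) (spec R - C)" unfolding openin_zariski by (rule exI)
  then show "closedin (zariski R) C" unfolding closedin_def topspace_zariski C by simp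
qed

lemma annihilator_in_prim:
  fixes A :: "('a, 'b) ring_scheme" and M :: "('a, 'm, 'd) module_scheme"
  assumes irr: "irreducible_module A M"
  shows "annihilator A M \<in> prim A"
proof -
  interpret left_module A M using irr unfolding irreducible_module_def by blast
  have nz: "carrier M \<noteq> {\<zero>\<^bsub>M\<^esub>}"
    and simple: "\<And>N. submodule N A M \<Longrightarrow> N = {\<zero>\<^bsub>M\<^esub>} \<or> N = carrier M"
    using irr unfolding irreducible_module_def by blast+
  obtain m where m: "m \<in> carrier M" "m \<noteq> \<zero>\<^bsub>M\<^esub>" using nz M.zero_closed by blast
  have smult_zero: "a \<odot>\<^bsub>M\<^esub> \<zero>\<^bsub>M\<^esub> = \<zero>\<^bsub>M\<^esub>" if "a \<in> carrier A" for a
  proof -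
    have "a \<odot>\<^bsub>M\<^esub> \<zero>\<^bsub>M\<^esub> \<oplus>\<^bsub>M\<^esub> a \<odot>\<^bsub>M\<^esub> \<zero>\<^bsub>M\<^esub> = a \<odot>\<^bsub>M\<^esub> \<zero>\<^bsub>M\<^esub> \<oplus>\<^bsub>M\<^esub> \<zero>\<^bsub>M\<^esub>"
      using smult_r_distr[OF that M.zero_closed M.zero_closed] smult_closed[OF that M.zero_closed]
      by simp
    then show ?thesis using smult_closed[OF that M.zero_closed] by (metis M.add.l_cancel M.zero_closed)
  qed
  have zero_smult: "\<zero>\<^bsub>A\<^esub> \<odot>\<^bsub>M\<^esub> x = \<zero>\<^bsub>M\<^esub>" if "x \<in> carrier M" for x
  proof -
    have "\<zero>\<^bsub>A\<^esub> \<odot>\<^bsub>M\<^esub> x \<oplus>\<^bsub>M\<^esub> \<zero>\<^bsub>A\<^esub> \<odot>\<^bsub>M\<^esub> x = \<zero>\<^bsub>A\<^esub> \<odot>\<^bsub>M\<^esub> x \<oplus>\<^bsub>M\<^esub> \<zero>\<^bsub>M\<^esub>"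
      using smult_l_distr[OF A.zero_closed A.zero_closed that] smult_closed[OF A.zero_closed that]
      by simp
    then show ?thesis using smult_closed[OF A.zero_closed that] by (metis M.add.l_cancel M.zero_closed)
  qed
  let ?N = "(\<lambda>a. a \<odot>\<^bsub>M\<^esub> m) ` carrier A"
  have neg: "inv\<^bsub>add_monoid M\<^esub> (a \<odot>\<^bsub>M\<^esub> m) = (\<ominus>\<^bsub>A\<^esub> a) \<odot>\<^bsub>M\<^esub> m" if a: "a \<in> carrier A" for a
  proof -
    have "(\<ominus>\<^bsub>A\<^esub> a) \<odot>\<^bsub>M\<^esub> m \<oplus>\<^bsub>M\<^esub> a \<odot>\<^bsub>M\<^esub> m = \<zero>\<^bsub>M\<^esub>"
      using smult_l_distr[of "\<ominus>\<^bsub>A\<^esub> a" a m] a m zero_smult by (simp add: A.l_neg)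
    then show ?thesis
      using M.minus_equality smult_closed m a by (metis A.a_inv_closed a_inv_def)
  qed
  have "submodule ?N A M"
  proof (intro submodule.intro subgroup.intro submodule_axioms.intro)
    show "?N \<subseteq> carrier (add_monoid M)" using smult_closed m by auto
    show "\<one>\<^bsub>add_monoid M\<^esub> \<in> ?N" using zero_smult m by (force intro: image_eqI[of _ _ "\<zero>\<^bsub>A\<^esub>"])
    show "x \<otimes>\<^bsub>add_monoid M\<^esub> y \<in> ?N" if xy: "x \<in> ?N" "y \<in> ?N" for x y
    proof -
      obtain a b where "a \<in> carrier A" "x = a \<odot>\<^bsub>M\<^esub> m" "b \<in> carrier A" "y = b \<odot>\<^bsub>M\<^esub> m"
        using xy by blast
      then show ?thesis
        using smult_l_distr[of a b m] m by (auto intro!: image_eqI[of _ _ "a \<oplus>\<^bsub>A\<^esub> b"])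
    qed
    show "inv\<^bsub>add_monoid M\<^esub> x \<in> ?N" if "x \<in> ?N" for x
      using that neg by auto
    show "a \<odot>\<^bsub>M\<^esub> x \<in> ?N" if ax: "a \<in> carrier A" "x \<in> ?N" for a x
    proof -
      obtain b where "b \<in> carrier A" "x = b \<odot>\<^bsub>M\<^esub> m" using ax by blast
      then show ?thesis
        using smult_assoc[of a b m] m ax by (auto intro!: image_eqI[of _ _ "a \<otimes>\<^bsub>A\<^esub> b"])
    qed
  qed
  moreover have "m \<in> ?N" using smult_one[OF m(1)] by (force intro: image_eqI[of _ _ "\<one>\<^bsub>A\<^esub>"])
  ultimately have cyc: "?N = carrier M" using simple m by blast
  define f where "f x = {a \<in> carrier A. a \<odot>\<^bsub>M\<^esub> m = x}" for x
  define g where "g = inv_into (carrier M) f"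
  have inj: "inj_on f (carrier M)"
  proof (rule inj_onI)
    fix x y assume "x \<in> carrier M" "y \<in> carrier M" and fxy: "f x = f y"
    then obtain a where "a \<in> carrier A" "x = a \<odot>\<^bsub>M\<^esub> m" using cyc by blast
    then show "x = y" using fxy unfolding f_def by blast
  qed
  have gf [simp]: "g (f x) = x" if "x \<in> carrier M" for x
    unfolding g_def using inj that by (rule inv_into_f_f)
  have f_eq [simp]: "f x = f y \<longleftrightarrow> x = y" if "x \<in> carrier M" "y \<in> carrier M" for x y
    using inj that by (rule inj_on_eq_iff)
  define M' :: "('a, 'a set) module" where
    "M' = \<lparr>carrier = f ` carrier M, monoid.mult = (\<lambda>_ _. {}), monoid.one = {}, ring.zero = f \<zero>\<^bsub>M\<^esub>,
           ring.add = (\<lambda>Z Y. f (g Z \<oplus>\<^bsub>M\<^esub> g Y)), smult = (\<lambda>a Z. f (a \<odot>\<^bsub>M\<^esub> g Z))\<rparr>"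
  have [simp]: "carrier M' = f ` carrier M" "\<zero>\<^bsub>M'\<^esub> = f \<zero>\<^bsub>M\<^esub>"
      "Z \<oplus>\<^bsub>M'\<^esub> Y = f (g Z \<oplus>\<^bsub>M\<^esub> g Y)" "a \<odot>\<^bsub>M'\<^esub> Z = f (a \<odot>\<^bsub>M\<^esub> g Z)" for Z Y a
    unfolding M'_def by simp_all
  have "abelian_group M'"
  proof (rule abelian_groupI)
    fix Z assume "Z \<in> carrier M'"
    then obtain x where x: "x \<in> carrier M" "Z = f x" by auto
    show "\<exists>Y\<in>carrier M'. Y \<oplus>\<^bsub>M'\<^esub> Z = \<zero>\<^bsub>M'\<^esub>"
      using x by (intro bexI[of _ "f (\<ominus>\<^bsub>M\<^esub> x)"]) (auto simp: M.l_neg)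
  qed (auto simp: M.a_ac)
  then interpret M': abelian_group M' .
  have lm': "left_module A M'"
  proof (intro left_module.intro left_module_axioms.intro)
  qed (auto simp: A.ring_axioms M'.abelian_group_axioms smult_closed smult_l_distr
         smult_r_distr smult_assoc smult_one)
  have "irreducible_module A M'"
    unfolding irreducible_module_def
  proof (intro conjI allI impI lm')
    show "carrier M' \<noteq> {\<zero>\<^bsub>M'\<^esub>}"
    proof
      assume "carrier M' = {\<zero>\<^bsub>M'\<^esub>}"
      moreover have "f m \<in> f ` carrier M" using m(1) by (rule imageI)
      ultimately have "f m = f \<zero>\<^bsub>M\<^esub>" by simp
      then show False using m by simp
    qed
    fix N' assume "submodule N' A M'"
    then interpret N': submodule N' A M' .
    have N'sub: "N' \<subseteq> f ` carrier M" using N'.subset by simp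
    have inv': "inv\<^bsub>add_monoid M'\<^esub> (f x) = f (\<ominus>\<^bsub>M\<^esub> x)" if x: "x \<in> carrier M" for x
    proof -
      have "f (\<ominus>\<^bsub>M\<^esub> x) \<oplus>\<^bsub>M'\<^esub> f x = \<zero>\<^bsub>M'\<^esub>" using x by (simp add: M.l_neg)
      then show ?thesis using M'.minus_equality[of "f (\<ominus>\<^bsub>M\<^esub> x)" "f x"] x by (simp add: a_inv_def)
    qed
    let ?N = "{x \<in> carrier M. f x \<in> N'}"
    have "submodule ?N A M"
    proof (intro submodule.intro subgroup.intro submodule_axioms.intro)
      show "\<one>\<^bsub>add_monoid M\<^esub> \<in> ?N" using N'.one_closed by simp
      show "x \<otimes>\<^bsub>add_monoid M\<^esub> y \<in> ?N" if "x \<in> ?N" "y \<in> ?N" for x y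
        using that N'.m_closed[of "f x" "f y"] by auto
      show "inv\<^bsub>add_monoid M\<^esub> x \<in> ?N" if "x \<in> ?N" for x
        using that N'.m_inv_closed[of "f x"] inv'[of x] by (auto simp flip: a_inv_def)
      show "a \<odot>\<^bsub>M\<^esub> x \<in> ?N" if "a \<in> carrier A" "x \<in> ?N" for a x
        using that N'.smult_closed[of a "f x"] smult_closed by auto
    qed auto
    then have "?N = {\<zero>\<^bsub>M\<^esub>} \<or> ?N = carrier M" by (rule simple)
    moreover have "N' = f ` ?N" using N'sub by blast
    ultimately show "N' = {\<zero>\<^bsub>M'\<^esub>} \<or> N' = carrier M'" by (metis (no_types, lifting)
      \<open>\<zero>\<^bsub>M'\<^esub> = f \<zero>\<^bsub>M\<^esub>\<close> \<open>carrier M' = f ` carrier M\<close> image_empty image_insert)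
  qed
  moreover have "annihilator A M = annihilator A M'"
    unfolding annihilator_def by (auto simp: smult_closed)
  ultimately show ?thesis unfolding prim_def by blast
qed

lemma char_act_homogeneous:
  fixes K :: "('k, 'l) ring_scheme" and R :: "('k, 'r, 'd) module_scheme"
  assumes R: "algebra K R" and gr: "graded_by G K R \<G>"
    and h: "h \<in> chars G K" and x: "x \<in> carrier G" and r: "r \<in> \<G> x"
  shows "char_act G R \<G> h r = h x \<odot>\<^bsub>R\<^esub> r"
proof -
  interpret algebra K R by (rule R)
  have sub: "submodule (\<G> y) K R" if "y \<in> carrier G" for y
    using gr that unfolding graded_by_def by blast
  have zero: "\<zero>\<^bsub>R\<^esub> \<in> \<G> y" if "y \<in> carrier G" for y
    using subgroup.one_closed[OF submodule.axioms(1)[OF sub[OF that]]] by simp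
  have rc: "r \<in> carrier R"
    using subgroup.subset[OF submodule.axioms(1)[OF sub[OF x]]] r by auto
  have hx: "h x \<in> carrier K"
    using h x unfolding chars_def hom_def units_of_def by auto
  let ?f = "\<lambda>y. if y = x then r else \<zero>\<^bsub>R\<^esub>"
  have supp: "{y. ?f y \<noteq> \<zero>\<^bsub>R\<^esub>} = (if r = \<zero>\<^bsub>R\<^esub> then {} else {x})" by auto
  have "homogeneous_decomposition G R \<G> r ?f"
    unfolding homogeneous_decomposition_def supp using x r rc zero by auto
  moreover have "\<exists>!f. homogeneous_decomposition G R \<G> r f"
    using gr rc unfolding graded_by_def by blast
  ultimately have "component G R \<G> r = ?f"
    unfolding component_def by (rule the1_equality[rotated])
  then show ?thesis
    unfolding char_act_def using rc hx by (simp add: supp)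
qed

end

theory Submission
  imports Defs
begin

text \<open>
  Fix \<open>w\<close>, and call \<open>x\<close>, \<open>y\<close> in \<open>G\<close> equivalent if \<open>c(x, -)\<close> and \<open>c(y, -)\<close> agree on \<open>G\<^sub>w\<close>. Elements
  whose degrees lie in one class multiply in \<open>A\<close> as in \<open>R\<close> up to a scalar, modulo a prime of the
  stratum, and elements with degrees outside \<open>G\<^sub>w\<close> lie in every such prime. By linear independence of
  characters, \<open>(P : rad(c\<^sub>w)\<^sup>\<bottom>)\<close> consists of the elements all of whose parts over the classes lie in
  \<open>P\<close>. It is the largest ideal of \<open>A\<close> inside \<open>P'\<close>, and it is prime. Conversely, a prime \<open>Q\<close> of \<open>A\<close>
  is an ideal of \<open>R\<close>, and an ideal of \<open>R\<close> over \<open>Q\<close> that is maximal with respect to avoiding the elements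
  outside \<open>Q\<close> with degrees in one class of \<open>G\<^sub>w\<close> is mapped to \<open>Q\<close>.

  Let \<open>u\<close> be the product of the \<open>r\<^sub>i\<close> with \<open>i \<notin> w\<close>. If \<open>Q\<close> annihilates a simple module, then the
  endomorphisms of that module are scalars (generic flatness), so any two elements with degrees in one
  class are proportional modulo \<open>Q\<close>, and a maximal ideal of \<open>R\<close> over \<open>Q\<close> lies over \<open>Q\<close> in the stratum
  as soon as it avoids \<open>u\<close>. It is found by adjoining \<open>u - \<mu>\<close> to \<open>Q\<close> for a suitable \<open>\<mu> \<noteq> 0\<close>, and in the
  same way a left ideal \<open>A(u' - \<mu>) + Q\<close> shows that the image of a maximal ideal is primitive.
\<close>

section \<open>Fields, characters and maximal left ideals\<close>

text \<open>Ideals of \<open>A\<close> are handled as subsets of \<open>R\<close> along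
  \<open>\<tau>\<close>, so that one set can be tested against both multiplications. Homogeneous
  elements of degrees x and y commute in \<open>A\<close> up to c(x, y)^2, hence a two-sided ideal
  of \<open>A\<close> sees only squares of values of c; the hypothesis on -1 ensures that squares
  separate the same degrees. What is extracted from an ideal in this way carries a monomial in the
  \<open>r i\<close> with i outside w as a denominator, and primes of the stratum cancel it because
  they contain no such monomial. The degrees of these monomials form only a submonoid of G_w, so
  elements of G_w are written as differences of them throughout.

  The constant \<mu> depends on the degree y of u: if s > 0 is least with y^s equivalent to the
  identity, then u^s is congruent to a scalar and \<mu> is an s-th root of it; if there is no such
  s, then \<mu> = 1.\<close>

lemma (in algebraically_closed) exists_root:
  assumes "set (a # p) \<subseteq> carrier L" "a \<noteq> \<zero>" "p \<noteq> []"
  shows "\<exists>x\<in>carrier L. eval (a # p) x = \<zero>"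
proof -
  have P: "a # p \<in> carrier (poly_ring L)"
    using assms by (auto simp: univ_poly_def polynomial_def)
  have "size (roots (a # p)) \<noteq> 0"
    using roots_over_carrier[OF P] assms(3) unfolding splitted_def by simp
  then obtain x where "x \<in># roots (a # p)"
    by (metis multiset_nonemptyE size_empty)
  then have "is_root (a # p) x" using roots_mem_iff_is_root[OF P] by simp
  then show ?thesis unfolding is_root_def by blast
qed

lemma (in ring) eval_replicate_zero:
  "set q \<subseteq> carrier R \<Longrightarrow> x \<in> carrier R \<Longrightarrow> eval (replicate m \<zero> @ q) x = eval q x"
  by (induction m) (auto simp: eval_in_carrier)

lemma (in algebraically_closed) exists_nth_root:
  assumes y: "y \<in> carrier L" "y \<noteq> \<zero>" and n: "n > 0"
  shows "\<exists>x\<in>carrier L. x \<noteq> \<zero> \<and> x [^] (n::nat) = y"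
proof -
  \<comment> \<open>Coefficient lists for \<open>eval\<close> start with the leading coefficient, so
    \<open>\<one> # ?q\<close> is the polynomial X^n - y.\<close>
  let ?q = "replicate (n - 1) \<zero> @ [\<ominus> y]"
  have "set ?q \<subseteq> carrier L" using y by (auto simp: set_replicate_conv_if)
  then have "\<exists>x\<in>carrier L. eval (\<one> # ?q) x = \<zero>" by (intro exists_root) auto
  then obtain x where x: "x \<in> carrier L" "eval (\<one> # ?q) x = \<zero>" by blast
  have "eval (\<one> # ?q) x = x [^] n \<oplus> eval ?q x"
    using x n by simp
  also have "eval ?q x = \<ominus> y" using x y by (subst eval_replicate_zero) auto
  finally have "x [^] n = y" using x y by (metis a_inv_closed minus_equality minus_minus nat_pow_closed)
  moreover have "x \<noteq> \<zero>" using calculation y n by (metis nat_pow_zero neq0_conv)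
  ultimately show ?thesis using x by blast
qed

text \<open>The graph of a homomorphism on a submonoid of \<open>G\<close>. It is stated for
  submonoids because the data to be extended in \<open>same_core_orbit\<close> are indexed by
  monomials, whose degrees are closed under products only; inverses are gained from
  maximality.\<close>

definition pairs_functional ::
    "('g, 'h) monoid_scheme \<Rightarrow> ('u, 'v) monoid_scheme \<Rightarrow> ('g \<times> 'u) set \<Rightarrow> bool" where
  "pairs_functional G U M \<longleftrightarrow> M \<subseteq> carrier G \<times> carrier U \<and> (\<one>\<^bsub>G\<^esub>, \<one>\<^bsub>U\<^esub>) \<in> M \<and>
     (\<forall>x y x' y'. (x, y) \<in> M \<longrightarrow> (x', y') \<in> M \<longrightarrow> (x \<otimes>\<^bsub>G\<^esub> x', y \<otimes>\<^bsub>U\<^esub> y') \<in> M) \<and>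
     (\<forall>x y y'. (x, y) \<in> M \<longrightarrow> (x, y') \<in> M \<longrightarrow> y = y')"

text \<open>Divisible groups are injective, in a form that starts from a partial homomorphism given on
  a submonoid.\<close>

lemma hom_extension_divisible:
  assumes G: "comm_group G" and U: "comm_group U"
    and div: "\<And>u n. u \<in> carrier U \<Longrightarrow> n > 0 \<Longrightarrow> \<exists>v\<in>carrier U. v [^]\<^bsub>U\<^esub> (n::nat) = u"
    and M0: "pairs_functional G U M0"
  shows "\<exists>h\<in>hom G U. \<forall>(x, y)\<in>M0. h x = y"
proof -
  interpret G: comm_group G by (rule G)
  interpret U: comm_group U by (rule U)
  let ?A = "{M. pairs_functional G U M \<and> M0 \<subseteq> M}"
  have "\<exists>M\<in>(?A). \<forall>Z\<in>(?A). M \<subseteq> Z \<longrightarrow> Z = M"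
  proof (rule subset_Zorn_nonempty)
    show "?A \<noteq> {}" using M0 by blast
    fix C assume C: "C \<noteq> {}" and ch: "subset.chain ?A C"
    have CA: "\<And>M. M \<in> C \<Longrightarrow> pairs_functional G U M \<and> M0 \<subseteq> M"
      using ch unfolding subset_chain_def by auto
    have two: "\<exists>M\<in>C. p \<in> M \<and> q \<in> M" if pq: "p \<in> \<Union>C" "q \<in> \<Union>C" for p q
    proof -
      obtain M M' where M: "M \<in> C" "p \<in> M" "M' \<in> C" "q \<in> M'" using pq by (elim UnionE)
      then have "M \<subseteq> M' \<or> M' \<subseteq> M" using ch unfolding subset_chain_def by simp
      then show ?thesis using M by (metis subsetD)
    qed
    show "\<Union>C \<in> ?A"
      unfolding mem_Collect_eq pairs_functional_def
    proof (intro conjI allI impI)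
      show "\<Union>C \<subseteq> carrier G \<times> carrier U" using CA unfolding pairs_functional_def by blast
      show "(\<one>\<^bsub>G\<^esub>, \<one>\<^bsub>U\<^esub>) \<in> \<Union>C" using CA C unfolding pairs_functional_def by blast
      show "M0 \<subseteq> \<Union>C" using CA C by blast
    next
      fix x y x' y' assume "(x, y) \<in> \<Union>C" "(x', y') \<in> \<Union>C"
      then obtain M where "M \<in> C" "(x, y) \<in> M" "(x', y') \<in> M" using two by blast
      then show "(x \<otimes>\<^bsub>G\<^esub> x', y \<otimes>\<^bsub>U\<^esub> y') \<in> \<Union>C" using CA unfolding pairs_functional_def by blast
    next
      fix x y y' assume "(x, y) \<in> \<Union>C" "(x, y') \<in> \<Union>C"
      then obtain M where "M \<in> C" "(x, y) \<in> M" "(x, y') \<in> M" using two by blast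
      then show "y = y'" using CA unfolding pairs_functional_def by blast
    qed
  qed
  then obtain M where MA: "M \<in> ?A" and maxA: "\<forall>Z\<in>?A. M \<subseteq> Z \<longrightarrow> Z = M"
    by (elim bexE)
  have M: "pairs_functional G U M" and M0M: "M0 \<subseteq> M" using MA by auto
  have max: "Z = M" if "pairs_functional G U Z" "M \<subseteq> Z" for Z
    using maxA that M0M by (metis (no_types, lifting) mem_Collect_eq subset_trans)
  have Mcar: "x \<in> carrier G" "y \<in> carrier U" if "(x, y) \<in> M" for x y
    using M that unfolding pairs_functional_def by blast+
  have M1: "(\<one>\<^bsub>G\<^esub>, \<one>\<^bsub>U\<^esub>) \<in> M" using M unfolding pairs_functional_def by blast
  have Mm: "(x \<otimes>\<^bsub>G\<^esub> x', y \<otimes>\<^bsub>U\<^esub> y') \<in> M" if "(x, y) \<in> M" "(x', y') \<in> M" for x y x' y'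
    using M that unfolding pairs_functional_def by blast
  have Mf: "y = y'" if "(x, y) \<in> M" "(x, y') \<in> M" for x y y'
    using M that unfolding pairs_functional_def by blast
  have Minv: "(inv\<^bsub>G\<^esub> x, inv\<^bsub>U\<^esub> y) \<in> M" if xy: "(x, y) \<in> M" for x y
  proof -
    \<comment> \<open>Quotients of pairs again form such a graph, since two representations of one
      element can be cross-multiplied inside \<open>M\<close>. By maximality the quotients already
      belong to \<open>M\<close>.\<close>
    let ?X = "{(a \<otimes>\<^bsub>G\<^esub> inv\<^bsub>G\<^esub> b, s \<otimes>\<^bsub>U\<^esub> inv\<^bsub>U\<^esub> t) | a b s t. (a, s) \<in> M \<and> (b, t) \<in> M}"
    have "pairs_functional G U ?X"
      unfolding pairs_functional_def
    proof (intro conjI allI impI)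
      show "?X \<subseteq> carrier G \<times> carrier U" using Mcar by blast
      show "(\<one>\<^bsub>G\<^esub>, \<one>\<^bsub>U\<^esub>) \<in> ?X" using M1 by force
    next
      fix x y x' y' assume "(x, y) \<in> ?X" "(x', y') \<in> ?X"
      then obtain a b s t a' b' s' t' where
        e: "x = a \<otimes>\<^bsub>G\<^esub> inv\<^bsub>G\<^esub> b" "y = s \<otimes>\<^bsub>U\<^esub> inv\<^bsub>U\<^esub> t" "x' = a' \<otimes>\<^bsub>G\<^esub> inv\<^bsub>G\<^esub> b'" "y' = s' \<otimes>\<^bsub>U\<^esub> inv\<^bsub>U\<^esub> t'"
        and m: "(a, s) \<in> M" "(b, t) \<in> M" "(a', s') \<in> M" "(b', t') \<in> M" by blast
      have "x \<otimes>\<^bsub>G\<^esub> x' = (a \<otimes>\<^bsub>G\<^esub> a') \<otimes>\<^bsub>G\<^esub> inv\<^bsub>G\<^esub> (b \<otimes>\<^bsub>G\<^esub> b')"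
        "y \<otimes>\<^bsub>U\<^esub> y' = (s \<otimes>\<^bsub>U\<^esub> s') \<otimes>\<^bsub>U\<^esub> inv\<^bsub>U\<^esub> (t \<otimes>\<^bsub>U\<^esub> t')"
        unfolding e using m[THEN Mcar(1)] m[THEN Mcar(2)]
        by (simp_all add: G.inv_mult U.inv_mult G.m_ac U.m_ac)
      then show "(x \<otimes>\<^bsub>G\<^esub> x', y \<otimes>\<^bsub>U\<^esub> y') \<in> ?X" using Mm m by blast
    next
      fix x y y' assume "(x, y) \<in> ?X" "(x, y') \<in> ?X"
      then obtain a b s t a' b' s' t' where
        e: "x = a \<otimes>\<^bsub>G\<^esub> inv\<^bsub>G\<^esub> b" "y = s \<otimes>\<^bsub>U\<^esub> inv\<^bsub>U\<^esub> t" "x = a' \<otimes>\<^bsub>G\<^esub> inv\<^bsub>G\<^esub> b'" "y' = s' \<otimes>\<^bsub>U\<^esub> inv\<^bsub>U\<^esub> t'"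
        and m: "(a, s) \<in> M" "(b, t) \<in> M" "(a', s') \<in> M" "(b', t') \<in> M" by blast
      note mc = m[THEN Mcar(1)] m[THEN Mcar(2)]
      have xc: "x \<in> carrier G" "y \<in> carrier U" "y' \<in> carrier U" using e mc by auto
      have a: "a = x \<otimes>\<^bsub>G\<^esub> b" using mc unfolding e(1) by (simp add: G.m_assoc)
      have a': "a' = x \<otimes>\<^bsub>G\<^esub> b'" using mc unfolding e(3) by (simp add: G.m_assoc)
      have s: "s = y \<otimes>\<^bsub>U\<^esub> t" using mc unfolding e(2) by (simp add: U.m_assoc)
      have s': "s' = y' \<otimes>\<^bsub>U\<^esub> t'" using mc unfolding e(4) by (simp add: U.m_assoc)
      have "a \<otimes>\<^bsub>G\<^esub> b' = a' \<otimes>\<^bsub>G\<^esub> b"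
        unfolding a a' using mc xc by (simp add: G.m_ac)
      then have "s \<otimes>\<^bsub>U\<^esub> t' = s' \<otimes>\<^bsub>U\<^esub> t"
        using Mm[OF m(1,4)] Mm[OF m(3,2)] Mf by metis
      then have "y \<otimes>\<^bsub>U\<^esub> (t \<otimes>\<^bsub>U\<^esub> t') = y' \<otimes>\<^bsub>U\<^esub> (t \<otimes>\<^bsub>U\<^esub> t')"
        unfolding s s' using mc xc by (simp add: U.m_ac)
      then show "y = y'" by (rule U.r_cancel) (use mc xc in simp_all)
    qed
    moreover have "M \<subseteq> ?X"
    proof
      fix p assume p: "p \<in> M"
      obtain a s where "p = (a, s)" by fastforce
      with p have "p = (a \<otimes>\<^bsub>G\<^esub> inv\<^bsub>G\<^esub> \<one>\<^bsub>G\<^esub>, s \<otimes>\<^bsub>U\<^esub> inv\<^bsub>U\<^esub> \<one>\<^bsub>U\<^esub>)" "(a, s) \<in> M" using Mcar by auto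
      then show "p \<in> ?X" using M1 by blast
    qed
    ultimately have "?X = M" by (rule max)
    moreover have "(inv\<^bsub>G\<^esub> x, inv\<^bsub>U\<^esub> y) = (\<one>\<^bsub>G\<^esub> \<otimes>\<^bsub>G\<^esub> inv\<^bsub>G\<^esub> x, \<one>\<^bsub>U\<^esub> \<otimes>\<^bsub>U\<^esub> inv\<^bsub>U\<^esub> y)"
      using Mcar[OF xy] by auto
    ultimately show ?thesis using M1 xy by blast
  qed
  have Mpow: "(x [^]\<^bsub>G\<^esub> n, y [^]\<^bsub>U\<^esub> n) \<in> M" if "(x, y) \<in> M" for x y and n :: nat
    by (induction n) (use that M1 Mm in auto)
  have total: "\<exists>y. (x, y) \<in> M" if x: "x \<in> carrier G" for x
  proof -
    \<comment> \<open>The value at x has to agree with every power of x that already has one. If m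
      is the least positive exponent with x^m in the domain, all such exponents are multiples of m
      and an m-th root of the value at x^m works; if there is no such m, y = 1 works.\<close>
    obtain y where y: "y \<in> carrier U" and comp: "\<And>d e. (x [^]\<^bsub>G\<^esub> (d::nat), e) \<in> M \<Longrightarrow> y [^]\<^bsub>U\<^esub> d = e"
    proof (cases "\<exists>m::nat. m > 0 \<and> (\<exists>b. (x [^]\<^bsub>G\<^esub> m, b) \<in> M)")
      case True
      define m :: nat where "m = (LEAST m. m > 0 \<and> (\<exists>b. (x [^]\<^bsub>G\<^esub> m, b) \<in> M))"
      have m0: "m > 0" and "\<exists>b. (x [^]\<^bsub>G\<^esub> m, b) \<in> M"
        using LeastI_ex[OF True] unfolding m_def by auto
      then obtain b where b: "(x [^]\<^bsub>G\<^esub> m, b) \<in> M" by blast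
      have least: "m \<le> k" if "k > 0" "(x [^]\<^bsub>G\<^esub> k, e) \<in> M" for k :: nat and e
        unfolding m_def using that by (intro Least_le) blast
      obtain y where y: "y \<in> carrier U" "y [^]\<^bsub>U\<^esub> m = b" using div[OF Mcar(2)[OF b] m0] by blast
      have "y [^]\<^bsub>U\<^esub> d = e" if de: "(x [^]\<^bsub>G\<^esub> d, e) \<in> M" for d :: nat and e
      proof -
        let ?q = "d div m" and ?r = "d mod m"
        have d: "d = m * ?q + ?r" by simp
        have q: "(x [^]\<^bsub>G\<^esub> (m * ?q), b [^]\<^bsub>U\<^esub> ?q) \<in> M"
          using Mpow[OF b, of ?q] x by (simp add: G.nat_pow_pow)
        have xd: "x [^]\<^bsub>G\<^esub> d = x [^]\<^bsub>G\<^esub> (m * ?q) \<otimes>\<^bsub>G\<^esub> x [^]\<^bsub>G\<^esub> ?r"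
          using x d G.nat_pow_mult by metis
        have "(x [^]\<^bsub>G\<^esub> d \<otimes>\<^bsub>G\<^esub> inv\<^bsub>G\<^esub> (x [^]\<^bsub>G\<^esub> (m * ?q)), e \<otimes>\<^bsub>U\<^esub> inv\<^bsub>U\<^esub> (b [^]\<^bsub>U\<^esub> ?q)) \<in> M"
          using Mm[OF de Minv[OF q]] .
        moreover have "x [^]\<^bsub>G\<^esub> d \<otimes>\<^bsub>G\<^esub> inv\<^bsub>G\<^esub> (x [^]\<^bsub>G\<^esub> (m * ?q)) = x [^]\<^bsub>G\<^esub> ?r"
          unfolding xd using x by (simp add: G.m_ac G.r_inv)
        ultimately have "\<not> ?r > 0" using least[of ?r] m0 mod_less_divisor[OF m0, of d] by fastforce
        then have d: "d = m * ?q" using d by simp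
        have "e = b [^]\<^bsub>U\<^esub> ?q" using de q d Mf by metis
        then show ?thesis using d y U.nat_pow_pow by metis
      qed
      with y show ?thesis using that by blast
    next
      case False
      have "\<one>\<^bsub>U\<^esub> [^]\<^bsub>U\<^esub> d = e" if "(x [^]\<^bsub>G\<^esub> d, e) \<in> M" for d :: nat and e
      proof -
        have d: "d = 0" using False that by (metis neq0_conv)
        then have "(\<one>\<^bsub>G\<^esub>, e) \<in> M" using that by simp
        then show ?thesis using d Mf[OF M1] by simp
      qed
      then show ?thesis by (rule that[OF U.one_closed])
    qed
    \<comment> \<open>Nonnegative powers of x are adjoined to the graph. Comparing two
      representations leads to a power x^(j - i) in the domain of \<open>M\<close>, which is where
      \<open>comp\<close> applies.\<close>
    let ?X = "{(a \<otimes>\<^bsub>G\<^esub> x [^]\<^bsub>G\<^esub> j, b \<otimes>\<^bsub>U\<^esub> y [^]\<^bsub>U\<^esub> j) | a b (j::nat). (a, b) \<in> M}"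
    have func: "b \<otimes>\<^bsub>U\<^esub> y [^]\<^bsub>U\<^esub> i = b' \<otimes>\<^bsub>U\<^esub> y [^]\<^bsub>U\<^esub> j"
      if m: "(a, b) \<in> M" "(a', b') \<in> M" and ij: "i \<le> j"
        and eq: "a \<otimes>\<^bsub>G\<^esub> x [^]\<^bsub>G\<^esub> i = a' \<otimes>\<^bsub>G\<^esub> x [^]\<^bsub>G\<^esub> j" for a b a' b' and i j :: nat
    proof -
      note mc = m[THEN Mcar(1)] m[THEN Mcar(2)]
      have xj: "x [^]\<^bsub>G\<^esub> j = x [^]\<^bsub>G\<^esub> (j - i) \<otimes>\<^bsub>G\<^esub> x [^]\<^bsub>G\<^esub> i"
        using x ij by (simp add: G.nat_pow_mult)
      have "a \<otimes>\<^bsub>G\<^esub> x [^]\<^bsub>G\<^esub> i = (a' \<otimes>\<^bsub>G\<^esub> x [^]\<^bsub>G\<^esub> (j - i)) \<otimes>\<^bsub>G\<^esub> x [^]\<^bsub>G\<^esub> i"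
        using eq xj mc x by (simp add: G.m_assoc)
      then have "a = a' \<otimes>\<^bsub>G\<^esub> x [^]\<^bsub>G\<^esub> (j - i)" by (rule G.r_cancel) (use mc x in simp_all)
      then have "x [^]\<^bsub>G\<^esub> (j - i) = a \<otimes>\<^bsub>G\<^esub> inv\<^bsub>G\<^esub> a'"
        using mc x by (simp add: G.m_comm[of a'] G.m_assoc)
      then have "y [^]\<^bsub>U\<^esub> (j - i) = b \<otimes>\<^bsub>U\<^esub> inv\<^bsub>U\<^esub> b'"
        using comp Mm[OF m(1) Minv[OF m(2)]] by simp
      then have "b = b' \<otimes>\<^bsub>U\<^esub> y [^]\<^bsub>U\<^esub> (j - i)"
        using mc y by (simp add: U.m_comm[of b'] U.m_assoc)
      then show ?thesis using mc y ij by (simp add: U.m_assoc U.nat_pow_mult)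
    qed
    have "pairs_functional G U ?X"
      unfolding pairs_functional_def
    proof (intro conjI allI impI)
      show "?X \<subseteq> carrier G \<times> carrier U" using Mcar x y by blast
      show "(\<one>\<^bsub>G\<^esub>, \<one>\<^bsub>U\<^esub>) \<in> ?X" using M1 by (force intro: exI[of _ "0::nat"])
    next
      fix u v u' v' assume "(u, v) \<in> ?X" "(u', v') \<in> ?X"
      then obtain a b a' b' and j j' :: nat where
        e: "u = a \<otimes>\<^bsub>G\<^esub> x [^]\<^bsub>G\<^esub> j" "v = b \<otimes>\<^bsub>U\<^esub> y [^]\<^bsub>U\<^esub> j" "u' = a' \<otimes>\<^bsub>G\<^esub> x [^]\<^bsub>G\<^esub> j'" "v' = b' \<otimes>\<^bsub>U\<^esub> y [^]\<^bsub>U\<^esub> j'"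
        and m: "(a, b) \<in> M" "(a', b') \<in> M" by blast
      have "u \<otimes>\<^bsub>G\<^esub> u' = (a \<otimes>\<^bsub>G\<^esub> a') \<otimes>\<^bsub>G\<^esub> x [^]\<^bsub>G\<^esub> (j + j')" "v \<otimes>\<^bsub>U\<^esub> v' = (b \<otimes>\<^bsub>U\<^esub> b') \<otimes>\<^bsub>U\<^esub> y [^]\<^bsub>U\<^esub> (j + j')"
        unfolding e using m[THEN Mcar(1)] m[THEN Mcar(2)] x y
        by (simp_all add: G.nat_pow_mult[symmetric] U.nat_pow_mult[symmetric] G.m_ac U.m_ac)
      then show "(u \<otimes>\<^bsub>G\<^esub> u', v \<otimes>\<^bsub>U\<^esub> v') \<in> ?X" using Mm[OF m] by blast
    next
      fix u v v' assume "(u, v) \<in> ?X" "(u, v') \<in> ?X"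
      then obtain a b a' b' and j j' :: nat where
        e: "u = a \<otimes>\<^bsub>G\<^esub> x [^]\<^bsub>G\<^esub> j" "v = b \<otimes>\<^bsub>U\<^esub> y [^]\<^bsub>U\<^esub> j" "u = a' \<otimes>\<^bsub>G\<^esub> x [^]\<^bsub>G\<^esub> j'" "v' = b' \<otimes>\<^bsub>U\<^esub> y [^]\<^bsub>U\<^esub> j'"
        and m: "(a, b) \<in> M" "(a', b') \<in> M" by blast
      show "v = v'"
        using func[OF m] func[OF m(2,1)] e by (metis linear)
    qed
    moreover have "M \<subseteq> ?X"
    proof
      fix p assume p: "p \<in> M"
      obtain a s where "p = (a, s)" by fastforce
      with p have "p = (a \<otimes>\<^bsub>G\<^esub> x [^]\<^bsub>G\<^esub> (0::nat), s \<otimes>\<^bsub>U\<^esub> y [^]\<^bsub>U\<^esub> (0::nat))" "(a, s) \<in> M" using Mcar by auto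
      then show "p \<in> ?X" by blast
    qed
    ultimately have "?X = M" by (rule max)
    moreover have "(x, y) = (\<one>\<^bsub>G\<^esub> \<otimes>\<^bsub>G\<^esub> x [^]\<^bsub>G\<^esub> (1::nat), \<one>\<^bsub>U\<^esub> \<otimes>\<^bsub>U\<^esub> y [^]\<^bsub>U\<^esub> (1::nat))" using x y by simp
    ultimately have "(x, y) \<in> M" using M1 by blast
    then show ?thesis ..
  qed
  define h where "h x = (THE y. (x, y) \<in> M)" for x
  have h: "h x = y" if "(x, y) \<in> M" for x y
    unfolding h_def using that Mf by blast
  have "h \<in> hom G U"
  proof (rule homI)
    fix x assume "x \<in> carrier G"
    then show "h x \<in> carrier U" using total h Mcar by metis
  next
    fix x x' assume "x \<in> carrier G" "x' \<in> carrier G"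
    then obtain y y' where "(x, y) \<in> M" "(x', y') \<in> M" using total by blast
    then show "h (x \<otimes>\<^bsub>G\<^esub> x') = h x \<otimes>\<^bsub>U\<^esub> h x'" using Mm h by metis
  qed
  then show ?thesis using h M0M by blast
qed

text \<open>One notion for both rings: in \<open>A\<close> it leads to simple modules, and in the
  commutative ring \<open>R\<close> it agrees with ideals (\<open>left_ideal_iff\<close>), so that a
  single use of Zorn's lemma yields primes, maximal ideals and maximal left ideals.\<close>

definition left_ideal :: "'a set \<Rightarrow> ('a, 'b) ring_scheme \<Rightarrow> bool" where
  "left_ideal I A \<longleftrightarrow> I \<subseteq> carrier A \<and> \<zero>\<^bsub>A\<^esub> \<in> I \<and> (\<forall>x\<in>I. \<forall>y\<in>I. x \<oplus>\<^bsub>A\<^esub> y \<in> I) \<and>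
     (\<forall>a\<in>carrier A. \<forall>x\<in>I. a \<otimes>\<^bsub>A\<^esub> x \<in> I)"

context
  fixes I and A (structure)
  assumes I: "left_ideal I A"
begin

lemma left_ideal_subset: "I \<subseteq> carrier A" and left_ideal_zero: "\<zero> \<in> I"
  and left_ideal_add: "\<And>x y. x \<in> I \<Longrightarrow> y \<in> I \<Longrightarrow> x \<oplus> y \<in> I"
  and left_ideal_mult: "\<And>a x. a \<in> carrier A \<Longrightarrow> x \<in> I \<Longrightarrow> a \<otimes> x \<in> I"
  using I unfolding left_ideal_def by auto

end

lemma (in ring) left_ideal_neg:
  assumes "left_ideal I R" "x \<in> I" shows "\<ominus> x \<in> I"
proof -
  have "\<ominus> \<one> \<otimes> x \<in> I" using left_ideal_mult[OF assms(1) _ assms(2)] by simp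
  then show ?thesis using assms left_ideal_subset[OF assms(1)] by (metis l_minus l_one one_closed subsetD)
qed

lemma (in cring) left_ideal_iff: "left_ideal I R \<longleftrightarrow> ideal I R"
proof
  assume I: "left_ideal I R"
  have sub: "I \<subseteq> carrier R" using I by (rule left_ideal_subset)
  show "ideal I R"
  proof (rule idealI[OF ring_axioms])
    show "subgroup I (add_monoid R)"
      using sub left_ideal_zero[OF I] left_ideal_add[OF I] left_ideal_neg[OF I]
      by (intro subgroup.intro) (auto simp: a_inv_def)
    fix a x assume "a \<in> I" "x \<in> carrier R"
    then show "x \<otimes> a \<in> I" "a \<otimes> x \<in> I"
      using left_ideal_mult[OF I] sub m_comm[of a x] by auto
  qed
next
  assume "ideal I R"
  then interpret ideal I R .
  show "left_ideal I R"
    unfolding left_ideal_def using a_subset by (auto simp: I_l_closed)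
qed

text \<open>Zorn's lemma with the avoided set left open: the set containing only 1 gives maximal
  left ideals, a multiplicatively closed set gives the primes of
  \<open>exists_prime_above\<close>.\<close>

lemma (in ring) left_ideal_maximal_avoiding:
  assumes "left_ideal I R" "I \<inter> S = {}"
  shows "\<exists>M. left_ideal M R \<and> I \<subseteq> M \<and> M \<inter> S = {} \<and>
    (\<forall>N. left_ideal N R \<longrightarrow> M \<subseteq> N \<longrightarrow> N \<inter> S = {} \<longrightarrow> N = M)"
proof -
  let ?A = "{M. left_ideal M R \<and> I \<subseteq> M \<and> M \<inter> S = {}}"
  have "\<exists>M\<in>(?A). \<forall>Z\<in>(?A). M \<subseteq> Z \<longrightarrow> Z = M"
  proof (rule subset_Zorn_nonempty)
    show "?A \<noteq> {}" using assms by blast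
    fix C assume C: "C \<noteq> {}" and ch: "subset.chain ?A C"
    have CA: "\<And>M. M \<in> C \<Longrightarrow> left_ideal M R \<and> I \<subseteq> M \<and> M \<inter> S = {}"
      using ch unfolding subset_chain_def by auto
    have two: "\<exists>M\<in>C. p \<in> M \<and> q \<in> M" if pq: "p \<in> \<Union>C" "q \<in> \<Union>C" for p q
    proof -
      obtain M M' where M: "M \<in> C" "p \<in> M" "M' \<in> C" "q \<in> M'" using pq by (elim UnionE)
      then have "M \<subseteq> M' \<or> M' \<subseteq> M" using ch unfolding subset_chain_def by simp
      then show ?thesis using M by (metis subsetD)
    qed
    have "left_ideal (\<Union>C) R"
      unfolding left_ideal_def
    proof (intro conjI ballI)
      show "\<Union>C \<subseteq> carrier R" using CA left_ideal_subset by blast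
      show "\<zero> \<in> \<Union>C" using CA C left_ideal_zero by blast
      show "x \<oplus> y \<in> \<Union>C" if xy: "x \<in> \<Union>C" "y \<in> \<Union>C" for x y
      proof -
        obtain M where "M \<in> C" "x \<in> M" "y \<in> M" using two[OF xy] by (elim bexE conjE)
        then show ?thesis using CA left_ideal_add[of M R x y] by (intro UnionI) auto
      qed
      show "a \<otimes> x \<in> \<Union>C" if ax: "a \<in> carrier R" "x \<in> \<Union>C" for a x
      proof -
        obtain M where "M \<in> C" "x \<in> M" using ax by (elim UnionE)
        then show ?thesis using CA left_ideal_mult[of M R a x] ax by (intro UnionI) auto
      qed
    qed
    then show "\<Union>C \<in> ?A" using CA C by blast
  qed
  then obtain M where MA: "M \<in> ?A" and maxA: "\<forall>Z\<in>?A. M \<subseteq> Z \<longrightarrow> Z = M"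
    by (elim bexE)
  have "N = M" if N: "left_ideal N R" "M \<subseteq> N" "N \<inter> S = {}" for N
  proof -
    have "N \<in> ?A" using MA N by auto
    from bspec[OF maxA this] N(2) show ?thesis by (rule mp)
  qed
  then show ?thesis using MA by (intro exI[of _ M]) simp
qed

lemma (in ring) left_ideal_sum_cyclic:
  assumes I: "left_ideal I R" and x: "x \<in> carrier R"
  shows "left_ideal {a \<otimes> x \<oplus> i | a i. a \<in> carrier R \<and> i \<in> I} R"
  unfolding left_ideal_def
proof (intro conjI ballI)
  note sub = left_ideal_subset[OF I]
  let ?J = "{a \<otimes> x \<oplus> i | a i. a \<in> carrier R \<and> i \<in> I}"
  show "?J \<subseteq> carrier R" using sub x by auto
  have "\<zero> = \<zero> \<otimes> x \<oplus> \<zero>" using x by simp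
  then show "\<zero> \<in> ?J" using left_ideal_zero[OF I] by blast
  show "y \<oplus> z \<in> ?J" if yz: "y \<in> ?J" "z \<in> ?J" for y z
  proof -
    obtain a i b j where *: "y = a \<otimes> x \<oplus> i" "z = b \<otimes> x \<oplus> j" "a \<in> carrier R" "i \<in> I" "b \<in> carrier R" "j \<in> I"
      using yz by blast
    then have "y \<oplus> z = (a \<oplus> b) \<otimes> x \<oplus> (i \<oplus> j)"
      using sub x by (auto simp: l_distr a_ac subset_iff)
    then show ?thesis using * left_ideal_add[OF I] by blast
  qed
  show "b \<otimes> y \<in> ?J" if b: "b \<in> carrier R" and y: "y \<in> ?J" for b y
  proof -
    obtain a i where *: "y = a \<otimes> x \<oplus> i" "a \<in> carrier R" "i \<in> I" using y by blast
    then have "b \<otimes> y = (b \<otimes> a) \<otimes> x \<oplus> b \<otimes> i"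
      using sub x b by (auto simp: r_distr m_assoc subset_iff)
    then show ?thesis using * b left_ideal_mult[OF I] by blast
  qed
qed

section \<open>Simple modules\<close>

lemma (in abelian_group) cancel_simps:
  assumes "a \<in> carrier G" "b \<in> carrier G" "c \<in> carrier G"
  shows "(a \<ominus> b) \<oplus> b = a" "(a \<oplus> c) \<ominus> (b \<oplus> c) = a \<ominus> b" "(a \<oplus> b) \<oplus> (c \<ominus> b) = a \<oplus> c"
proof -
  have 1: "(a \<ominus> b) \<oplus> b = a" if "a \<in> carrier G" "b \<in> carrier G" for a b
    using that by (simp add: minus_eq a_assoc l_neg)
  show "(a \<ominus> b) \<oplus> b = a" using assms 1 by simp
  show "(a \<oplus> c) \<ominus> (b \<oplus> c) = a \<ominus> b"
  proof -
    have "(a \<oplus> c) \<ominus> (b \<oplus> c) = a \<oplus> (c \<oplus> (\<ominus> c \<oplus> \<ominus> b))"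
      using assms by (simp add: minus_eq minus_add a_assoc a_comm[of b c])
    then show ?thesis using assms by (simp add: minus_eq r_neg2)
  qed
  have "(a \<oplus> b) \<oplus> (c \<ominus> b) = a \<oplus> ((c \<ominus> b) \<oplus> b)" using assms by (simp add: a_ac)
  then show "(a \<oplus> b) \<oplus> (c \<ominus> b) = a \<oplus> c" using 1[of c b] assms by simp
qed

locale simple_module = left_module A M
    for A :: "('a, 'b) ring_scheme" (structure) and M :: "('a, 'm, 'd) module_scheme" (structure) +
  assumes nonzero: "carrier M \<noteq> {\<zero>\<^bsub>M\<^esub>}"
    and simple: "\<And>N. submodule N A M \<Longrightarrow> N = {\<zero>\<^bsub>M\<^esub>} \<or> N = carrier M"

lemma irreducible_module_iff: "irreducible_module A M \<longleftrightarrow> simple_module A M"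
  unfolding irreducible_module_def simple_module_def simple_module_axioms_def by blast

context left_module
begin

lemma smult_zero_right: "a \<in> carrier A \<Longrightarrow> a \<odot>\<^bsub>M\<^esub> \<zero>\<^bsub>M\<^esub> = \<zero>\<^bsub>M\<^esub>"
  using smult_r_distr[of a "\<zero>\<^bsub>M\<^esub>" "\<zero>\<^bsub>M\<^esub>"] smult_closed[of a "\<zero>\<^bsub>M\<^esub>"]
  by (simp add: M.add.l_cancel_one')

lemma smult_zero_left: "x \<in> carrier M \<Longrightarrow> \<zero>\<^bsub>A\<^esub> \<odot>\<^bsub>M\<^esub> x = \<zero>\<^bsub>M\<^esub>"
  using smult_l_distr[of "\<zero>\<^bsub>A\<^esub>" "\<zero>\<^bsub>A\<^esub>" x] smult_closed[of "\<zero>\<^bsub>A\<^esub>" x]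
  by (simp add: M.add.l_cancel_one')

lemma smult_neg_left:
  assumes "a \<in> carrier A" "x \<in> carrier M"
  shows "(\<ominus>\<^bsub>A\<^esub> a) \<odot>\<^bsub>M\<^esub> x = \<ominus>\<^bsub>M\<^esub> (a \<odot>\<^bsub>M\<^esub> x)"
proof -
  have "(\<ominus>\<^bsub>A\<^esub> a) \<odot>\<^bsub>M\<^esub> x \<oplus>\<^bsub>M\<^esub> a \<odot>\<^bsub>M\<^esub> x = \<zero>\<^bsub>M\<^esub>"
    using smult_l_distr[of "\<ominus>\<^bsub>A\<^esub> a" a x] assms smult_zero_left by (simp add: A.l_neg)
  then show ?thesis using M.minus_equality smult_closed assms by (metis A.a_inv_closed)
qed

lemma submodule_if:
  assumes "N \<subseteq> carrier M" "\<zero>\<^bsub>M\<^esub> \<in> N" "\<And>x y. x \<in> N \<Longrightarrow> y \<in> N \<Longrightarrow> x \<oplus>\<^bsub>M\<^esub> y \<in> N"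
    and sm: "\<And>a x. a \<in> carrier A \<Longrightarrow> x \<in> N \<Longrightarrow> a \<odot>\<^bsub>M\<^esub> x \<in> N"
  shows "submodule N A M"
proof (intro submodule.intro subgroup.intro submodule_axioms.intro)
  fix x assume x: "x \<in> N"
  then have "(\<ominus>\<^bsub>A\<^esub> \<one>\<^bsub>A\<^esub>) \<odot>\<^bsub>M\<^esub> x = \<ominus>\<^bsub>M\<^esub> x"
    using assms(1) smult_neg_left smult_one by (metis A.one_closed subsetD)
  then show "inv\<^bsub>add_monoid M\<^esub> x \<in> N" using sm[of "\<ominus>\<^bsub>A\<^esub> \<one>\<^bsub>A\<^esub>" x] x by (simp add: a_inv_def)
qed (use assms in auto)

lemma submodule_left_ideal_image:
  assumes L: "left_ideal L A" and m: "m \<in> carrier M"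
  shows "submodule ((\<lambda>a. a \<odot>\<^bsub>M\<^esub> m) ` L) A M"
proof (rule submodule_if)
  note sub = left_ideal_subset[OF L]
  show "(\<lambda>a. a \<odot>\<^bsub>M\<^esub> m) ` L \<subseteq> carrier M" using sub m smult_closed by auto
  show "\<zero>\<^bsub>M\<^esub> \<in> (\<lambda>a. a \<odot>\<^bsub>M\<^esub> m) ` L"
    using left_ideal_zero[OF L] smult_zero_left[OF m] by (metis imageI)
  show "x \<oplus>\<^bsub>M\<^esub> y \<in> (\<lambda>a. a \<odot>\<^bsub>M\<^esub> m) ` L"
    if xy: "x \<in> (\<lambda>a. a \<odot>\<^bsub>M\<^esub> m) ` L" "y \<in> (\<lambda>a. a \<odot>\<^bsub>M\<^esub> m) ` L" for x y
  proof -
    obtain a b where ab: "a \<in> L" "b \<in> L" "x = a \<odot>\<^bsub>M\<^esub> m" "y = b \<odot>\<^bsub>M\<^esub> m" using xy by blast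
    then have "x \<oplus>\<^bsub>M\<^esub> y = (a \<oplus>\<^bsub>A\<^esub> b) \<odot>\<^bsub>M\<^esub> m" using sub m by (simp add: smult_l_distr subset_iff)
    then show ?thesis using left_ideal_add[OF L] ab by blast
  qed
  show "b \<odot>\<^bsub>M\<^esub> x \<in> (\<lambda>a. a \<odot>\<^bsub>M\<^esub> m) ` L"
    if b: "b \<in> carrier A" and x: "x \<in> (\<lambda>a. a \<odot>\<^bsub>M\<^esub> m) ` L" for b x
  proof -
    obtain a where a: "a \<in> L" "x = a \<odot>\<^bsub>M\<^esub> m" using x by blast
    then have "b \<odot>\<^bsub>M\<^esub> x = (b \<otimes>\<^bsub>A\<^esub> a) \<odot>\<^bsub>M\<^esub> m" using sub m b by (simp add: smult_assoc subset_iff)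
    then show ?thesis using left_ideal_mult[OF L b] a by blast
  qed
qed

lemma annihilator_ideal: "ideal (annihilator A M) A"
proof (rule idealI[OF A.ring_axioms])
  show "subgroup (annihilator A M) (add_monoid A)"
  proof (intro subgroup.intro)
    fix x assume "x \<in> annihilator A M"
    then show "inv\<^bsub>add_monoid A\<^esub> x \<in> annihilator A M"
      unfolding annihilator_def using smult_neg_left by (auto simp flip: a_inv_def)
  qed (auto simp: annihilator_def smult_zero_left smult_l_distr)
qed (auto simp: annihilator_def smult_assoc smult_zero_right smult_closed)

end

context simple_module
begin

text \<open>Schur's lemma for additive maps that need not be linear: \<open>ker\<close> and
  \<open>img\<close> say just enough for kernel and image to be submodules.
  \<open>class_scalar\<close> uses it for the action of a ring element, which is linear only up to
  an automorphism.\<close>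

lemma bij_betw_if:
  assumes closed: "\<And>v. v \<in> carrier M \<Longrightarrow> f v \<in> carrier M"
    and add: "\<And>u v. u \<in> carrier M \<Longrightarrow> v \<in> carrier M \<Longrightarrow> f (u \<oplus>\<^bsub>M\<^esub> v) = f u \<oplus>\<^bsub>M\<^esub> f v"
    and ker: "\<And>a v. a \<in> carrier A \<Longrightarrow> v \<in> carrier M \<Longrightarrow> f v = \<zero>\<^bsub>M\<^esub> \<Longrightarrow> f (a \<odot>\<^bsub>M\<^esub> v) = \<zero>\<^bsub>M\<^esub>"
    and img: "\<And>a v. a \<in> carrier A \<Longrightarrow> v \<in> carrier M \<Longrightarrow> \<exists>u\<in>carrier M. a \<odot>\<^bsub>M\<^esub> f v = f u"
    and nz: "v0 \<in> carrier M" "f v0 \<noteq> \<zero>\<^bsub>M\<^esub>"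
  shows "bij_betw f (carrier M) (carrier M)"
proof -
  have f0: "f \<zero>\<^bsub>M\<^esub> = \<zero>\<^bsub>M\<^esub>"
    using add[of "\<zero>\<^bsub>M\<^esub>" "\<zero>\<^bsub>M\<^esub>"] closed[of "\<zero>\<^bsub>M\<^esub>"] by (simp add: M.add.l_cancel_one')
  have "submodule {v \<in> carrier M. f v = \<zero>\<^bsub>M\<^esub>} A M"
    by (rule submodule_if) (auto simp: f0 add ker smult_closed)
  then have "{v \<in> carrier M. f v = \<zero>\<^bsub>M\<^esub>} = {\<zero>\<^bsub>M\<^esub>}"
    using simple nz by blast
  then have k: "v = \<zero>\<^bsub>M\<^esub>" if "v \<in> carrier M" "f v = \<zero>\<^bsub>M\<^esub>" for v using that by blast
  have "inj_on f (carrier M)"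
  proof (rule inj_onI)
    fix u v assume uv: "u \<in> carrier M" "v \<in> carrier M" "f u = f v"
    have "f (u \<ominus>\<^bsub>M\<^esub> v) \<oplus>\<^bsub>M\<^esub> f v = f u"
      using uv add[of "u \<ominus>\<^bsub>M\<^esub> v" v] by (simp add: M.minus_eq M.a_assoc M.l_neg)
    then have "f (u \<ominus>\<^bsub>M\<^esub> v) = \<zero>\<^bsub>M\<^esub>" using uv closed[of "u \<ominus>\<^bsub>M\<^esub> v"] closed[of v]
      by (simp add: M.add.r_cancel_one)
    then have "u \<ominus>\<^bsub>M\<^esub> v = \<zero>\<^bsub>M\<^esub>" using k uv by simp
    moreover have "(u \<ominus>\<^bsub>M\<^esub> v) \<oplus>\<^bsub>M\<^esub> v = u" using uv by (simp add: M.minus_eq M.a_assoc M.l_neg)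
    ultimately show "u = v" using uv by simp
  qed
  moreover have "submodule (f ` carrier M) A M"
  proof (rule submodule_if)
    show "\<zero>\<^bsub>M\<^esub> \<in> f ` carrier M" using f0 by (metis M.zero_closed imageI)
    show "x \<oplus>\<^bsub>M\<^esub> y \<in> f ` carrier M" if "x \<in> f ` carrier M" "y \<in> f ` carrier M" for x y
      using that add by (auto simp flip: add)
    show "a \<odot>\<^bsub>M\<^esub> x \<in> f ` carrier M" if "a \<in> carrier A" "x \<in> f ` carrier M" for a x
    proof -
      obtain v where "v \<in> carrier M" "x = f v" using \<open>x \<in> f ` carrier M\<close> by (rule imageE)
      then obtain u where "u \<in> carrier M" "a \<odot>\<^bsub>M\<^esub> x = f u" using img[of a v] \<open>a \<in> carrier A\<close> by auto
      then show ?thesis by simp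
    qed
  qed (use closed in auto)
  then have "f ` carrier M = carrier M" using simple nz by blast
  ultimately show ?thesis unfolding bij_betw_def by simp
qed

lemma cyclic:
  assumes "m \<in> carrier M" "m \<noteq> \<zero>\<^bsub>M\<^esub>"
  shows "(\<lambda>a. a \<odot>\<^bsub>M\<^esub> m) ` carrier A = carrier M"
proof -
  have "left_ideal (carrier A) A" unfolding left_ideal_def by auto
  then have "submodule ((\<lambda>a. a \<odot>\<^bsub>M\<^esub> m) ` carrier A) A M" using assms(1) by (rule submodule_left_ideal_image)
  moreover have "m \<in> (\<lambda>a. a \<odot>\<^bsub>M\<^esub> m) ` carrier A" using smult_one[OF assms(1)] by (metis A.one_closed imageI)
  ultimately show ?thesis using simple assms(2) by blast
qed

text \<open>If \<open>J\<close> does not kill the module then J m is the whole module for some m,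
  and so I M = (I J) m = 0.\<close>

lemma annihilator_prime: "prime_ideal (annihilator A M) A"
  unfolding prime_ideal_def
proof (intro conjI allI impI)
  show "annihilator A M \<noteq> carrier A"
  proof
    assume eq: "annihilator A M = carrier A"
    then have "\<one>\<^bsub>A\<^esub> \<in> annihilator A M" by simp
    then have "\<forall>x\<in>carrier M. x = \<zero>\<^bsub>M\<^esub>" unfolding annihilator_def using smult_one by auto
    then show False using nonzero M.zero_closed by blast
  qed
  fix I J assume I: "ideal I A" and J: "ideal J A" and IJ: "ideal_prod A I J \<subseteq> annihilator A M"
  interpret I: ideal I A by (rule I)
  interpret J: ideal J A by (rule J)
  show "I \<subseteq> annihilator A M \<or> J \<subseteq> annihilator A M"
  proof (rule disjCI)
    assume "\<not> J \<subseteq> annihilator A M"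
    then obtain j m where jm: "j \<in> J" "m \<in> carrier M" "j \<odot>\<^bsub>M\<^esub> m \<noteq> \<zero>\<^bsub>M\<^esub>"
      unfolding annihilator_def using J.Icarr by blast
    have lJ: "left_ideal J A" unfolding left_ideal_def using J.Icarr J.zero_closed J.a_closed J.I_l_closed by auto
    have "submodule ((\<lambda>a. a \<odot>\<^bsub>M\<^esub> m) ` J) A M" using lJ jm(2) by (rule submodule_left_ideal_image)
    moreover have "(\<lambda>a. a \<odot>\<^bsub>M\<^esub> m) ` J \<noteq> {\<zero>\<^bsub>M\<^esub>}" using jm by blast
    ultimately have eq: "(\<lambda>a. a \<odot>\<^bsub>M\<^esub> m) ` J = carrier M" using simple by blast
    show "I \<subseteq> annihilator A M"
    proof
      fix i assume i: "i \<in> I"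
      have "i \<odot>\<^bsub>M\<^esub> x = \<zero>\<^bsub>M\<^esub>" if "x \<in> carrier M" for x
      proof -
        have "x \<in> (\<lambda>a. a \<odot>\<^bsub>M\<^esub> m) ` J" using that eq by simp
        then obtain b where b: "b \<in> J" "x = b \<odot>\<^bsub>M\<^esub> m" by blast
        have "i \<otimes>\<^bsub>A\<^esub> b \<in> annihilator A M" using IJ ideal_prod.prod[of i I b J A] i b by blast
        then have "(i \<otimes>\<^bsub>A\<^esub> b) \<odot>\<^bsub>M\<^esub> m = \<zero>\<^bsub>M\<^esub>" using jm(2) unfolding annihilator_def by blast
        then show ?thesis using smult_assoc[of i b m] I.Icarr[OF i] J.Icarr[OF b(1)] jm(2) b(2) by simp
      qed
      then show "i \<in> annihilator A M" unfolding annihilator_def using I.Icarr[OF i] by blast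
    qed
  qed
qed (rule annihilator_ideal)

end

lemma prim_imp_spec: "P \<in> prim A \<Longrightarrow> P \<in> spec A"
  unfolding prim_def spec_def by (auto simp: irreducible_module_iff simple_module.annihilator_prime)

text \<open>The quotient by a maximal left ideal, built on coset representatives chosen by
  \<open>\<rho>\<close> rather than on cosets, so that elements of the module have the same type as
  those of the ring.\<close>

lemma (in ring) simple_quotient:
  assumes L: "left_ideal L R" and one: "\<one> \<notin> L"
    and maximal: "\<And>N. left_ideal N R \<Longrightarrow> L \<subseteq> N \<Longrightarrow> \<one> \<notin> N \<Longrightarrow> N = L"
  shows "\<exists>(V :: ('a, 'a) module) \<rho>. simple_module R V \<and> \<rho> ` carrier R = carrier V \<and>
    (\<forall>a\<in>carrier R. \<forall>b\<in>carrier R. \<rho> (a \<oplus> b) = \<rho> a \<oplus>\<^bsub>V\<^esub> \<rho> b \<and> \<rho> (a \<otimes> b) = a \<odot>\<^bsub>V\<^esub> \<rho> b) \<and>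
    (\<forall>a\<in>carrier R. \<rho> a = \<zero>\<^bsub>V\<^esub> \<longleftrightarrow> a \<in> L)"
proof -
  note sub = left_ideal_subset[OF L] and addL = left_ideal_add[OF L] and multL = left_ideal_mult[OF L]
    and negL = left_ideal_neg[OF L] and zeroL = left_ideal_zero[OF L]
  define \<rho> where "\<rho> a = (SOME b. b \<in> carrier R \<and> b \<ominus> a \<in> L)" for a
  have r: "\<rho> a \<in> carrier R \<and> \<rho> a \<ominus> a \<in> L" if "a \<in> carrier R" for a
  proof -
    have "a \<in> carrier R \<and> a \<ominus> a \<in> L" using that zeroL by (simp add: minus_eq r_neg)
    then show ?thesis unfolding \<rho>_def by (rule someI)
  qed
  have rc: "\<rho> a \<in> carrier R" if "a \<in> carrier R" for a using r[OF that] by simp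
  have shift: "c \<ominus> b \<in> L" if "c \<in> carrier R" "a \<in> carrier R" "b \<in> carrier R" "c \<ominus> a \<in> L" "a \<ominus> b \<in> L" for a b c
  proof -
    have "(c \<ominus> a) \<oplus> (a \<ominus> b) = c \<ominus> b" using that by (simp add: minus_eq a_assoc r_neg1)
    then show ?thesis using addL[OF that(4,5)] by simp
  qed
  have sym: "b \<ominus> a \<in> L" if "a \<in> carrier R" "b \<in> carrier R" "a \<ominus> b \<in> L" for a b
    using negL[OF that(3)] that by (simp add: minus_eq minus_add a_comm)
  have eq: "\<rho> a = \<rho> b \<longleftrightarrow> a \<ominus> b \<in> L" if a: "a \<in> carrier R" and b: "b \<in> carrier R" for a b
  proof
    assume e: "\<rho> a = \<rho> b"
    have "\<rho> a \<ominus> b \<in> L" "a \<ominus> \<rho> a \<in> L" using e r[OF a] r[OF b] sym[of "\<rho> a" a] a by simp_all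
    then show "a \<ominus> b \<in> L" using shift[of a "\<rho> a" b] a b r by blast
  next
    assume ab: "a \<ominus> b \<in> L"
    \<comment> \<open>The two choice predicates are equivalent, so the chosen representatives are
      equal and not merely congruent.\<close>
    have "c \<ominus> a \<in> L \<longleftrightarrow> c \<ominus> b \<in> L" if "c \<in> carrier R" for c
      using shift[of c a b] shift[of c b a] sym[of a b] ab a b that by blast
    then show "\<rho> a = \<rho> b" unfolding \<rho>_def by (intro arg_cong[of _ _ Eps]) auto
  qed
  have radd: "\<rho> (\<rho> a \<oplus> \<rho> b) = \<rho> (a \<oplus> b)" if a: "a \<in> carrier R" and b: "b \<in> carrier R" for a b
  proof -
    have "(\<rho> a \<oplus> \<rho> b) \<ominus> (a \<oplus> b) = (\<rho> a \<ominus> a) \<oplus> (\<rho> b \<ominus> b)"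
      using a b r[OF a] r[OF b] by (simp add: minus_eq minus_add a_ac)
    then show ?thesis using a b r[OF a] r[OF b] addL by (simp add: eq)
  qed
  have rmult: "\<rho> (a \<otimes> \<rho> b) = \<rho> (a \<otimes> b)" if a: "a \<in> carrier R" and b: "b \<in> carrier R" for a b
  proof -
    have "(a \<otimes> \<rho> b) \<ominus> (a \<otimes> b) = a \<otimes> (\<rho> b \<ominus> b)"
      using a b r[OF b] by (simp add: minus_eq r_distr r_minus)
    then show ?thesis using a b r[OF b] multL by (simp add: eq)
  qed
  define V :: "('a, 'a) module" where
    "V = \<lparr>carrier = \<rho> ` carrier R, monoid.mult = (\<lambda>_ _. \<zero>), monoid.one = \<zero>, ring.zero = \<rho> \<zero>,
           ring.add = (\<lambda>x y. \<rho> (x \<oplus> y)), smult = (\<lambda>a x. \<rho> (a \<otimes> x))\<rparr>"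
  have [simp]: "carrier V = \<rho> ` carrier R" "\<zero>\<^bsub>V\<^esub> = \<rho> \<zero>"
    unfolding V_def by simp_all
  have V1 [simp]: "\<rho> a \<oplus>\<^bsub>V\<^esub> \<rho> b = \<rho> (a \<oplus> b)" "a \<odot>\<^bsub>V\<^esub> \<rho> b = \<rho> (a \<otimes> b)"
    if "a \<in> carrier R" "b \<in> carrier R" for a b
    using that radd rmult unfolding V_def by simp_all
  have ab: "abelian_group V"
  proof (rule abelian_groupI)
    fix x assume "x \<in> carrier V"
    then obtain a where a: "a \<in> carrier R" "x = \<rho> a" by auto
    show "\<exists>y\<in>carrier V. y \<oplus>\<^bsub>V\<^esub> x = \<zero>\<^bsub>V\<^esub>"
      using a by (intro bexI[of _ "\<rho> (\<ominus> a)"]) (auto simp: l_neg)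
  qed (auto simp: a_ac)
  have lm: "left_module R V"
    by (intro left_module.intro left_module_axioms.intro)
      (auto simp: ring_axioms ab l_distr r_distr m_assoc)
  then interpret V: left_module R V .
  have zero: "\<rho> a = \<zero>\<^bsub>V\<^esub> \<longleftrightarrow> a \<in> L" if "a \<in> carrier R" for a
    using that eq[of a \<zero>] by (simp add: minus_eq)
  have "simple_module R V"
  proof (intro simple_module.intro simple_module_axioms.intro lm)
    show "carrier V \<noteq> {\<zero>\<^bsub>V\<^esub>}"
    proof
      assume *: "carrier V = {\<zero>\<^bsub>V\<^esub>}"
      have "\<rho> \<one> \<in> carrier V" by simp
      then have "\<rho> \<one> = \<zero>\<^bsub>V\<^esub>" unfolding * by simp
      then show False using zero[of \<one>] one by simp
    qed
    fix N assume "submodule N R V"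
    then interpret N: submodule N R V .
    have Nadd: "x \<oplus>\<^bsub>V\<^esub> y \<in> N" if "x \<in> N" "y \<in> N" for x y using N.m_closed[OF that] by simp
    have Nzero: "\<zero>\<^bsub>V\<^esub> \<in> N" using N.one_closed by simp
    have Nsub: "N \<subseteq> \<rho> ` carrier R" using N.subset by simp
    let ?J = "{a \<in> carrier R. \<rho> a \<in> N}"
    have J: "left_ideal ?J R"
      unfolding left_ideal_def
    proof (intro conjI ballI)
      show "?J \<subseteq> carrier R" by blast
      show "\<zero> \<in> ?J" using Nzero by simp
      show "x \<oplus> y \<in> ?J" if "x \<in> ?J" "y \<in> ?J" for x y
        using that Nadd[of "\<rho> x" "\<rho> y"] by simp
      show "a \<otimes> x \<in> ?J" if "a \<in> carrier R" "x \<in> ?J" for a x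
        using that N.smult_closed[of a "\<rho> x"] by simp
    qed
    have LJ: "L \<subseteq> ?J"
    proof
      fix a assume "a \<in> L"
      then show "a \<in> ?J" using zero[of a] sub Nzero by auto
    qed
    show "N = {\<zero>\<^bsub>V\<^esub>} \<or> N = carrier V"
    proof (cases "\<one> \<in> ?J")
      case True
      have "\<rho> a \<in> N" if "a \<in> carrier R" for a
        using N.smult_closed[of a "\<rho> \<one>"] True that by simp
      then show ?thesis using Nsub by auto
    next
      case False
      have "?J = L" by (rule maximal[OF J LJ False])
      then have "\<rho> a = \<zero>\<^bsub>V\<^esub>" if "\<rho> a \<in> N" "a \<in> carrier R" for a using zero that by blast
      then have "N \<subseteq> {\<zero>\<^bsub>V\<^esub>}" using Nsub by blast
      then show ?thesis using Nzero by blast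
    qed
  qed
  then show ?thesis
    using zero by (intro exI[of _ V] exI[of _ \<rho>] conjI ballI) simp_all
qed

section \<open>Endomorphisms of simple modules over algebras with a monomial basis\<close>

text \<open>Univariate polynomials as coefficient lists with the constant term first, so that evaluation
  is the Horner scheme.\<close>

context ring
begin

primrec ev :: "'a list \<Rightarrow> 'a \<Rightarrow> 'a" where
  "ev [] x = \<zero>"
| "ev (a # p) x = a \<oplus> x \<otimes> ev p x"

fun hadd :: "'a list \<Rightarrow> 'a list \<Rightarrow> 'a list" where
  "hadd [] q = q"
| "hadd p [] = p"
| "hadd (a # p) (b # q) = (a \<oplus> b) # hadd p q"

definition hscale :: "'a \<Rightarrow> 'a list \<Rightarrow> 'a list" where
  "hscale a p = map (\<lambda>b. a \<otimes> b) p"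

primrec hmult :: "'a list \<Rightarrow> 'a list \<Rightarrow> 'a list" where
  "hmult [] q = []"
| "hmult (a # p) q = hadd (hscale a q) (\<zero> # hmult p q)"

primrec hpow :: "'a list \<Rightarrow> nat \<Rightarrow> 'a list" where
  "hpow p 0 = [\<one>]"
| "hpow p (Suc k) = hmult p (hpow p k)"

text \<open>Synthetic division by X - x. If p = p(x) + (X - x) q, then a + X p = (a + x p(x)) + (X -
  x) (p + x q), which explains the recursion.\<close>

primrec hquot :: "'a \<Rightarrow> 'a list \<Rightarrow> 'a list" where
  "hquot x [] = []"
| "hquot x (a # p) = hadd p (hscale x (hquot x p))"

lemma ev_closed [simp]: "set p \<subseteq> carrier R \<Longrightarrow> x \<in> carrier R \<Longrightarrow> ev p x \<in> carrier R"
  by (induction p) auto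

lemma set_hadd: "set p \<subseteq> carrier R \<Longrightarrow> set q \<subseteq> carrier R \<Longrightarrow> set (hadd p q) \<subseteq> carrier R"
  by (induction p q rule: hadd.induct) auto

lemma set_hscale: "a \<in> carrier R \<Longrightarrow> set p \<subseteq> carrier R \<Longrightarrow> set (hscale a p) \<subseteq> carrier R"
  unfolding hscale_def by auto

lemma set_hmult: "set p \<subseteq> carrier R \<Longrightarrow> set q \<subseteq> carrier R \<Longrightarrow> set (hmult p q) \<subseteq> carrier R"
proof (induction p)
  case (Cons a p)
  then show ?case by (simp add: set_hadd set_hscale)
qed simp

lemma set_hpow: "set p \<subseteq> carrier R \<Longrightarrow> set (hpow p k) \<subseteq> carrier R"
  by (induction k) (auto simp: set_hmult)

lemma set_hquot: "set p \<subseteq> carrier R \<Longrightarrow> x \<in> carrier R \<Longrightarrow> set (hquot x p) \<subseteq> carrier R"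
  by (induction p) (auto simp: set_hadd set_hscale)

lemma length_hadd: "length (hadd p q) = max (length p) (length q)"
  by (induction p q rule: hadd.induct) auto

lemma length_hquot: "length (hquot x p) = length p - 1"
  by (induction p) (auto simp: length_hadd hscale_def)

lemma last_hadd: "length q < length p \<Longrightarrow> last (hadd p q) = last p"
proof (induction p q rule: hadd.induct)
  case (3 a p b q)
  then have "p \<noteq> []" by auto
  moreover have "hadd p q \<noteq> []" using 3 length_hadd[of p q] by (metis length_0_conv max.strict_order_iff not_less_zero Suc_less_eq length_Cons max_def)
  ultimately show ?case using 3 by simp
qed auto

lemma last_hquot: "length p \<ge> 2 \<Longrightarrow> last (hquot x p) = last p"
  by (cases p) (auto simp: last_hadd length_hquot hscale_def)

end

context cring
begin

lemma ev_hadd: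
  "set p \<subseteq> carrier R \<Longrightarrow> set q \<subseteq> carrier R \<Longrightarrow> x \<in> carrier R \<Longrightarrow> ev (hadd p q) x = ev p x \<oplus> ev q x"
proof (induction p q rule: hadd.induct)
  case (3 a p b q)
  then show ?case by (simp add: r_distr a_ac)
qed auto

lemma ev_hscale: "a \<in> carrier R \<Longrightarrow> set p \<subseteq> carrier R \<Longrightarrow> x \<in> carrier R \<Longrightarrow> ev (hscale a p) x = a \<otimes> ev p x"
  by (induction p) (auto simp: hscale_def r_distr m_ac)

lemma ev_hmult:
  "set p \<subseteq> carrier R \<Longrightarrow> set q \<subseteq> carrier R \<Longrightarrow> x \<in> carrier R \<Longrightarrow> ev (hmult p q) x = ev p x \<otimes> ev q x"
proof (induction p)
  case (Cons a p)
  then show ?case by (simp add: ev_hadd set_hscale set_hmult ev_hscale l_distr m_assoc)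
qed simp

lemma ev_eval: "set p \<subseteq> carrier R \<Longrightarrow> x \<in> carrier R \<Longrightarrow> ev p x = eval (rev p) x"
proof (induction p)
  case (Cons a p)
  then have "eval (rev p @ [a]) x = (eval (rev p) x \<otimes> x) \<oplus> a"
    by (intro eval_append_aux) auto
  then show ?case using Cons by (simp add: a_comm m_comm flip: Cons.IH)
qed simp

end

lemma (in domain) ev_hpow:
  assumes "set p \<subseteq> carrier R" "x \<in> carrier R" "ev p x \<noteq> \<zero>"
  shows "ev (hpow p k) x \<noteq> \<zero>"
proof (induction k)
  case (Suc k)
  then show ?case using assms set_hpow[OF assms(1), of k] by (simp add: ev_hmult integral_iff)
qed (use assms in auto)

lemma (in algebraically_closed) ev_root:
  assumes p: "set p \<subseteq> carrier L" "length p \<ge> 2" "last p \<noteq> \<zero>"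
  shows "\<exists>x\<in>carrier L. ev p x = \<zero>"
proof -
  obtain q a where qa: "p = q @ [a]" using p(2) by (cases p rule: rev_cases) auto
  then have "q \<noteq> []" using p(2) by auto
  then have "\<exists>x\<in>carrier L. eval (a # rev q) x = \<zero>"
    using p qa by (intro exists_root) auto
  then show ?thesis using ev_eval[OF p(1)] qa by auto
qed

text \<open>Coefficient lists are not normalised, so zero coefficients at the end are stripped until
  the last entry is a true leading coefficient.\<close>

lemma (in algebraically_closed) ev_root_nonconstant:
  assumes "set (a # p) \<subseteq> carrier L" "\<exists>b\<in>set p. b \<noteq> \<zero>"
  shows "\<exists>x\<in>carrier L. ev (a # p) x = \<zero>"
  using assms
proof (induction p rule: rev_induct)
  case (snoc b p)
  show ?case
  proof (cases "b = \<zero>")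
    case True
    have "ev (q @ [\<zero>]) x = ev q x" if "set q \<subseteq> carrier L" "x \<in> carrier L" for q x
      using that by (induction q) auto
    then have "ev (a # (p @ [b])) x = ev (a # p) x" if "x \<in> carrier L" for x
      using True snoc.prems that by simp
    moreover have "\<exists>x\<in>carrier L. ev (a # p) x = \<zero>" using snoc True by auto
    ultimately show ?thesis by metis
  next
    case False
    then show ?thesis using snoc.prems by (intro ev_root) auto
  qed
qed simp

text \<open>\<open>V\<close> becomes a module over K[X] with X acting as \<open>\<theta>\<close>.
  The last assumption is what Schur's lemma gives for an endomorphism of a simple module that is not
  scalar. It makes all nonzero polynomials act bijectively (\<open>act_bij\<close>), and it is
  refuted once monomials are added.\<close>

locale poly_action = K: algebraically_closed K + V: abelian_group V
    for K :: "('k, 'l) ring_scheme" (structure) and V :: "('v, 'm) ring_scheme" (structure) +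
  fixes s :: "'k \<Rightarrow> 'v \<Rightarrow> 'v" and \<theta> :: "'v \<Rightarrow> 'v"
  assumes s_closed [simp]: "a \<in> carrier K \<Longrightarrow> v \<in> carrier V \<Longrightarrow> s a v \<in> carrier V"
    and s_add_left: "a \<in> carrier K \<Longrightarrow> b \<in> carrier K \<Longrightarrow> v \<in> carrier V \<Longrightarrow> s (a \<oplus> b) v = s a v \<oplus>\<^bsub>V\<^esub> s b v"
    and s_add: "a \<in> carrier K \<Longrightarrow> u \<in> carrier V \<Longrightarrow> v \<in> carrier V \<Longrightarrow> s a (u \<oplus>\<^bsub>V\<^esub> v) = s a u \<oplus>\<^bsub>V\<^esub> s a v"
    and s_mult: "a \<in> carrier K \<Longrightarrow> b \<in> carrier K \<Longrightarrow> v \<in> carrier V \<Longrightarrow> s (a \<otimes> b) v = s a (s b v)"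
    and s_one [simp]: "v \<in> carrier V \<Longrightarrow> s \<one> v = v"
    and th_closed [simp]: "v \<in> carrier V \<Longrightarrow> \<theta> v \<in> carrier V"
    and th_add: "u \<in> carrier V \<Longrightarrow> v \<in> carrier V \<Longrightarrow> \<theta> (u \<oplus>\<^bsub>V\<^esub> v) = \<theta> u \<oplus>\<^bsub>V\<^esub> \<theta> v"
    and th_s: "a \<in> carrier K \<Longrightarrow> v \<in> carrier V \<Longrightarrow> \<theta> (s a v) = s a (\<theta> v)"
    and th_bij: "x \<in> carrier K \<Longrightarrow> bij_betw (\<lambda>v. \<theta> v \<ominus>\<^bsub>V\<^esub> s x v) (carrier V) (carrier V)"
begin

primrec act :: "'k list \<Rightarrow> 'v \<Rightarrow> 'v" where
  "act [] v = \<zero>\<^bsub>V\<^esub>"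
| "act (a # p) v = s a v \<oplus>\<^bsub>V\<^esub> \<theta> (act p v)"

lemma additive_zero:
  assumes "\<And>v. v \<in> carrier V \<Longrightarrow> f v \<in> carrier V"
    "\<And>u v. u \<in> carrier V \<Longrightarrow> v \<in> carrier V \<Longrightarrow> f (u \<oplus>\<^bsub>V\<^esub> v) = f u \<oplus>\<^bsub>V\<^esub> f v"
  shows "f \<zero>\<^bsub>V\<^esub> = \<zero>\<^bsub>V\<^esub>"
  using assms(1)[of "\<zero>\<^bsub>V\<^esub>"] assms(2)[of "\<zero>\<^bsub>V\<^esub>" "\<zero>\<^bsub>V\<^esub>"] by (simp add: V.add.l_cancel_one')

lemma additive_minus:
  assumes "\<And>v. v \<in> carrier V \<Longrightarrow> f v \<in> carrier V"
    "\<And>u v. u \<in> carrier V \<Longrightarrow> v \<in> carrier V \<Longrightarrow> f (u \<oplus>\<^bsub>V\<^esub> v) = f u \<oplus>\<^bsub>V\<^esub> f v"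
    and "u \<in> carrier V" "v \<in> carrier V"
  shows "f (u \<ominus>\<^bsub>V\<^esub> v) = f u \<ominus>\<^bsub>V\<^esub> f v"
proof -
  have "f (u \<ominus>\<^bsub>V\<^esub> v) \<oplus>\<^bsub>V\<^esub> f v = f u"
    using assms(2)[of "u \<ominus>\<^bsub>V\<^esub> v" v] assms(3,4) by (simp add: V.cancel_simps)
  then show ?thesis using assms(1,3,4) by (metis V.cancel_simps(1) V.add.r_cancel V.minus_closed)
qed

lemma th_zero [simp]: "\<theta> \<zero>\<^bsub>V\<^esub> = \<zero>\<^bsub>V\<^esub>" by (rule additive_zero) (auto simp: th_add)

lemma s_zero [simp]: "a \<in> carrier K \<Longrightarrow> s a \<zero>\<^bsub>V\<^esub> = \<zero>\<^bsub>V\<^esub>" by (rule additive_zero) (auto simp: s_add)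

lemma s_zero_left [simp]: "v \<in> carrier V \<Longrightarrow> s \<zero> v = \<zero>\<^bsub>V\<^esub>"
  using s_add_left[of \<zero> \<zero> v] s_closed[of \<zero> v] by (simp add: V.add.l_cancel_one')

lemma s_neg: "a \<in> carrier K \<Longrightarrow> v \<in> carrier V \<Longrightarrow> s (\<ominus> a) v = \<ominus>\<^bsub>V\<^esub> s a v"
  using s_add_left[of "\<ominus> a" a v] V.minus_equality[of "s (\<ominus> a) v" "s a v"] by (simp add: K.l_neg)

lemma act_closed [simp]: "set p \<subseteq> carrier K \<Longrightarrow> v \<in> carrier V \<Longrightarrow> act p v \<in> carrier V"
  by (induction p) auto

lemma act_commute:
  assumes "\<And>v. v \<in> carrier V \<Longrightarrow> f v \<in> carrier V"
    "\<And>u v. u \<in> carrier V \<Longrightarrow> v \<in> carrier V \<Longrightarrow> f (u \<oplus>\<^bsub>V\<^esub> v) = f u \<oplus>\<^bsub>V\<^esub> f v"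
    "\<And>a v. a \<in> carrier K \<Longrightarrow> v \<in> carrier V \<Longrightarrow> f (s a v) = s a (f v)"
    "\<And>v. v \<in> carrier V \<Longrightarrow> f (\<theta> v) = \<theta> (f v)"
    and "v \<in> carrier V" "set p \<subseteq> carrier K"
  shows "f (act p v) = act p (f v)"
  using assms(6)
proof (induction p)
  case Nil
  then show ?case using additive_zero[of f] assms(1,2) by simp
next
  case (Cons a p)
  then show ?case using assms(1-5) by simp
qed

lemma act_add: "set p \<subseteq> carrier K \<Longrightarrow> u \<in> carrier V \<Longrightarrow> v \<in> carrier V \<Longrightarrow> act p (u \<oplus>\<^bsub>V\<^esub> v) = act p u \<oplus>\<^bsub>V\<^esub> act p v"
  by (induction p) (auto simp: s_add th_add V.a_ac)

lemma act_th: "set p \<subseteq> carrier K \<Longrightarrow> v \<in> carrier V \<Longrightarrow> act p (\<theta> v) = \<theta> (act p v)"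
  by (rule act_commute[of \<theta>, symmetric]) (auto simp: th_add th_s)

lemma s_comm: "a \<in> carrier K \<Longrightarrow> b \<in> carrier K \<Longrightarrow> v \<in> carrier V \<Longrightarrow> s a (s b v) = s b (s a v)"
  using s_mult[of a b v] s_mult[of b a v] K.m_comm[of a b] by simp

lemma act_s: "a \<in> carrier K \<Longrightarrow> set p \<subseteq> carrier K \<Longrightarrow> v \<in> carrier V \<Longrightarrow> act p (s a v) = s a (act p v)"
  by (rule act_commute[of "s a", symmetric]) (auto simp: s_add th_s s_comm)

lemma act_comm:
  "set p \<subseteq> carrier K \<Longrightarrow> set q \<subseteq> carrier K \<Longrightarrow> v \<in> carrier V \<Longrightarrow> act p (act q v) = act q (act p v)"
  by (rule act_commute[of "act p"]) (auto simp: act_add act_s act_th)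

lemma act_hadd:
  "set p \<subseteq> carrier K \<Longrightarrow> set q \<subseteq> carrier K \<Longrightarrow> v \<in> carrier V \<Longrightarrow> act (K.hadd p q) v = act p v \<oplus>\<^bsub>V\<^esub> act q v"
proof (induction p q rule: K.hadd.induct)
  case (3 a p b q)
  then show ?case by (simp add: s_add_left th_add V.a_ac)
qed auto

lemma act_hscale:
  "a \<in> carrier K \<Longrightarrow> set p \<subseteq> carrier K \<Longrightarrow> v \<in> carrier V \<Longrightarrow> act (K.hscale a p) v = s a (act p v)"
  by (induction p) (auto simp: K.hscale_def s_add s_mult th_s)

lemma act_hmult:
  "set p \<subseteq> carrier K \<Longrightarrow> set q \<subseteq> carrier K \<Longrightarrow> v \<in> carrier V \<Longrightarrow> act (K.hmult p q) v = act p (act q v)"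
proof (induction p)
  case (Cons a p)
  then show ?case by (simp add: act_hadd K.set_hscale K.set_hmult act_hscale)
qed simp

text \<open>Division with remainder by X - x, read as an identity of operators. At a root x of the
  polynomial its action is \<open>\<theta>\<close> - x composed with the action of the
  quotient.\<close>

lemma act_hquot:
  assumes x: "x \<in> carrier K" and v: "v \<in> carrier V" and p: "set p \<subseteq> carrier K"
  shows "act p v = s (K.ev p x) v \<oplus>\<^bsub>V\<^esub> (\<theta> (act (K.hquot x p) v) \<ominus>\<^bsub>V\<^esub> s x (act (K.hquot x p) v))"
  using p
proof (induction p)
  case Nil
  then show ?case using x v by (simp add: V.minus_eq V.r_neg)
next
  case (Cons a p)
  define e where "e = K.ev p x"
  define w where "w = act p v"
  define u where "u = act (K.hquot x p) v"
  have a: "a \<in> carrier K" and p: "set p \<subseteq> carrier K" using Cons.prems by auto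
  have e: "e \<in> carrier K" unfolding e_def using p x by simp
  have w: "w \<in> carrier V" unfolding w_def using p v by simp
  have u: "u \<in> carrier V" unfolding u_def using K.set_hquot[OF p x] v by simp
  have IH: "w = s e v \<oplus>\<^bsub>V\<^esub> (\<theta> u \<ominus>\<^bsub>V\<^esub> s x u)" using Cons p unfolding w_def u_def e_def by simp
  have q: "act (K.hquot x (a # p)) v = w \<oplus>\<^bsub>V\<^esub> s x u"
    using p x v by (simp add: act_hadd act_hscale K.set_hquot K.set_hscale w_def u_def)
  have "s x w = s x (s e v) \<oplus>\<^bsub>V\<^esub> (s x (\<theta> u) \<ominus>\<^bsub>V\<^esub> s x (s x u))"
    unfolding IH using x u e v additive_minus[of "s x" "\<theta> u" "s x u"] by (simp add: s_add)
  then have "s x w \<oplus>\<^bsub>V\<^esub> s x (s x u) = s x (s e v) \<oplus>\<^bsub>V\<^esub> s x (\<theta> u)"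
    using x u e v by (simp add: V.a_assoc V.cancel_simps)
  then have "\<theta> (w \<oplus>\<^bsub>V\<^esub> s x u) \<ominus>\<^bsub>V\<^esub> s x (w \<oplus>\<^bsub>V\<^esub> s x u) = \<theta> w \<ominus>\<^bsub>V\<^esub> s x (s e v)"
    using x u e v w by (simp add: th_add s_add th_s V.cancel_simps)
  moreover have "s (K.ev (a # p) x) v = s a v \<oplus>\<^bsub>V\<^esub> s x (s e v)"
    using a x e v p by (simp add: s_add_left s_mult e_def)
  ultimately show ?case unfolding q using a x e v w by (simp add: V.cancel_simps w_def)
qed

lemma s_bij: "a \<in> carrier K \<Longrightarrow> a \<noteq> \<zero> \<Longrightarrow> bij_betw (s a) (carrier V) (carrier V)"
proof (rule bij_betw_byWitness[of _ "s (inv a)"])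
  assume a: "a \<in> carrier K" "a \<noteq> \<zero>"
  then have "a \<in> Units K" using K.field_Units by auto
  then have i: "inv a \<in> carrier K" "inv a \<otimes> a = \<one>" "a \<otimes> inv a = \<one>" by auto
  show "\<forall>v\<in>carrier V. s (inv a) (s a v) = v" "\<forall>v\<in>carrier V. s a (s (inv a) v) = v"
    using a i by (auto simp flip: s_mult)
  show "s a ` carrier V \<subseteq> carrier V" "s (inv a) ` carrier V \<subseteq> carrier V" using a i by auto
qed

text \<open>Over an algebraically closed field the action is a composite of maps
  \<open>\<theta>\<close> - x and one nonzero scalar, all of them bijective. \<open>hquot\<close>
  lowers the length by one and keeps the leading coefficient, so the induction applies to
  it.\<close>

lemma act_bij_last:
  "set p \<subseteq> carrier K \<Longrightarrow> p \<noteq> [] \<Longrightarrow> last p \<noteq> \<zero> \<Longrightarrow> bij_betw (act p) (carrier V) (carrier V)"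
proof (induction "length p" arbitrary: p rule: less_induct)
  case less
  show ?case
  proof (cases "length p \<ge> 2")
    case False
    with less.prems(2) obtain a where a: "p = [a]" by (cases p; cases "tl p") auto
    then have "bij_betw (s a) (carrier V) (carrier V)" using less.prems by (intro s_bij) auto
    then show ?thesis unfolding a using less.prems a by (subst bij_betw_cong[of _ _ "s a"]) auto
  next
    case True
    obtain x where x: "x \<in> carrier K" "K.ev p x = \<zero>"
      using K.ev_root[OF less.prems(1) True less.prems(3)] by blast
    let ?q = "K.hquot x p"
    have q: "set ?q \<subseteq> carrier K" using K.set_hquot less.prems(1) x(1) by blast
    have "length ?q = length p - 1" by (rule K.length_hquot)
    moreover have "last ?q = last p" using True by (rule K.last_hquot)
    ultimately have "bij_betw (act ?q) (carrier V) (carrier V)"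
      using True less.prems q by (intro less.hyps) auto
    then have "bij_betw ((\<lambda>v. \<theta> v \<ominus>\<^bsub>V\<^esub> s x v) \<circ> act ?q) (carrier V) (carrier V)"
      using th_bij[OF x(1)] by (rule bij_betw_trans)
    moreover have "act p v = ((\<lambda>v. \<theta> v \<ominus>\<^bsub>V\<^esub> s x v) \<circ> act ?q) v" if "v \<in> carrier V" for v
      using act_hquot[OF x(1) that less.prems(1)] x q that by simp
    ultimately show ?thesis by (subst bij_betw_cong)
  qed
qed

lemma act_bij:
  "set p \<subseteq> carrier K \<Longrightarrow> \<exists>a\<in>set p. a \<noteq> \<zero> \<Longrightarrow> bij_betw (act p) (carrier V) (carrier V)"
proof (induction p rule: rev_induct)
  case (snoc b p)
  show ?case
  proof (cases "b = \<zero>")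
    case True
    have "act (q @ [\<zero>]) v = act q v" if "set q \<subseteq> carrier K" "v \<in> carrier V" for q v
      using that by (induction q) auto
    then have "act (p @ [b]) v = act p v" if "v \<in> carrier V" for v
      using True snoc.prems that by simp
    moreover have "bij_betw (act p) (carrier V) (carrier V)" using snoc True by auto
    ultimately show ?thesis by (subst bij_betw_cong)
  next
    case False
    then show ?thesis using snoc.prems by (intro act_bij_last) auto
  qed
qed simp

lemma act_all_zero: "\<forall>a\<in>set p. a = \<zero> \<Longrightarrow> v \<in> carrier V \<Longrightarrow> act p v = \<zero>\<^bsub>V\<^esub>"
  by (induction p) auto

lemma ev_all_zero: "\<forall>a\<in>set p. a = \<zero> \<Longrightarrow> x \<in> carrier K \<Longrightarrow> K.ev p x = \<zero>"
  by (induction p) auto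

end

subsection \<open>Exponent vectors\<close>

definition exps :: "nat \<Rightarrow> (nat \<Rightarrow> nat) set" where
  "exps n = {\<alpha>. \<forall>i. i \<notin> {1..n} \<longrightarrow> \<alpha> i = 0}"

text \<open>The lexicographic order in which the highest index where the exponents differ decides.
  It is a monomial order: total and well-founded on \<open>exps n\<close> and compatible with
  addition.\<close>

definition exp_less :: "(nat \<Rightarrow> nat) \<Rightarrow> (nat \<Rightarrow> nat) \<Rightarrow> bool" where
  "exp_less \<alpha> \<beta> \<longleftrightarrow> (\<exists>i. \<alpha> i < \<beta> i \<and> (\<forall>j>i. \<alpha> j = \<beta> j))"

lemma exps_add: "\<alpha> \<in> exps n \<Longrightarrow> \<beta> \<in> exps n \<Longrightarrow> (\<lambda>i. \<alpha> i + \<beta> i) \<in> exps n"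
  unfolding exps_def by auto

lemma exps_support: "\<alpha> \<in> exps n \<Longrightarrow> \<alpha> i \<noteq> 0 \<Longrightarrow> i \<in> {1..n}"
  unfolding exps_def by auto

lemma exps_zero: "(\<lambda>_. 0) \<in> exps n"
  unfolding exps_def by auto

lemma exp_less_add: "exp_less \<alpha> \<beta> \<Longrightarrow> exp_less (\<lambda>i. \<alpha> i + \<gamma> i) (\<lambda>i. \<beta> i + \<gamma> i)"
  unfolding exp_less_def by auto

lemma exp_less_zero: "\<not> exp_less \<alpha> (\<lambda>_. 0)"
  unfolding exp_less_def by auto

lemma exp_less_trans:
  assumes "exp_less \<alpha> \<beta>" "exp_less \<beta> \<gamma>" shows "exp_less \<alpha> \<gamma>"
proof -
  obtain i j where ij: "\<alpha> i < \<beta> i" "\<forall>k>i. \<alpha> k = \<beta> k" "\<beta> j < \<gamma> j" "\<forall>k>j. \<beta> k = \<gamma> k"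
    using assms unfolding exp_less_def by blast
  consider "i < j" | "i = j" | "j < i" by linarith
  then have "\<alpha> (max i j) < \<gamma> (max i j)" using ij by cases auto
  moreover have "\<forall>k > max i j. \<alpha> k = \<gamma> k" using ij by auto
  ultimately show ?thesis unfolding exp_less_def by blast
qed

lemma exp_less_total:
  assumes "\<alpha> \<in> exps n" "\<beta> \<in> exps n" "\<alpha> \<noteq> \<beta>"
  shows "exp_less \<alpha> \<beta> \<or> exp_less \<beta> \<alpha>"
proof -
  let ?D = "{i. \<alpha> i \<noteq> \<beta> i}"
  have "?D \<subseteq> {1..n}"
  proof
    fix i assume "i \<in> ?D"
    then have "\<alpha> i \<noteq> 0 \<or> \<beta> i \<noteq> 0" by auto
    then show "i \<in> {1..n}" using assms(1,2) exps_support by metis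
  qed
  then have fin: "finite ?D" by (rule finite_subset) simp
  have ne: "?D \<noteq> {}" using assms(3) by auto
  let ?i = "Max ?D"
  have "?i \<in> ?D" using fin ne by (rule Max_in)
  moreover have "\<forall>j > ?i. \<alpha> j = \<beta> j" using Max_ge[OF fin] by (metis (mono_tags) leD mem_Collect_eq)
  ultimately have "\<alpha> ?i < \<beta> ?i \<and> (\<forall>j > ?i. \<alpha> j = \<beta> j) \<or> \<beta> ?i < \<alpha> ?i \<and> (\<forall>j > ?i. \<beta> j = \<alpha> j)"
    by (metis (mono_tags) mem_Collect_eq nat_neq_iff)
  then show ?thesis unfolding exp_less_def by blast
qed

text \<open>The exponent at the top index is compared before all others, so the order embeds into
  the lexicographic product of < on that exponent and the order for one index fewer.\<close>

lemma wf_exp_less: "wf {(\<alpha>, \<beta>). \<alpha> \<in> exps n \<and> \<beta> \<in> exps n \<and> exp_less \<alpha> \<beta>}"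
proof (induction n)
  case 0
  have "\<alpha> = (\<lambda>_. 0)" if "\<alpha> \<in> exps 0" for \<alpha> using that unfolding exps_def by auto
  then have e: "{(\<alpha>, \<beta>). \<alpha> \<in> exps 0 \<and> \<beta> \<in> exps 0 \<and> exp_less \<alpha> \<beta>} = {}"
    using exp_less_zero by fastforce
  show ?case unfolding e wf_def by blast
next
  case (Suc n)
  let ?R = "{(\<alpha>, \<beta>). \<alpha> \<in> exps n \<and> \<beta> \<in> exps n \<and> exp_less \<alpha> \<beta>}"
  let ?f = "\<lambda>\<alpha> :: nat \<Rightarrow> nat. (\<alpha> (Suc n), \<alpha>(Suc n := 0))"
  have wf: "wf (inv_image (less_than <*lex*> ?R) ?f)"
    using Suc by (intro wf_inv_image wf_lex_prod) auto
  have "{(\<alpha>, \<beta>). \<alpha> \<in> exps (Suc n) \<and> \<beta> \<in> exps (Suc n) \<and> exp_less \<alpha> \<beta>} \<subseteq> inv_image (less_than <*lex*> ?R) ?f"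
  proof clarify
    fix \<alpha> \<beta> assume ab: "\<alpha> \<in> exps (Suc n)" "\<beta> \<in> exps (Suc n)" "exp_less \<alpha> \<beta>"
    obtain i where i: "\<alpha> i < \<beta> i" "\<forall>j>i. \<alpha> j = \<beta> j" using ab(3) unfolding exp_less_def by blast
    have "i \<le> Suc n"
    proof (rule ccontr)
      assume "\<not> i \<le> Suc n"
      then have "\<beta> i = 0" using ab(2) unfolding exps_def by auto
      then show False using i(1) by simp
    qed
    have red: "\<gamma>(Suc n := 0) \<in> exps n" if "\<gamma> \<in> exps (Suc n)" for \<gamma>
      using that unfolding exps_def by auto
    show "(\<alpha>, \<beta>) \<in> inv_image (less_than <*lex*> ?R) ?f"
    proof (cases "i = Suc n")
      case True
      then show ?thesis using i by simp
    next
      case False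
      then have "i < Suc n" using \<open>i \<le> Suc n\<close> by simp
      then have eq: "\<alpha> (Suc n) = \<beta> (Suc n)" using i by blast
      have "exp_less (\<alpha>(Suc n := 0)) (\<beta>(Suc n := 0))"
        unfolding exp_less_def using i False by (intro exI[of _ i]) auto
      then show ?thesis using eq red ab by simp
    qed
  qed
  then show ?case using wf wf_subset by blast
qed

lemma exp_greatest:
  assumes "finite F" "F \<noteq> {}" "F \<subseteq> exps n"
  shows "\<exists>\<beta>\<in>F. \<forall>\<gamma>\<in>F - {\<beta>}. exp_less \<gamma> \<beta>"
  using assms
proof (induction F rule: finite_ne_induct)
  case (insert \<alpha> F)
  then obtain \<beta> where b: "\<beta> \<in> F" "\<forall>\<gamma>\<in>F - {\<beta>}. exp_less \<gamma> \<beta>" by auto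
  then have "exp_less \<alpha> \<beta> \<or> exp_less \<beta> \<alpha>"
    using insert by (intro exp_less_total[of _ n]) auto
  then show ?case
  proof
    assume "exp_less \<alpha> \<beta>"
    then show ?thesis using b by auto
  next
    assume ba: "exp_less \<beta> \<alpha>"
    have "exp_less \<gamma> \<alpha>" if "\<gamma> \<in> F" for \<gamma>
      using b(2) that ba exp_less_trans by (cases "\<gamma> = \<beta>") blast+
    then show ?thesis by auto
  qed
qed auto

lemma incseq_subsequence:
  fixes g :: "nat \<Rightarrow> nat"
  shows "\<exists>f. strict_mono f \<and> incseq (g \<circ> f)"
proof -
  \<comment> \<open>Beyond any m there is an index at which g takes its minimum on the tail.\<close>
  have step: "\<exists>k>m. \<forall>j>m. g k \<le> g j" for m
  proof -
    obtain k where "k \<in> {m<..}" "\<forall>j\<in>{m<..}. g k \<le> g j"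
      using arg_min_natI[of "\<lambda>k. k \<in> {m<..}" "Suc m" g] arg_min_nat_le[of "\<lambda>k. k \<in> {m<..}" _ g] by auto
    then show ?thesis by auto
  qed
  obtain f where f: "\<And>k. f k < f (Suc k) \<and> (\<forall>j > f k. g (f (Suc k)) \<le> g j)"
    using dependent_nat_choice[of "\<lambda>_ _. True" "\<lambda>_ x y. x < y \<and> (\<forall>j>x. g y \<le> g j)"] step by auto
  have mono: "strict_mono f" using f by (simp add: strict_mono_Suc_iff)
  have "g (f (Suc k)) \<le> g (f (Suc (Suc k)))" for k
    using f[of k] f[of "Suc k"] by (meson less_trans)
  \<comment> \<open>The starting index f 0 is arbitrary and need not be a minimum of any tail, hence
    the shift by one.\<close>
  then have "incseq (g \<circ> (\<lambda>k. f (Suc k)))" by (intro incseq_SucI) simp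
  moreover have "strict_mono (\<lambda>k. f (Suc k))" using mono by (simp add: strict_mono_def)
  ultimately show ?thesis by blast
qed

lemma incseq_subsequence_finite:
  fixes g :: "nat \<Rightarrow> 'i \<Rightarrow> nat"
  assumes "finite I"
  shows "\<exists>f. strict_mono f \<and> (\<forall>i\<in>I. incseq (\<lambda>k. g (f k) i))"
  using assms
proof (induction I)
  case empty
  show ?case using strict_mono_id by auto
next
  case (insert i I)
  then obtain f where f: "strict_mono f" "\<forall>i\<in>I. incseq (\<lambda>k. g (f k) i)" by blast
  obtain f' where f': "strict_mono f'" "incseq ((\<lambda>k. g (f k) i) \<circ> f')"
    using incseq_subsequence by blast
  have "strict_mono (f \<circ> f')" using f(1) f'(1) by (rule strict_mono_o)
  moreover have "incseq (\<lambda>k. g ((f \<circ> f') k) j)" if "j \<in> insert i I" for j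
  proof (cases "j = i")
    case True
    then show ?thesis using f'(2) by (simp add: comp_def)
  next
    case False
    then have "incseq (\<lambda>k. g (f k) j)" using f(2) that by auto
    then show ?thesis using strict_mono_mono[OF f'(1)] unfolding incseq_def mono_def by simp
  qed
  ultimately show ?case by blast
qed

text \<open>The minimal elements of Z are finite in number: an infinite sequence of them would have
  a subsequence that increases in every coordinate, and two of its members would be comparable,
  hence equal by minimality. Every element dominates a minimal one by induction on the sum of its
  exponents.\<close>

lemma dickson:
  assumes "Z \<subseteq> exps n"
  shows "\<exists>F. finite F \<and> F \<subseteq> Z \<and> (\<forall>\<alpha>\<in>Z. \<exists>\<phi>\<in>F. \<forall>i. \<phi> i \<le> \<alpha> i)"
proof -
  define F where "F = {\<alpha>\<in>Z. \<forall>\<beta>\<in>Z. (\<forall>i. \<beta> i \<le> \<alpha> i) \<longrightarrow> \<beta> = \<alpha>}"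
  have "finite F"
  proof (rule ccontr)
    assume "infinite F"
    then obtain g :: "nat \<Rightarrow> nat \<Rightarrow> nat" where g: "inj g" "range g \<subseteq> F"
      using infinite_countable_subset by blast
    obtain f where f: "strict_mono f" "\<forall>i\<in>{1..n}. incseq (\<lambda>k. g (f k) i)"
      using incseq_subsequence_finite[of "{1..n}" g] by auto
    have gF: "g k \<in> F" for k using g(2) by auto
    then have gZ: "g k \<in> exps n" for k using assms unfolding F_def by blast
    have "g (f 0) i \<le> g (f 1) i" for i
    proof (cases "i \<in> {1..n}")
      case True
      then show ?thesis using f(2) by (simp add: incseq_def)
    next
      case False
      then show ?thesis using gZ unfolding exps_def by simp
    qed
    then have "g (f 0) = g (f 1)" using gF unfolding F_def by blast
    then have "f 0 = f 1" using g(1) by (simp add: inj_eq)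
    then show False using f(1) by (metis less_irrefl strict_monoD zero_less_one)
  qed
  moreover have "\<exists>\<phi>\<in>F. \<forall>i. \<phi> i \<le> \<alpha> i" if "\<alpha> \<in> Z" for \<alpha>
    using that
  proof (induction "\<Sum>i\<in>{1..n}. \<alpha> i" arbitrary: \<alpha> rule: less_induct)
    case less
    show ?case
    proof (cases "\<alpha> \<in> F")
      case False
      then obtain \<beta> where b: "\<beta> \<in> Z" "\<forall>i. \<beta> i \<le> \<alpha> i" "\<beta> \<noteq> \<alpha>" using less.prems unfolding F_def by blast
      then obtain i where i: "\<beta> i \<noteq> \<alpha> i" by auto
      then have "\<beta> i < \<alpha> i" using b(2) by (simp add: le_neq_trans)
      then have "i \<in> {1..n}" using less.prems assms unfolding exps_def by force
      then have "(\<Sum>i\<in>{1..n}. \<beta> i) < (\<Sum>i\<in>{1..n}. \<alpha> i)"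
        using b(2) \<open>\<beta> i < \<alpha> i\<close> by (intro sum_strict_mono_ex1) auto
      then obtain \<phi> where "\<phi> \<in> F" "\<forall>i. \<phi> i \<le> \<beta> i" using less.hyps b(1) by blast
      then show ?thesis using b(2) order_trans by blast
    qed auto
  qed
  moreover have "F \<subseteq> Z" unfolding F_def by blast
  ultimately show ?thesis by blast
qed

subsection \<open>Generic flatness\<close>

text \<open>An abstract simple module with a chosen vector: \<open>v\<close> stands for the
  monomials applied to that vector, \<open>sh\<close> for multiplication by a monomial, and
  \<open>\<kappa>\<close> for the nonzero scalars by which a product of monomials in the twist
  differs from a monomial. Leading-term arguments survive such scalars.\<close>

locale monomial_action = poly_action K V s \<theta>
    for K :: "('k, 'l) ring_scheme" (structure) and V :: "('v, 'm) ring_scheme" (structure)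
      and s :: "'k \<Rightarrow> 'v \<Rightarrow> 'v" and \<theta> :: "'v \<Rightarrow> 'v" +
  fixes n :: nat and v :: "(nat \<Rightarrow> nat) \<Rightarrow> 'v" and sh :: "(nat \<Rightarrow> nat) \<Rightarrow> 'v \<Rightarrow> 'v"
    and \<kappa> :: "(nat \<Rightarrow> nat) \<Rightarrow> (nat \<Rightarrow> nat) \<Rightarrow> 'k"
  assumes v_closed [simp]: "\<alpha> \<in> exps n \<Longrightarrow> v \<alpha> \<in> carrier V"
    and v_zero: "v (\<lambda>_. 0) \<noteq> \<zero>\<^bsub>V\<^esub>"
    and sh_closed [simp]: "\<gamma> \<in> exps n \<Longrightarrow> u \<in> carrier V \<Longrightarrow> sh \<gamma> u \<in> carrier V"
    and sh_add: "\<gamma> \<in> exps n \<Longrightarrow> u \<in> carrier V \<Longrightarrow> u' \<in> carrier V \<Longrightarrow> sh \<gamma> (u \<oplus>\<^bsub>V\<^esub> u') = sh \<gamma> u \<oplus>\<^bsub>V\<^esub> sh \<gamma> u'"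
    and sh_s: "\<gamma> \<in> exps n \<Longrightarrow> a \<in> carrier K \<Longrightarrow> u \<in> carrier V \<Longrightarrow> sh \<gamma> (s a u) = s a (sh \<gamma> u)"
    and sh_th: "\<gamma> \<in> exps n \<Longrightarrow> u \<in> carrier V \<Longrightarrow> sh \<gamma> (\<theta> u) = \<theta> (sh \<gamma> u)"
    and kappa: "\<gamma> \<in> exps n \<Longrightarrow> \<alpha> \<in> exps n \<Longrightarrow> \<kappa> \<gamma> \<alpha> \<in> carrier K - {\<zero>}"
    and sh_v: "\<gamma> \<in> exps n \<Longrightarrow> \<alpha> \<in> exps n \<Longrightarrow> sh \<gamma> (v \<alpha>) = s (\<kappa> \<gamma> \<alpha>) (v (\<lambda>i. \<alpha> i + \<gamma> i))"
    and v_span: "\<lbrakk>W \<subseteq> carrier V; \<zero>\<^bsub>V\<^esub> \<in> W; \<And>u u'. u \<in> W \<Longrightarrow> u' \<in> W \<Longrightarrow> u \<oplus>\<^bsub>V\<^esub> u' \<in> W;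
        \<And>a u. a \<in> carrier K \<Longrightarrow> u \<in> W \<Longrightarrow> s a u \<in> W; v ` exps n \<subseteq> W\<rbrakk> \<Longrightarrow> W = carrier V"
begin

definition stable :: "'v set \<Rightarrow> bool" where
  "stable W \<longleftrightarrow> W \<subseteq> carrier V \<and> \<zero>\<^bsub>V\<^esub> \<in> W \<and> (\<forall>u\<in>W. \<forall>u'\<in>W. u \<oplus>\<^bsub>V\<^esub> u' \<in> W) \<and>
     (\<forall>p u. set p \<subseteq> carrier K \<longrightarrow> u \<in> W \<longrightarrow> act p u \<in> W)"

text \<open>The submodule over K[X] that the monomials with exponents in Z generate.\<close>

definition dspan :: "(nat \<Rightarrow> nat) set \<Rightarrow> 'v set" where
  "dspan Z = \<Inter>{W. stable W \<and> v ` Z \<subseteq> W}"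

definition below :: "(nat \<Rightarrow> nat) \<Rightarrow> (nat \<Rightarrow> nat) set" where
  "below \<alpha> = {\<beta> \<in> exps n. exp_less \<beta> \<alpha>}"

definition nontrivial :: "'k list \<Rightarrow> bool" where
  "nontrivial p \<longleftrightarrow> set p \<subseteq> carrier K \<and> (\<exists>a\<in>set p. a \<noteq> \<zero>)"

text \<open>The analogue of the exponents of an initial ideal: those at which the monomial is
  torsion modulo the K[X]-span of the smaller ones. By \<open>dspan_below_add\<close> the set is
  closed under adding exponents, which makes \<open>dickson\<close> applicable.\<close>

definition bound :: "(nat \<Rightarrow> nat) set" where
  "bound = {\<alpha> \<in> exps n. \<exists>p. nontrivial p \<and> act p (v \<alpha>) \<in> dspan (below \<alpha>)}"

lemma stableD:
  assumes "stable W"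
  shows "W \<subseteq> carrier V" "\<zero>\<^bsub>V\<^esub> \<in> W" "\<And>u u'. u \<in> W \<Longrightarrow> u' \<in> W \<Longrightarrow> u \<oplus>\<^bsub>V\<^esub> u' \<in> W"
    "\<And>p u. set p \<subseteq> carrier K \<Longrightarrow> u \<in> W \<Longrightarrow> act p u \<in> W"
  using assms unfolding stable_def by auto

lemma stable_carrier: "stable (carrier V)"
  unfolding stable_def by auto

lemma stable_s: "stable W \<Longrightarrow> a \<in> carrier K \<Longrightarrow> u \<in> W \<Longrightarrow> s a u \<in> W"
  using stableD(4)[of W "[a]" u] stableD(1)[of W] by auto

lemma stable_minus:
  assumes W: "stable W" and u: "u \<in> W" "u' \<in> W" shows "u \<ominus>\<^bsub>V\<^esub> u' \<in> W"
proof -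
  have c: "u \<in> carrier V" "u' \<in> carrier V" using stableD(1)[OF W] u by auto
  have "s (\<ominus> \<one>) u' = \<ominus>\<^bsub>V\<^esub> u'" using s_neg[of \<one> u'] c by simp
  then have "\<ominus>\<^bsub>V\<^esub> u' \<in> W" using stable_s[OF W _ u(2), of "\<ominus> \<one>"] by simp
  then show ?thesis using stableD(3)[OF W u(1)] by (simp add: V.minus_eq)
qed

lemma dspan_stable:
  assumes "Z \<subseteq> exps n" shows "stable (dspan Z)"
proof -
  have "dspan Z \<subseteq> carrier V" using stable_carrier assms unfolding dspan_def by (intro Inter_lower) auto
  then show ?thesis unfolding stable_def dspan_def using stableD by auto
qed

lemma dspan_base: "\<alpha> \<in> Z \<Longrightarrow> v \<alpha> \<in> dspan Z"
  unfolding dspan_def by blast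

lemma dspan_least: "stable W \<Longrightarrow> (\<And>\<alpha>. \<alpha> \<in> Z \<Longrightarrow> v \<alpha> \<in> W) \<Longrightarrow> dspan Z \<subseteq> W"
  unfolding dspan_def by blast

lemma dspan_mono: "Z \<subseteq> Y \<Longrightarrow> dspan Z \<subseteq> dspan Y"
  unfolding dspan_def by blast

lemma dspan_empty: "dspan {} = {\<zero>\<^bsub>V\<^esub>}"
proof -
  have "act p \<zero>\<^bsub>V\<^esub> = \<zero>\<^bsub>V\<^esub>" if "set p \<subseteq> carrier K" for p
    by (rule additive_zero) (use that act_add in auto)
  then have "stable {\<zero>\<^bsub>V\<^esub>}" unfolding stable_def by auto
  then show ?thesis using dspan_least[of "{\<zero>\<^bsub>V\<^esub>}" "{}"] stableD(2)[OF dspan_stable[of "{}"]] by blast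
qed

lemma dspan_insert:
  assumes "Z \<subseteq> exps n" "\<alpha> \<in> exps n" "u \<in> dspan (insert \<alpha> Z)"
  shows "\<exists>p y. set p \<subseteq> carrier K \<and> y \<in> dspan Z \<and> u = act p (v \<alpha>) \<oplus>\<^bsub>V\<^esub> y"
proof -
  let ?W = "{act p (v \<alpha>) \<oplus>\<^bsub>V\<^esub> y | p y. set p \<subseteq> carrier K \<and> y \<in> dspan Z}"
  note Z = stableD[OF dspan_stable[OF assms(1)]]
  have va: "v \<alpha> \<in> carrier V" using assms(2) by simp
  have "stable ?W"
    unfolding stable_def
  proof (intro conjI ballI allI impI)
    show "?W \<subseteq> carrier V" using va Z(1) by auto
    show "\<zero>\<^bsub>V\<^esub> \<in> ?W" using Z(2) by (force intro: exI[of _ "[]"])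
    fix u u' assume "u \<in> ?W" "u' \<in> ?W"
    then obtain p y p' y' where *: "u = act p (v \<alpha>) \<oplus>\<^bsub>V\<^esub> y" "u' = act p' (v \<alpha>) \<oplus>\<^bsub>V\<^esub> y'"
      "set p \<subseteq> carrier K" "set p' \<subseteq> carrier K" "y \<in> dspan Z" "y' \<in> dspan Z" by blast
    then have c: "y \<in> carrier V" "y' \<in> carrier V" using Z(1) by auto
    have "u \<oplus>\<^bsub>V\<^esub> u' = act (K.hadd p p') (v \<alpha>) \<oplus>\<^bsub>V\<^esub> (y \<oplus>\<^bsub>V\<^esub> y')"
      using * va c by (simp add: act_hadd V.a_ac)
    then show "u \<oplus>\<^bsub>V\<^esub> u' \<in> ?W" using Z(3) * K.set_hadd by blast
  next
    fix q u assume q: "set q \<subseteq> carrier K" and "u \<in> ?W"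
    then obtain p y where *: "u = act p (v \<alpha>) \<oplus>\<^bsub>V\<^esub> y" "set p \<subseteq> carrier K" "y \<in> dspan Z" by blast
    then have c: "y \<in> carrier V" using Z(1) by auto
    have "act q u = act (K.hmult q p) (v \<alpha>) \<oplus>\<^bsub>V\<^esub> act q y"
      using * va c q by (simp add: act_add act_hmult)
    then show "act q u \<in> ?W" using Z(4) * q K.set_hmult by blast
  qed
  moreover have "v \<beta> \<in> ?W" if b: "\<beta> \<in> insert \<alpha> Z" for \<beta>
  proof (cases "\<beta> = \<alpha>")
    case True
    have "v \<alpha> = act [\<one>] (v \<alpha>) \<oplus>\<^bsub>V\<^esub> \<zero>\<^bsub>V\<^esub>" using va by simp
    moreover have "set [\<one>] \<subseteq> carrier K" by simp
    ultimately show ?thesis using True Z(2) by blast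
  next
    case False
    then have "v \<beta> \<in> dspan Z" using b dspan_base by blast
    moreover have "v \<beta> = act [] (v \<alpha>) \<oplus>\<^bsub>V\<^esub> v \<beta>" using False b assms(1) by auto
    moreover have "set [] \<subseteq> carrier K" by simp
    ultimately show ?thesis by blast
  qed
  ultimately have "dspan (insert \<alpha> Z) \<subseteq> ?W" by (rule dspan_least)
  then show ?thesis using assms(3) by blast
qed

lemma dspan_finite:
  assumes "Z \<subseteq> exps n" "u \<in> dspan Z"
  shows "\<exists>F. finite F \<and> F \<subseteq> Z \<and> u \<in> dspan F"
proof -
  let ?W = "{u. \<exists>F. finite F \<and> F \<subseteq> Z \<and> u \<in> dspan F}"
  have st: "stable (dspan F)" if "F \<subseteq> Z" for F using that assms(1) by (intro dspan_stable) blast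
  have "stable ?W"
    unfolding stable_def
  proof (intro conjI ballI allI impI)
    show "?W \<subseteq> carrier V" using stableD(1)[OF st] by blast
    show "\<zero>\<^bsub>V\<^esub> \<in> ?W" using stableD(2)[OF st[of "{}"]] by blast
    fix u u' assume "u \<in> ?W" "u' \<in> ?W"
    then obtain F F' where F: "finite F" "F \<subseteq> Z" "u \<in> dspan F" "finite F'" "F' \<subseteq> Z" "u' \<in> dspan F'" by blast
    have "u \<in> dspan (F \<union> F')" "u' \<in> dspan (F \<union> F')"
      using F dspan_mono[of F "F \<union> F'"] dspan_mono[of F' "F \<union> F'"] by blast+
    then have "u \<oplus>\<^bsub>V\<^esub> u' \<in> dspan (F \<union> F')" using stableD(3)[OF st[of "F \<union> F'"]] F by simp
    then show "u \<oplus>\<^bsub>V\<^esub> u' \<in> ?W" using F by (intro CollectI exI[of _ "F \<union> F'"]) simp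
  next
    fix p u assume "set p \<subseteq> carrier K" "u \<in> ?W"
    then show "act p u \<in> ?W" using stableD(4)[OF st] by blast
  qed
  moreover have "v \<alpha> \<in> ?W" if "\<alpha> \<in> Z" for \<alpha>
    using that dspan_base[of \<alpha> "{\<alpha>}"] by (intro CollectI exI[of _ "{\<alpha>}"]) simp
  ultimately have "dspan Z \<subseteq> ?W" by (rule dspan_least)
  then show ?thesis using assms(2) by blast
qed

lemma below_subset: "below \<alpha> \<subseteq> exps n" unfolding below_def by blast

text \<open>Multiplication by the monomial \<gamma> is K[X]-linear and carries the span below
  \<alpha> into the span below \<alpha> + \<gamma>, because the order respects addition. The scalar
  \<open>\<kappa> \<gamma> \<alpha>\<close> that appears is a unit and is cancelled. The same
  polynomial p therefore works for both exponents.\<close>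

lemma dspan_below_add:
  assumes a: "\<alpha> \<in> exps n" and g: "\<gamma> \<in> exps n" and p: "set p \<subseteq> carrier K"
    and mem: "act p (v \<alpha>) \<in> dspan (below \<alpha>)"
  shows "act p (v (\<lambda>i. \<alpha> i + \<gamma> i)) \<in> dspan (below (\<lambda>i. \<alpha> i + \<gamma> i))"
proof -
  let ?\<alpha>' = "\<lambda>i. \<alpha> i + \<gamma> i"
  have D: "stable (dspan (below ?\<alpha>'))" by (intro dspan_stable below_subset)
  have shact: "sh \<gamma> (act q u) = act q (sh \<gamma> u)" if "set q \<subseteq> carrier K" "u \<in> carrier V" for q u
    using that g by (intro act_commute[of "sh \<gamma>"]) (auto simp: sh_add sh_s sh_th)
  let ?W = "{u \<in> carrier V. sh \<gamma> u \<in> dspan (below ?\<alpha>')}"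
  have "stable ?W"
    unfolding stable_def
  proof (intro conjI ballI allI impI)
    show "\<zero>\<^bsub>V\<^esub> \<in> ?W"
      using additive_zero[of "sh \<gamma>"] g stableD(2)[OF D] by (simp add: sh_add)
  qed (use stableD[OF D] g in \<open>auto simp: sh_add shact\<close>)
  moreover have "v \<beta> \<in> ?W" if "\<beta> \<in> below \<alpha>" for \<beta>
  proof -
    have b: "\<beta> \<in> exps n" "exp_less \<beta> \<alpha>" using that unfolding below_def by auto
    have "(\<lambda>i. \<beta> i + \<gamma> i) \<in> below ?\<alpha>'"
      using exps_add[OF b(1) g] exp_less_add[OF b(2)] unfolding below_def by blast
    then have "s (\<kappa> \<gamma> \<beta>) (v (\<lambda>i. \<beta> i + \<gamma> i)) \<in> dspan (below ?\<alpha>')"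
      using kappa[OF g b(1)] by (intro stable_s[OF D] dspan_base) auto
    then show ?thesis using b g sh_v by simp
  qed
  ultimately have "dspan (below \<alpha>) \<subseteq> ?W" by (rule dspan_least)
  then have "sh \<gamma> (act p (v \<alpha>)) \<in> dspan (below ?\<alpha>')" using mem by blast
  then have mem: "s (\<kappa> \<gamma> \<alpha>) (act p (v ?\<alpha>')) \<in> dspan (below ?\<alpha>')"
    using shact[OF p] a g p kappa[OF g a] exps_add[OF a g] by (simp add: sh_v act_s)
  have u: "\<kappa> \<gamma> \<alpha> \<in> Units K" using kappa[OF g a] K.field_Units by simp
  have mem': "s (inv (\<kappa> \<gamma> \<alpha>)) (s (\<kappa> \<gamma> \<alpha>) (act p (v ?\<alpha>'))) \<in> dspan (below ?\<alpha>')"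
    using K.Units_inv_closed[OF u] mem by (rule stable_s[OF D])
  have "s (inv (\<kappa> \<gamma> \<alpha>)) (s (\<kappa> \<gamma> \<alpha>) (act p (v ?\<alpha>'))) = act p (v ?\<alpha>')"
    using u p exps_add[OF a g] by (simp flip: s_mult add: K.Units_closed)
  then show ?thesis using mem' by simp
qed

lemma act_inj:
  assumes "nontrivial p" "u \<in> carrier V" "act p u = \<zero>\<^bsub>V\<^esub>" shows "u = \<zero>\<^bsub>V\<^esub>"
proof -
  have "act p \<zero>\<^bsub>V\<^esub> = \<zero>\<^bsub>V\<^esub>"
    by (rule additive_zero) (use assms act_add in \<open>auto simp: nontrivial_def\<close>)
  then show ?thesis using act_bij[of p] assms unfolding nontrivial_def bij_betw_def inj_on_def
    by (metis V.zero_closed)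
qed

text \<open>Both factors act injectively, so their product does not kill the nonzero vector at
  exponent 0, as a list of zeros would.\<close>

lemma nontrivial_hmult:
  assumes p: "nontrivial p" and q: "nontrivial q" shows "nontrivial (K.hmult p q)"
proof (rule ccontr)
  assume not: "\<not> nontrivial (K.hmult p q)"
  have set: "set p \<subseteq> carrier K" "set q \<subseteq> carrier K" "set (K.hmult p q) \<subseteq> carrier K"
    using p q K.set_hmult unfolding nontrivial_def by auto
  have v0: "v (\<lambda>_. 0) \<in> carrier V" using exps_zero by simp
  have pq: "act p (act q (v (\<lambda>_. 0))) = \<zero>\<^bsub>V\<^esub>"
    using act_hmult[OF set(1,2) v0] act_all_zero[of "K.hmult p q"] v0 not set(3) unfolding nontrivial_def by auto
  have "act q (v (\<lambda>_. 0)) = \<zero>\<^bsub>V\<^esub>" using act_inj[OF p act_closed[OF set(2) v0] pq] .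
  then have "v (\<lambda>_. 0) = \<zero>\<^bsub>V\<^esub>" by (rule act_inj[OF q v0])
  then show False using v_zero by simp
qed

lemma nontrivial_one: "nontrivial [\<one>]"
  unfolding nontrivial_def by simp

text \<open>The polynomials that belong to the finitely many minimal elements of
  \<open>bound\<close> are multiplied together. The product f is the one element that has to be
  inverted in generic flatness.\<close>

lemma common_bound:
  "\<exists>f. nontrivial f \<and> (\<forall>\<alpha>\<in>bound. act f (v \<alpha>) \<in> dspan (below \<alpha>))"
proof -
  have bs: "bound \<subseteq> exps n" unfolding bound_def by blast
  obtain F where F: "finite F" "F \<subseteq> bound" "\<forall>\<alpha>\<in>bound. \<exists>\<phi>\<in>F. \<forall>i. \<phi> i \<le> \<alpha> i"
    using dickson[OF bs] by (elim exE conjE)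
  have "\<exists>f. nontrivial f \<and> (\<forall>\<alpha>\<in>F. act f (v \<alpha>) \<in> dspan (below \<alpha>))"
    using F(1,2)
  proof (induction F)
    case empty
    then show ?case using nontrivial_one by blast
  next
    case (insert \<phi> F)
    then obtain f where f: "nontrivial f" "\<forall>\<alpha>\<in>F. act f (v \<alpha>) \<in> dspan (below \<alpha>)" by blast
    obtain p where p: "nontrivial p" "act p (v \<phi>) \<in> dspan (below \<phi>)"
      using insert.prems unfolding bound_def by blast
    have set: "set p \<subseteq> carrier K" "set f \<subseteq> carrier K" using p f unfolding nontrivial_def by auto
    have vc: "v \<alpha> \<in> carrier V" if "\<alpha> \<in> insert \<phi> F" for \<alpha> using that insert.prems unfolding bound_def by auto
    have "act (K.hmult f p) (v \<alpha>) \<in> dspan (below \<alpha>)" if a: "\<alpha> \<in> insert \<phi> F" for \<alpha>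
    proof -
      note st = stableD(4)[OF dspan_stable[OF below_subset[of \<alpha>]]]
      show ?thesis
      proof (cases "\<alpha> = \<phi>")
        case True
        then show ?thesis using st[OF set(2) p(2)[folded True]] act_hmult[OF set(2,1) vc[OF a]] by simp
      next
        case False
        then have "act f (v \<alpha>) \<in> dspan (below \<alpha>)" using a f(2) by blast
        then show ?thesis using st[OF set(1)] act_hmult[OF set(2,1) vc[OF a]] act_comm[OF set(2,1) vc[OF a]] by simp
      qed
    qed
    then show ?case using nontrivial_hmult[OF f(1) p(1)] by blast
  qed
  then obtain f where f: "nontrivial f" "\<forall>\<alpha>\<in>F. act f (v \<alpha>) \<in> dspan (below \<alpha>)" by blast
  have "act f (v \<alpha>) \<in> dspan (below \<alpha>)" if a: "\<alpha> \<in> bound" for \<alpha>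
  proof -
    obtain \<phi> where ph: "\<phi> \<in> F" "\<forall>i. \<phi> i \<le> \<alpha> i" using F(3) a by blast
    have ex: "\<alpha> \<in> exps n" "\<phi> \<in> exps n" using a F(2) ph(1) unfolding bound_def by auto
    have g: "(\<lambda>i. \<alpha> i - \<phi> i) \<in> exps n" using ex unfolding exps_def by auto
    have "act f (v (\<lambda>i. \<phi> i + (\<alpha> i - \<phi> i))) \<in> dspan (below (\<lambda>i. \<phi> i + (\<alpha> i - \<phi> i)))"
      using f ph(1) unfolding nontrivial_def by (intro dspan_below_add[OF ex(2) g]) auto
    then show ?thesis using ph(2) by simp
  qed
  then show ?thesis using f(1) by blast
qed

text \<open>Let \<beta> be the greatest exponent in F, with coefficient p. All other terms,
  including the one at exponent 0, lie below \<beta>, so p would put \<beta> into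
  \<open>bound\<close> if it were nonzero. Hence \<beta> drops out. Once F is exhausted, e kills the
  nonzero vector at 0 and must be zero.\<close>

lemma independent:
  assumes "finite F" "F \<subseteq> exps n - bound - {\<lambda>_. 0}" and e: "set e \<subseteq> carrier K"
    and mem: "act e (v (\<lambda>_. 0)) \<in> dspan F"
  shows "\<not> nontrivial e"
  using assms(1,2,4)
proof (induction "card F" arbitrary: F rule: less_induct)
  case less
  show ?case
  proof (cases "F = {}")
    case True
    then show ?thesis using less.prems(3) act_inj[of e "v (\<lambda>_. 0)"] v_zero exps_zero by (auto simp: dspan_empty)
  next
    case False
    obtain \<beta> where b: "\<beta> \<in> F" "\<forall>\<gamma>\<in>F - {\<beta>}. exp_less \<gamma> \<beta>"
      using exp_greatest[OF less.prems(1) False, of n] less.prems(2) by blast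
    let ?F = "F - {\<beta>}"
    have Fe: "F \<subseteq> exps n" using less.prems(2) by blast
    have be: "\<beta> \<in> exps n" "\<beta> \<notin> bound" "\<beta> \<noteq> (\<lambda>_. 0)" using b(1) less.prems(2) by auto
    have ins: "insert \<beta> ?F = F" using b(1) by blast
    obtain p y where p: "set p \<subseteq> carrier K" and y: "y \<in> dspan ?F"
      and eq: "act e (v (\<lambda>_. 0)) = act p (v \<beta>) \<oplus>\<^bsub>V\<^esub> y"
      using dspan_insert[of ?F \<beta> "act e (v (\<lambda>_. 0))"] less.prems(3) Fe be(1) unfolding ins by blast
    have D: "stable (dspan (below \<beta>))" by (intro dspan_stable below_subset)
    have yD: "y \<in> dspan (below \<beta>)"
      using y b(2) Fe dspan_mono[of ?F "below \<beta>"] unfolding below_def by blast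
    have "(\<lambda>_. 0) \<in> below \<beta>"
      unfolding below_def using exp_less_total[OF exps_zero be(1)] be(3) exp_less_zero exps_zero by auto
    then have "act e (v (\<lambda>_. 0)) \<in> dspan (below \<beta>)"
      using stableD(4)[OF D e] dspan_base by blast
    then have "act e (v (\<lambda>_. 0)) \<ominus>\<^bsub>V\<^esub> y \<in> dspan (below \<beta>)" using yD stable_minus[OF D] by blast
    moreover have yc: "y \<in> carrier V" using yD stableD(1)[OF D] by blast
    have "act e (v (\<lambda>_. 0)) \<ominus>\<^bsub>V\<^esub> y = act p (v \<beta>)"
      unfolding eq using yc p be(1) by (simp add: V.minus_eq V.a_assoc V.r_neg)
    ultimately have "act p (v \<beta>) \<in> dspan (below \<beta>)" by simp
    then have "\<not> nontrivial p" using be(1,2) unfolding bound_def by blast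
    then have "act p (v \<beta>) = \<zero>\<^bsub>V\<^esub>" using p be(1) act_all_zero[of p] unfolding nontrivial_def by auto
    then have "act e (v (\<lambda>_. 0)) \<in> dspan ?F" using eq y yc by simp
    moreover have "finite ?F" "?F \<subseteq> exps n - bound - {\<lambda>_. 0}" using less.prems by auto
    ultimately show ?thesis
      by (intro less.hyps[OF card_Diff1_less[OF less.prems(1) b(1)]])
  qed
qed

text \<open>All nonzero polynomials in \<open>\<theta>\<close> act bijectively, so \<open>V\<close> is a vector space over \<open>K(\<theta>)\<close>. The monomials
  with exponents outside \<open>bound\<close> are independent over \<open>K[\<theta>]\<close>, and \<open>V\<close> is their span over
  \<open>K[\<theta>, 1/f]\<close>. On this free module \<open>\<theta> - x\<close> is not surjective if \<open>f(x) \<noteq> 0\<close>, and such an \<open>x\<close> is a root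
  of \<open>1 + t f(t)\<close>.\<close>

lemma impossible: False
proof -
  let ?o = "\<lambda>_ :: nat. 0 :: nat"
  obtain f where f: "nontrivial f" and fb: "\<And>\<alpha>. \<alpha> \<in> bound \<Longrightarrow> act f (v \<alpha>) \<in> dspan (below \<alpha>)"
    using common_bound by blast
  have fK: "set f \<subseteq> carrier K" using f unfolding nontrivial_def by blast
  let ?D = "exps n - bound"
  have D: "stable (dspan ?D)" by (intro dspan_stable) blast
  have fpK: "set (K.hpow f k) \<subseteq> carrier K" for k using K.set_hpow[OF fK] .
  have v0: "v ?o \<in> carrier V" using exps_zero by simp
  have fpow: "act (K.hpow f (j + k)) u = act (K.hpow f j) (act (K.hpow f k) u)" if "u \<in> carrier V" for j k u
    by (induction j) (use that fK fpK in \<open>auto simp: act_hmult\<close>)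
  let ?W = "{u \<in> carrier V. \<exists>k. act (K.hpow f k) u \<in> dspan ?D}"
  have W: "stable ?W"
    unfolding stable_def
  proof (intro conjI ballI allI impI)
    show "?W \<subseteq> carrier V" by blast
    show "\<zero>\<^bsub>V\<^esub> \<in> ?W" using stableD(2,4)[OF D] fpK[of 0] by blast
  next
    fix u u' assume "u \<in> ?W" "u' \<in> ?W"
    then obtain j k where c: "u \<in> carrier V" "u' \<in> carrier V"
      and m: "act (K.hpow f j) u \<in> dspan ?D" "act (K.hpow f k) u' \<in> dspan ?D" by blast
    have "act (K.hpow f (j + k)) u \<in> dspan ?D" "act (K.hpow f (j + k)) u' \<in> dspan ?D"
      using fpow[OF c(1), of k j] fpow[OF c(2), of j k] stableD(4)[OF D fpK m(1)] stableD(4)[OF D fpK m(2)]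
      by (simp_all add: add.commute)
    then have "act (K.hpow f (j + k)) (u \<oplus>\<^bsub>V\<^esub> u') \<in> dspan ?D"
      using act_add[OF fpK c] stableD(3)[OF D] by simp
    then show "u \<oplus>\<^bsub>V\<^esub> u' \<in> ?W" using c by blast
  next
    fix p u assume p: "set p \<subseteq> carrier K" and "u \<in> ?W"
    then obtain k where u: "u \<in> carrier V" and m: "act (K.hpow f k) u \<in> dspan ?D" by blast
    have "act (K.hpow f k) (act p u) \<in> dspan ?D"
      using act_comm[OF fpK p u] stableD(4)[OF D p m] by simp
    then show "act p u \<in> ?W" using p u by auto
  qed
  \<comment> \<open>Well-founded induction: for \<alpha> in \<open>bound\<close> the polynomial f
    moves the vector into the span of smaller monomials, for which a power of f is already known, so
    one more factor f is enough.\<close>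
  have vW: "v \<alpha> \<in> ?W" if "\<alpha> \<in> exps n" for \<alpha>
    using wf_exp_less[of n] that
  proof (induction \<alpha> rule: wf_induct_rule)
    case (less \<alpha>)
    show ?case
    proof (cases "\<alpha> \<in> bound")
      case True
      have "v \<beta> \<in> ?W" if "\<beta> \<in> below \<alpha>" for \<beta>
        using less that unfolding below_def by blast
      then have "dspan (below \<alpha>) \<subseteq> ?W" by (intro dspan_least W)
      then have "act f (v \<alpha>) \<in> ?W" using fb[OF True] by blast
      then obtain k where "act (K.hpow f k) (act f (v \<alpha>)) \<in> dspan ?D" by blast
      then have "act (K.hpow f (Suc k)) (v \<alpha>) \<in> dspan ?D"
        using less.prems fK fpK[of k] act_comm[OF fK fpK[of k], of "v \<alpha>"] by (simp add: act_hmult)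
      then show ?thesis using v_closed[OF less.prems] by blast
    next
      case False
      then have "v \<alpha> \<in> dspan ?D" using less.prems by (intro dspan_base) blast
      then have "act (K.hpow f 0) (v \<alpha>) \<in> dspan ?D" using less.prems by simp
      then show ?thesis using v_closed[OF less.prems] by blast
    qed
  qed
  have WV: "?W = carrier V"
  proof (rule v_span)
    show "?W \<subseteq> carrier V" by blast
    show "\<zero>\<^bsub>V\<^esub> \<in> ?W" by (rule stableD(2)[OF W])
    show "u \<oplus>\<^bsub>V\<^esub> u' \<in> ?W" if "u \<in> ?W" "u' \<in> ?W" for u u' using that by (rule stableD(3)[OF W])
    show "s a u \<in> ?W" if "a \<in> carrier K" "u \<in> ?W" for a u using that by (rule stable_s[OF W])
    show "v ` exps n \<subseteq> ?W"
    proof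
      fix u assume "u \<in> v ` exps n"
      then obtain \<alpha> where "\<alpha> \<in> exps n" "u = v \<alpha>" by (elim imageE)
      then show "u \<in> ?W" using vW by (simp only:)
    qed
  qed
  have o: "?o \<in> ?D"
  proof -
    have "below ?o = {}" unfolding below_def using exp_less_zero by blast
    then have "?o \<notin> bound" unfolding bound_def using act_inj v_zero v0 by (auto simp: dspan_empty)
    then show ?thesis using exps_zero by blast
  qed
  have "\<exists>x\<in>carrier K. K.ev (\<one> # f) x = \<zero>"
    using f unfolding nontrivial_def by (intro K.ev_root_nonconstant) auto
  then obtain x where x: "x \<in> carrier K" "\<one> \<oplus> x \<otimes> K.ev f x = \<zero>" by auto
  have evf: "K.ev f x \<noteq> \<zero>"
  proof
    assume "K.ev f x = \<zero>"
    then show False using x by simp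
  qed
  obtain y where y: "y \<in> carrier V" "\<theta> y \<ominus>\<^bsub>V\<^esub> s x y = v ?o"
    using th_bij[OF x(1)] v0 unfolding bij_betw_def by (metis (no_types, lifting) imageE)
  have "y \<in> ?W" using y(1) WV by simp
  then obtain k where k: "act (K.hpow f k) y \<in> dspan ?D" by blast
  let ?Do = "?D - {?o}"
  have ins: "insert ?o ?Do = ?D" using o by blast
  obtain d z where d: "set d \<subseteq> carrier K" and z: "z \<in> dspan ?Do"
    and eq: "act (K.hpow f k) y = act d (v ?o) \<oplus>\<^bsub>V\<^esub> z"
    using dspan_insert[of ?Do ?o "act (K.hpow f k) y"] k exps_zero unfolding ins by blast
  have Do: "stable (dspan ?Do)" by (intro dspan_stable) blast
  let ?l = "[\<ominus> x, \<one>]"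
  have lK: "set ?l \<subseteq> carrier K" using x(1) by simp
  have l: "act ?l u = \<theta> u \<ominus>\<^bsub>V\<^esub> s x u" if "u \<in> carrier V" for u
    using that x(1) by (simp add: s_neg V.minus_eq V.a_comm)
  \<comment> \<open>This is e = f^k - (X - x) d. Clearing denominators in (\<open>\<theta>\<close> -
    x) y = v 0 gives e v 0 = (X - x) z with z in the span of the other independent monomials.
    Independence forces e = 0, and evaluation at x leaves f(x)^k = 0, a contradiction.\<close>
  let ?e = "K.hadd (K.hpow f k) (K.hscale (\<ominus> \<one>) (K.hmult ?l d))"
  have eK: "set ?e \<subseteq> carrier K" using fpK lK d by (intro K.set_hadd K.set_hscale K.set_hmult) auto
  have zc: "z \<in> carrier V" using z stableD(1)[OF Do] by blast
  have "act (K.hpow f k) (v ?o) = act (K.hpow f k) (act ?l y)" using l[OF y(1)] y(2) by simp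
  also have "\<dots> = act ?l (act d (v ?o) \<oplus>\<^bsub>V\<^esub> z)"
    using act_comm[OF fpK lK y(1)] eq by simp
  also have "\<dots> = act ?l (act d (v ?o)) \<oplus>\<^bsub>V\<^esub> act ?l z"
    using d v0 zc by (intro act_add lK) auto
  finally have 1: "act (K.hpow f k) (v ?o) = act ?l (act d (v ?o)) \<oplus>\<^bsub>V\<^esub> act ?l z" .
  have "act ?e (v ?o) = act (K.hpow f k) (v ?o) \<oplus>\<^bsub>V\<^esub> s (\<ominus> \<one>) (act ?l (act d (v ?o)))"
    using fpK lK d v0 by (simp only: act_hadd act_hscale act_hmult K.set_hscale K.set_hmult K.a_inv_closed K.one_closed)
  also have "s (\<ominus> \<one>) (act ?l (act d (v ?o))) = \<ominus>\<^bsub>V\<^esub> act ?l (act d (v ?o))"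
    using s_neg[of \<one> "act ?l (act d (v ?o))"] act_closed[OF lK act_closed[OF d v0]] by (simp del: act.simps)
  also have "act (K.hpow f k) (v ?o) \<oplus>\<^bsub>V\<^esub> \<ominus>\<^bsub>V\<^esub> act ?l (act d (v ?o)) = act ?l z"
    unfolding 1 using act_closed[OF lK act_closed[OF d v0]] act_closed[OF lK zc]
    by (simp del: act.simps add: V.a_comm[of "act ?l (act d (v ?o))"] V.a_assoc V.r_neg)
  finally have "act ?e (v ?o) \<in> dspan ?Do" using stableD(4)[OF Do lK z] by simp
  then obtain F where F: "finite F" "F \<subseteq> ?Do" "act ?e (v ?o) \<in> dspan F"
    using dspan_finite[of ?Do] by blast
  have "\<not> nontrivial ?e" using F by (intro independent[OF F(1) _ eK]) auto
  then have e0: "K.ev ?e x = \<zero>" using ev_all_zero[OF _ x(1)] eK unfolding nontrivial_def by blast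
  have evl: "K.ev ?l x = \<zero>" using x(1) by (simp add: K.l_neg)
  have evd: "K.ev d x \<in> carrier K" "K.ev (K.hpow f k) x \<in> carrier K"
    using K.ev_closed[OF d x(1)] K.ev_closed[OF fpK x(1)] by auto
  have "K.ev ?e x = K.ev (K.hpow f k) x \<oplus> \<ominus> \<one> \<otimes> (K.ev ?l x \<otimes> K.ev d x)"
    using fpK lK d x(1) by (simp only: K.ev_hadd K.ev_hscale K.ev_hmult K.set_hscale K.set_hmult K.a_inv_closed K.one_closed)
  also have "\<dots> = K.ev (K.hpow f k) x" unfolding evl using evd by simp
  finally have "K.ev (K.hpow f k) x = \<zero>" unfolding e0 by (rule sym)
  then show False using K.ev_hpow[OF fK x(1) evf] by simp
qed

end

section \<open>Graded commutative algebras\<close>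

locale graded_algebra =
  fixes R :: "('k, 'r, 'd) module_scheme" (structure)
    and K :: "('k, 'l) ring_scheme"
    and G :: "('g, 'h) monoid_scheme"
    and \<G> :: "'g \<Rightarrow> 'r set"
  assumes alg: "algebra K R" and closed_field: "algebraically_closed K"
    and grp: "comm_group G" and graded: "graded_by G K R \<G>"

sublocale graded_algebra \<subseteq> R: cring R by (rule algebra.axioms(2)[OF alg])
sublocale graded_algebra \<subseteq> K: algebraically_closed K by (rule closed_field)
sublocale graded_algebra \<subseteq> G: comm_group G by (rule grp)
sublocale graded_algebra \<subseteq> Alg: algebra K R by (rule alg)

context graded_algebra
begin

lemma Units_K: "Units K = carrier K - {\<zero>\<^bsub>K\<^esub>}"
  by (rule K.field_Units)

subsection \<open>Homogeneous components\<close>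

lemma gr_sub: "x \<in> carrier G \<Longrightarrow> submodule (\<G> x) K R"
  using graded unfolding graded_by_def by blast

lemma homog_closed: "x \<in> carrier G \<Longrightarrow> a \<in> \<G> x \<Longrightarrow> a \<in> carrier R"
  using subgroup.subset[OF submodule.axioms(1)[OF gr_sub]] by auto

lemma homog_zero: "x \<in> carrier G \<Longrightarrow> \<zero> \<in> \<G> x"
  using subgroup.one_closed[OF submodule.axioms(1)[OF gr_sub]] by auto

lemma homog_add: "x \<in> carrier G \<Longrightarrow> a \<in> \<G> x \<Longrightarrow> b \<in> \<G> x \<Longrightarrow> a \<oplus> b \<in> \<G> x"
  using subgroup.m_closed[OF submodule.axioms(1)[OF gr_sub]] by auto

lemma homog_smult: "x \<in> carrier G \<Longrightarrow> k \<in> carrier K \<Longrightarrow> a \<in> \<G> x \<Longrightarrow> k \<odot> a \<in> \<G> x"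
  using submodule.smult_closed[OF gr_sub] by auto

lemma homog_mult: "x \<in> carrier G \<Longrightarrow> y \<in> carrier G \<Longrightarrow> a \<in> \<G> x \<Longrightarrow> b \<in> \<G> y \<Longrightarrow> a \<otimes> b \<in> \<G> (x \<otimes>\<^bsub>G\<^esub> y)"
  using graded unfolding graded_by_def by blast

abbreviation cmp :: "'r \<Rightarrow> 'g \<Rightarrow> 'r" where
  "cmp \<equiv> component G R \<G>"

definition supp :: "'r \<Rightarrow> 'g set" where
  "supp m = {x. cmp m x \<noteq> \<zero>}"

lemma cmp_decomposition:
  "m \<in> carrier R \<Longrightarrow> homogeneous_decomposition G R \<G> m (cmp m)"
  using graded unfolding graded_by_def component_def by (metis (no_types, lifting) theI')

lemma cmp_eqI:
  assumes "m \<in> carrier R" "homogeneous_decomposition G R \<G> m f" shows "cmp m = f"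
proof -
  have "\<exists>!f. homogeneous_decomposition G R \<G> m f" using graded assms(1) unfolding graded_by_def by blast
  then show ?thesis using cmp_decomposition[OF assms(1)] assms(2) by blast
qed

lemma cmp_in: "m \<in> carrier R \<Longrightarrow> x \<in> carrier G \<Longrightarrow> cmp m x \<in> \<G> x"
  using cmp_decomposition[of m] unfolding homogeneous_decomposition_def by blast

lemma cmp_outside: "m \<in> carrier R \<Longrightarrow> x \<notin> carrier G \<Longrightarrow> cmp m x = \<zero>"
  using cmp_decomposition[of m] unfolding homogeneous_decomposition_def by blast

lemma cmp_closed [simp]: "m \<in> carrier R \<Longrightarrow> cmp m x \<in> carrier R"
  using cmp_in cmp_outside homog_closed by (cases "x \<in> carrier G") auto

lemma supp_finite: "m \<in> carrier R \<Longrightarrow> finite (supp m)"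
  using cmp_decomposition[of m] unfolding homogeneous_decomposition_def supp_def by blast

lemma supp_subset: "m \<in> carrier R \<Longrightarrow> supp m \<subseteq> carrier G"
  using cmp_outside unfolding supp_def by blast

lemma cmp_sum: "m \<in> carrier R \<Longrightarrow> m = finsum R (cmp m) (supp m)"
  using cmp_decomposition[of m] unfolding homogeneous_decomposition_def supp_def by blast

lemma finsum_homogeneous:
  assumes f: "\<And>x. x \<in> carrier G \<Longrightarrow> f x \<in> \<G> x" and S: "finite S" "S \<subseteq> carrier G"
    and out: "\<And>x. x \<notin> S \<Longrightarrow> f x = \<zero>"
  shows "finsum R f S \<in> carrier R" "cmp (finsum R f S) = f"
proof -
  have fc: "f x \<in> carrier R" for x using f homog_closed out S by (metis R.zero_closed subsetD)
  then show c: "finsum R f S \<in> carrier R" by (intro R.finsum_closed) auto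
  have sub: "{x. f x \<noteq> \<zero>} \<subseteq> S" using out by blast
  have "finsum R f {x. f x \<noteq> \<zero>} = finsum R f S"
    using S(1) sub fc by (intro R.add.finprod_mono_neutral_cong_left) auto
  then have "homogeneous_decomposition G R \<G> (finsum R f S) f"
    unfolding homogeneous_decomposition_def using f out S sub finite_subset[OF sub S(1)] by auto
  then show "cmp (finsum R f S) = f" by (rule cmp_eqI[OF c])
qed

lemma cmp_homog:
  assumes "x \<in> carrier G" "a \<in> \<G> x" shows "cmp a y = (if y = x then a else \<zero>)"
proof -
  let ?f = "\<lambda>y. if y = x then a else \<zero>"
  have "cmp (finsum R ?f {x}) = ?f"
    using assms homog_zero by (intro finsum_homogeneous(2)) auto
  moreover have "finsum R ?f {x} = a" using homog_closed[OF assms] by simp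
  ultimately show ?thesis by simp
qed

lemma cmp_add:
  assumes a: "a \<in> carrier R" and b: "b \<in> carrier R" shows "cmp (a \<oplus> b) x = cmp a x \<oplus> cmp b x"
proof -
  let ?S = "supp a \<union> supp b" and ?f = "\<lambda>x. cmp a x \<oplus> cmp b x"
  have S: "finite ?S" "?S \<subseteq> carrier G" using supp_finite supp_subset a b by auto
  have "cmp (finsum R ?f ?S) = ?f"
    using S a b cmp_in homog_add by (intro finsum_homogeneous(2)) (auto simp: supp_def)
  moreover have "finsum R ?f ?S = finsum R (cmp a) ?S \<oplus> finsum R (cmp b) ?S"
    using a b by (intro R.finsum_addf) auto
  moreover have "finsum R (cmp c) ?S = c" if "c = a \<or> c = b" for c
  proof -
    have "finsum R (cmp c) (supp c) = finsum R (cmp c) ?S"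
      using S(1) a b that by (intro R.add.finprod_mono_neutral_cong_left) (auto simp: supp_def)
    then show ?thesis using cmp_sum[of c] a b that by auto
  qed
  ultimately show ?thesis by (metis (no_types, lifting))
qed

lemma cmp_zero: "cmp \<zero> x = \<zero>"
  using cmp_homog[OF G.one_closed homog_zero[OF G.one_closed], of x] by (simp split: if_splits)

lemma graded_induct [consumes 1, case_names zero homog add]:
  assumes m: "m \<in> carrier R" and zero: "P \<zero>"
    and homog: "\<And>x a. x \<in> carrier G \<Longrightarrow> a \<in> \<G> x \<Longrightarrow> P a"
    and add: "\<And>a b. a \<in> carrier R \<Longrightarrow> b \<in> carrier R \<Longrightarrow> P a \<Longrightarrow> P b \<Longrightarrow> P (a \<oplus> b)"
  shows "P m"
proof -
  have "finsum R (cmp m) S \<in> carrier R \<and> P (finsum R (cmp m) S)" if "finite S" "S \<subseteq> carrier G" for S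
    using that
  proof (induction S)
    case empty
    then show ?case using zero by simp
  next
    case (insert x S)
    then have "P (cmp m x)" using m cmp_in[of m x] homog[of x] by simp
    then have "P (cmp m x \<oplus> finsum R (cmp m) S)" using insert m by (intro add) auto
    then show ?case using insert m by (simp add: R.finsum_insert)
  qed
  then show ?thesis using cmp_sum[OF m] supp_finite[OF m] supp_subset[OF m] by metis
qed

lemma cmp_ext:
  assumes "a \<in> carrier R" "b \<in> carrier R" "\<And>x. x \<in> carrier G \<Longrightarrow> cmp a x = cmp b x"
  shows "a = b"
proof -
  have "cmp a = cmp b" using assms cmp_outside by (metis ext)
  then show ?thesis using cmp_sum[OF assms(1)] cmp_sum[OF assms(2)] unfolding supp_def by simp
qed

lemma cmp_mult_homog:
  assumes z: "z \<in> carrier G" and b: "b \<in> \<G> z" and m: "m \<in> carrier R" and x: "x \<in> carrier G"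
  shows "cmp (b \<otimes> m) (z \<otimes>\<^bsub>G\<^esub> x) = b \<otimes> cmp m x"
  using m
proof (induction m rule: graded_induct)
  case zero
  then show ?case using homog_closed[OF z b] by (simp add: cmp_zero)
next
  case (homog y a)
  have "cmp (b \<otimes> a) (z \<otimes>\<^bsub>G\<^esub> x) = (if z \<otimes>\<^bsub>G\<^esub> x = z \<otimes>\<^bsub>G\<^esub> y then b \<otimes> a else \<zero>)"
    using z b homog homog_mult by (intro cmp_homog) auto
  moreover have "z \<otimes>\<^bsub>G\<^esub> x = z \<otimes>\<^bsub>G\<^esub> y \<longleftrightarrow> x = y" using z x homog(1) by simp
  ultimately show ?case using cmp_homog[OF homog, of x] homog_closed[OF z b] by simp
next
  case (add a a')
  then show ?case using homog_closed[OF z b] by (simp add: R.r_distr cmp_add)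
qed

text \<open>Comparing the components of a 1 = a in the degree of a homogeneous element a shows that
  the component of 1 in the neutral degree fixes a. So this component is an identity element
  itself.\<close>

lemma one_homog: "\<one> \<in> \<G> \<one>\<^bsub>G\<^esub>"
proof -
  let ?e = "cmp \<one> \<one>\<^bsub>G\<^esub>"
  have e: "?e \<in> \<G> \<one>\<^bsub>G\<^esub>" using cmp_in by simp
  have ec: "?e \<in> carrier R" by simp
  have "?e \<otimes> m = m" if "m \<in> carrier R" for m
    using that
  proof (induction m rule: graded_induct)
    case (homog x a)
    have "cmp (a \<otimes> \<one>) (x \<otimes>\<^bsub>G\<^esub> \<one>\<^bsub>G\<^esub>) = a \<otimes> ?e"
      using homog by (intro cmp_mult_homog) auto
    then have "cmp a x = a \<otimes> ?e" using homog homog_closed by simp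
    then show ?case using cmp_homog[OF homog, of x] homog_closed[OF homog] ec by (simp add: R.m_comm)
  qed (auto simp: R.r_distr)
  then have "?e = \<one>" using ec by (metis R.one_closed R.r_one)
  then show ?thesis using e by simp
qed

subsection \<open>Scaling of components\<close>

definition kfun :: "('g \<Rightarrow> 'k) \<Rightarrow> bool" where
  "kfun \<phi> \<longleftrightarrow> (\<forall>x\<in>carrier G. \<phi> x \<in> carrier K)"

text \<open>The operator is applied to arbitrary functions on \<open>G\<close> and not only to
  characters: indicator functions give the projections onto sets of degrees, so projections and
  characters follow the same rules.\<close>

abbreviation sg :: "('g \<Rightarrow> 'k) \<Rightarrow> 'r \<Rightarrow> 'r" where
  "sg \<equiv> char_act G R \<G>"

lemma kfunD: "kfun \<phi> \<Longrightarrow> x \<in> carrier G \<Longrightarrow> \<phi> x \<in> carrier K"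
  unfolding kfun_def by blast

lemma kfun_mult: "kfun \<phi> \<Longrightarrow> kfun \<psi> \<Longrightarrow> kfun (\<lambda>x. \<phi> x \<otimes>\<^bsub>K\<^esub> \<psi> x)"
  unfolding kfun_def by auto

lemma sg_cmp:
  assumes p: "kfun \<phi>" and m: "m \<in> carrier R"
  shows "sg \<phi> m \<in> carrier R" "x \<in> carrier G \<Longrightarrow> cmp (sg \<phi> m) x = \<phi> x \<odot> cmp m x"
proof -
  let ?f = "\<lambda>x. if x \<in> carrier G then \<phi> x \<odot> cmp m x else \<zero>"
  have fs: "?f y \<in> \<G> y" if "y \<in> carrier G" for y
    using that p m cmp_in homog_smult kfunD by auto
  have out: "?f y = \<zero>" if "y \<notin> supp m" for y
    using that kfunD[OF p] by (auto simp: supp_def)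
  note * = finsum_homogeneous[of ?f, OF fs supp_finite[OF m] supp_subset[OF m] out]
  have "sg \<phi> m = finsum R ?f (supp m)"
    unfolding char_act_def supp_def[symmetric]
    using supp_subset[OF m] kfunD[OF p] m by (intro R.finsum_cong) (auto simp: subset_iff simp_implies_def)
  then show "sg \<phi> m \<in> carrier R" "x \<in> carrier G \<Longrightarrow> cmp (sg \<phi> m) x = \<phi> x \<odot> cmp m x"
    using * by auto
qed

lemmas sg_closed [simp] = sg_cmp(1)

lemma cmp_smult:
  assumes k: "k \<in> carrier K" and m: "m \<in> carrier R" shows "cmp (k \<odot> m) x = k \<odot> cmp m x"
  using m
proof (induction m rule: graded_induct)
  case zero
  then show ?case using k by (simp add: cmp_zero Alg.smult_r_null)
next
  case (homog y a)
  then show ?case using cmp_homog[OF homog(1) homog_smult[OF homog(1) k homog(2)]] cmp_homog[OF homog] k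
    by (simp add: Alg.smult_r_null)
next
  case (add a b)
  then show ?case using k by (simp add: cmp_add Alg.smult_r_distr)
qed

lemma sg_cong:
  assumes "kfun \<phi>" "kfun \<psi>" "m \<in> carrier R" "\<And>x. x \<in> supp m \<Longrightarrow> \<phi> x = \<psi> x"
  shows "sg \<phi> m = sg \<psi> m"
proof (rule cmp_ext)
  fix x assume x: "x \<in> carrier G"
  show "cmp (sg \<phi> m) x = cmp (sg \<psi> m) x"
    using assms x kfunD[OF assms(1) x] kfunD[OF assms(2) x]
    by (cases "x \<in> supp m") (auto simp: sg_cmp(2) supp_def Alg.smult_r_null)
qed (use assms in auto)

lemma sg_add: "kfun \<phi> \<Longrightarrow> a \<in> carrier R \<Longrightarrow> b \<in> carrier R \<Longrightarrow> sg \<phi> (a \<oplus> b) = sg \<phi> a \<oplus> sg \<phi> b"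
  by (rule cmp_ext) (auto simp: sg_cmp(2) cmp_add Alg.smult_r_distr kfunD)

lemma sg_zero: "kfun \<phi> \<Longrightarrow> sg \<phi> \<zero> = \<zero>"
  by (rule cmp_ext) (auto simp: sg_cmp(2) cmp_zero Alg.smult_r_null kfunD)

lemma smult_comm: "a \<in> carrier K \<Longrightarrow> b \<in> carrier K \<Longrightarrow> m \<in> carrier R \<Longrightarrow> a \<odot> (b \<odot> m) = b \<odot> (a \<odot> m)"
  by (metis Alg.smult_assoc1 K.m_comm)

lemma sg_smult: "kfun \<phi> \<Longrightarrow> k \<in> carrier K \<Longrightarrow> a \<in> carrier R \<Longrightarrow> sg \<phi> (k \<odot> a) = k \<odot> sg \<phi> a"
  by (rule cmp_ext) (auto simp: sg_cmp(2) cmp_smult kfunD intro: smult_comm)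

lemma sg_sg:
  "kfun \<phi> \<Longrightarrow> kfun \<psi> \<Longrightarrow> m \<in> carrier R \<Longrightarrow> sg \<phi> (sg \<psi> m) = sg (\<lambda>x. \<phi> x \<otimes>\<^bsub>K\<^esub> \<psi> x) m"
  by (rule cmp_ext) (auto simp: sg_cmp(2) kfun_mult kfunD Alg.smult_assoc1)

lemma sg_fun_add:
  "kfun \<phi> \<Longrightarrow> kfun \<psi> \<Longrightarrow> m \<in> carrier R \<Longrightarrow> sg (\<lambda>x. \<phi> x \<oplus>\<^bsub>K\<^esub> \<psi> x) m = sg \<phi> m \<oplus> sg \<psi> m"
proof (rule cmp_ext)
  assume *: "kfun \<phi>" "kfun \<psi>" "m \<in> carrier R"
  then have "kfun (\<lambda>x. \<phi> x \<oplus>\<^bsub>K\<^esub> \<psi> x)" unfolding kfun_def by auto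
  with * show "sg (\<lambda>x. \<phi> x \<oplus>\<^bsub>K\<^esub> \<psi> x) m \<in> carrier R"
    "\<And>x. x \<in> carrier G \<Longrightarrow> cmp (sg (\<lambda>x. \<phi> x \<oplus>\<^bsub>K\<^esub> \<psi> x) m) x = cmp (sg \<phi> m \<oplus> sg \<psi> m) x"
    by (auto simp: sg_cmp(2) cmp_add kfunD Alg.smult_l_distr)
qed auto

lemma sg_const:
  assumes k: "k \<in> carrier K" and m: "m \<in> carrier R" shows "sg (\<lambda>_. k) m = k \<odot> m"
proof (rule cmp_ext)
  have "kfun (\<lambda>_. k)" using k unfolding kfun_def by simp
  then show "sg (\<lambda>_. k) m \<in> carrier R"
    "\<And>x. x \<in> carrier G \<Longrightarrow> cmp (sg (\<lambda>_. k) m) x = cmp (k \<odot> m) x"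
    using k m by (auto simp: sg_cmp(2) cmp_smult)
qed (use k m in auto)

lemma sg_homog:
  assumes p: "kfun \<phi>" and x: "x \<in> carrier G" and a: "a \<in> \<G> x"
  shows "sg \<phi> a = \<phi> x \<odot> a"
proof (rule cmp_ext)
  fix y assume "y \<in> carrier G"
  then show "cmp (sg \<phi> a) y = cmp (\<phi> x \<odot> a) y"
    using p x a kfunD[OF p] homog_closed[OF x a] cmp_homog[OF x a]
    by (simp add: sg_cmp(2) cmp_smult Alg.smult_r_null)
qed (use p x homog_closed[OF x a] kfunD in auto)

lemma smult_mult_right:
  assumes "k \<in> carrier K" "a \<in> carrier R" "b \<in> carrier R" shows "a \<otimes> (k \<odot> b) = k \<odot> (a \<otimes> b)"
  using assms Alg.smult_assoc2[of k b a] R.m_comm[of a b] R.m_comm[of a "k \<odot> b"] by simp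

lemma sg_mult_homog:
  assumes p: "kfun \<phi>" and z: "z \<in> carrier G" and b: "b \<in> \<G> z" and m: "m \<in> carrier R"
  shows "sg \<phi> (b \<otimes> m) = b \<otimes> sg (\<lambda>x. \<phi> (z \<otimes>\<^bsub>G\<^esub> x)) m"
proof (rule cmp_ext)
  have q: "kfun (\<lambda>x. \<phi> (z \<otimes>\<^bsub>G\<^esub> x))" using p z unfolding kfun_def by simp
  have bc: "b \<in> carrier R" using homog_closed[OF z b] .
  show "sg \<phi> (b \<otimes> m) \<in> carrier R" "b \<otimes> sg (\<lambda>x. \<phi> (z \<otimes>\<^bsub>G\<^esub> x)) m \<in> carrier R"
    using p q bc m by auto
  fix x assume x: "x \<in> carrier G"
  define y where "y = inv\<^bsub>G\<^esub> z \<otimes>\<^bsub>G\<^esub> x"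
  have y: "y \<in> carrier G" "x = z \<otimes>\<^bsub>G\<^esub> y" using x z unfolding y_def by (auto simp flip: G.m_assoc)
  show "cmp (sg \<phi> (b \<otimes> m)) x = cmp (b \<otimes> sg (\<lambda>x. \<phi> (z \<otimes>\<^bsub>G\<^esub> x)) m) x"
    unfolding y(2) using y(1) z b m bc p q kfunD[OF p]
    by (simp add: sg_cmp(2) cmp_mult_homog smult_mult_right)
qed

definition subspace :: "'r set \<Rightarrow> bool" where
  "subspace W \<longleftrightarrow> W \<subseteq> carrier R \<and> \<zero> \<in> W \<and> (\<forall>a\<in>W. \<forall>b\<in>W. a \<oplus> b \<in> W) \<and> (\<forall>k\<in>carrier K. \<forall>a\<in>W. k \<odot> a \<in> W)"

lemma subspaceD:
  assumes "subspace W"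
  shows "W \<subseteq> carrier R" "\<zero> \<in> W" "\<And>a b. a \<in> W \<Longrightarrow> b \<in> W \<Longrightarrow> a \<oplus> b \<in> W"
    "\<And>k a. k \<in> carrier K \<Longrightarrow> a \<in> W \<Longrightarrow> k \<odot> a \<in> W"
  using assms unfolding subspace_def by auto

lemma neg_smult: "a \<in> carrier R \<Longrightarrow> \<ominus> a = (\<ominus>\<^bsub>K\<^esub> \<one>\<^bsub>K\<^esub>) \<odot> a"
  by (simp add: Alg.smult_l_minus)

lemma subspace_minus:
  assumes W: "subspace W" and "a \<in> W" "b \<in> W" shows "a \<ominus> b \<in> W"
proof -
  have "b \<in> carrier R" using assms subspaceD(1) by blast
  then have "\<ominus> b \<in> W" using subspaceD(4)[OF W _ assms(3), of "\<ominus>\<^bsub>K\<^esub> \<one>\<^bsub>K\<^esub>"] neg_smult by simp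
  then show ?thesis using subspaceD(3)[OF W assms(2)] by (simp add: R.minus_eq)
qed

lemma subspace_cancel:
  assumes W: "subspace W" and a: "a \<in> carrier R" and k: "k \<in> carrier K" "k \<noteq> \<zero>\<^bsub>K\<^esub>" and m: "k \<odot> a \<in> W"
  shows "a \<in> W"
proof -
  have u: "k \<in> Units K" using k Units_K by simp
  have "inv\<^bsub>K\<^esub> k \<odot> (k \<odot> a) = a" using u a k Alg.smult_assoc1[of "inv\<^bsub>K\<^esub> k" k a] by simp
  then show ?thesis using subspaceD(4)[OF W K.Units_inv_closed[OF u] m] by simp
qed

definition ind :: "('g \<Rightarrow> bool) \<Rightarrow> 'g \<Rightarrow> 'k" where
  "ind Z x = (if Z x then \<one>\<^bsub>K\<^esub> else \<zero>\<^bsub>K\<^esub>)"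

lemma kfun_ind [simp]: "kfun (ind Z)"
  unfolding kfun_def ind_def by simp

lemma supp_sg:
  assumes "kfun \<phi>" "m \<in> carrier R" shows "supp (sg \<phi> m) \<subseteq> {x \<in> supp m. \<phi> x \<noteq> \<zero>\<^bsub>K\<^esub>}"
proof
  fix x assume x: "x \<in> supp (sg \<phi> m)"
  then have xG: "x \<in> carrier G" using supp_subset[of "sg \<phi> m"] assms by auto
  have "\<phi> x \<odot> cmp m x \<noteq> \<zero>" using x sg_cmp(2)[OF assms xG] unfolding supp_def by simp
  moreover have "\<phi> x \<odot> \<zero> = \<zero>" "\<zero>\<^bsub>K\<^esub> \<odot> cmp m x = \<zero>"
    using kfunD[OF assms(1) xG] assms(2) by (simp_all add: Alg.smult_r_null Alg.smult_l_null)
  ultimately show "x \<in> {x \<in> supp m. \<phi> x \<noteq> \<zero>\<^bsub>K\<^esub>}" unfolding supp_def by auto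
qed

lemma sg_one: "m \<in> carrier R \<Longrightarrow> sg (\<lambda>_. \<one>\<^bsub>K\<^esub>) m = m"
  using sg_const[of "\<one>\<^bsub>K\<^esub>" m] by simp

lemma sg_ind_all:
  assumes "m \<in> carrier R" "\<And>x. x \<in> supp m \<Longrightarrow> Z x" shows "sg (ind Z) m = m"
proof -
  have "sg (ind Z) m = sg (\<lambda>_. \<one>\<^bsub>K\<^esub>) m"
    using assms by (intro sg_cong) (auto simp: ind_def kfun_def)
  then show ?thesis using sg_one assms(1) by simp
qed

lemma sg_zero_if:
  assumes "m \<in> carrier R" "kfun \<phi>" "\<And>x. x \<in> supp m \<Longrightarrow> \<phi> x = \<zero>\<^bsub>K\<^esub>" shows "sg \<phi> m = \<zero>"
proof -
  have "sg \<phi> m = sg (\<lambda>_. \<zero>\<^bsub>K\<^esub>) m"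
    using assms by (intro sg_cong) (auto simp: kfun_def)
  then show ?thesis using sg_const[of "\<zero>\<^bsub>K\<^esub>" m] assms(1) by (simp add: Alg.smult_l_null)
qed

text \<open>The argument behind the linear independence of characters.\<close>

lemma character_elimination:
  assumes W: "subspace W" and kf: "\<And>h. h \<in> \<Xi> \<Longrightarrow> kfun h"
    and one: "h1 \<in> \<Xi>" "\<And>x. x \<in> carrier G \<Longrightarrow> h1 x = \<one>\<^bsub>K\<^esub>"
    and mult: "\<And>h h'. h \<in> \<Xi> \<Longrightarrow> h' \<in> \<Xi> \<Longrightarrow> \<exists>h''\<in>\<Xi>. \<forall>x\<in>carrier G. h'' x = h x \<otimes>\<^bsub>K\<^esub> h' x"
    and E: "\<And>x y. x \<in> carrier G \<Longrightarrow> y \<in> carrier G \<Longrightarrow> (\<And>h. h \<in> \<Xi> \<Longrightarrow> h x = h y) \<Longrightarrow> E x y"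
    and E': "\<And>x y h. x \<in> carrier G \<Longrightarrow> y \<in> carrier G \<Longrightarrow> h \<in> \<Xi> \<Longrightarrow> E x y \<Longrightarrow> h x = h y"
    and r: "r \<in> carrier R" "\<And>h. h \<in> \<Xi> \<Longrightarrow> sg h r \<in> W" and x: "x \<in> carrier G"
  shows "sg (ind (\<lambda>y. E y x)) r \<in> W"
  using r
proof (induction "card (supp r)" arbitrary: r rule: less_induct)
  case (less r)
  note r = less.prems
  have h1r: "sg h1 r = r"
    using sg_cong[OF kf[OF one(1)], of "\<lambda>_. \<one>\<^bsub>K\<^esub>" r] one(2) r(1) supp_subset[OF r(1)] sg_one
    by (auto simp: kfun_def)
  show ?case
  proof (cases "\<forall>y\<in>supp r. E y x")
    case True
    then show ?thesis using sg_ind_all[OF r(1), of "\<lambda>y. E y x"] h1r r(2)[OF one(1)] by simp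
  next
    case False
    then obtain z where z: "z \<in> supp r" "\<not> E z x" by blast
    have zG: "z \<in> carrier G" using z(1) supp_subset[OF r(1)] by blast
    obtain h where h: "h \<in> \<Xi>" "h z \<noteq> h x" using E[OF zG x] z(2) by blast
    have kh: "kfun h" using kf h(1) by blast
    have hz: "h z \<in> carrier K" "h x \<in> carrier K" using kfunD[OF kh] zG x by auto
    \<comment> \<open>Scaling by h - h(z) removes the degree z from the support, while the whole
      class of x is multiplied by the constant h(x) - h(z), which is nonzero and can be cancelled at
      the end.\<close>
    define \<psi> where "\<psi> y = h y \<oplus>\<^bsub>K\<^esub> \<ominus>\<^bsub>K\<^esub> h z" for y
    have kc: "kfun (\<lambda>_. \<ominus>\<^bsub>K\<^esub> h z)" using hz unfolding kfun_def by simp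
    have kp: "kfun \<psi>" using kh hz unfolding \<psi>_def kfun_def by simp
    define r' where "r' = sg \<psi> r"
    have r'c: "r' \<in> carrier R" unfolding r'_def using kp r(1) by simp
    have "\<psi> z = \<zero>\<^bsub>K\<^esub>" unfolding \<psi>_def using hz by (simp add: K.r_neg)
    then have "supp r' \<subseteq> supp r - {z}" unfolding r'_def using supp_sg[OF kp r(1)] by blast
    then have card: "card (supp r') < card (supp r)"
      using z(1) supp_finite[OF r(1)] by (meson card_Diff1_less card_mono finite_Diff le_less_trans)
    \<comment> \<open>The hypothesis survives because the family is closed under products: h'
      applied to r' is (h' h) applied to r minus h(z) times h' applied to r.\<close>
    have "sg h' r' \<in> W" if h': "h' \<in> \<Xi>" for h'
    proof -
      have kh': "kfun h'" using kf h' by blast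
      obtain h'' where h'': "h'' \<in> \<Xi>" "\<forall>x\<in>carrier G. h'' x = h' x \<otimes>\<^bsub>K\<^esub> h x" using mult[OF h' h(1)] by blast
      have "sg h' r' = sg (\<lambda>y. h' y \<otimes>\<^bsub>K\<^esub> \<psi> y) r" unfolding r'_def using kh' kp r(1) by (rule sg_sg)
      also have "\<dots> = sg (\<lambda>y. h'' y \<oplus>\<^bsub>K\<^esub> h' y \<otimes>\<^bsub>K\<^esub> (\<ominus>\<^bsub>K\<^esub> h z)) r"
      proof (rule sg_cong)
        show "kfun (\<lambda>y. h' y \<otimes>\<^bsub>K\<^esub> \<psi> y)" using kh' kp by (rule kfun_mult)
        show "kfun (\<lambda>y. h'' y \<oplus>\<^bsub>K\<^esub> h' y \<otimes>\<^bsub>K\<^esub> (\<ominus>\<^bsub>K\<^esub> h z))"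
          using kf[OF h''(1)] kh' hz unfolding kfun_def by simp
        fix y assume "y \<in> supp r"
        then have "y \<in> carrier G" using supp_subset[OF r(1)] by blast
        then show "h' y \<otimes>\<^bsub>K\<^esub> \<psi> y = h'' y \<oplus>\<^bsub>K\<^esub> h' y \<otimes>\<^bsub>K\<^esub> (\<ominus>\<^bsub>K\<^esub> h z)"
          unfolding \<psi>_def using h''(2) kfunD[OF kh] kfunD[OF kh'] hz by (simp add: K.r_distr)
      qed (rule r(1))
      also have "\<dots> = sg h'' r \<oplus> sg (\<lambda>y. h' y \<otimes>\<^bsub>K\<^esub> (\<ominus>\<^bsub>K\<^esub> h z)) r"
        using kf[OF h''(1)] kfun_mult[OF kh' kc] r(1) by (rule sg_fun_add)
      also have "sg (\<lambda>y. h' y \<otimes>\<^bsub>K\<^esub> (\<ominus>\<^bsub>K\<^esub> h z)) r = sg h' (sg (\<lambda>_. \<ominus>\<^bsub>K\<^esub> h z) r)"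
        using kh' kc r(1) by (rule sg_sg[symmetric])
      also have "sg (\<lambda>_. \<ominus>\<^bsub>K\<^esub> h z) r = (\<ominus>\<^bsub>K\<^esub> h z) \<odot> r" using hz r(1) by (intro sg_const) auto
      also have "sg h' ((\<ominus>\<^bsub>K\<^esub> h z) \<odot> r) = (\<ominus>\<^bsub>K\<^esub> h z) \<odot> sg h' r" using hz r(1) kh' by (intro sg_smult) auto
      finally have "sg h' r' = sg h'' r \<oplus> (\<ominus>\<^bsub>K\<^esub> h z) \<odot> sg h' r" .
      then show ?thesis using subspaceD(3,4)[OF W] r(2)[OF h''(1)] r(2)[OF h'] hz by simp
    qed
    then have IH: "sg (ind (\<lambda>y. E y x)) r' \<in> W" by (intro less.hyps[OF card r'c]) auto
    let ?i = "ind (\<lambda>y. E y x)" and ?k = "h x \<oplus>\<^bsub>K\<^esub> \<ominus>\<^bsub>K\<^esub> h z"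
    have k: "?k \<in> carrier K" using hz by simp
    have kc': "kfun (\<lambda>_. ?k)" using k unfolding kfun_def by simp
    have "sg ?i r' = sg (\<lambda>y. ?i y \<otimes>\<^bsub>K\<^esub> \<psi> y) r" unfolding r'_def using kp r(1) by (intro sg_sg) auto
    also have "\<dots> = sg (\<lambda>y. ?k \<otimes>\<^bsub>K\<^esub> ?i y) r"
    proof (rule sg_cong)
      show "kfun (\<lambda>y. ?i y \<otimes>\<^bsub>K\<^esub> \<psi> y)" "kfun (\<lambda>y. ?k \<otimes>\<^bsub>K\<^esub> ?i y)"
        using kfun_mult[OF kfun_ind kp] kfun_mult[OF kc' kfun_ind] by auto
      fix y assume "y \<in> supp r"
      then have y: "y \<in> carrier G" using supp_subset[OF r(1)] by blast
      show "?i y \<otimes>\<^bsub>K\<^esub> \<psi> y = ?k \<otimes>\<^bsub>K\<^esub> ?i y"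
      proof (cases "E y x")
        case True
        then have "h y = h x" using E'[OF y x h(1)] by blast
        then show ?thesis unfolding ind_def \<psi>_def using True hz by simp
      next
        case False
        then show ?thesis unfolding ind_def \<psi>_def using hz kfunD[OF kh y] by simp
      qed
    qed (rule r(1))
    also have "\<dots> = sg (\<lambda>_. ?k) (sg ?i r)" using kc' r(1) by (intro sg_sg[symmetric]) auto
    also have "\<dots> = ?k \<odot> sg ?i r" using k r(1) by (intro sg_const) auto
    finally have "?k \<odot> sg ?i r \<in> W" using IH by simp
    moreover have "?k \<noteq> \<zero>\<^bsub>K\<^esub>"
    proof
      assume "?k = \<zero>\<^bsub>K\<^esub>"
      then have "h x = h z" using hz by (metis K.a_inv_closed K.minus_equality K.minus_minus)
      then show False using h(2) by simp
    qed
    ultimately show ?thesis using subspace_cancel[OF W _ k] r(1) by simp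
  qed
qed

text \<open>The element is a finite sum of its parts over the classes, and \<phi> acts on each part
  as one scalar. The induction on the size of the support splits off the class of one degree at a
  time.\<close>

lemma class_reassembly:
  assumes W: "subspace W" and kp: "kfun \<phi>"
    and E_refl: "\<And>x. x \<in> carrier G \<Longrightarrow> E x x"
    and E_sym: "\<And>x y. x \<in> carrier G \<Longrightarrow> y \<in> carrier G \<Longrightarrow> E x y \<Longrightarrow> E y x"
    and E_trans: "\<And>x y z. x \<in> carrier G \<Longrightarrow> y \<in> carrier G \<Longrightarrow> z \<in> carrier G \<Longrightarrow> E x y \<Longrightarrow> E y z \<Longrightarrow> E x z"
    and E_phi: "\<And>x y. x \<in> carrier G \<Longrightarrow> y \<in> carrier G \<Longrightarrow> E x y \<Longrightarrow> \<phi> x = \<phi> y"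
    and r: "r \<in> carrier R" "\<And>x. x \<in> carrier G \<Longrightarrow> sg (ind (\<lambda>y. E y x)) r \<in> W"
  shows "sg \<phi> r \<in> W"
  using r
proof (induction "card (supp r)" arbitrary: r rule: less_induct)
  case (less r)
  note r = less.prems
  show ?case
  proof (cases "supp r = {}")
    case True
    then have "sg \<phi> r = \<zero>" using r(1) kp by (intro sg_zero_if) auto
    then show ?thesis using subspaceD(2)[OF W] by simp
  next
    case False
    then obtain x where x: "x \<in> supp r" by blast
    have xG: "x \<in> carrier G" using x supp_subset[OF r(1)] by blast
    let ?n = "ind (\<lambda>y. \<not> E y x)" and ?i = "ind (\<lambda>y. E y x)"
    define r' where "r' = sg ?n r"
    have r'c: "r' \<in> carrier R" unfolding r'_def using r(1) by simp
    have "?n x = \<zero>\<^bsub>K\<^esub>" unfolding ind_def using E_refl[OF xG] by simp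
    then have "supp r' \<subseteq> supp r - {x}" unfolding r'_def using supp_sg[OF kfun_ind r(1)] by blast
    then have card: "card (supp r') < card (supp r)"
      using x supp_finite[OF r(1)] by (meson card_Diff1_less card_mono finite_Diff le_less_trans)
    have "sg (ind (\<lambda>y. E y z)) r' \<in> W" if z: "z \<in> carrier G" for z
    proof -
      have eq: "sg (ind (\<lambda>y. E y z)) r' = sg (\<lambda>y. ind (\<lambda>y. E y z) y \<otimes>\<^bsub>K\<^esub> ?n y) r"
        unfolding r'_def using r(1) by (intro sg_sg) auto
      have kk: "kfun (\<lambda>y. ind (\<lambda>y. E y z) y \<otimes>\<^bsub>K\<^esub> ?n y)" by (intro kfun_mult) auto
      show ?thesis
      proof (cases "E z x")
        case True
        have "ind (\<lambda>y. E y z) y \<otimes>\<^bsub>K\<^esub> ?n y = \<zero>\<^bsub>K\<^esub>" if "y \<in> supp r" for y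
        proof -
          have "y \<in> carrier G" using that supp_subset[OF r(1)] by blast
          then have "E y z \<Longrightarrow> E y x" using E_trans[OF _ z xG] True by blast
          then show ?thesis unfolding ind_def by auto
        qed
        then have "sg (\<lambda>y. ind (\<lambda>y. E y z) y \<otimes>\<^bsub>K\<^esub> ?n y) r = \<zero>" using r(1) kk by (intro sg_zero_if) auto
        then show ?thesis using eq subspaceD(2)[OF W] by simp
      next
        case False
        have "sg (\<lambda>y. ind (\<lambda>y. E y z) y \<otimes>\<^bsub>K\<^esub> ?n y) r = sg (ind (\<lambda>y. E y z)) r"
        proof (rule sg_cong[OF kk kfun_ind r(1)])
          fix y assume "y \<in> supp r"
          then have y: "y \<in> carrier G" using supp_subset[OF r(1)] by blast
          have "E y z \<Longrightarrow> \<not> E y x"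
            using E_trans[OF z y xG] E_sym[OF y z] False by blast
          then show "ind (\<lambda>y. E y z) y \<otimes>\<^bsub>K\<^esub> ?n y = ind (\<lambda>y. E y z) y" unfolding ind_def by auto
        qed
        then show ?thesis using eq r(2)[OF z] by simp
      qed
    qed
    then have IH: "sg \<phi> r' \<in> W" by (intro less.hyps[OF card r'c]) auto
    have kx: "\<phi> x \<in> carrier K" using kfunD[OF kp xG] .
    have ki: "kfun (\<lambda>y. \<phi> x \<otimes>\<^bsub>K\<^esub> ?i y)" and kn: "kfun (\<lambda>y. \<phi> y \<otimes>\<^bsub>K\<^esub> ?n y)"
      using kx kp by (auto simp: kfun_def ind_def)
    have "sg \<phi> r = sg (\<lambda>y. \<phi> y \<otimes>\<^bsub>K\<^esub> ?n y \<oplus>\<^bsub>K\<^esub> \<phi> x \<otimes>\<^bsub>K\<^esub> ?i y) r"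
    proof (rule sg_cong[OF kp _ r(1)])
      show "kfun (\<lambda>y. \<phi> y \<otimes>\<^bsub>K\<^esub> ?n y \<oplus>\<^bsub>K\<^esub> \<phi> x \<otimes>\<^bsub>K\<^esub> ?i y)" using ki kn unfolding kfun_def by simp
      fix y assume "y \<in> supp r"
      then have y: "y \<in> carrier G" using supp_subset[OF r(1)] by blast
      show "\<phi> y = \<phi> y \<otimes>\<^bsub>K\<^esub> ?n y \<oplus>\<^bsub>K\<^esub> \<phi> x \<otimes>\<^bsub>K\<^esub> ?i y"
        unfolding ind_def using E_phi[OF y xG] kx kfunD[OF kp y] by auto
    qed
    also have "\<dots> = sg (\<lambda>y. \<phi> y \<otimes>\<^bsub>K\<^esub> ?n y) r \<oplus> sg (\<lambda>y. \<phi> x \<otimes>\<^bsub>K\<^esub> ?i y) r"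
      using kn ki r(1) by (rule sg_fun_add)
    also have "sg (\<lambda>y. \<phi> y \<otimes>\<^bsub>K\<^esub> ?n y) r = sg \<phi> r'"
      unfolding r'_def using kp r(1) by (intro sg_sg[symmetric]) auto
    also have "sg (\<lambda>y. \<phi> x \<otimes>\<^bsub>K\<^esub> ?i y) r = sg (\<lambda>_. \<phi> x) (sg ?i r)"
      by (rule sg_sg[symmetric]) (use kx r(1) in \<open>auto simp: kfun_def ind_def\<close>)
    also have "sg (\<lambda>_. \<phi> x) (sg ?i r) = \<phi> x \<odot> sg ?i r" using kx r(1) by (intro sg_const) auto
    finally have "sg \<phi> r = sg \<phi> r' \<oplus> \<phi> x \<odot> sg ?i r" .
    then show ?thesis using subspaceD(3,4)[OF W] IH r(2)[OF xG] kx by simp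
  qed
qed

subsection \<open>Characters\<close>

lemma chars_Units: "h \<in> chars G K \<Longrightarrow> x \<in> carrier G \<Longrightarrow> h x \<in> Units K"
  unfolding chars_def hom_def units_of_def by auto

lemma chars_kfun: "h \<in> chars G K \<Longrightarrow> kfun h"
  unfolding kfun_def using chars_Units K.Units_closed by blast

lemma chars_mult: "h \<in> chars G K \<Longrightarrow> x \<in> carrier G \<Longrightarrow> y \<in> carrier G \<Longrightarrow> h (x \<otimes>\<^bsub>G\<^esub> y) = h x \<otimes>\<^bsub>K\<^esub> h y"
  unfolding chars_def hom_def units_of_def by auto

lemma charsI:
  assumes "\<And>x. x \<in> carrier G \<Longrightarrow> h x \<in> Units K"
    "\<And>x y. x \<in> carrier G \<Longrightarrow> y \<in> carrier G \<Longrightarrow> h (x \<otimes>\<^bsub>G\<^esub> y) = h x \<otimes>\<^bsub>K\<^esub> h y"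
  shows "h \<in> chars G K"
  using assms unfolding chars_def hom_def units_of_def by auto

lemma chars_one: "h \<in> chars G K \<Longrightarrow> h \<one>\<^bsub>G\<^esub> = \<one>\<^bsub>K\<^esub>"
proof -
  assume h: "h \<in> chars G K"
  have "h \<one>\<^bsub>G\<^esub> \<otimes>\<^bsub>K\<^esub> h \<one>\<^bsub>G\<^esub> = h \<one>\<^bsub>G\<^esub> \<otimes>\<^bsub>K\<^esub> \<one>\<^bsub>K\<^esub>" "h \<one>\<^bsub>G\<^esub> \<in> Units K"
    using chars_mult[OF h G.one_closed G.one_closed] chars_Units[OF h G.one_closed] by auto
  then show ?thesis using K.m_lcancel[of "h \<one>\<^bsub>G\<^esub>" "h \<one>\<^bsub>G\<^esub>" "\<one>\<^bsub>K\<^esub>"] Units_K by auto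
qed

lemma chars_inverse:
  assumes "h \<in> chars G K" shows "(\<lambda>x. inv\<^bsub>K\<^esub> h x) \<in> chars G K"
proof (rule charsI)
  fix x y assume xy: "x \<in> carrier G" "y \<in> carrier G"
  have u: "h x \<in> Units K" "h y \<in> Units K" using chars_Units[OF assms] xy by auto
  have "(inv\<^bsub>K\<^esub> h x \<otimes>\<^bsub>K\<^esub> inv\<^bsub>K\<^esub> h y) \<otimes>\<^bsub>K\<^esub> (h x \<otimes>\<^bsub>K\<^esub> h y)
    = (inv\<^bsub>K\<^esub> h x \<otimes>\<^bsub>K\<^esub> h x) \<otimes>\<^bsub>K\<^esub> (inv\<^bsub>K\<^esub> h y \<otimes>\<^bsub>K\<^esub> h y)"
    using u[THEN K.Units_closed] u[THEN K.Units_inv_closed] by (simp only: K.m_ac K.m_closed)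
  then have "(inv\<^bsub>K\<^esub> h x \<otimes>\<^bsub>K\<^esub> inv\<^bsub>K\<^esub> h y) \<otimes>\<^bsub>K\<^esub> (h x \<otimes>\<^bsub>K\<^esub> h y) = \<one>\<^bsub>K\<^esub>" using u by simp
  then show "inv\<^bsub>K\<^esub> h (x \<otimes>\<^bsub>G\<^esub> y) = inv\<^bsub>K\<^esub> h x \<otimes>\<^bsub>K\<^esub> inv\<^bsub>K\<^esub> h y"
    unfolding chars_mult[OF assms xy] using u[THEN K.Units_closed] u[THEN K.Units_inv_closed]
    by (intro K.comm_inv_char) (simp_all add: K.m_comm[of "h x \<otimes>\<^bsub>K\<^esub> h y" "inv\<^bsub>K\<^esub> h x \<otimes>\<^bsub>K\<^esub> inv\<^bsub>K\<^esub> h y"])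
qed (use chars_Units[OF assms] in auto)

lemma chars_prod: "h \<in> chars G K \<Longrightarrow> h' \<in> chars G K \<Longrightarrow> (\<lambda>x. h x \<otimes>\<^bsub>K\<^esub> h' x) \<in> chars G K"
  by (rule charsI) (auto simp: chars_Units chars_mult K.Units_closed K.m_ac)

lemma sg_char_mult_homog:
  assumes h: "h \<in> chars G K" and z: "z \<in> carrier G" and b: "b \<in> \<G> z" and m: "m \<in> carrier R"
  shows "sg h (b \<otimes> m) = h z \<odot> (b \<otimes> sg h m)"
proof -
  note kh = chars_kfun[OF h]
  have "sg h (b \<otimes> m) = b \<otimes> sg (\<lambda>x. h (z \<otimes>\<^bsub>G\<^esub> x)) m" using kh z b m by (rule sg_mult_homog)
  also have "sg (\<lambda>x. h (z \<otimes>\<^bsub>G\<^esub> x)) m = sg (\<lambda>x. h z \<otimes>\<^bsub>K\<^esub> h x) m"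
    using z m chars_mult[OF h] supp_subset[OF m] kfunD[OF kh] by (intro sg_cong) (auto simp: kfun_def)
  also have "\<dots> = sg (\<lambda>_. h z) (sg h m)"
    using kh z m by (intro sg_sg[symmetric]) (auto simp: kfun_def)
  also have "\<dots> = h z \<odot> sg h m" using kfunD[OF kh z] kh m by (intro sg_const) auto
  also have "b \<otimes> (h z \<odot> sg h m) = h z \<odot> (b \<otimes> sg h m)"
    using kfunD[OF kh z] kh m homog_closed[OF z b] by (intro smult_mult_right) auto
  finally show ?thesis .
qed

lemma sg_char_mult:
  assumes h: "h \<in> chars G K" and a: "a \<in> carrier R" and b: "b \<in> carrier R"
  shows "sg h (a \<otimes> b) = sg h a \<otimes> sg h b"
  using a
proof (induction a rule: graded_induct)
  case zero
  then show ?case using b chars_kfun[OF h] by (simp add: sg_zero)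
next
  case (homog x a)
  then show ?case using sg_char_mult_homog[OF h homog b] sg_homog[OF chars_kfun[OF h] homog] kfunD[OF chars_kfun[OF h]]
      homog_closed[OF homog] b chars_kfun[OF h] by (simp add: Alg.smult_assoc2)
next
  case (add a a')
  then show ?case using b chars_kfun[OF h] by (simp add: sg_add R.l_distr)
qed

lemma sg_char_inverse:
  assumes h: "h \<in> chars G K" and m: "m \<in> carrier R"
  shows "sg h (sg (\<lambda>x. inv\<^bsub>K\<^esub> h x) m) = m" "sg (\<lambda>x. inv\<^bsub>K\<^esub> h x) (sg h m) = m"
proof -
  note kh = chars_kfun[OF h] and kh' = chars_kfun[OF chars_inverse[OF h]]
  have "sg h (sg (\<lambda>x. inv\<^bsub>K\<^esub> h x) m) = sg (\<lambda>x. h x \<otimes>\<^bsub>K\<^esub> inv\<^bsub>K\<^esub> h x) m"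
    using kh kh' m by (rule sg_sg)
  also have "\<dots> = sg (\<lambda>_. \<one>\<^bsub>K\<^esub>) m"
    using kfun_mult[OF kh kh'] m supp_subset[OF m] chars_Units[OF h] by (intro sg_cong) (auto simp: kfun_def)
  finally show "sg h (sg (\<lambda>x. inv\<^bsub>K\<^esub> h x) m) = m" using sg_one[OF m] by simp
  have "sg (\<lambda>x. inv\<^bsub>K\<^esub> h x) (sg h m) = sg (\<lambda>x. inv\<^bsub>K\<^esub> h x \<otimes>\<^bsub>K\<^esub> h x) m"
    using kh' kh m by (rule sg_sg)
  also have "\<dots> = sg (\<lambda>_. \<one>\<^bsub>K\<^esub>) m"
    using kfun_mult[OF kh' kh] m supp_subset[OF m] chars_Units[OF h] by (intro sg_cong) (auto simp: kfun_def)
  finally show "sg (\<lambda>x. inv\<^bsub>K\<^esub> h x) (sg h m) = m" using sg_one[OF m] by simp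
qed

text \<open>Images of ideals under a character are rewritten as preimages under the inverse
  character, for which membership can be tested directly.\<close>

lemma sg_image:
  assumes h: "h \<in> chars G K" and P: "P \<subseteq> carrier R"
  shows "sg h ` P = {m \<in> carrier R. sg (\<lambda>x. inv\<^bsub>K\<^esub> h x) m \<in> P}"
proof (intro equalityI subsetI)
  fix m assume "m \<in> sg h ` P"
  then obtain p where "p \<in> P" "m = sg h p" by blast
  then show "m \<in> {m \<in> carrier R. sg (\<lambda>x. inv\<^bsub>K\<^esub> h x) m \<in> P}"
    using P sg_char_inverse(2)[OF h] chars_kfun[OF h] by (auto simp: subset_iff)
next
  fix m assume "m \<in> {m \<in> carrier R. sg (\<lambda>x. inv\<^bsub>K\<^esub> h x) m \<in> P}"
  then show "m \<in> sg h ` P" using sg_char_inverse(1)[OF h, of m] by (metis (no_types, lifting) imageI mem_Collect_eq)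
qed

lemma ideal_subspace:
  assumes "ideal I R" shows "subspace I"
proof -
  interpret I: ideal I R by (rule assms)
  have "k \<odot> a \<in> I" if "k \<in> carrier K" "a \<in> I" for k a
  proof -
    have "k \<odot> a = (k \<odot> \<one>) \<otimes> a" using that I.Icarr Alg.smult_assoc2[of k \<one> a] by simp
    then show ?thesis using that I.I_l_closed by simp
  qed
  then show ?thesis unfolding subspace_def using I.a_subset I.zero_closed I.a_closed by auto
qed

end

subsection \<open>Monomials in homogeneous generators\<close>

locale generated_algebra = graded_algebra R K G \<G>
    for R :: "('k, 'r, 'd) module_scheme" (structure)
    and K :: "('k, 'l) ring_scheme"
    and G :: "('g, 'h) monoid_scheme"
    and \<G> :: "'g \<Rightarrow> 'r set" +
  fixes n :: nat and r :: "nat \<Rightarrow> 'r" and \<delta> :: "nat \<Rightarrow> 'g"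
  assumes degrees: "\<forall>i\<in>{1..n}. \<delta> i \<in> carrier G \<and> r i \<in> \<G> (\<delta> i)"
    and generators: "algebra_generated K R (r ` {1..n}) = carrier R"
begin

definition mon :: "(nat \<Rightarrow> nat) \<Rightarrow> 'r" where
  "mon \<alpha> = finprod R (\<lambda>i. r i [^] \<alpha> i) {1..n}"

definition deg :: "(nat \<Rightarrow> nat) \<Rightarrow> 'g" where
  "deg \<alpha> = finprod G (\<lambda>i. \<delta> i [^]\<^bsub>G\<^esub> \<alpha> i) {1..n}"

lemma delta_closed: "i \<in> {1..n} \<Longrightarrow> \<delta> i \<in> carrier G"
  using degrees by blast

lemma r_homog: "i \<in> {1..n} \<Longrightarrow> r i \<in> \<G> (\<delta> i)"
  using degrees by blast

lemma r_closed: "i \<in> {1..n} \<Longrightarrow> r i \<in> carrier R"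
  using homog_closed[OF delta_closed r_homog] .

lemma pow_homog: "x \<in> carrier G \<Longrightarrow> a \<in> \<G> x \<Longrightarrow> a [^] k \<in> \<G> (x [^]\<^bsub>G\<^esub> (k::nat))"
  by (induction k) (auto simp: one_homog homog_mult)

lemma deg_closed [simp]: "deg \<alpha> \<in> carrier G"
  unfolding deg_def using delta_closed by (intro G.finprod_closed) auto

lemma mon_closed [simp]: "mon \<alpha> \<in> carrier R"
  unfolding mon_def using r_closed by (intro R.finprod_closed) auto

lemma mon_homog: "mon \<alpha> \<in> \<G> (deg \<alpha>)"
proof -
  have "finprod R (\<lambda>i. r i [^] \<alpha> i) S \<in> \<G> (finprod G (\<lambda>i. \<delta> i [^]\<^bsub>G\<^esub> \<alpha> i) S)"
    if "finite S" "S \<subseteq> {1..n}" for S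
    using that
  proof (induction S)
    case empty
    then show ?case using one_homog by simp
  next
    case (insert i S)
    have i: "i \<in> {1..n}" and S: "S \<subseteq> {1..n}" using insert.prems by auto
    have c: "(\<lambda>i. r i [^] \<alpha> i) \<in> S \<rightarrow> carrier R" "(\<lambda>i. \<delta> i [^]\<^bsub>G\<^esub> \<alpha> i) \<in> S \<rightarrow> carrier G"
      using S r_closed delta_closed by (auto intro!: R.nat_pow_closed G.nat_pow_closed)
    have c': "r i [^] \<alpha> i \<in> carrier R" "\<delta> i [^]\<^bsub>G\<^esub> \<alpha> i \<in> carrier G"
      using r_closed[OF i] delta_closed[OF i] by auto
    have "r i [^] \<alpha> i \<otimes> finprod R (\<lambda>i. r i [^] \<alpha> i) S
      \<in> \<G> (\<delta> i [^]\<^bsub>G\<^esub> \<alpha> i \<otimes>\<^bsub>G\<^esub> finprod G (\<lambda>i. \<delta> i [^]\<^bsub>G\<^esub> \<alpha> i) S)"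
      using pow_homog[OF delta_closed[OF i] r_homog[OF i]] insert.IH[OF S] c c'
      by (intro homog_mult) auto
    then show ?case using insert.hyps c c' by (simp add: R.finprod_insert G.finprod_insert)
  qed
  then show ?thesis unfolding mon_def deg_def by simp
qed

lemma mon_add: "mon (\<lambda>i. \<alpha> i + \<beta> i) = mon \<alpha> \<otimes> mon \<beta>"
proof -
  have "mon (\<lambda>i. \<alpha> i + \<beta> i) = finprod R (\<lambda>i. r i [^] \<alpha> i \<otimes> r i [^] \<beta> i) {1..n}"
    unfolding mon_def using r_closed by (intro R.finprod_cong') (auto simp: R.nat_pow_mult)
  also have "\<dots> = mon \<alpha> \<otimes> mon \<beta>"
    unfolding mon_def using r_closed by (intro R.finprod_multf) auto
  finally show ?thesis .
qed

lemma deg_add: "deg (\<lambda>i. \<alpha> i + \<beta> i) = deg \<alpha> \<otimes>\<^bsub>G\<^esub> deg \<beta>"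
proof -
  have "deg (\<lambda>i. \<alpha> i + \<beta> i) = finprod G (\<lambda>i. \<delta> i [^]\<^bsub>G\<^esub> \<alpha> i \<otimes>\<^bsub>G\<^esub> \<delta> i [^]\<^bsub>G\<^esub> \<beta> i) {1..n}"
    unfolding deg_def using delta_closed by (intro G.finprod_cong') (auto simp: G.nat_pow_mult)
  also have "\<dots> = deg \<alpha> \<otimes>\<^bsub>G\<^esub> deg \<beta>"
    unfolding deg_def using delta_closed by (intro G.finprod_multf) auto
  finally show ?thesis .
qed

lemma mon_zero: "mon (\<lambda>_. 0) = \<one>"
  unfolding mon_def by (simp add: R.finprod_one_eqI)

lemma deg_zero: "deg (\<lambda>_. 0) = \<one>\<^bsub>G\<^esub>"
  unfolding deg_def by (simp add: G.finprod_one_eqI)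

definition unit_exp :: "nat \<Rightarrow> nat \<Rightarrow> nat" where
  "unit_exp i j = (if i = j then 1 else 0)"

lemma mon_unit_exp:
  assumes i: "i \<in> {1..n}" shows "mon (unit_exp i) = r i"
proof -
  have "mon (unit_exp i) = finprod R (\<lambda>j. if i = j then r j else \<one>) {1..n}"
    unfolding mon_def using r_closed by (intro R.finprod_cong') (auto simp: unit_exp_def)
  also have "\<dots> = r i" using i r_closed by (intro R.finprod_singleton) auto
  finally show ?thesis .
qed

lemma deg_unit_exp:
  assumes i: "i \<in> {1..n}" shows "deg (unit_exp i) = \<delta> i"
proof -
  have "deg (unit_exp i) = finprod G (\<lambda>j. if i = j then \<delta> j else \<one>\<^bsub>G\<^esub>) {1..n}"
    unfolding deg_def using delta_closed by (intro G.finprod_cong') (auto simp: unit_exp_def)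
  also have "\<dots> = \<delta> i" using i delta_closed by (intro G.finprod_singleton) auto
  finally show ?thesis .
qed

lemma unit_exp_exps: "i \<in> {1..n} \<Longrightarrow> unit_exp i \<in> exps n"
  unfolding unit_exp_def exps_def by auto

lemma mon_factor:
  assumes i: "i \<in> {1..n}" and a: "\<alpha> i \<noteq> 0"
  shows "mon \<alpha> = mon (\<alpha>(i := \<alpha> i - 1)) \<otimes> r i"
proof -
  have "\<alpha> = (\<lambda>j. (\<alpha>(i := \<alpha> i - 1)) j + unit_exp i j)"
    by (rule ext) (use a in \<open>auto simp: unit_exp_def\<close>)
  then show ?thesis using mon_add[of "\<alpha>(i := \<alpha> i - 1)" "unit_exp i"] mon_unit_exp[OF i] by simp
qed

text \<open>The smallest subspace containing all monomials is closed under multiplication, so it is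
  a subalgebra that contains the generators.\<close>

lemma monomials_span:
  assumes W: "subspace W" and mW: "\<And>\<alpha>. \<alpha> \<in> exps n \<Longrightarrow> mon \<alpha> \<in> W"
  shows "W = carrier R"
proof -
  let ?C = "{U. subspace U \<and> (\<forall>\<alpha>\<in>exps n. mon \<alpha> \<in> U)}"
  \<comment> \<open>\<open>W\<close> itself need not be closed under multiplication. For the least
    such subspace this can be shown by applying leastness to the elements whose products stay
    inside.\<close>
  define W0 where "W0 = \<Inter>?C"
  have car: "subspace (carrier R)" unfolding subspace_def by auto
  have W0sub: "W0 \<subseteq> carrier R" unfolding W0_def using car by auto
  have W0: "subspace W0"
    unfolding subspace_def[of W0]
  proof (intro conjI ballI W0sub)
    show "\<zero> \<in> W0" unfolding W0_def using subspaceD(2) by blast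
    show "a \<oplus> b \<in> W0" if "a \<in> W0" "b \<in> W0" for a b
      using that subspaceD(3) unfolding W0_def by blast
    show "k \<odot> a \<in> W0" if "k \<in> carrier K" "a \<in> W0" for k a
      using that subspaceD(4) unfolding W0_def by blast
  qed
  have mW0: "mon \<alpha> \<in> W0" if "\<alpha> \<in> exps n" for \<alpha> using that unfolding W0_def by blast
  have least: "a \<in> U" if "a \<in> W0" "subspace U" "\<And>\<alpha>. \<alpha> \<in> exps n \<Longrightarrow> mon \<alpha> \<in> U" for a U
    using that unfolding W0_def by blast
  have mult_sub: "subspace {a \<in> carrier R. a \<otimes> b \<in> W0}" if "b \<in> carrier R" for b
    unfolding subspace_def
  proof (intro conjI ballI)
    show "\<zero> \<in> {a \<in> carrier R. a \<otimes> b \<in> W0}" using that subspaceD(2)[OF W0] by simp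
    show "a \<oplus> a' \<in> {a \<in> carrier R. a \<otimes> b \<in> W0}"
      if "a \<in> {a \<in> carrier R. a \<otimes> b \<in> W0}" "a' \<in> {a \<in> carrier R. a \<otimes> b \<in> W0}" for a a'
      using that \<open>b \<in> carrier R\<close> subspaceD(3)[OF W0, of "a \<otimes> b" "a' \<otimes> b"] by (simp add: R.l_distr)
    show "k \<odot> a \<in> {a \<in> carrier R. a \<otimes> b \<in> W0}"
      if "k \<in> carrier K" "a \<in> {a \<in> carrier R. a \<otimes> b \<in> W0}" for k a
      using that \<open>b \<in> carrier R\<close> subspaceD(4)[OF W0, of k "a \<otimes> b"] by (simp add: Alg.smult_assoc2)
  qed auto
  have mon_mult: "a \<otimes> mon \<beta> \<in> W0" if a: "a \<in> W0" and b: "\<beta> \<in> exps n" for a \<beta>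
  proof -
    have "a \<in> {a \<in> carrier R. a \<otimes> mon \<beta> \<in> W0}"
    proof (rule least[OF a mult_sub])
      fix \<alpha> assume "\<alpha> \<in> exps n"
      then have "mon (\<lambda>i. \<alpha> i + \<beta> i) \<in> W0" using b by (intro mW0 exps_add)
      then show "mon \<alpha> \<in> {a \<in> carrier R. a \<otimes> mon \<beta> \<in> W0}" unfolding mon_add by simp
    qed simp
    then show ?thesis by simp
  qed
  have mult: "a \<otimes> b \<in> W0" if a: "a \<in> W0" and b: "b \<in> W0" for a b
  proof -
    have bc: "b \<in> carrier R" using b W0sub by blast
    have "a \<in> {a \<in> carrier R. a \<otimes> b \<in> W0}"
    proof (rule least[OF a mult_sub[OF bc]])
      fix \<alpha> assume "\<alpha> \<in> exps n"
      then have "b \<otimes> mon \<alpha> \<in> W0" using b by (intro mon_mult)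
      then show "mon \<alpha> \<in> {a \<in> carrier R. a \<otimes> b \<in> W0}" using R.m_comm[OF bc, of "mon \<alpha>"] by simp
    qed
    then show ?thesis by simp
  qed
  have neg: "\<ominus> a \<in> W0" if "a \<in> W0" for a
    using subspaceD(4)[OF W0 _ that, of "\<ominus>\<^bsub>K\<^esub> \<one>\<^bsub>K\<^esub>"] neg_smult[of a] that W0sub by auto
  have "subring W0 R"
  proof (rule R.subringI)
    show "\<one> \<in> W0" using mW0[OF exps_zero] mon_zero by simp
  qed (use W0sub neg mult subspaceD(3)[OF W0] in auto)
  moreover have "submodule W0 K R"
    using W0sub neg subspaceD[OF W0] by (intro Alg.submoduleI) auto
  moreover have "r ` {1..n} \<subseteq> W0"
  proof
    fix a assume "a \<in> r ` {1..n}"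
    then obtain i where "i \<in> {1..n}" "a = r i" by blast
    then show "a \<in> W0" using mW0[OF unit_exp_exps] mon_unit_exp by metis
  qed
  ultimately have "carrier R \<subseteq> W0"
    using generators unfolding algebra_generated_def by blast
  moreover have "W0 \<subseteq> W" using least[OF _ W mW] by (intro subsetI)
  ultimately show ?thesis using subspaceD(1)[OF W] by (intro equalityI) simp_all
qed

text \<open>Apply \<open>monomials_span\<close> to the elements whose component at x lies in W: a
  monomial of another degree has component 0 there.\<close>

lemma homogeneous_monomials_span:
  assumes W: "subspace W" and x: "x \<in> carrier G" and a: "a \<in> \<G> x"
    and mW: "\<And>\<alpha>. \<alpha> \<in> exps n \<Longrightarrow> deg \<alpha> = x \<Longrightarrow> mon \<alpha> \<in> W"
  shows "a \<in> W"
proof -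
  let ?U = "{m \<in> carrier R. cmp m x \<in> W}"
  have "subspace ?U"
    unfolding subspace_def using subspaceD[OF W] by (auto simp: cmp_zero cmp_add cmp_smult)
  moreover have "mon \<alpha> \<in> ?U" if "\<alpha> \<in> exps n" for \<alpha>
    using that mW[OF that] cmp_homog[OF deg_closed[of \<alpha>] mon_homog[of \<alpha>], of x] subspaceD(2)[OF W] by auto
  ultimately have "?U = carrier R" by (rule monomials_span)
  then have "cmp a x \<in> W" using homog_closed[OF x a] by blast
  then show ?thesis using cmp_homog[OF x a, of x] by simp
qed

end

text \<open>Instead of the ideals generated by a and d, the largest ideals with the required
  products in P are used; they are described by membership conditions and involve no sums of
  products. J consists of all y with a R y in P, and I of all x with x R J in P.\<close>

lemma (in ring) prime_ideal_elementwise: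
  assumes P: "prime_ideal P R" and a: "a \<in> carrier R" and d: "d \<in> carrier R"
    and ad: "\<And>b. b \<in> carrier R \<Longrightarrow> a \<otimes> b \<otimes> d \<in> P"
  shows "a \<in> P \<or> d \<in> P"
proof -
  have idP: "ideal P R" and pr: "\<And>I J. ideal I R \<Longrightarrow> ideal J R \<Longrightarrow> ideal_prod R I J \<subseteq> P \<Longrightarrow> I \<subseteq> P \<or> J \<subseteq> P"
    using P unfolding prime_ideal_def by auto
  interpret P: ideal P R by (rule idP)
  have Psub: "P \<subseteq> carrier R" by (rule P.a_subset)
  have Pneg: "x \<in> P \<Longrightarrow> \<ominus> x \<in> P" for x by (rule P.a_inv_closed)
  let ?J = "{y \<in> carrier R. \<forall>b\<in>carrier R. a \<otimes> b \<otimes> y \<in> P}"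
  let ?I = "{x \<in> carrier R. \<forall>b\<in>carrier R. \<forall>y\<in>?J. x \<otimes> b \<otimes> y \<in> P}"
  have J: "ideal ?J R"
  proof (rule idealI[OF ring_axioms])
    show "subgroup ?J (add_monoid R)"
    proof (intro subgroup.intro)
      fix x assume x: "x \<in> ?J"
      have "a \<otimes> b \<otimes> (\<ominus> x) \<in> P" if "b \<in> carrier R" for b
        using x that Pneg[of "a \<otimes> b \<otimes> x"] a by (simp add: r_minus)
      then show "inv\<^bsub>add_monoid R\<^esub> x \<in> ?J" using x by (simp flip: a_inv_def)
    qed (use a P.zero_closed in \<open>auto simp: r_distr\<close>)
    fix y x assume y: "y \<in> ?J" and x: "x \<in> carrier R"
    have "a \<otimes> b \<otimes> (x \<otimes> y) \<in> P" if b: "b \<in> carrier R" for b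
    proof -
      have "a \<otimes> (b \<otimes> x) \<otimes> y \<in> P" using y x b by simp
      then show ?thesis using y x b a by (simp add: m_assoc)
    qed
    then show "x \<otimes> y \<in> ?J" using y x by simp
    have "a \<otimes> b \<otimes> (y \<otimes> x) \<in> P" if b: "b \<in> carrier R" for b
    proof -
      have "a \<otimes> b \<otimes> y \<otimes> x \<in> P" using y b by (intro P.I_r_closed[OF _ x]) blast
      then show ?thesis using y x b a by (simp add: m_assoc)
    qed
    then show "y \<otimes> x \<in> ?J" using y x by simp
  qed
  have I: "ideal ?I R"
  proof (rule idealI[OF ring_axioms])
    show "subgroup ?I (add_monoid R)"
    proof (intro subgroup.intro)
      fix x assume x: "x \<in> ?I"
      have "(\<ominus> x) \<otimes> b \<otimes> y \<in> P" if "b \<in> carrier R" "y \<in> ?J" for b y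
        using x that Pneg[of "x \<otimes> b \<otimes> y"] by (simp add: l_minus)
      then show "inv\<^bsub>add_monoid R\<^esub> x \<in> ?I" using x by (simp flip: a_inv_def)
    qed (use P.zero_closed in \<open>auto simp: l_distr\<close>)
    fix z x assume z: "z \<in> ?I" and x: "x \<in> carrier R"
    have "x \<otimes> z \<otimes> b \<otimes> y \<in> P" if b: "b \<in> carrier R" and y: "y \<in> ?J" for b y
    proof -
      have "x \<otimes> (z \<otimes> b \<otimes> y) \<in> P" using z b y by (intro P.I_l_closed[OF _ x]) blast
      then show ?thesis using z x b y by (simp add: m_assoc)
    qed
    then show "x \<otimes> z \<in> ?I" using z x by simp
    have "z \<otimes> x \<otimes> b \<otimes> y \<in> P" if b: "b \<in> carrier R" and y: "y \<in> ?J" for b y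
    proof -
      have "z \<otimes> (x \<otimes> b) \<otimes> y \<in> P" using z x b y by blast
      then show ?thesis using z x b y by (simp add: m_assoc)
    qed
    then show "z \<otimes> x \<in> ?I" using z x by simp
  qed
  have "ideal_prod R ?I ?J \<subseteq> P"
  proof
    fix s assume "s \<in> ideal_prod R ?I ?J"
    then show "s \<in> P"
    proof induction
      case (prod i j)
      then have "i \<otimes> \<one> \<otimes> j \<in> P" by blast
      then show ?case using prod by simp
    qed (rule P.a_closed)
  qed
  then have "?I \<subseteq> P \<or> ?J \<subseteq> P" by (rule pr[OF I J])
  moreover have "d \<in> ?J" using d ad by blast
  moreover have "a \<in> ?I" using a by blast
  ultimately show ?thesis by blast
qed

section \<open>Twists\<close>

locale twisted_algebra = generated_algebra R K G \<G> n r \<delta>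
    for R :: "('k, 'r, 'd) module_scheme" (structure)
    and K :: "('k, 'l) ring_scheme"
    and G :: "('g, 'h) monoid_scheme"
    and \<G> :: "'g \<Rightarrow> 'r set"
    and n :: nat and r :: "nat \<Rightarrow> 'r" and \<delta> :: "nat \<Rightarrow> 'g" +
  fixes c :: "'g \<Rightarrow> 'g \<Rightarrow> 'k" and A :: "('k, 'a, 'e) module_scheme" and \<tau> :: "'r \<Rightarrow> 'a"
  assumes bichar: "alternating_bicharacter G K c"
    and twist: "is_twist G K R \<G> c A \<tau>"

lemma (in twisted_algebra) assoc: "assoc_algebra K A"
  using twist unfolding is_twist_def by blast

sublocale twisted_algebra \<subseteq> A: ring A by (rule assoc_algebra.axioms(2)[OF assoc])

section \<open>Multiplication and ideals of the twist, expressed inside \<open>R\<close>\<close>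

context twisted_algebra
begin

lemma tau_bij: "bij_betw \<tau> (carrier R) (carrier A)"
  and tau_add: "\<And>a b. a \<in> carrier R \<Longrightarrow> b \<in> carrier R \<Longrightarrow> \<tau> (a \<oplus> b) = \<tau> a \<oplus>\<^bsub>A\<^esub> \<tau> b"
  and tau_smult: "\<And>k a. k \<in> carrier K \<Longrightarrow> a \<in> carrier R \<Longrightarrow> \<tau> (k \<odot> a) = k \<odot>\<^bsub>A\<^esub> \<tau> a"
  and tau_homog_mult: "\<And>x y a b. x \<in> carrier G \<Longrightarrow> y \<in> carrier G \<Longrightarrow> a \<in> \<G> x \<Longrightarrow> b \<in> \<G> y \<Longrightarrow>
    \<tau> a \<otimes>\<^bsub>A\<^esub> \<tau> b = c x y \<odot>\<^bsub>A\<^esub> \<tau> (a \<otimes> b)"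
  using twist unfolding is_twist_def by auto

lemma tau_closed [simp]: "a \<in> carrier R \<Longrightarrow> \<tau> a \<in> carrier A"
  using tau_bij bij_betwE by blast

lemma tau_inj: "a \<in> carrier R \<Longrightarrow> b \<in> carrier R \<Longrightarrow> \<tau> a = \<tau> b \<Longrightarrow> a = b"
  using tau_bij unfolding bij_betw_def inj_on_def by blast

lemma tau_surj: "y \<in> carrier A \<Longrightarrow> \<exists>a\<in>carrier R. y = \<tau> a"
  using tau_bij unfolding bij_betw_def by blast

lemma tau_zero: "\<tau> \<zero> = \<zero>\<^bsub>A\<^esub>"
  using tau_add[of \<zero> \<zero>] tau_closed[of \<zero>] by (simp add: A.add.l_cancel_one')

lemma tau_mem: "I \<subseteq> carrier R \<Longrightarrow> a \<in> carrier R \<Longrightarrow> \<tau> a \<in> \<tau> ` I \<longleftrightarrow> a \<in> I"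
  using tau_inj by (auto simp: subset_iff)

lemma tau_preimage: "Q \<subseteq> carrier A \<Longrightarrow> \<tau> ` {a \<in> carrier R. \<tau> a \<in> Q} = Q"
  using tau_surj by blast

lemma tau_minus: "a \<in> carrier R \<Longrightarrow> b \<in> carrier R \<Longrightarrow> \<tau> (a \<ominus> b) = \<tau> a \<ominus>\<^bsub>A\<^esub> \<tau> b"
proof -
  assume ab: "a \<in> carrier R" "b \<in> carrier R"
  have "\<tau> (a \<ominus> b) \<oplus>\<^bsub>A\<^esub> \<tau> b = \<tau> a"
    using tau_add[of "a \<ominus> b" b] ab by (simp add: R.cancel_simps(1))
  then show ?thesis using ab A.cancel_simps(1)[of "\<tau> a" "\<tau> b"]
    by (metis A.add.r_cancel A.minus_closed R.minus_closed tau_closed)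
qed

lemma c_Units [simp]: "x \<in> carrier G \<Longrightarrow> y \<in> carrier G \<Longrightarrow> c x y \<in> Units K"
  and c_mult_left: "\<And>x y z. x \<in> carrier G \<Longrightarrow> y \<in> carrier G \<Longrightarrow> z \<in> carrier G \<Longrightarrow> c (x \<otimes>\<^bsub>G\<^esub> y) z = c x z \<otimes>\<^bsub>K\<^esub> c y z"
  and c_mult_right: "\<And>x y z. x \<in> carrier G \<Longrightarrow> y \<in> carrier G \<Longrightarrow> z \<in> carrier G \<Longrightarrow> c x (y \<otimes>\<^bsub>G\<^esub> z) = c x y \<otimes>\<^bsub>K\<^esub> c x z"
  and c_self: "\<And>x. x \<in> carrier G \<Longrightarrow> c x x = \<one>\<^bsub>K\<^esub>"
  using bichar unfolding alternating_bicharacter_def by auto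

lemma c_closed [simp]: "x \<in> carrier G \<Longrightarrow> y \<in> carrier G \<Longrightarrow> c x y \<in> carrier K"
  using c_Units K.Units_closed by blast

lemma c_nonzero: "x \<in> carrier G \<Longrightarrow> y \<in> carrier G \<Longrightarrow> c x y \<noteq> \<zero>\<^bsub>K\<^esub>"
  using c_Units Units_K by blast

lemma c_left_char: "x \<in> carrier G \<Longrightarrow> c x \<in> chars G K"
  by (rule charsI) (auto simp: c_mult_right)

lemma c_right_char: "x \<in> carrier G \<Longrightarrow> (\<lambda>z. c z x) \<in> chars G K"
  by (rule charsI) (auto simp: c_mult_left)

lemma c_skew:
  assumes "x \<in> carrier G" "y \<in> carrier G" shows "c x y \<otimes>\<^bsub>K\<^esub> c y x = \<one>\<^bsub>K\<^esub>"
proof -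
  have "\<one>\<^bsub>K\<^esub> = c (x \<otimes>\<^bsub>G\<^esub> y) (x \<otimes>\<^bsub>G\<^esub> y)" using assms by (simp add: c_self)
  also have "\<dots> = (c x x \<otimes>\<^bsub>K\<^esub> c x y) \<otimes>\<^bsub>K\<^esub> (c y x \<otimes>\<^bsub>K\<^esub> c y y)"
    using assms by (simp add: c_mult_left c_mult_right K.m_ac)
  finally show ?thesis using assms by (simp add: c_self)
qed

lemma c_inv: "x \<in> carrier G \<Longrightarrow> y \<in> carrier G \<Longrightarrow> c y x = inv\<^bsub>K\<^esub> c x y"
  using c_skew[of x y] c_skew[of y x] K.comm_inv_char[of "c x y" "c y x"] by simp

lemma c_one_left: "x \<in> carrier G \<Longrightarrow> c \<one>\<^bsub>G\<^esub> x = \<one>\<^bsub>K\<^esub>"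
  using chars_one[OF c_right_char] by simp

lemma c_one_right: "x \<in> carrier G \<Longrightarrow> c x \<one>\<^bsub>G\<^esub> = \<one>\<^bsub>K\<^esub>"
  using chars_one[OF c_left_char] by simp

text \<open>A homogeneous factor multiplies in \<open>A\<close> as in \<open>R\<close> once the
  other factor has been rescaled by the character c(x, -), or by c(-, x) when the factor stands on
  the right (\<open>tau_mult_right\<close>). This is how products in \<open>A\<close> are computed
  from here on.\<close>

lemma tau_mult_left:
  assumes x: "x \<in> carrier G" and b: "b \<in> \<G> x" and m: "m \<in> carrier R"
  shows "\<tau> b \<otimes>\<^bsub>A\<^esub> \<tau> m = \<tau> (b \<otimes> sg (c x) m)"
  using m
proof (induction m rule: graded_induct)
  case zero
  then show ?case using homog_closed[OF x b] chars_kfun[OF c_left_char[OF x]] by (simp add: sg_zero tau_zero)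
next
  case (homog y a)
  then show ?case using x b homog_closed[OF x b] homog_closed[OF homog] sg_homog[OF chars_kfun[OF c_left_char[OF x]] homog]
    by (simp add: tau_homog_mult smult_mult_right tau_smult)
next
  case (add a a')
  then show ?case using homog_closed[OF x b] chars_kfun[OF c_left_char[OF x]]
    by (simp add: sg_add R.r_distr A.r_distr tau_add)
qed

lemma tau_mult_right:
  assumes x: "x \<in> carrier G" and b: "b \<in> \<G> x" and m: "m \<in> carrier R"
  shows "\<tau> m \<otimes>\<^bsub>A\<^esub> \<tau> b = \<tau> (b \<otimes> sg (\<lambda>z. c z x) m)"
  using m
proof (induction m rule: graded_induct)
  case zero
  then show ?case using homog_closed[OF x b] chars_kfun[OF c_right_char[OF x]] by (simp add: sg_zero tau_zero)
next
  case (homog y a)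
  then show ?case using x b homog_closed[OF x b] homog_closed[OF homog] sg_homog[OF chars_kfun[OF c_right_char[OF x]] homog]
    R.m_comm[OF homog_closed[OF x b] homog_closed[OF homog]]
    by (simp add: tau_homog_mult smult_mult_right tau_smult)
next
  case (add a a')
  then show ?case using homog_closed[OF x b] chars_kfun[OF c_right_char[OF x]]
    by (simp add: sg_add R.r_distr A.l_distr tau_add)
qed

lemma tau_one: "\<tau> \<one> = \<one>\<^bsub>A\<^esub>"
proof -
  have "\<tau> \<one> \<otimes>\<^bsub>A\<^esub> \<tau> m = \<tau> m" if m: "m \<in> carrier R" for m
  proof -
    have "sg (c \<one>\<^bsub>G\<^esub>) m = sg (\<lambda>_. \<one>\<^bsub>K\<^esub>) m"
      using m supp_subset[OF m] c_one_left chars_kfun[OF c_left_char] by (intro sg_cong) (auto simp: kfun_def)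
    then show ?thesis using tau_mult_left[OF G.one_closed one_homog m] m sg_one[OF m] by simp
  qed
  then have "\<tau> \<one> \<otimes>\<^bsub>A\<^esub> \<one>\<^bsub>A\<^esub> = \<one>\<^bsub>A\<^esub>" using tau_surj[OF A.one_closed] by metis
  then show ?thesis by simp
qed

lemma tau_smult_one: "k \<in> carrier K \<Longrightarrow> a \<in> carrier R \<Longrightarrow> \<tau> (k \<odot> \<one>) \<otimes>\<^bsub>A\<^esub> \<tau> a = \<tau> (k \<odot> a)"
  and tau_smult_one_right: "k \<in> carrier K \<Longrightarrow> a \<in> carrier R \<Longrightarrow> \<tau> a \<otimes>\<^bsub>A\<^esub> \<tau> (k \<odot> \<one>) = \<tau> (k \<odot> a)"
proof -
  interpret AA: assoc_algebra K A by (rule assoc)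
  show "k \<in> carrier K \<Longrightarrow> a \<in> carrier R \<Longrightarrow> \<tau> (k \<odot> \<one>) \<otimes>\<^bsub>A\<^esub> \<tau> a = \<tau> (k \<odot> a)"
    using AA.smult_mult_left[of k "\<one>\<^bsub>A\<^esub>" "\<tau> a"] by (simp add: tau_smult tau_one)
  show "k \<in> carrier K \<Longrightarrow> a \<in> carrier R \<Longrightarrow> \<tau> a \<otimes>\<^bsub>A\<^esub> \<tau> (k \<odot> \<one>) = \<tau> (k \<odot> a)"
    using AA.smult_mult_right[of k "\<tau> a" "\<one>\<^bsub>A\<^esub>"] by (simp add: tau_smult tau_one)
qed

lemma tau_mon_mult: "\<tau> (mon \<alpha>) \<otimes>\<^bsub>A\<^esub> \<tau> (mon \<beta>) = \<tau> (c (deg \<alpha>) (deg \<beta>) \<odot> mon (\<lambda>i. \<alpha> i + \<beta> i))"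
  using tau_homog_mult[OF deg_closed deg_closed mon_homog mon_homog, of \<alpha> \<beta>]
  by (simp add: mon_add tau_smult)

lemma tau_finsum:
  assumes "finite S" "f \<in> S \<rightarrow> carrier R"
  shows "\<tau> (finsum R f S) = finsum A (\<lambda>x. \<tau> (f x)) S"
  using assms
proof (induction S)
  case empty
  then show ?case by (simp add: tau_zero)
next
  case (insert x S)
  have fc: "f x \<in> carrier R" "f \<in> S \<rightarrow> carrier R" "(\<lambda>x. \<tau> (f x)) \<in> S \<rightarrow> carrier A"
    using insert.prems by (auto simp: Pi_iff)
  have "finsum R f S \<in> carrier R" using fc(2) by (rule R.finsum_closed)
  moreover have "finsum R f (insert x S) = f x \<oplus> finsum R f S"
    using insert.hyps fc by (intro R.finsum_insert)
  moreover have "finsum A (\<lambda>x. \<tau> (f x)) (insert x S) = \<tau> (f x) \<oplus>\<^bsub>A\<^esub> finsum A (\<lambda>x. \<tau> (f x)) S"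
    using insert.hyps fc by (intro A.finsum_insert tau_closed)
  ultimately show ?case using insert.IH[OF fc(2)] fc(1) by (simp add: tau_add)
qed

text \<open>\<open>component\<close> is a definite description, so uniqueness has to be proved for
  \<open>A\<close> too. A decomposition of \<open>\<tau> m\<close> is pulled back along
  \<open>\<tau>\<close> to one of m.\<close>

lemma component_twist:
  assumes m: "m \<in> carrier R"
  shows "component G A (\<lambda>x. \<tau> ` \<G> x) (\<tau> m) = (\<lambda>x. \<tau> (cmp m x))"
  unfolding component_def[of G A]
proof (rule the_equality)
  have z: "\<tau> (cmp m x) \<noteq> \<zero>\<^bsub>A\<^esub> \<longleftrightarrow> x \<in> supp m" for x
    using tau_inj[of "cmp m x" \<zero>] m tau_zero unfolding supp_def by auto
  have "\<tau> m = finsum A (\<lambda>x. \<tau> (cmp m x)) (supp m)"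
    using tau_finsum[OF supp_finite[OF m], of "cmp m"] cmp_sum[OF m] m by auto
  then show "homogeneous_decomposition G A (\<lambda>x. \<tau> ` \<G> x) (\<tau> m) (\<lambda>x. \<tau> (cmp m x))"
    unfolding homogeneous_decomposition_def z using m cmp_in cmp_outside tau_zero supp_finite by auto
  fix f assume f: "homogeneous_decomposition G A (\<lambda>x. \<tau> ` \<G> x) (\<tau> m) f"
  define g where "g x = inv_into (carrier R) \<tau> (f x)" for x
  have fx: "f x \<in> \<tau> ` \<G> x" if "x \<in> carrier G" for x using f that unfolding homogeneous_decomposition_def by blast
  have fo: "f x = \<zero>\<^bsub>A\<^esub>" if "x \<notin> carrier G" for x using f that unfolding homogeneous_decomposition_def by blast
  have inv: "inv_into (carrier R) \<tau> (\<tau> a) = a" if "a \<in> carrier R" for a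
    using tau_bij that unfolding bij_betw_def by (simp add: inv_into_f_f)
  have gx: "g x \<in> \<G> x" if "x \<in> carrier G" for x
    using fx[OF that] inv homog_closed[OF that] unfolding g_def by auto
  have go: "g x = \<zero>" if "x \<notin> carrier G" for x
    using fo[OF that] inv[of \<zero>] tau_zero unfolding g_def by simp
  have gc: "g x \<in> carrier R" for x using gx go homog_closed by (cases "x \<in> carrier G") auto
  have tg: "\<tau> (g x) = f x" for x
  proof (cases "x \<in> carrier G")
    case True
    then show ?thesis using fx[OF True] inv homog_closed[OF True] unfolding g_def by auto
  next
    case False
    then show ?thesis using fo go tau_zero by simp
  qed
  have supp: "{x. g x \<noteq> \<zero>} = {x. f x \<noteq> \<zero>\<^bsub>A\<^esub>}"
    using tg tau_inj[OF gc R.zero_closed] tau_zero by (metis (no_types, opaque_lifting))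
  have fin: "finite {x. f x \<noteq> \<zero>\<^bsub>A\<^esub>}" and sum: "\<tau> m = finsum A f {x. f x \<noteq> \<zero>\<^bsub>A\<^esub>}"
    using f unfolding homogeneous_decomposition_def by auto
  have "\<tau> (finsum R g {x. g x \<noteq> \<zero>}) = \<tau> m"
    using tau_finsum[of "{x. g x \<noteq> \<zero>}" g] fin gc unfolding sum supp tg by simp
  moreover have "finsum R g {x. g x \<noteq> \<zero>} \<in> carrier R" using gc by (intro R.finsum_closed) auto
  ultimately have "m = finsum R g {x. g x \<noteq> \<zero>}" using tau_inj m by metis
  then have "homogeneous_decomposition G R \<G> m g"
    unfolding homogeneous_decomposition_def using gx go fin supp by simp
  then have "cmp m = g" by (rule cmp_eqI[OF m])
  then show "f = (\<lambda>x. \<tau> (cmp m x))" using tg by auto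
qed

lemma char_act_twist:
  assumes h: "h \<in> chars G K" and m: "m \<in> carrier R"
  shows "char_act G A (\<lambda>x. \<tau> ` \<G> x) h (\<tau> m) = \<tau> (sg h m)"
proof -
  have z: "\<tau> (cmp m x) \<noteq> \<zero>\<^bsub>A\<^esub> \<longleftrightarrow> x \<in> supp m" for x
    using tau_inj[of "cmp m x" \<zero>] m tau_zero unfolding supp_def by auto
  have kh: "h x \<in> carrier K" if "x \<in> supp m" for x
    using kfunD[OF chars_kfun[OF h]] that supp_subset[OF m] by blast
  have "char_act G A (\<lambda>x. \<tau> ` \<G> x) h (\<tau> m) = finsum A (\<lambda>x. h x \<odot>\<^bsub>A\<^esub> \<tau> (cmp m x)) (supp m)"
    unfolding char_act_def component_twist[OF m] z by simp
  also have "\<dots> = finsum A (\<lambda>x. \<tau> (h x \<odot> cmp m x)) (supp m)"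
    using kh m by (intro A.finsum_cong') (auto simp: tau_smult[symmetric])
  also have "\<dots> = \<tau> (finsum R (\<lambda>x. h x \<odot> cmp m x) (supp m))"
    using kh m supp_finite[OF m] by (intro tau_finsum[symmetric]) auto
  also have "finsum R (\<lambda>x. h x \<odot> cmp m x) (supp m) = sg h m"
    unfolding char_act_def supp_def by simp
  finally show ?thesis .
qed

text \<open>Ideals of \<open>A\<close>, carried by subsets of \<open>R\<close>: the same set can
  then be compared with ideals of \<open>R\<close> and be acted on by \<open>sg\<close>.\<close>

definition tideal :: "'r set \<Rightarrow> bool" where
  "tideal I \<longleftrightarrow> I \<subseteq> carrier R \<and> ideal (\<tau> ` I) A"

lemma tideal_subspace:
  assumes "tideal I" shows "subspace I"
proof -
  have sub: "I \<subseteq> carrier R" using assms unfolding tideal_def by blast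
  interpret I: ideal "\<tau> ` I" A using assms unfolding tideal_def by blast
  show ?thesis
    unfolding subspace_def
  proof (intro conjI ballI)
    show "\<zero> \<in> I" using I.zero_closed tau_mem[OF sub R.zero_closed] tau_zero by simp
    show "a \<oplus> b \<in> I" if ab: "a \<in> I" "b \<in> I" for a b
    proof -
      have ac: "a \<in> carrier R" "b \<in> carrier R" using ab sub by auto
      have "\<tau> (a \<oplus> b) \<in> \<tau> ` I"
        unfolding tau_add[OF ac] using ab by (intro I.a_closed imageI)
      then show ?thesis using tau_mem[OF sub] ac by simp
    qed
    show "k \<odot> a \<in> I" if "k \<in> carrier K" "a \<in> I" for k a
    proof -
      have ac: "a \<in> carrier R" using that sub by blast
      have "\<tau> (k \<odot> \<one>) \<otimes>\<^bsub>A\<^esub> \<tau> a \<in> \<tau> ` I" using that ac by (intro I.I_l_closed) auto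
      then show ?thesis using that ac tau_mem[OF sub, of "k \<odot> a"] by (simp add: tau_smult_one)
    qed
  qed (rule sub)
qed

lemma tideal_mult:
  assumes I: "tideal I" and x: "x \<in> carrier G" and b: "b \<in> \<G> x" and m: "m \<in> I"
  shows "b \<otimes> sg (c x) m \<in> I" "b \<otimes> sg (\<lambda>z. c z x) m \<in> I"
proof -
  have sub: "I \<subseteq> carrier R" using I unfolding tideal_def by blast
  interpret I: ideal "\<tau> ` I" A using I unfolding tideal_def by blast
  have bc: "b \<in> carrier R" and mc: "m \<in> carrier R" using homog_closed[OF x b] m sub by auto
  have "\<tau> b \<otimes>\<^bsub>A\<^esub> \<tau> m \<in> \<tau> ` I" "\<tau> m \<otimes>\<^bsub>A\<^esub> \<tau> b \<in> \<tau> ` I"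
    using m bc by (auto intro: I.I_l_closed I.I_r_closed)
  then show "b \<otimes> sg (c x) m \<in> I" "b \<otimes> sg (\<lambda>z. c z x) m \<in> I"
    using tau_mult_left[OF x b mc] tau_mult_right[OF x b mc] tau_mem[OF sub] bc mc
      chars_kfun[OF c_left_char[OF x]] chars_kfun[OF c_right_char[OF x]] by auto
qed

lemma tidealI:
  assumes W: "subspace I"
    and l: "\<And>x b m. x \<in> carrier G \<Longrightarrow> b \<in> \<G> x \<Longrightarrow> m \<in> I \<Longrightarrow> b \<otimes> sg (c x) m \<in> I"
    and r: "\<And>x b m. x \<in> carrier G \<Longrightarrow> b \<in> \<G> x \<Longrightarrow> m \<in> I \<Longrightarrow> b \<otimes> sg (\<lambda>z. c z x) m \<in> I"
  shows "tideal I"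
  unfolding tideal_def
proof (intro conjI)
  show sub: "I \<subseteq> carrier R" using subspaceD(1)[OF W] .
  have addI: "y \<oplus>\<^bsub>A\<^esub> y' \<in> \<tau> ` I" if yy: "y \<in> \<tau> ` I" "y' \<in> \<tau> ` I" for y y'
  proof -
    obtain a b where ab: "a \<in> I" "b \<in> I" "y = \<tau> a" "y' = \<tau> b" using yy by blast
    then have "y \<oplus>\<^bsub>A\<^esub> y' = \<tau> (a \<oplus> b)" using sub by (simp add: tau_add subset_iff)
    then show ?thesis using subspaceD(3)[OF W ab(1,2)] by simp
  qed
  have zeroI: "\<zero>\<^bsub>A\<^esub> \<in> \<tau> ` I" using subspaceD(2)[OF W] tau_zero by (metis imageI)
  have mult: "\<tau> a \<otimes>\<^bsub>A\<^esub> \<tau> m \<in> \<tau> ` I \<and> \<tau> m \<otimes>\<^bsub>A\<^esub> \<tau> a \<in> \<tau> ` I" if a: "a \<in> carrier R" and m: "m \<in> I" for a m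
  proof -
    have mc: "m \<in> carrier R" using m sub by blast
    show ?thesis using a
    proof (induction a rule: graded_induct)
      case zero
      then show ?case using mc zeroI by (simp add: tau_zero)
    next
      case (homog x b)
      then show ?case using l[OF homog m] r[OF homog m] tau_mult_left[OF homog mc] tau_mult_right[OF homog mc] by simp
    next
      case (add a b)
      then show ?case using mc addI by (simp add: tau_add A.l_distr A.r_distr)
    qed
  qed
  show "ideal (\<tau> ` I) A"
  proof (rule idealI[OF A.ring_axioms])
    show "subgroup (\<tau> ` I) (add_monoid A)"
    proof (intro subgroup.intro)
      fix y assume "y \<in> \<tau> ` I"
      then obtain a where a: "a \<in> I" "y = \<tau> a" by blast
      have ac: "a \<in> carrier R" using a sub by blast
      have "\<zero> \<ominus> a \<in> I" using subspace_minus[OF W subspaceD(2)[OF W] a(1)] .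
      then have "\<tau> (\<zero> \<ominus> a) \<in> \<tau> ` I" by blast
      moreover have "\<tau> (\<zero> \<ominus> a) = \<ominus>\<^bsub>A\<^esub> y" using ac a(2) by (simp add: tau_minus tau_zero A.minus_eq)
      ultimately show "inv\<^bsub>add_monoid A\<^esub> y \<in> \<tau> ` I" by (simp flip: a_inv_def)
    next
      show "\<tau> ` I \<subseteq> carrier (add_monoid A)" using sub by auto
    qed (use zeroI addI in auto)
    fix y z assume y: "y \<in> \<tau> ` I" and z: "z \<in> carrier A"
    obtain m where m: "m \<in> I" "y = \<tau> m" using y by blast
    obtain a where a: "a \<in> carrier R" "z = \<tau> a" using tau_surj[OF z] by blast
    show "z \<otimes>\<^bsub>A\<^esub> y \<in> \<tau> ` I" "y \<otimes>\<^bsub>A\<^esub> z \<in> \<tau> ` I" using mult[OF a(1) m(1)] a(2) m(2) by auto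
  qed
qed

lemma tideal_preimage:
  assumes "ideal Q A" shows "tideal {a \<in> carrier R. \<tau> a \<in> Q}" "\<tau> ` {a \<in> carrier R. \<tau> a \<in> Q} = Q"
proof -
  interpret ideal Q A by (rule assms)
  show "\<tau> ` {a \<in> carrier R. \<tau> a \<in> Q} = Q" using a_subset by (rule tau_preimage)
  then show "tideal {a \<in> carrier R. \<tau> a \<in> Q}" unfolding tideal_def using assms by auto
qed

end

section \<open>Supports of sums, products and rescaled elements\<close>

context graded_algebra
begin

lemma subspace_cmps:
  assumes W: "subspace W" and m: "m \<in> carrier R" and mW: "\<And>x. x \<in> supp m \<Longrightarrow> cmp m x \<in> W"
  shows "m \<in> W"
proof -
  have "finsum R (cmp m) S \<in> W" if "finite S" "S \<subseteq> supp m" for S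
    using that
  proof (induction S)
    case empty
    then show ?case using subspaceD(2)[OF W] by simp
  next
    case (insert x S)
    then have "finsum R (cmp m) (insert x S) = cmp m x \<oplus> finsum R (cmp m) S"
      using m by (intro R.finsum_insert) auto
    then show ?case using insert mW subspaceD(3)[OF W] by simp
  qed
  then show ?thesis using cmp_sum[OF m] supp_finite[OF m] by (metis subset_refl)
qed

lemma supp_homog: "x \<in> carrier G \<Longrightarrow> a \<in> \<G> x \<Longrightarrow> supp a \<subseteq> {x}"
  unfolding supp_def using cmp_homog by auto

lemma supp_smult: "k \<in> carrier K \<Longrightarrow> m \<in> carrier R \<Longrightarrow> supp (k \<odot> m) \<subseteq> supp m"
  unfolding supp_def by (auto simp: cmp_smult Alg.smult_r_null)

lemma supp_add: "a \<in> carrier R \<Longrightarrow> b \<in> carrier R \<Longrightarrow> supp (a \<oplus> b) \<subseteq> supp a \<union> supp b"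
  unfolding supp_def by (auto simp: cmp_add)

lemma supp_minus:
  assumes "a \<in> carrier R" "b \<in> carrier R" shows "supp (a \<ominus> b) \<subseteq> supp a \<union> supp b"
proof -
  have "supp (\<ominus> b) \<subseteq> supp b" using assms neg_smult[of b] supp_smult[of "\<ominus>\<^bsub>K\<^esub> \<one>\<^bsub>K\<^esub>" b] by simp
  then show ?thesis using supp_add[of a "\<ominus> b"] assms by (auto simp: R.minus_eq)
qed

lemma supp_sg_ind: "m \<in> carrier R \<Longrightarrow> supp (sg (ind Z) m) \<subseteq> {x \<in> supp m. Z x}"
  using supp_sg[OF kfun_ind, of m Z] unfolding ind_def by (auto split: if_splits)

lemma subspace_supp: "subspace {m \<in> carrier R. supp m \<subseteq> Z}"
  unfolding subspace_def
proof (intro conjI ballI)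
  show "\<zero> \<in> {m \<in> carrier R. supp m \<subseteq> Z}" by (auto simp: supp_def cmp_zero)
  show "m \<oplus> m' \<in> {m \<in> carrier R. supp m \<subseteq> Z}"
    if "m \<in> {m \<in> carrier R. supp m \<subseteq> Z}" "m' \<in> {m \<in> carrier R. supp m \<subseteq> Z}" for m m'
    using that supp_add[of m m'] by auto
  show "k \<odot> m \<in> {m \<in> carrier R. supp m \<subseteq> Z}"
    if "k \<in> carrier K" "m \<in> {m \<in> carrier R. supp m \<subseteq> Z}" for k m
    using that supp_smult[of k m] by auto
qed auto

lemma subspace_mult_preimage:
  assumes W: "subspace W" and u: "u \<in> carrier R" shows "subspace {m \<in> carrier R. u \<otimes> m \<in> W}"
  unfolding subspace_def using u subspaceD(2,3,4)[OF W] by (auto simp: R.r_distr smult_mult_right)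

lemma mult_components_in:
  assumes W: "subspace W" and a: "a \<in> carrier R" and b: "b \<in> carrier R"
    and ab: "\<And>x y. x \<in> supp a \<Longrightarrow> y \<in> supp b \<Longrightarrow> cmp a x \<otimes> cmp b y \<in> W"
  shows "a \<otimes> b \<in> W"
proof -
  have "b \<otimes> cmp a x \<in> W" if x: "x \<in> supp a" for x
  proof -
    have "b \<in> {m \<in> carrier R. cmp a x \<otimes> m \<in> W}"
      by (rule subspace_cmps[OF subspace_mult_preimage[OF W] b]) (use ab x a b in auto)
    then show ?thesis using a b by (simp add: R.m_comm)
  qed
  then have "a \<in> {m \<in> carrier R. b \<otimes> m \<in> W}"
    by (intro subspace_cmps[OF subspace_mult_preimage[OF W b] a]) (use a in auto)
  then show ?thesis using a b by (simp add: R.m_comm)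
qed

lemma supp_mult:
  assumes a: "a \<in> carrier R" and b: "b \<in> carrier R"
  shows "supp (a \<otimes> b) \<subseteq> {x \<otimes>\<^bsub>G\<^esub> y | x y. x \<in> supp a \<and> y \<in> supp b}" (is "_ \<subseteq> ?S")
proof -
  have "a \<otimes> b \<in> {m \<in> carrier R. supp m \<subseteq> ?S}"
  proof (rule mult_components_in[OF subspace_supp a b])
    fix x y assume xy: "x \<in> supp a" "y \<in> supp b"
    then have G: "x \<in> carrier G" "y \<in> carrier G" using supp_subset a b by auto
    have "cmp a x \<otimes> cmp b y \<in> \<G> (x \<otimes>\<^bsub>G\<^esub> y)" using G a b by (intro homog_mult cmp_in)
    then have "supp (cmp a x \<otimes> cmp b y) \<subseteq> {x \<otimes>\<^bsub>G\<^esub> y}" using G by (intro supp_homog) auto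
    moreover have "x \<otimes>\<^bsub>G\<^esub> y \<in> ?S" using xy by blast
    ultimately show "cmp a x \<otimes> cmp b y \<in> {m \<in> carrier R. supp m \<subseteq> ?S}" using a b by auto
  qed
  then show ?thesis by simp
qed

lemma sg_eq_smult:
  assumes p: "kfun \<phi>" and m: "m \<in> carrier R" and k: "k \<in> carrier K" and eq: "\<And>x. x \<in> supp m \<Longrightarrow> \<phi> x = k"
  shows "sg \<phi> m = k \<odot> m"
proof -
  have "sg \<phi> m = sg (\<lambda>_. k) m" using assms by (intro sg_cong) (auto simp: kfun_def)
  then show ?thesis using sg_const[OF k m] by simp
qed

lemma sg_comm: "kfun \<phi> \<Longrightarrow> kfun \<psi> \<Longrightarrow> m \<in> carrier R \<Longrightarrow> sg \<phi> (sg \<psi> m) = sg \<psi> (sg \<phi> m)"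
  using sg_sg[of \<phi> \<psi> m] sg_sg[of \<psi> \<phi> m]
    sg_cong[OF kfun_mult[of \<phi> \<psi>] kfun_mult[of \<psi> \<phi>], of m] K.m_comm kfunD supp_subset[of m]
  by (metis subsetD)

end

lemma (in left_module) smult_minus_right:
  assumes "a \<in> carrier A" "u \<in> carrier M" "v \<in> carrier M"
  shows "a \<odot>\<^bsub>M\<^esub> (u \<ominus>\<^bsub>M\<^esub> v) = a \<odot>\<^bsub>M\<^esub> u \<ominus>\<^bsub>M\<^esub> a \<odot>\<^bsub>M\<^esub> v"
proof -
  have "a \<odot>\<^bsub>M\<^esub> (u \<ominus>\<^bsub>M\<^esub> v) \<oplus>\<^bsub>M\<^esub> a \<odot>\<^bsub>M\<^esub> v = a \<odot>\<^bsub>M\<^esub> u"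
    using smult_r_distr[of a "u \<ominus>\<^bsub>M\<^esub> v" v] assms by (simp add: M.cancel_simps(1))
  moreover have "(a \<odot>\<^bsub>M\<^esub> u \<ominus>\<^bsub>M\<^esub> a \<odot>\<^bsub>M\<^esub> v) \<oplus>\<^bsub>M\<^esub> a \<odot>\<^bsub>M\<^esub> v = a \<odot>\<^bsub>M\<^esub> u"
    using assms smult_closed by (simp add: M.cancel_simps(1))
  ultimately show ?thesis using assms smult_closed by (metis M.add.r_cancel M.minus_closed)
qed

context twisted_algebra
begin

subsection \<open>Endomorphisms of simple modules are scalar\<close>

text \<open>If \<theta> is not scalar, Schur's lemma makes \<theta> - x bijective for every x in the
  field. The module is spanned by the monomials applied to one nonzero vector, and
  \<open>impossible\<close> excludes this combination.\<close>

lemma simple_module_scalar: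
  fixes V :: "('a, 'v, 'm) module_scheme"
  assumes V: "simple_module A V"
    and closed: "\<And>v. v \<in> carrier V \<Longrightarrow> \<theta> v \<in> carrier V"
    and add: "\<And>u v. u \<in> carrier V \<Longrightarrow> v \<in> carrier V \<Longrightarrow> \<theta> (u \<oplus>\<^bsub>V\<^esub> v) = \<theta> u \<oplus>\<^bsub>V\<^esub> \<theta> v"
    and lin: "\<And>a v. a \<in> carrier A \<Longrightarrow> v \<in> carrier V \<Longrightarrow> \<theta> (a \<odot>\<^bsub>V\<^esub> v) = a \<odot>\<^bsub>V\<^esub> \<theta> v"
  shows "\<exists>k\<in>carrier K. \<forall>v\<in>carrier V. \<theta> v = \<tau> (k \<odot> \<one>) \<odot>\<^bsub>V\<^esub> v"
proof (rule ccontr)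
  assume contra: "\<not> ?thesis"
  interpret V: simple_module A V by (rule V)
  define s where "s k v = \<tau> (k \<odot> \<one>) \<odot>\<^bsub>V\<^esub> v" for k v
  have s_closed: "s k v \<in> carrier V" if "k \<in> carrier K" "v \<in> carrier V" for k v
    unfolding s_def using that by (intro V.smult_closed) auto
  have s_lin: "a \<odot>\<^bsub>V\<^esub> s k v = s k (a \<odot>\<^bsub>V\<^esub> v)" if kva: "k \<in> carrier K" "v \<in> carrier V" "a \<in> carrier A" for k v a
  proof -
    obtain e where e: "e \<in> carrier R" "a = \<tau> e" using tau_surj[OF kva(3)] by blast
    have "a \<otimes>\<^bsub>A\<^esub> \<tau> (k \<odot> \<one>) = \<tau> (k \<odot> \<one>) \<otimes>\<^bsub>A\<^esub> a"
      unfolding e(2) using e kva by (simp add: tau_smult_one tau_smult_one_right)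
    then show ?thesis unfolding s_def using kva V.smult_assoc[of a "\<tau> (k \<odot> \<one>)" v] V.smult_assoc[of "\<tau> (k \<odot> \<one>)" a v] by simp
  qed
  have s_add: "s k (u \<oplus>\<^bsub>V\<^esub> v) = s k u \<oplus>\<^bsub>V\<^esub> s k v" if "k \<in> carrier K" "u \<in> carrier V" "v \<in> carrier V" for k u v
    unfolding s_def using that by (simp add: V.smult_r_distr)
  obtain m where m: "m \<in> carrier V" "m \<noteq> \<zero>\<^bsub>V\<^esub>" using V.nonzero V.M.zero_closed by blast
  have bij: "bij_betw (\<lambda>v. \<theta> v \<ominus>\<^bsub>V\<^esub> s x v) (carrier V) (carrier V)" if x: "x \<in> carrier K" for x
  proof -
    have lin': "\<theta> (a \<odot>\<^bsub>V\<^esub> v) \<ominus>\<^bsub>V\<^esub> s x (a \<odot>\<^bsub>V\<^esub> v) = a \<odot>\<^bsub>V\<^esub> (\<theta> v \<ominus>\<^bsub>V\<^esub> s x v)"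
      if "a \<in> carrier A" "v \<in> carrier V" for a v
      using that x closed s_closed by (simp add: lin V.smult_minus_right s_lin)
    have "\<exists>v\<in>carrier V. \<theta> v \<noteq> s x v" using contra x unfolding s_def by blast
    then obtain v0 where v0: "v0 \<in> carrier V" "\<theta> v0 \<noteq> s x v0" by blast
    show ?thesis
    proof (rule V.bij_betw_if)
      show "\<theta> v \<ominus>\<^bsub>V\<^esub> s x v \<in> carrier V" if "v \<in> carrier V" for v using that x closed s_closed by simp
      show "\<theta> (u \<oplus>\<^bsub>V\<^esub> v) \<ominus>\<^bsub>V\<^esub> s x (u \<oplus>\<^bsub>V\<^esub> v) = (\<theta> u \<ominus>\<^bsub>V\<^esub> s x u) \<oplus>\<^bsub>V\<^esub> (\<theta> v \<ominus>\<^bsub>V\<^esub> s x v)"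
        if "u \<in> carrier V" "v \<in> carrier V" for u v
        using that x closed s_closed by (simp add: add s_add V.M.minus_eq V.M.minus_add V.M.a_ac)
      show "\<theta> (a \<odot>\<^bsub>V\<^esub> v) \<ominus>\<^bsub>V\<^esub> s x (a \<odot>\<^bsub>V\<^esub> v) = \<zero>\<^bsub>V\<^esub>"
        if "a \<in> carrier A" "v \<in> carrier V" "\<theta> v \<ominus>\<^bsub>V\<^esub> s x v = \<zero>\<^bsub>V\<^esub>" for a v
        using lin'[OF that(1,2)] that(1,3) V.smult_zero_right by simp
      show "\<exists>u\<in>carrier V. a \<odot>\<^bsub>V\<^esub> (\<theta> v \<ominus>\<^bsub>V\<^esub> s x v) = \<theta> u \<ominus>\<^bsub>V\<^esub> s x u"
        if "a \<in> carrier A" "v \<in> carrier V" for a v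
        using lin'[OF that] that V.smult_closed by metis
      show "v0 \<in> carrier V" by (rule v0)
      show "\<theta> v0 \<ominus>\<^bsub>V\<^esub> s x v0 \<noteq> \<zero>\<^bsub>V\<^esub>"
      proof
        assume "\<theta> v0 \<ominus>\<^bsub>V\<^esub> s x v0 = \<zero>\<^bsub>V\<^esub>"
        then have "\<theta> v0 = s x v0" using V.M.cancel_simps(1)[of "\<theta> v0" "s x v0"] closed s_closed x v0(1) by simp
        then show False using v0(2) by simp
      qed
    qed
  qed
  \<comment> \<open>The scalars \<open>\<kappa>\<close> are values of the bicharacter on degrees of
    monomials, hence units.\<close>
  interpret monomial_action K V s \<theta> n "\<lambda>\<alpha>. \<tau> (mon \<alpha>) \<odot>\<^bsub>V\<^esub> m" "\<lambda>\<gamma> u. \<tau> (mon \<gamma>) \<odot>\<^bsub>V\<^esub> u" "\<lambda>\<gamma> \<alpha>. c (deg \<gamma>) (deg \<alpha>)"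
  proof (intro monomial_action.intro poly_action.intro poly_action_axioms.intro monomial_action_axioms.intro)
    show "algebraically_closed K" by (rule closed_field)
    show "abelian_group V" by (rule V.M.abelian_group_axioms)
    show "s (a \<oplus>\<^bsub>K\<^esub> b) v = s a v \<oplus>\<^bsub>V\<^esub> s b v" if "a \<in> carrier K" "b \<in> carrier K" "v \<in> carrier V" for a b v
      unfolding s_def using that by (simp add: Alg.smult_l_distr tau_add V.smult_l_distr)
    show "s (a \<otimes>\<^bsub>K\<^esub> b) v = s a (s b v)" if "a \<in> carrier K" "b \<in> carrier K" "v \<in> carrier V" for a b v
    proof -
      have "\<tau> ((a \<otimes>\<^bsub>K\<^esub> b) \<odot> \<one>) = \<tau> (a \<odot> \<one>) \<otimes>\<^bsub>A\<^esub> \<tau> (b \<odot> \<one>)"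
        using that by (simp add: tau_smult_one Alg.smult_assoc1)
      then show ?thesis unfolding s_def using that by (simp add: V.smult_assoc)
    qed
    show "s \<one>\<^bsub>K\<^esub> v = v" if "v \<in> carrier V" for v
      unfolding s_def using that by (simp add: tau_one V.smult_one)
    show "\<theta> (s a v) = s a (\<theta> v)" if "a \<in> carrier K" "v \<in> carrier V" for a v
      unfolding s_def using that by (intro lin) auto
    show "\<tau> (mon \<alpha>) \<odot>\<^bsub>V\<^esub> m \<in> carrier V" for \<alpha> using m by (intro V.smult_closed) auto
    show "\<tau> (mon (\<lambda>_. 0)) \<odot>\<^bsub>V\<^esub> m \<noteq> \<zero>\<^bsub>V\<^esub>" using m by (simp add: mon_zero tau_one V.smult_one)
    show "\<tau> (mon \<gamma>) \<odot>\<^bsub>V\<^esub> u \<in> carrier V" if "u \<in> carrier V" for \<gamma> u using that by (intro V.smult_closed) auto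
    show "\<tau> (mon \<gamma>) \<odot>\<^bsub>V\<^esub> (u \<oplus>\<^bsub>V\<^esub> u') = \<tau> (mon \<gamma>) \<odot>\<^bsub>V\<^esub> u \<oplus>\<^bsub>V\<^esub> \<tau> (mon \<gamma>) \<odot>\<^bsub>V\<^esub> u'"
      if "u \<in> carrier V" "u' \<in> carrier V" for \<gamma> u u' using that by (intro V.smult_r_distr) auto
    show "\<tau> (mon \<gamma>) \<odot>\<^bsub>V\<^esub> s a u = s a (\<tau> (mon \<gamma>) \<odot>\<^bsub>V\<^esub> u)"
      if "a \<in> carrier K" "u \<in> carrier V" for \<gamma> a u using that by (intro s_lin) auto
    show "\<tau> (mon \<gamma>) \<odot>\<^bsub>V\<^esub> \<theta> u = \<theta> (\<tau> (mon \<gamma>) \<odot>\<^bsub>V\<^esub> u)" if "u \<in> carrier V" for \<gamma> u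
      using that by (intro lin[symmetric]) auto
    show "c (deg \<gamma>) (deg \<alpha>) \<in> carrier K - {\<zero>\<^bsub>K\<^esub>}" for \<gamma> \<alpha> using c_nonzero by simp
    show "\<tau> (mon \<gamma>) \<odot>\<^bsub>V\<^esub> (\<tau> (mon \<alpha>) \<odot>\<^bsub>V\<^esub> m) = s (c (deg \<gamma>) (deg \<alpha>)) (\<tau> (mon (\<lambda>i. \<alpha> i + \<gamma> i)) \<odot>\<^bsub>V\<^esub> m)" for \<gamma> \<alpha>
    proof -
      have "\<tau> (mon \<gamma>) \<otimes>\<^bsub>A\<^esub> \<tau> (mon \<alpha>) = \<tau> (c (deg \<gamma>) (deg \<alpha>) \<odot> \<one>) \<otimes>\<^bsub>A\<^esub> \<tau> (mon (\<lambda>i. \<alpha> i + \<gamma> i))"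
        using tau_mon_mult[of \<gamma> \<alpha>] by (simp add: tau_smult_one add.commute)
      then show ?thesis unfolding s_def using m by (simp flip: V.smult_assoc)
    qed
    show "W = carrier V"
      if W: "W \<subseteq> carrier V" "\<zero>\<^bsub>V\<^esub> \<in> W" "\<And>u u'. u \<in> W \<Longrightarrow> u' \<in> W \<Longrightarrow> u \<oplus>\<^bsub>V\<^esub> u' \<in> W"
        "\<And>a u. a \<in> carrier K \<Longrightarrow> u \<in> W \<Longrightarrow> s a u \<in> W" "(\<lambda>\<alpha>. \<tau> (mon \<alpha>) \<odot>\<^bsub>V\<^esub> m) ` exps n \<subseteq> W" for W
    proof -
      let ?U = "{a \<in> carrier R. \<tau> a \<odot>\<^bsub>V\<^esub> m \<in> W}"
      have "subspace ?U"
        unfolding subspace_def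
      proof (intro conjI ballI)
        show "\<zero> \<in> ?U" using W(2) m by (simp add: tau_zero V.smult_zero_left)
        show "a \<oplus> b \<in> ?U" if "a \<in> ?U" "b \<in> ?U" for a b
          using that W(3) m by (simp add: tau_add V.smult_l_distr)
        show "k \<odot> a \<in> ?U" if k: "k \<in> carrier K" and a: "a \<in> ?U" for k a
        proof -
          have "\<tau> (k \<odot> a) \<odot>\<^bsub>V\<^esub> m = s k (\<tau> a \<odot>\<^bsub>V\<^esub> m)"
            unfolding s_def using k a m V.smult_assoc[of "\<tau> (k \<odot> \<one>)" "\<tau> a" m] tau_smult_one[of k a] by simp
          then show ?thesis using k a W(4) by simp
        qed
      qed auto
      moreover have "mon \<alpha> \<in> ?U" if "\<alpha> \<in> exps n" for \<alpha> using that W(5) by auto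
      ultimately have U: "?U = carrier R" by (rule monomials_span)
      have "carrier V \<subseteq> W"
      proof
        fix v assume "v \<in> carrier V"
        then have "v \<in> (\<lambda>a. a \<odot>\<^bsub>V\<^esub> m) ` carrier A" using V.cyclic[OF m] by simp
        then obtain a where a: "a \<in> carrier A" "v = a \<odot>\<^bsub>V\<^esub> m" by blast
        obtain e where e: "e \<in> carrier R" "a = \<tau> e" using tau_surj[OF a(1)] by blast
        have "e \<in> ?U" using e(1) U by simp
        then show "v \<in> W" using a(2) e(2) by simp
      qed
      then show ?thesis using W(1) by blast
    qed
  qed (use closed add s_closed s_add bij in auto)
  show False by (rule impossible)
qed

subsection \<open>Prime ideals of the twist\<close>

definition tprime :: "'r set \<Rightarrow> bool" where
  "tprime Q \<longleftrightarrow> Q \<subseteq> carrier R \<and> prime_ideal (\<tau> ` Q) A"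

lemma tprime_tideal: "tprime Q \<Longrightarrow> tideal Q"
  unfolding tprime_def tideal_def prime_ideal_def by blast

lemma tideal_one: "tideal Q \<Longrightarrow> \<one> \<in> Q \<Longrightarrow> \<tau> ` Q = carrier A"
proof -
  assume Q: "tideal Q" "\<one> \<in> Q"
  interpret ideal "\<tau> ` Q" A using Q unfolding tideal_def by blast
  have "\<one>\<^bsub>A\<^esub> \<in> \<tau> ` Q" using Q(2) tau_one by (metis imageI)
  then show ?thesis by (rule one_imp_carrier)
qed

lemma tprime_one: "tprime Q \<Longrightarrow> \<one> \<notin> Q"
  using tideal_one[OF tprime_tideal] unfolding tprime_def prime_ideal_def by blast

text \<open>Both products are multiples of \<open>\<tau> (b \<otimes> e)\<close>, one by c(x, y) and
  the other by its inverse, so they differ by a square. All the squares in the sequel come from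
  here.\<close>

lemma tau_homog_commute:
  assumes x: "x \<in> carrier G" and y: "y \<in> carrier G" and b: "b \<in> \<G> x" and e: "e \<in> \<G> y"
  shows "\<tau> b \<otimes>\<^bsub>A\<^esub> \<tau> e = \<tau> ((c x y \<otimes>\<^bsub>K\<^esub> c x y) \<odot> \<one>) \<otimes>\<^bsub>A\<^esub> (\<tau> e \<otimes>\<^bsub>A\<^esub> \<tau> b)"
proof -
  have bc: "b \<in> carrier R" "e \<in> carrier R" using homog_closed x y b e by auto
  have "\<tau> e \<otimes>\<^bsub>A\<^esub> \<tau> b = \<tau> (c y x \<odot> (b \<otimes> e))"
    using tau_homog_mult[OF y x e b] x y bc by (simp add: tau_smult R.m_comm)
  moreover have "\<tau> b \<otimes>\<^bsub>A\<^esub> \<tau> e = \<tau> (c x y \<odot> (b \<otimes> e))"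
    using tau_homog_mult[OF x y b e] x y bc by (simp add: tau_smult)
  moreover have "(c x y \<otimes>\<^bsub>K\<^esub> c x y) \<odot> (c y x \<odot> (b \<otimes> e)) = c x y \<odot> (b \<otimes> e)"
  proof -
    have "(c x y \<otimes>\<^bsub>K\<^esub> c x y) \<otimes>\<^bsub>K\<^esub> c y x = c x y"
      using x y c_skew[OF x y] by (simp add: K.m_assoc)
    then show ?thesis using x y bc by (simp flip: Alg.smult_assoc1)
  qed
  ultimately show ?thesis using x y bc by (simp add: tau_smult_one)
qed

text \<open>A homogeneous element commutes with homogeneous elements up to units, so with b
  homogeneous b A m lies in A b m. Hence primality holds for plain products as soon as one factor is
  homogeneous, whatever the other one is.\<close>

lemma tprime_homog:
  assumes Q: "tprime Q" and x: "x \<in> carrier G" and b: "b \<in> \<G> x" and m: "m \<in> carrier R"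
  shows "b \<otimes> sg (c x) m \<in> Q \<Longrightarrow> b \<in> Q \<or> m \<in> Q" "b \<otimes> sg (\<lambda>z. c z x) m \<in> Q \<Longrightarrow> b \<in> Q \<or> m \<in> Q"
proof -
  have sub: "Q \<subseteq> carrier R" and pr: "prime_ideal (\<tau> ` Q) A" using Q unfolding tprime_def by auto
  interpret I: ideal "\<tau> ` Q" A using pr unfolding prime_ideal_def by blast
  have bc: "b \<in> carrier R" using homog_closed[OF x b] .
  have comm: "\<tau> b \<otimes>\<^bsub>A\<^esub> \<tau> e \<otimes>\<^bsub>A\<^esub> \<tau> m = \<tau> ((c x y \<otimes>\<^bsub>K\<^esub> c x y) \<odot> \<one>) \<otimes>\<^bsub>A\<^esub> \<tau> e \<otimes>\<^bsub>A\<^esub> (\<tau> b \<otimes>\<^bsub>A\<^esub> \<tau> m)"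
    "\<tau> m \<otimes>\<^bsub>A\<^esub> \<tau> e \<otimes>\<^bsub>A\<^esub> \<tau> b = (\<tau> m \<otimes>\<^bsub>A\<^esub> \<tau> b) \<otimes>\<^bsub>A\<^esub> (\<tau> ((c y x \<otimes>\<^bsub>K\<^esub> c y x) \<odot> \<one>) \<otimes>\<^bsub>A\<^esub> \<tau> e)"
    if y: "y \<in> carrier G" and e: "e \<in> \<G> y" for y e
  proof -
    have ec: "e \<in> carrier R" using homog_closed[OF y e] .
    let ?k = "\<tau> ((c x y \<otimes>\<^bsub>K\<^esub> c x y) \<odot> \<one>)" and ?l = "\<tau> ((c y x \<otimes>\<^bsub>K\<^esub> c y x) \<odot> \<one>)"
    have kc: "?k \<in> carrier A" "?l \<in> carrier A" using x y by auto
    show "\<tau> b \<otimes>\<^bsub>A\<^esub> \<tau> e \<otimes>\<^bsub>A\<^esub> \<tau> m = ?k \<otimes>\<^bsub>A\<^esub> \<tau> e \<otimes>\<^bsub>A\<^esub> (\<tau> b \<otimes>\<^bsub>A\<^esub> \<tau> m)"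
      unfolding tau_homog_commute[OF x y b e] using kc ec bc m by (simp add: A.m_assoc)
    have "?l \<otimes>\<^bsub>A\<^esub> (\<tau> b \<otimes>\<^bsub>A\<^esub> \<tau> e) = \<tau> b \<otimes>\<^bsub>A\<^esub> (?l \<otimes>\<^bsub>A\<^esub> \<tau> e)"
      using tau_smult_one[of "c y x \<otimes>\<^bsub>K\<^esub> c y x"] tau_smult_one_right[of "c y x \<otimes>\<^bsub>K\<^esub> c y x"] x y bc ec kc
        A.m_assoc[of ?l "\<tau> b" "\<tau> e"] A.m_assoc[of "\<tau> b" ?l "\<tau> e"] by simp
    then show "\<tau> m \<otimes>\<^bsub>A\<^esub> \<tau> e \<otimes>\<^bsub>A\<^esub> \<tau> b = (\<tau> m \<otimes>\<^bsub>A\<^esub> \<tau> b) \<otimes>\<^bsub>A\<^esub> (?l \<otimes>\<^bsub>A\<^esub> \<tau> e)"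
      using tau_homog_commute[OF y x e b] kc ec bc m by (simp add: A.m_assoc)
  qed
  show "b \<in> Q \<or> m \<in> Q" if "b \<otimes> sg (c x) m \<in> Q"
  proof -
    have bm: "\<tau> b \<otimes>\<^bsub>A\<^esub> \<tau> m \<in> \<tau> ` Q" using that tau_mult_left[OF x b m] by simp
    have hom: "\<tau> b \<otimes>\<^bsub>A\<^esub> \<tau> e \<otimes>\<^bsub>A\<^esub> \<tau> m \<in> \<tau> ` Q" if "e \<in> carrier R" for e
      using that
    proof (induction e rule: graded_induct)
      case zero
      then show ?case using bc m I.zero_closed by (simp add: tau_zero)
    next
      case (homog y e)
      then show ?case unfolding comm(1)[OF homog] using bm x homog_closed[OF homog]
        by (intro I.I_l_closed[OF bm]) auto
    next
      case (add e e')
      then show ?case using bc m I.a_closed by (simp add: tau_add A.l_distr A.r_distr)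
    qed
    have "\<tau> b \<in> \<tau> ` Q \<or> \<tau> m \<in> \<tau> ` Q"
      using pr
    proof (rule A.prime_ideal_elementwise)
      fix y assume "y \<in> carrier A"
      then show "\<tau> b \<otimes>\<^bsub>A\<^esub> y \<otimes>\<^bsub>A\<^esub> \<tau> m \<in> \<tau> ` Q" using hom tau_surj by blast
    qed (use bc m in auto)
    then show ?thesis using tau_mem[OF sub] bc m by blast
  qed
  show "b \<in> Q \<or> m \<in> Q" if "b \<otimes> sg (\<lambda>z. c z x) m \<in> Q"
  proof -
    have mb: "\<tau> m \<otimes>\<^bsub>A\<^esub> \<tau> b \<in> \<tau> ` Q" using that tau_mult_right[OF x b m] by simp
    have hom: "\<tau> m \<otimes>\<^bsub>A\<^esub> \<tau> e \<otimes>\<^bsub>A\<^esub> \<tau> b \<in> \<tau> ` Q" if "e \<in> carrier R" for e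
      using that
    proof (induction e rule: graded_induct)
      case zero
      then show ?case using bc m I.zero_closed by (simp add: tau_zero)
    next
      case (homog y e)
      then show ?case unfolding comm(2)[OF homog] using mb x homog_closed[OF homog]
        by (intro I.I_r_closed[OF mb]) auto
    next
      case (add e e')
      then show ?case using bc m I.a_closed by (simp add: tau_add A.l_distr A.r_distr)
    qed
    have "\<tau> m \<in> \<tau> ` Q \<or> \<tau> b \<in> \<tau> ` Q"
      using pr
    proof (rule A.prime_ideal_elementwise)
      fix y assume "y \<in> carrier A"
      then show "\<tau> m \<otimes>\<^bsub>A\<^esub> y \<otimes>\<^bsub>A\<^esub> \<tau> b \<in> \<tau> ` Q" using hom tau_surj by blast
    qed (use bc m in auto)
    then show ?thesis using tau_mem[OF sub] bc m by blast
  qed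
qed

lemma tprime_homog_both:
  assumes Q: "tprime Q" and x: "x \<in> carrier G" and y: "y \<in> carrier G" and b: "b \<in> \<G> x" and d: "d \<in> \<G> y"
    and bd: "b \<otimes> d \<in> Q"
  shows "b \<in> Q \<or> d \<in> Q"
proof -
  have "b \<otimes> sg (c x) d = c x y \<odot> (b \<otimes> d)"
    using sg_homog[OF chars_kfun[OF c_left_char[OF x]] y d] homog_closed x y b d by (simp add: smult_mult_right)
  then have "b \<otimes> sg (c x) d \<in> Q"
    using subspaceD(4)[OF tideal_subspace[OF tprime_tideal[OF Q]] _ bd] x y by simp
  then show ?thesis using tprime_homog(1)[OF Q x b homog_closed[OF y d]] by blast
qed

end

section \<open>The ideal theory of one stratum\<close>

locale stratum_algebra = twisted_algebra R K G \<G> n r \<delta> c A \<tau>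
    for R :: "('k, 'r, 'd) module_scheme" (structure)
    and K :: "('k, 'l) ring_scheme"
    and G :: "('g, 'h) monoid_scheme"
    and \<G> :: "'g \<Rightarrow> 'r set"
    and n :: nat and r :: "nat \<Rightarrow> 'r" and \<delta> :: "nat \<Rightarrow> 'g"
    and c :: "'g \<Rightarrow> 'g \<Rightarrow> 'k" and A :: "('k, 'a, 'e) module_scheme" and \<tau> :: "'r \<Rightarrow> 'a" +
  fixes w :: "nat set"
  assumes w_subset: "w \<subseteq> {1..n}"
    and minus_one: "\<ominus>\<^bsub>K\<^esub> \<one>\<^bsub>K\<^esub> \<notin> generate (units_of K) {c x y | x y. x \<in> carrier G \<and> y \<in> carrier G}
        \<or> ring_char K = 2"
begin

abbreviation S :: "'g set" where "S \<equiv> stratum_group G n \<delta> w"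

abbreviation cr :: "'g \<Rightarrow> 'g \<Rightarrow> 'k" where "cr y \<equiv> (\<lambda>z. c z y)"

definition off :: "(nat \<Rightarrow> nat) set" where
  "off = {\<alpha> \<in> exps n. \<forall>i\<in>w. \<alpha> i = 0}"

definition E :: "'g \<Rightarrow> 'g \<Rightarrow> bool" where
  "E x y \<longleftrightarrow> (\<forall>z\<in>S. c x z = c y z)"

abbreviation part :: "'g \<Rightarrow> 'r \<Rightarrow> 'r" where
  "part x \<equiv> sg (ind (\<lambda>y. E y x))"

lemma S_subgroup: "subgroup S G"
  unfolding stratum_group_def using delta_closed by (intro G.generate_is_subgroup) auto

lemma S_closed: "x \<in> S \<Longrightarrow> x \<in> carrier G"
  using subgroup.subset[OF S_subgroup] by blast

lemma S_one: "\<one>\<^bsub>G\<^esub> \<in> S" and S_mult: "\<And>x y. x \<in> S \<Longrightarrow> y \<in> S \<Longrightarrow> x \<otimes>\<^bsub>G\<^esub> y \<in> S"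
  and S_inv: "\<And>x. x \<in> S \<Longrightarrow> inv\<^bsub>G\<^esub> x \<in> S"
  using S_subgroup subgroup.one_closed subgroup.m_closed subgroup.m_inv_closed by auto

lemma S_pow: "x \<in> S \<Longrightarrow> x [^]\<^bsub>G\<^esub> (k::nat) \<in> S"
  by (induction k) (auto simp: S_one S_mult)

lemma delta_S: "i \<in> {1..n} - w \<Longrightarrow> \<delta> i \<in> S"
  unfolding stratum_group_def by (intro generate.incl) blast

lemma off_exps: "\<alpha> \<in> off \<Longrightarrow> \<alpha> \<in> exps n"
  unfolding off_def by blast

lemma off_add: "\<alpha> \<in> off \<Longrightarrow> \<beta> \<in> off \<Longrightarrow> (\<lambda>i. \<alpha> i + \<beta> i) \<in> off"
  unfolding off_def using exps_add by auto

lemma off_zero: "(\<lambda>_. 0) \<in> off"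
  unfolding off_def using exps_zero by auto

lemma off_unit_exp: "i \<in> {1..n} - w \<Longrightarrow> unit_exp i \<in> off"
  unfolding off_def using unit_exp_exps by (auto simp: unit_exp_def)

lemma deg_S: assumes "\<alpha> \<in> off" shows "deg \<alpha> \<in> S"
proof -
  have "finprod G (\<lambda>i. \<delta> i [^]\<^bsub>G\<^esub> \<alpha> i) T \<in> S" if "finite T" "T \<subseteq> {1..n}" for T
    using that
  proof (induction T)
    case empty
    then show ?case using S_one by simp
  next
    case (insert i T)
    have i: "i \<in> {1..n}" using insert.prems by blast
    have "\<delta> i [^]\<^bsub>G\<^esub> \<alpha> i \<in> S"
    proof (cases "i \<in> w")
      case True
      then show ?thesis using assms S_one unfolding off_def by simp
    next
      case False
      then show ?thesis using i delta_S S_pow by blast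
    qed
    moreover have "finprod G (\<lambda>i. \<delta> i [^]\<^bsub>G\<^esub> \<alpha> i) (insert i T)
      = \<delta> i [^]\<^bsub>G\<^esub> \<alpha> i \<otimes>\<^bsub>G\<^esub> finprod G (\<lambda>i. \<delta> i [^]\<^bsub>G\<^esub> \<alpha> i) T"
      using insert delta_closed by (intro G.finprod_insert) auto
    ultimately show ?case using insert S_mult by simp
  qed
  then show ?thesis unfolding deg_def by simp
qed

text \<open>Monomials realise only a submonoid of G_w. Writing an element of G_w as a difference of
  two degrees of monomials reduces statements about G_w to multiplications by monomials on both
  sides.\<close>

lemma S_quotient:
  assumes "x \<in> S" shows "\<exists>\<alpha>\<in>off. \<exists>\<beta>\<in>off. x \<otimes>\<^bsub>G\<^esub> deg \<beta> = deg \<alpha>"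
  using assms unfolding stratum_group_def
proof (induction rule: generate.induct)
  case one
  have "\<one>\<^bsub>G\<^esub> \<otimes>\<^bsub>G\<^esub> deg (\<lambda>_. 0) = deg (\<lambda>_. 0)" by simp
  then show ?case using off_zero by blast
next
  case (incl h)
  then obtain i where i: "i \<in> {1..n} - w" "h = \<delta> i" by blast
  then have "h \<otimes>\<^bsub>G\<^esub> deg (\<lambda>_. 0) = deg (unit_exp i)" using deg_unit_exp[of i] delta_closed[of i] by (simp add: deg_zero)
  then show ?case using off_zero off_unit_exp[OF i(1)] by blast
next
  case (inv h)
  then obtain i where i: "i \<in> {1..n} - w" "h = \<delta> i" by blast
  then have "inv\<^bsub>G\<^esub> h \<otimes>\<^bsub>G\<^esub> deg (unit_exp i) = deg (\<lambda>_. 0)" using deg_unit_exp[of i] delta_closed[of i] by (simp add: deg_zero)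
  then show ?case using off_zero off_unit_exp[OF i(1)] by blast
next
  case (eng h1 h2)
  then obtain \<alpha>1 \<beta>1 \<alpha>2 \<beta>2 where o: "\<alpha>1 \<in> off" "\<beta>1 \<in> off" "\<alpha>2 \<in> off" "\<beta>2 \<in> off"
    and e: "h1 \<otimes>\<^bsub>G\<^esub> deg \<beta>1 = deg \<alpha>1" "h2 \<otimes>\<^bsub>G\<^esub> deg \<beta>2 = deg \<alpha>2" by blast
  have h: "h1 \<in> carrier G" "h2 \<in> carrier G"
    using eng.hyps S_closed unfolding stratum_group_def by auto
  have "h1 \<otimes>\<^bsub>G\<^esub> h2 \<otimes>\<^bsub>G\<^esub> deg (\<lambda>i. \<beta>1 i + \<beta>2 i) = (h1 \<otimes>\<^bsub>G\<^esub> deg \<beta>1) \<otimes>\<^bsub>G\<^esub> (h2 \<otimes>\<^bsub>G\<^esub> deg \<beta>2)"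
    using h by (simp add: deg_add G.m_ac)
  then have "h1 \<otimes>\<^bsub>G\<^esub> h2 \<otimes>\<^bsub>G\<^esub> deg (\<lambda>i. \<beta>1 i + \<beta>2 i) = deg (\<lambda>i. \<alpha>1 i + \<alpha>2 i)"
    unfolding e by (simp add: deg_add)
  then show ?case using off_add o by blast
qed

lemma E_refl: "E x x" unfolding E_def by simp
lemma E_sym: "E x y \<Longrightarrow> E y x" unfolding E_def by simp
lemma E_trans: "E x y \<Longrightarrow> E y z \<Longrightarrow> E x z" unfolding E_def by simp

lemma E_mult:
  assumes "x \<in> carrier G" "x' \<in> carrier G" "y \<in> carrier G" "y' \<in> carrier G" "E x x'" "E y y'"
  shows "E (x \<otimes>\<^bsub>G\<^esub> y) (x' \<otimes>\<^bsub>G\<^esub> y')"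
  unfolding E_def
proof
  fix z assume z: "z \<in> S"
  then have "c x z = c x' z" "c y z = c y' z" using assms(5,6) unfolding E_def by auto
  then show "c (x \<otimes>\<^bsub>G\<^esub> y) z = c (x' \<otimes>\<^bsub>G\<^esub> y') z" using assms S_closed[OF z] by (simp add: c_mult_left)
qed

lemma E_left: "x \<in> carrier G \<Longrightarrow> y \<in> carrier G \<Longrightarrow> z \<in> S \<Longrightarrow> E x y \<Longrightarrow> c z x = c z y"
  using c_inv[of x z] c_inv[of y z] S_closed[of z] unfolding E_def by simp

lemma kfun_cr: "y \<in> carrier G \<Longrightarrow> kfun (cr y)" by (rule chars_kfun[OF c_right_char])
lemma kfun_cl: "y \<in> carrier G \<Longrightarrow> kfun (c y)" by (rule chars_kfun[OF c_left_char])

lemma ring_char_two: "ring_char K = 2 \<Longrightarrow> \<one>\<^bsub>K\<^esub> \<oplus>\<^bsub>K\<^esub> \<one>\<^bsub>K\<^esub> = \<zero>\<^bsub>K\<^esub>"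
proof -
  assume *: "ring_char K = 2"
  have "\<one>\<^bsub>K\<^esub> [^]\<^bsub>add_monoid K\<^esub> group.ord (add_monoid K) \<one>\<^bsub>K\<^esub> = \<one>\<^bsub>add_monoid K\<^esub>"
    using group.pow_ord_eq_1[OF K.a_group, of "\<one>\<^bsub>K\<^esub>"] by simp
  then have "\<one>\<^bsub>K\<^esub> [^]\<^bsub>add_monoid K\<^esub> (2::nat) = \<zero>\<^bsub>K\<^esub>" using * unfolding ring_char_def by simp
  then show ?thesis by (simp add: numeral_2_eq_2 nat_pow_def)
qed

text \<open>The only use of the hypothesis on \<open>-1\<close>: the squares of the characters \<open>c(-, y)\<close> separate the
  same elements as the characters themselves.\<close>

lemma c_square_inj:
  assumes x: "x \<in> carrier G" and y: "y \<in> carrier G" and z: "z \<in> carrier G"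
    and sq: "c x z \<otimes>\<^bsub>K\<^esub> c x z = c y z \<otimes>\<^bsub>K\<^esub> c y z"
  shows "c x z = c y z"
proof -
  \<comment> \<open>The ratio t of the two values satisfies t^2 = 1, so t is 1 or -1, and t is
    itself a value of c. If t = -1, the hypothesis leaves only characteristic 2, where -1 =
    1.\<close>
  let ?t = "c (x \<otimes>\<^bsub>G\<^esub> inv\<^bsub>G\<^esub> y) z"
  have G: "x \<otimes>\<^bsub>G\<^esub> inv\<^bsub>G\<^esub> y \<in> carrier G" using x y by simp
  have t: "?t \<in> carrier K" using G z by simp
  have "c ((x \<otimes>\<^bsub>G\<^esub> inv\<^bsub>G\<^esub> y) \<otimes>\<^bsub>G\<^esub> y) z = ?t \<otimes>\<^bsub>K\<^esub> c y z" using G y z by (rule c_mult_left)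
  then have xz: "c x z = ?t \<otimes>\<^bsub>K\<^esub> c y z" using x y by (simp add: G.m_assoc)
  have yz: "c y z \<in> carrier K" "c y z \<noteq> \<zero>\<^bsub>K\<^esub>" using y z c_nonzero by auto
  have "(?t \<otimes>\<^bsub>K\<^esub> ?t) \<otimes>\<^bsub>K\<^esub> (c y z \<otimes>\<^bsub>K\<^esub> c y z) = \<one>\<^bsub>K\<^esub> \<otimes>\<^bsub>K\<^esub> (c y z \<otimes>\<^bsub>K\<^esub> c y z)"
    using sq t yz unfolding xz by (simp add: K.m_ac)
  then have tt: "?t \<otimes>\<^bsub>K\<^esub> ?t = \<one>\<^bsub>K\<^esub>"
    using K.m_rcancel[of "c y z \<otimes>\<^bsub>K\<^esub> c y z" "?t \<otimes>\<^bsub>K\<^esub> ?t" "\<one>\<^bsub>K\<^esub>"] t yz by (simp add: K.integral_iff)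
  have "(?t \<ominus>\<^bsub>K\<^esub> \<one>\<^bsub>K\<^esub>) \<otimes>\<^bsub>K\<^esub> (?t \<oplus>\<^bsub>K\<^esub> \<one>\<^bsub>K\<^esub>) = \<zero>\<^bsub>K\<^esub>"
  proof -
    have "(?t \<ominus>\<^bsub>K\<^esub> \<one>\<^bsub>K\<^esub>) \<otimes>\<^bsub>K\<^esub> (?t \<oplus>\<^bsub>K\<^esub> \<one>\<^bsub>K\<^esub>) = (?t \<otimes>\<^bsub>K\<^esub> ?t \<oplus>\<^bsub>K\<^esub> ?t) \<ominus>\<^bsub>K\<^esub> (\<one>\<^bsub>K\<^esub> \<oplus>\<^bsub>K\<^esub> ?t)"
      using t by (simp add: K.minus_eq K.l_distr K.r_distr K.minus_add K.l_minus K.a_ac)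
    also have "\<dots> = \<zero>\<^bsub>K\<^esub>" unfolding tt using t by (simp add: K.minus_eq K.r_neg)
    finally show ?thesis .
  qed
  then have "?t \<ominus>\<^bsub>K\<^esub> \<one>\<^bsub>K\<^esub> = \<zero>\<^bsub>K\<^esub> \<or> ?t \<oplus>\<^bsub>K\<^esub> \<one>\<^bsub>K\<^esub> = \<zero>\<^bsub>K\<^esub>" using t by (simp add: K.integral_iff)
  then have "?t = \<one>\<^bsub>K\<^esub>"
  proof
    assume "?t \<ominus>\<^bsub>K\<^esub> \<one>\<^bsub>K\<^esub> = \<zero>\<^bsub>K\<^esub>"
    then show ?thesis using K.cancel_simps(1)[of ?t "\<one>\<^bsub>K\<^esub>"] t by simp
  next
    assume "?t \<oplus>\<^bsub>K\<^esub> \<one>\<^bsub>K\<^esub> = \<zero>\<^bsub>K\<^esub>"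
    then have m: "\<ominus>\<^bsub>K\<^esub> \<one>\<^bsub>K\<^esub> = ?t" using t by (simp add: K.minus_equality)
    have "?t \<in> generate (units_of K) {c x y | x y. x \<in> carrier G \<and> y \<in> carrier G}"
      using G z by (intro generate.incl) blast
    then have "ring_char K = 2" using minus_one m by simp
    then have "\<one>\<^bsub>K\<^esub> \<oplus>\<^bsub>K\<^esub> \<one>\<^bsub>K\<^esub> = \<zero>\<^bsub>K\<^esub>" by (rule ring_char_two)
    then have "\<ominus>\<^bsub>K\<^esub> \<one>\<^bsub>K\<^esub> = \<one>\<^bsub>K\<^esub>" by (simp add: K.minus_equality)
    then show ?thesis using m by simp
  qed
  then show ?thesis using xz yz by simp
qed

lemma c_inv_right:
  assumes "x \<in> carrier G" "y \<in> carrier G" shows "c x (inv\<^bsub>G\<^esub> y) = c y x"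
proof -
  have "c x y \<otimes>\<^bsub>K\<^esub> c x (inv\<^bsub>G\<^esub> y) = \<one>\<^bsub>K\<^esub>"
    using assms c_mult_right[of x y "inv\<^bsub>G\<^esub> y"] c_one_right by simp
  then show ?thesis using c_skew[OF assms] assms c_nonzero[OF assms] K.m_lcancel[of "c x y" "c x (inv\<^bsub>G\<^esub> y)" "c y x"] by simp
qed

lemma c_eq_on_S:
  assumes x: "x \<in> carrier G" and y: "y \<in> carrier G" and eq: "\<And>\<alpha>. \<alpha> \<in> off \<Longrightarrow> c x (deg \<alpha>) = c y (deg \<alpha>)"
  shows "E x y"
  unfolding E_def
proof
  fix z assume z: "z \<in> S"
  then obtain \<alpha> \<beta> where ab: "\<alpha> \<in> off" "\<beta> \<in> off" "z \<otimes>\<^bsub>G\<^esub> deg \<beta> = deg \<alpha>" using S_quotient by blast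
  have zG: "z \<in> carrier G" using S_closed[OF z] .
  have "c x z \<otimes>\<^bsub>K\<^esub> c x (deg \<beta>) = c y z \<otimes>\<^bsub>K\<^esub> c x (deg \<beta>)"
    using c_mult_right[of x z "deg \<beta>"] c_mult_right[of y z "deg \<beta>"] eq[OF ab(1)] eq[OF ab(2)] ab(3) x y zG by simp
  then show "c x z = c y z"
    using K.m_rcancel[of "c x (deg \<beta>)" "c x z" "c y z"] x y zG c_nonzero by simp
qed

lemma part_elimination:
  assumes W: "subspace W" and m: "m \<in> carrier R" and mW: "\<And>y. y \<in> S \<Longrightarrow> sg (cr y) m \<in> W" and x: "x \<in> carrier G"
  shows "part x m \<in> W"
proof (rule character_elimination[where \<Xi> = "cr ` S" and ?h1.0 = "cr \<one>\<^bsub>G\<^esub>", OF W])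
  show "kfun h" if "h \<in> cr ` S" for h using that kfun_cr S_closed by blast
  show "cr \<one>\<^bsub>G\<^esub> \<in> cr ` S" using S_one by blast
  show "c y \<one>\<^bsub>G\<^esub> = \<one>\<^bsub>K\<^esub>" if "y \<in> carrier G" for y using c_one_right that by simp
  show "\<exists>h''\<in>cr ` S. \<forall>x\<in>carrier G. h'' x = h x \<otimes>\<^bsub>K\<^esub> h' x" if hh: "h \<in> cr ` S" "h' \<in> cr ` S" for h h'
  proof -
    obtain y y' where "y \<in> S" "y' \<in> S" "h = cr y" "h' = cr y'" using hh by blast
    then show ?thesis using S_mult S_closed c_mult_right by (intro bexI[of _ "cr (y \<otimes>\<^bsub>G\<^esub> y')"]) auto
  qed
  show "E u v" if "\<And>h. h \<in> cr ` S \<Longrightarrow> h u = h v" for u v using that unfolding E_def by blast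
  show "h u = h v" if "h \<in> cr ` S" "E u v" for u v h using that unfolding E_def by blast
qed (use m mW x in auto)

text \<open>The family of squares is indexed by monomials alone. That is a family closed under
  products, as \<open>character_elimination\<close> asks, and it separates the classes by
  \<open>c_square_inj\<close> together with \<open>c_eq_on_S\<close>.\<close>

lemma part_elimination_squares:
  assumes W: "subspace W" and m: "m \<in> carrier R"
    and mW: "\<And>\<alpha>. \<alpha> \<in> off \<Longrightarrow> sg (\<lambda>z. c z (deg \<alpha>) \<otimes>\<^bsub>K\<^esub> c z (deg \<alpha>)) m \<in> W" and x: "x \<in> carrier G"
  shows "part x m \<in> W"
proof -
  let ?h = "\<lambda>\<alpha> z. c z (deg \<alpha>) \<otimes>\<^bsub>K\<^esub> c z (deg \<alpha>)"
  show ?thesis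
  proof (rule character_elimination[where \<Xi> = "?h ` off" and ?h1.0 = "?h (\<lambda>_. 0)", OF W])
    show "kfun h" if "h \<in> ?h ` off" for h using that kfun_mult kfun_cr by auto
    show "?h (\<lambda>_. 0) \<in> ?h ` off" using off_zero by blast
    show "?h (\<lambda>_. 0) y = \<one>\<^bsub>K\<^esub>" if "y \<in> carrier G" for y using c_one_right that by (simp add: deg_zero)
    show "\<exists>h''\<in>?h ` off. \<forall>x\<in>carrier G. h'' x = h x \<otimes>\<^bsub>K\<^esub> h' x" if hh: "h \<in> ?h ` off" "h' \<in> ?h ` off" for h h'
    proof -
      obtain \<alpha> \<beta> where ab: "\<alpha> \<in> off" "\<beta> \<in> off" "h = ?h \<alpha>" "h' = ?h \<beta>" using hh by blast
      have "?h (\<lambda>i. \<alpha> i + \<beta> i) \<in> ?h ` off" using off_add[OF ab(1,2)] by blast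
      moreover have "\<forall>x\<in>carrier G. ?h (\<lambda>i. \<alpha> i + \<beta> i) x = ?h \<alpha> x \<otimes>\<^bsub>K\<^esub> ?h \<beta> x"
        by (simp add: deg_add c_mult_right K.m_ac)
      ultimately show ?thesis unfolding ab(3,4) by (intro bexI[where x = "?h (\<lambda>i. \<alpha> i + \<beta> i)"])
    qed
    show "E u v" if u: "u \<in> carrier G" and v: "v \<in> carrier G" and eq: "\<And>h. h \<in> ?h ` off \<Longrightarrow> h u = h v" for u v
    proof (rule c_eq_on_S[OF u v])
      fix \<alpha> assume "\<alpha> \<in> off"
      then have "?h \<alpha> u = ?h \<alpha> v" using eq by blast
      then show "c u (deg \<alpha>) = c v (deg \<alpha>)" using u v by (intro c_square_inj) auto
    qed
    show "h u = h v" if "h \<in> ?h ` off" "E u v" for u v h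
      using that deg_S unfolding E_def by auto
  qed (use m mW x in auto)
qed

lemma part_supp: "m \<in> carrier R \<Longrightarrow> supp (part x m) \<subseteq> {z \<in> supp m. E z x}"
  by (rule supp_sg_ind)

lemma part_reassembly:
  assumes W: "subspace W" and p: "kfun \<phi>" and pE: "\<And>x y. x \<in> carrier G \<Longrightarrow> y \<in> carrier G \<Longrightarrow> E x y \<Longrightarrow> \<phi> x = \<phi> y"
    and m: "m \<in> carrier R" and mW: "\<And>x. x \<in> carrier G \<Longrightarrow> part x m \<in> W"
  shows "sg \<phi> m \<in> W"
proof (rule class_reassembly[OF W p, of E])
  show "E y x" if "E x y" for x y using that by (rule E_sym)
  show "E x z" if "E x y" "E y z" for x y z using that by (rule E_trans)
  show "E x x" for x by (rule E_refl)
  show "\<phi> x = \<phi> y" if "x \<in> carrier G" "y \<in> carrier G" "E x y" for x y using that by (rule pE)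
  show "m \<in> carrier R" by (rule m)
  show "part x m \<in> W" if "x \<in> carrier G" for x using that by (rule mW)
qed

lemma parts_in_imp:
  assumes W: "subspace W" and m: "m \<in> carrier R" and mW: "\<And>x. x \<in> carrier G \<Longrightarrow> part x m \<in> W"
  shows "m \<in> W"
proof -
  have "sg (\<lambda>_. \<one>\<^bsub>K\<^esub>) m \<in> W" by (rule part_reassembly[OF W _ _ m mW]) (auto simp: kfun_def)
  then show ?thesis using sg_one[OF m] by simp
qed

lemma sg_class:
  assumes m: "m \<in> carrier R" and x: "x \<in> carrier G" and sup: "\<And>z. z \<in> supp m \<Longrightarrow> E z x" and y: "y \<in> S"
  shows "sg (cr y) m = c x y \<odot> m" "sg (c y) m = c y x \<odot> m"
proof -
  have yG: "y \<in> carrier G" using S_closed[OF y] .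
  show "sg (cr y) m = c x y \<odot> m"
    using x yG y sup by (intro sg_eq_smult[OF kfun_cr[OF yG] m]) (auto simp: E_def)
  show "sg (c y) m = c y x \<odot> m"
    using x yG y sup supp_subset[OF m] by (intro sg_eq_smult[OF kfun_cl[OF yG] m]) (auto intro!: E_left)
qed

lemma mon_off_or:
  assumes a: "\<alpha> \<in> exps n" "\<alpha> \<notin> off"
  shows "\<exists>i\<in>w. mon \<alpha> = mon (\<alpha>(i := \<alpha> i - 1)) \<otimes> r i"
proof -
  obtain i where i: "i \<in> w" "\<alpha> i \<noteq> 0" using a unfolding off_def by blast
  then have "i \<in> {1..n}" using w_subset by blast
  then show ?thesis using mon_factor i by blast
qed

text \<open>The homogeneous elements of degree outside \<open>G\<^sub>w\<close> are combinations of monomials involving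
  some \<open>r\<^sub>i\<close> with \<open>i \<in> w\<close>.\<close>

lemma outside_mem:
  assumes W: "subspace W" and mW: "\<And>\<alpha>. \<alpha> \<in> exps n \<Longrightarrow> \<alpha> \<notin> off \<Longrightarrow> mon \<alpha> \<in> W"
    and x: "x \<in> carrier G" "x \<notin> S" and a: "a \<in> \<G> x"
  shows "a \<in> W"
  using deg_S x(2) by (intro homogeneous_monomials_span[OF W x(1) a] mW) auto

lemma outside_supp_mem:
  assumes W: "subspace W" and out: "\<And>x a. x \<in> carrier G \<Longrightarrow> x \<notin> S \<Longrightarrow> a \<in> \<G> x \<Longrightarrow> a \<in> W"
    and m: "m \<in> carrier R" and sup: "\<And>x. x \<in> supp m \<Longrightarrow> x \<notin> S"
  shows "m \<in> W"
  using out sup supp_subset[OF m] cmp_in[OF m] by (intro subspace_cmps[OF W m]) blast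

text \<open>For a degree z of a inside G_w, multiplication in \<open>A\<close> rescales all of b by
  the single scalar c(z, y) = c(x, y). Components of a with degree outside G_w lie in W and
  contribute elements of W to both sides. The element p represents the product of \<open>A\<close>
  inside \<open>R\<close>.\<close>

lemma class_product:
  assumes W: "ideal W R" and out: "\<And>x a. x \<in> carrier G \<Longrightarrow> x \<notin> S \<Longrightarrow> a \<in> \<G> x \<Longrightarrow> a \<in> W"
    and a: "a \<in> carrier R" "\<And>z. z \<in> supp a \<Longrightarrow> E z x" and b: "b \<in> carrier R" "\<And>z. z \<in> supp b \<Longrightarrow> E z y"
    and x: "x \<in> carrier G" and y: "y \<in> S"
  shows "\<exists>p\<in>carrier R. \<tau> p = \<tau> a \<otimes>\<^bsub>A\<^esub> \<tau> b \<and> p \<ominus> c x y \<odot> (a \<otimes> b) \<in> W"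
proof -
  have Ws: "subspace W" using W by (rule ideal_subspace)
  interpret W: ideal W R by (rule W)
  have yG: "y \<in> carrier G" using S_closed[OF y] .
  have k: "c x y \<in> carrier K" using x yG by simp
  let ?U = "{a \<in> carrier R. \<exists>p\<in>carrier R. \<tau> p = \<tau> a \<otimes>\<^bsub>A\<^esub> \<tau> b \<and> p \<ominus> c x y \<odot> (a \<otimes> b) \<in> W}"
  have U: "subspace ?U"
    unfolding subspace_def
  proof (intro conjI ballI)
    show "\<zero> \<in> ?U"
      using b(1) k subspaceD(2)[OF Ws] by (auto intro!: bexI[of _ \<zero>] simp: tau_zero Alg.smult_r_null R.minus_eq)
    show "a \<oplus> a' \<in> ?U" if aa: "a \<in> ?U" "a' \<in> ?U" for a a'
    proof -
      obtain p p' where p: "p \<in> carrier R" "\<tau> p = \<tau> a \<otimes>\<^bsub>A\<^esub> \<tau> b" "p \<ominus> c x y \<odot> (a \<otimes> b) \<in> W"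
        "p' \<in> carrier R" "\<tau> p' = \<tau> a' \<otimes>\<^bsub>A\<^esub> \<tau> b" "p' \<ominus> c x y \<odot> (a' \<otimes> b) \<in> W" using aa by blast
      have ac: "a \<in> carrier R" "a' \<in> carrier R" using aa by auto
      have "(p \<oplus> p') \<ominus> c x y \<odot> ((a \<oplus> a') \<otimes> b) = (p \<ominus> c x y \<odot> (a \<otimes> b)) \<oplus> (p' \<ominus> c x y \<odot> (a' \<otimes> b))"
        using p ac b(1) k by (simp add: R.l_distr Alg.smult_r_distr R.minus_eq R.minus_add R.a_ac)
      then have "(p \<oplus> p') \<ominus> c x y \<odot> ((a \<oplus> a') \<otimes> b) \<in> W" using subspaceD(3)[OF Ws p(3,6)] by simp
      moreover have "\<tau> (p \<oplus> p') = \<tau> (a \<oplus> a') \<otimes>\<^bsub>A\<^esub> \<tau> b" using p ac b(1) by (simp add: tau_add A.l_distr)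
      ultimately show ?thesis using p ac by blast
    qed
    show "k' \<odot> a \<in> ?U" if k': "k' \<in> carrier K" and aa: "a \<in> ?U" for k' a
    proof -
      obtain p where p: "p \<in> carrier R" "\<tau> p = \<tau> a \<otimes>\<^bsub>A\<^esub> \<tau> b" "p \<ominus> c x y \<odot> (a \<otimes> b) \<in> W" using aa by blast
      have ac: "a \<in> carrier R" using aa by auto
      have "k' \<odot> (p \<ominus> c x y \<odot> (a \<otimes> b)) = k' \<odot> p \<ominus> c x y \<odot> ((k' \<odot> a) \<otimes> b)"
        using p(1) ac b(1) k k' smult_comm[of k' "c x y" "a \<otimes> b"]
        by (simp add: R.minus_eq Alg.smult_r_distr Alg.smult_r_minus Alg.smult_assoc2)
      then have "k' \<odot> p \<ominus> c x y \<odot> ((k' \<odot> a) \<otimes> b) \<in> W" using subspaceD(4)[OF Ws k' p(3)] by simp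
      moreover have "\<tau> (k' \<odot> p) = \<tau> (k' \<odot> a) \<otimes>\<^bsub>A\<^esub> \<tau> b"
      proof -
        have "\<tau> (k' \<odot> p) = \<tau> (k' \<odot> \<one>) \<otimes>\<^bsub>A\<^esub> \<tau> p" using tau_smult_one[OF k' p(1)] by simp
        also have "\<dots> = (\<tau> (k' \<odot> \<one>) \<otimes>\<^bsub>A\<^esub> \<tau> a) \<otimes>\<^bsub>A\<^esub> \<tau> b"
          unfolding p(2) using k' ac b(1) by (simp add: A.m_assoc)
        finally show ?thesis using tau_smult_one[OF k' ac] by simp
      qed
      ultimately show ?thesis using p ac k' by auto
    qed
  qed auto
  have "cmp a z \<in> ?U" if z: "z \<in> supp a" for z
  proof -
    have zG: "z \<in> carrier G" using z supp_subset[OF a(1)] by blast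
    have az: "cmp a z \<in> \<G> z" "cmp a z \<in> carrier R" using cmp_in[OF a(1) zG] a(1) by auto
    have t: "\<tau> (cmp a z) \<otimes>\<^bsub>A\<^esub> \<tau> b = \<tau> (cmp a z \<otimes> sg (c z) b)" using tau_mult_left[OF zG az(1) b(1)] .
    have pc: "cmp a z \<otimes> sg (c z) b \<in> carrier R" using az b(1) kfun_cl[OF zG] by simp
    show ?thesis
    proof (cases "z \<in> S")
      case True
      have "c z y = c x y" using a(2)[OF z] y unfolding E_def by blast
      then have "cmp a z \<otimes> sg (c z) b = c x y \<odot> (cmp a z \<otimes> b)"
        using sg_class(2)[OF b(1) yG b(2) True] az b(1) k by (simp add: smult_mult_right)
      then have "cmp a z \<otimes> sg (c z) b \<ominus> c x y \<odot> (cmp a z \<otimes> b) = \<zero>"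
        using az b(1) k by (simp add: R.minus_eq R.r_neg)
      then show ?thesis using t pc az subspaceD(2)[OF Ws] by auto
    next
      case False
      have "cmp a z \<in> W" using out[OF zG False az(1)] .
      then have "cmp a z \<otimes> sg (c z) b \<in> W" "cmp a z \<otimes> b \<in> W"
        using W.I_r_closed[of "cmp a z"] kfun_cl[OF zG] b(1) by simp_all
      then have "cmp a z \<otimes> sg (c z) b \<ominus> c x y \<odot> (cmp a z \<otimes> b) \<in> W"
        using subspaceD(4)[OF Ws k] by (intro subspace_minus[OF Ws])
      then show ?thesis using t pc az by auto
    qed
  qed
  then have "a \<in> ?U" by (rule subspace_cmps[OF U a(1)])
  then show ?thesis by blast
qed

text \<open>The characters c(j, -) and c(-, j) with j in G_w act on p as scalars, so the computation
  for two homogeneous elements carries over unchanged.\<close>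

lemma class_commute:
  assumes p: "p \<in> carrier R" and x: "x \<in> carrier G" and sup: "\<And>z. z \<in> supp p \<Longrightarrow> E z x"
    and j: "j \<in> S" and b: "b \<in> \<G> j"
  shows "\<tau> p \<otimes>\<^bsub>A\<^esub> \<tau> b = \<tau> ((c x j \<otimes>\<^bsub>K\<^esub> c x j) \<odot> \<one>) \<otimes>\<^bsub>A\<^esub> (\<tau> b \<otimes>\<^bsub>A\<^esub> \<tau> p)"
proof -
  have jG: "j \<in> carrier G" using S_closed[OF j] .
  have bc: "b \<in> carrier R" using homog_closed[OF jG b] .
  have k: "c x j \<otimes>\<^bsub>K\<^esub> c x j \<in> carrier K" using x jG by simp
  have 1: "sg (cr j) p = c x j \<odot> p" using p x sup j by (rule sg_class(1))
  have 2: "sg (c j) p = c j x \<odot> p" using p x sup j by (rule sg_class(2))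
  have "\<tau> p \<otimes>\<^bsub>A\<^esub> \<tau> b = \<tau> (c x j \<odot> (b \<otimes> p))"
    unfolding tau_mult_right[OF jG b p] 1 using bc p x jG by (simp add: smult_mult_right)
  moreover have "\<tau> b \<otimes>\<^bsub>A\<^esub> \<tau> p = \<tau> (c j x \<odot> (b \<otimes> p))"
    unfolding tau_mult_left[OF jG b p] 2 using bc p x jG by (simp add: smult_mult_right)
  moreover have "(c x j \<otimes>\<^bsub>K\<^esub> c x j) \<odot> (c j x \<odot> (b \<otimes> p)) = c x j \<odot> (b \<otimes> p)"
  proof -
    have "(c x j \<otimes>\<^bsub>K\<^esub> c x j) \<otimes>\<^bsub>K\<^esub> c j x = c x j" using c_skew[OF x jG] x jG by (simp add: K.m_assoc)
    then show ?thesis using Alg.smult_assoc1[of "c x j \<otimes>\<^bsub>K\<^esub> c x j" "c j x" "b \<otimes> p"] k x jG bc p by simp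
  qed
  ultimately show ?thesis
    using tau_smult_one[OF k, of "c j x \<odot> (b \<otimes> p)"] x jG bc p by simp
qed

text \<open>For a monomial of degree d, multiplying m by it on the right in \<open>A\<close> equals
  multiplying by it on the left after m has been rescaled by c(-, d)^2. So all these rescalings of m
  belong to the subspace of elements that some monomial carries into I, and elimination by squares
  isolates one class. The monomial stays as a denominator.\<close>

lemma localized_part:
  assumes I: "tideal I" and m: "m \<in> I" and x: "x \<in> carrier G"
  shows "\<exists>\<alpha>\<in>off. mon \<alpha> \<otimes> sg (c (deg \<alpha>)) (part x m) \<in> I"
proof -
  note Is = tideal_subspace[OF I]
  have mc: "m \<in> carrier R" using m subspaceD(1)[OF Is] by blast
  \<comment> \<open>Common denominators: a monomial that works may be multiplied by any further one,
    so two elements can share the exponent \<alpha> + \<beta>.\<close>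
  have enlarge: "mon (\<lambda>i. \<alpha> i + \<beta> i) \<otimes> sg (c (deg (\<lambda>i. \<alpha> i + \<beta> i))) m \<in> I"
    if mI: "mon \<alpha> \<otimes> sg (c (deg \<alpha>)) m \<in> I" and mc: "m \<in> carrier R" for \<alpha> \<beta> m
  proof -
    have kf: "kfun (c (deg \<beta>))" "kfun (c (deg \<alpha>))" using kfun_cl by auto
    have mm: "mon \<beta> \<otimes> sg (c (deg \<beta>)) (mon \<alpha> \<otimes> sg (c (deg \<alpha>)) m) \<in> I"
      by (rule tideal_mult(1)[OF I deg_closed mon_homog mI])
    have "sg (c (deg \<beta>)) (mon \<alpha> \<otimes> sg (c (deg \<alpha>)) m) = c (deg \<beta>) (deg \<alpha>) \<odot> (mon \<alpha> \<otimes> sg (c (deg \<beta>)) (sg (c (deg \<alpha>)) m))"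
      using kf mc by (intro sg_char_mult_homog[OF c_left_char deg_closed mon_homog]) auto
    also have "sg (c (deg \<beta>)) (sg (c (deg \<alpha>)) m) = sg (\<lambda>z. c (deg \<beta>) z \<otimes>\<^bsub>K\<^esub> c (deg \<alpha>) z) m"
      using kf mc by (rule sg_sg)
    also have "\<dots> = sg (c (deg (\<lambda>i. \<alpha> i + \<beta> i))) m"
      using kf mc supp_subset[OF mc] by (intro sg_cong kfun_mult kfun_cl) (auto simp: deg_add c_mult_left K.m_comm)
    finally have "c (deg \<beta>) (deg \<alpha>) \<odot> (mon (\<lambda>i. \<alpha> i + \<beta> i) \<otimes> sg (c (deg (\<lambda>i. \<alpha> i + \<beta> i))) m) \<in> I"
      using mm mc kfun_cl[OF deg_closed] by (simp add: smult_mult_right mon_add R.m_ac)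
    moreover have "mon (\<lambda>i. \<alpha> i + \<beta> i) \<otimes> sg (c (deg (\<lambda>i. \<alpha> i + \<beta> i))) m \<in> carrier R"
      using mc kfun_cl[OF deg_closed] by simp
    moreover have "c (deg \<beta>) (deg \<alpha>) \<in> carrier K" "c (deg \<beta>) (deg \<alpha>) \<noteq> \<zero>\<^bsub>K\<^esub>" using c_nonzero by auto
    ultimately show ?thesis using subspace_cancel[OF Is] by blast
  qed
  let ?W = "{m \<in> carrier R. \<exists>\<alpha>\<in>off. mon \<alpha> \<otimes> sg (c (deg \<alpha>)) m \<in> I}"
  have W: "subspace ?W"
    unfolding subspace_def
  proof (intro conjI ballI)
    show "\<zero> \<in> ?W" using off_zero kfun_cl[OF deg_closed] subspaceD(2)[OF Is] by (auto simp: sg_zero)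
    show "a \<oplus> b \<in> ?W" if ab: "a \<in> ?W" "b \<in> ?W" for a b
    proof -
      obtain \<alpha> \<beta> where o: "\<alpha> \<in> off" "\<beta> \<in> off" and c: "a \<in> carrier R" "b \<in> carrier R"
        and i: "mon \<alpha> \<otimes> sg (c (deg \<alpha>)) a \<in> I" "mon \<beta> \<otimes> sg (c (deg \<beta>)) b \<in> I" using ab by blast
      let ?g = "\<lambda>i. \<alpha> i + \<beta> i"
      have "mon ?g \<otimes> sg (c (deg ?g)) a \<in> I" "mon ?g \<otimes> sg (c (deg ?g)) b \<in> I"
        using enlarge[OF i(1) c(1), of \<beta>] enlarge[OF i(2) c(2), of \<alpha>] by (simp_all add: add.commute)
      then have "mon ?g \<otimes> sg (c (deg ?g)) (a \<oplus> b) \<in> I"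
        using subspaceD(3)[OF Is] c kfun_cl[OF deg_closed] by (simp add: sg_add R.r_distr)
      then show ?thesis using off_add[OF o] c by blast
    qed
    show "k \<odot> a \<in> ?W" if k: "k \<in> carrier K" and a: "a \<in> ?W" for k a
    proof -
      obtain \<alpha> where o: "\<alpha> \<in> off" and c: "a \<in> carrier R" and i: "mon \<alpha> \<otimes> sg (c (deg \<alpha>)) a \<in> I" using a by blast
      have "mon \<alpha> \<otimes> sg (c (deg \<alpha>)) (k \<odot> a) \<in> I"
        using subspaceD(4)[OF Is k i] c k kfun_cl[OF deg_closed] by (simp add: sg_smult smult_mult_right)
      then show ?thesis using o c k by auto
    qed
  qed auto
  have "part x m \<in> ?W"
  proof (rule part_elimination_squares[OF W mc _ x])
    fix \<alpha> assume o: "\<alpha> \<in> off"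
    have kf: "kfun (c (deg \<alpha>))" "kfun (cr (deg \<alpha>))" "kfun (\<lambda>z. c z (deg \<alpha>) \<otimes>\<^bsub>K\<^esub> c z (deg \<alpha>))"
      using kfun_cl kfun_cr kfun_mult[OF kfun_cr kfun_cr] by auto
    have "sg (c (deg \<alpha>)) (sg (\<lambda>z. c z (deg \<alpha>) \<otimes>\<^bsub>K\<^esub> c z (deg \<alpha>)) m)
      = sg (\<lambda>z. c (deg \<alpha>) z \<otimes>\<^bsub>K\<^esub> (c z (deg \<alpha>) \<otimes>\<^bsub>K\<^esub> c z (deg \<alpha>))) m"
      using kf(1,3) mc by (rule sg_sg)
    also have "\<dots> = sg (cr (deg \<alpha>)) m"
    proof (rule sg_cong[OF kfun_mult[OF kf(1,3)] kf(2) mc])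
      fix z assume "z \<in> supp m"
      then have z: "z \<in> carrier G" using supp_subset[OF mc] by blast
      show "c (deg \<alpha>) z \<otimes>\<^bsub>K\<^esub> (c z (deg \<alpha>) \<otimes>\<^bsub>K\<^esub> c z (deg \<alpha>)) = c z (deg \<alpha>)"
        using c_skew[OF deg_closed z] z by (simp flip: K.m_assoc)
    qed
    finally have "mon \<alpha> \<otimes> sg (c (deg \<alpha>)) (sg (\<lambda>z. c z (deg \<alpha>) \<otimes>\<^bsub>K\<^esub> c z (deg \<alpha>)) m) \<in> I"
      using tideal_mult(2)[OF I deg_closed mon_homog m] by simp
    then show "sg (\<lambda>z. c z (deg \<alpha>) \<otimes>\<^bsub>K\<^esub> c z (deg \<alpha>)) m \<in> ?W" using o mc kf(3) by auto
  qed
  then show ?thesis by blast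
qed

end

context stratum_algebra
begin

subsection \<open>From primes of \<open>R\<close> to primes of the twist\<close>

text \<open>The intersection of the translates of P by the characters c(y, -) with y in G_w. They
  form only part of rad(c_w)^perp, but give the same intersection
  (\<open>core_eq_char_core\<close>), and they are the characters that occur in products of
  \<open>A\<close>.\<close>

definition core :: "'r set \<Rightarrow> 'r set" where
  "core P = {m \<in> carrier R. \<forall>y\<in>S. sg (cr y) m \<in> P}"

text \<open>Stated for any set that is prime with respect to homogeneous factors, so that it serves
  primes of \<open>R\<close> and primes of \<open>A\<close> alike.\<close>

lemma mon_notin:
  assumes one: "\<one> \<notin> Q"
    and pr: "\<And>x y b d. x \<in> carrier G \<Longrightarrow> y \<in> carrier G \<Longrightarrow> b \<in> \<G> x \<Longrightarrow> d \<in> \<G> y \<Longrightarrow> b \<otimes> d \<in> Q \<Longrightarrow> b \<in> Q \<or> d \<in> Q"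
    and ri: "\<And>i. i \<in> {1..n} - w \<Longrightarrow> r i \<notin> Q" and a: "\<alpha> \<in> off"
  shows "mon \<alpha> \<notin> Q"
  using a
proof (induction "\<Sum>i\<in>{1..n}. \<alpha> i" arbitrary: \<alpha> rule: less_induct)
  case less
  show ?case
  proof (cases "\<alpha> = (\<lambda>_. 0)")
    case True
    then show ?thesis using one mon_zero by simp
  next
    case False
    then obtain i where i0: "\<alpha> i \<noteq> 0" by blast
    then have i: "i \<in> {1..n}" using exps_support off_exps less.prems by blast
    have iw: "i \<notin> w" using i0 less.prems unfolding off_def by auto
    let ?\<beta> = "\<alpha>(i := \<alpha> i - 1)"
    have b: "?\<beta> \<in> off" using less.prems iw unfolding off_def exps_def by auto
    have "(\<Sum>j\<in>{1..n}. ?\<beta> j) < (\<Sum>j\<in>{1..n}. \<alpha> j)"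
      using i i0 by (intro sum_strict_mono_ex1) auto
    then have "mon ?\<beta> \<notin> Q" using less.hyps b by blast
    moreover have "r i \<notin> Q" using ri i iw by blast
    ultimately have "mon ?\<beta> \<otimes> r i \<notin> Q"
      using pr[OF deg_closed delta_closed[OF i] mon_homog r_homog[OF i]] by blast
    then show ?thesis using mon_factor[of i \<alpha>, OF i i0] by simp
  qed
qed

text \<open>The characters c(y, -) and c(-, y) are inverse to each other because c is
  alternating.\<close>

lemma sg_cl_cr: "y \<in> carrier G \<Longrightarrow> m \<in> carrier R \<Longrightarrow> sg (c y) (sg (cr y) m) = m"
proof -
  assume y: "y \<in> carrier G" and m: "m \<in> carrier R"
  have "sg (c y) (sg (cr y) m) = sg (\<lambda>z. c y z \<otimes>\<^bsub>K\<^esub> c z y) m"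
    using kfun_cl[OF y] kfun_cr[OF y] m by (rule sg_sg)
  also have "\<dots> = \<one>\<^bsub>K\<^esub> \<odot> m"
    using c_skew[OF y] supp_subset[OF m] by (intro sg_eq_smult kfun_mult kfun_cl kfun_cr y m) auto
  finally show ?thesis using m by simp
qed

lemma sg_cl: "x \<in> carrier G \<Longrightarrow> m \<in> carrier R \<Longrightarrow> sg (c x) m = sg (cr (inv\<^bsub>G\<^esub> x)) m"
  using supp_subset[of m] by (intro sg_cong kfun_cl kfun_cr) (auto simp: c_inv_right)

lemma sg_cr_cr: "x \<in> carrier G \<Longrightarrow> y \<in> carrier G \<Longrightarrow> m \<in> carrier R \<Longrightarrow> sg (cr y) (sg (cr x) m) = sg (cr (y \<otimes>\<^bsub>G\<^esub> x)) m"
proof -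
  assume a: "x \<in> carrier G" "y \<in> carrier G" "m \<in> carrier R"
  have "sg (cr y) (sg (cr x) m) = sg (\<lambda>z. c z y \<otimes>\<^bsub>K\<^esub> c z x) m" using a by (intro sg_sg kfun_cr)
  also have "\<dots> = sg (cr (y \<otimes>\<^bsub>G\<^esub> x)) m"
    using a supp_subset[OF a(3)] by (intro sg_cong kfun_mult kfun_cr) (auto simp: c_mult_right)
  finally show ?thesis .
qed

context
  fixes P assumes P: "P \<in> spec_stratum R n r w"
begin

lemma stratum_prime: "primeideal P R"
  using P unfolding spec_stratum_def R.spec_commutative by simp

lemma stratum_ideal: "ideal P R"
  using stratum_prime by (rule primeideal.axioms(1))

lemma stratum_subspace: "subspace P"
  using stratum_ideal by (rule ideal_subspace)

lemma stratum_subset: "P \<subseteq> carrier R"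
  using subspaceD(1)[OF stratum_subspace] .

lemma stratum_primeD: "a \<in> carrier R \<Longrightarrow> b \<in> carrier R \<Longrightarrow> a \<otimes> b \<in> P \<Longrightarrow> a \<in> P \<or> b \<in> P"
  using primeideal.I_prime[OF stratum_prime] .

lemma stratum_one: "\<one> \<notin> P"
  using primeideal.I_notcarr[OF stratum_prime] ideal.one_imp_carrier[OF stratum_ideal] by blast

lemma stratum_r: "i \<in> {1..n} \<Longrightarrow> r i \<in> P \<longleftrightarrow> i \<in> w"
  using P unfolding spec_stratum_def by blast

lemma stratum_mult: "a \<in> P \<Longrightarrow> b \<in> carrier R \<Longrightarrow> a \<otimes> b \<in> P" "a \<in> P \<Longrightarrow> b \<in> carrier R \<Longrightarrow> b \<otimes> a \<in> P"
  using ideal.I_r_closed[OF stratum_ideal] ideal.I_l_closed[OF stratum_ideal] by auto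

lemma stratum_mon: "\<alpha> \<in> off \<Longrightarrow> mon \<alpha> \<notin> P"
  by (rule mon_notin) (use stratum_one stratum_primeD homog_closed stratum_r in auto)

lemma stratum_mon_in:
  assumes "\<alpha> \<in> exps n" "\<alpha> \<notin> off" shows "mon \<alpha> \<in> P"
proof -
  obtain i where i: "i \<in> w" "mon \<alpha> = mon (\<alpha>(i := \<alpha> i - 1)) \<otimes> r i" using mon_off_or[OF assms] by blast
  have "r i \<in> P" using i(1) w_subset stratum_r by blast
  then show ?thesis unfolding i(2) by (intro stratum_mult(2)) auto
qed

lemma stratum_outside: "x \<in> carrier G \<Longrightarrow> x \<notin> S \<Longrightarrow> a \<in> \<G> x \<Longrightarrow> a \<in> P"
  by (rule outside_mem[OF stratum_subspace stratum_mon_in])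

lemma stratum_outside_supp: "m \<in> carrier R \<Longrightarrow> (\<And>x. x \<in> supp m \<Longrightarrow> x \<notin> S) \<Longrightarrow> m \<in> P"
  by (rule outside_supp_mem[OF stratum_subspace stratum_outside])

lemma core_carrier: "core P \<subseteq> carrier R"
  unfolding core_def by blast

lemma core_subset: "core P \<subseteq> P"
proof
  fix m assume m: "m \<in> core P"
  then have mc: "m \<in> carrier R" unfolding core_def by blast
  have "sg (cr \<one>\<^bsub>G\<^esub>) m = \<one>\<^bsub>K\<^esub> \<odot> m"
    using mc supp_subset[OF mc] c_one_right by (intro sg_eq_smult kfun_cr) auto
  then have "sg (cr \<one>\<^bsub>G\<^esub>) m = m" using mc by simp
  moreover have "sg (cr \<one>\<^bsub>G\<^esub>) m \<in> P" using m S_one unfolding core_def by blast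
  ultimately show "m \<in> P" by simp
qed

lemma core_subspace: "subspace (core P)"
  unfolding subspace_def core_def
  using subspaceD(2,3,4)[OF stratum_subspace] kfun_cr S_closed by (auto simp: sg_zero sg_add sg_smult)

lemma core_part: "m \<in> core P \<Longrightarrow> x \<in> carrier G \<Longrightarrow> part x m \<in> P"
  unfolding core_def by (intro part_elimination stratum_subspace) auto

text \<open>On a single class every character c(-, y) with y in G_w is a scalar, so membership in P
  is not affected by it.\<close>

lemma class_core:
  assumes m: "m \<in> P" and x: "x \<in> carrier G" and sup: "\<And>z. z \<in> supp m \<Longrightarrow> E z x"
  shows "m \<in> core P"
  unfolding core_def
proof (intro CollectI conjI ballI)
  show mc: "m \<in> carrier R" using m stratum_subset by blast
  fix y assume y: "y \<in> S"
  have "sg (cr y) m = c x y \<odot> m" using mc x sup y by (rule sg_class(1))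
  then show "sg (cr y) m \<in> P"
    using m x S_closed[OF y] subspaceD(4)[OF stratum_subspace, of "c x y" m] by simp
qed

lemma core_part_core: "m \<in> core P \<Longrightarrow> x \<in> carrier G \<Longrightarrow> part x m \<in> core P"
  using core_part part_supp[of m x] core_carrier by (intro class_core) auto

lemma parts_core: "m \<in> carrier R \<Longrightarrow> (\<And>x. x \<in> carrier G \<Longrightarrow> part x m \<in> P) \<Longrightarrow> m \<in> core P"
proof -
  assume m: "m \<in> carrier R" and mP: "\<And>x. x \<in> carrier G \<Longrightarrow> part x m \<in> P"
  show "m \<in> core P"
  proof (rule parts_in_imp[OF core_subspace m])
    fix x assume x: "x \<in> carrier G"
    show "part x m \<in> core P" using part_supp[OF m, of x] by (intro class_core[OF mP[OF x] x]) blast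
  qed
qed

text \<open>Multiplication in \<open>A\<close> by a homogeneous b of degree x translates the index y
  of the character by x or by its inverse. For x in G_w the index remains in G_w; otherwise b itself
  lies in P.\<close>

lemma core_tideal: "tideal (core P)"
proof (rule tidealI[OF core_subspace])
  \<comment> \<open>Right multiplication is the case x' = x and left multiplication the case where
    x' is the inverse of x, since c(x, -) = c(-, inverse of x).\<close>
  have *: "b \<otimes> sg (cr x') m \<in> core P"
    if x: "x \<in> carrier G" and b: "b \<in> \<G> x" and m: "m \<in> core P" and x': "x' \<in> carrier G" "x \<in> S \<Longrightarrow> x' \<in> S" for x x' b m
    unfolding core_def
  proof (intro CollectI conjI ballI)
    have bc: "b \<in> carrier R" and mc: "m \<in> carrier R" using homog_closed[OF x b] m core_carrier by auto
    show "b \<otimes> sg (cr x') m \<in> carrier R" using bc mc kfun_cr[OF x'(1)] by simp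
    fix y assume y: "y \<in> S"
    have yG: "y \<in> carrier G" using S_closed[OF y] .
    have "sg (cr y) (b \<otimes> sg (cr x') m) = c x y \<odot> (b \<otimes> sg (cr y) (sg (cr x') m))"
      using mc kfun_cr[OF x'(1)] by (intro sg_char_mult_homog[OF c_right_char[OF yG] x b]) auto
    also have "sg (cr y) (sg (cr x') m) = sg (cr (y \<otimes>\<^bsub>G\<^esub> x')) m" using x'(1) yG mc by (rule sg_cr_cr)
    finally have eq: "sg (cr y) (b \<otimes> sg (cr x') m) = c x y \<odot> (b \<otimes> sg (cr (y \<otimes>\<^bsub>G\<^esub> x')) m)" .
    have "b \<otimes> sg (cr (y \<otimes>\<^bsub>G\<^esub> x')) m \<in> P"
    proof (cases "x \<in> S")
      case True
      then have "sg (cr (y \<otimes>\<^bsub>G\<^esub> x')) m \<in> P" using m S_mult[OF y x'(2)] unfolding core_def by blast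
      then show ?thesis using bc by (intro stratum_mult(2)) auto
    next
      case False
      then have "b \<in> P" using stratum_outside[OF x] b by blast
      then show ?thesis using mc kfun_cr[of "y \<otimes>\<^bsub>G\<^esub> x'"] yG x'(1) by (intro stratum_mult(1)) auto
    qed
    then show "sg (cr y) (b \<otimes> sg (cr x') m) \<in> P"
      unfolding eq using x yG by (intro subspaceD(4)[OF stratum_subspace]) auto
  qed
  fix x b m assume x: "x \<in> carrier G" and b: "b \<in> \<G> x" and m: "m \<in> core P"
  have mc: "m \<in> carrier R" using m core_carrier by auto
  show "b \<otimes> sg (cr x) m \<in> core P" using *[OF x b m x] by blast
  show "b \<otimes> sg (c x) m \<in> core P"
    unfolding sg_cl[OF x mc] using x S_inv by (intro *[OF x b m]) auto
qed

text \<open>Choose monomials with y + deg \<beta> = deg \<alpha>. Multiplying by the one for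
  \<alpha> on the right and by the one for \<beta> on the left rescales m by c(deg \<beta>, -) c(-,
  deg \<alpha>) = c(-, y). The result lies in I, hence in P, and the monomials cancel since P is
  prime.\<close>

lemma core_largest:
  assumes I: "tideal I" and IP: "I \<subseteq> P" shows "I \<subseteq> core P"
proof
  fix m assume m: "m \<in> I"
  have mc: "m \<in> carrier R" using m IP stratum_subset by blast
  show "m \<in> core P"
    unfolding core_def
  proof (intro CollectI conjI ballI mc)
    fix y assume y: "y \<in> S"
    then have yG: "y \<in> carrier G" using S_closed by blast
    obtain \<alpha> \<beta> where ab: "\<alpha> \<in> off" "\<beta> \<in> off" "y \<otimes>\<^bsub>G\<^esub> deg \<beta> = deg \<alpha>" using S_quotient[OF y] by blast
    have kf: "kfun (cr (deg \<alpha>))" "kfun (c (deg \<beta>))" "kfun (cr y)" using kfun_cl kfun_cr yG by auto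
    have "mon \<alpha> \<otimes> sg (cr (deg \<alpha>)) m \<in> I" by (rule tideal_mult(2)[OF I deg_closed mon_homog m])
    then have "mon \<beta> \<otimes> sg (c (deg \<beta>)) (mon \<alpha> \<otimes> sg (cr (deg \<alpha>)) m) \<in> I"
      by (rule tideal_mult(1)[OF I deg_closed mon_homog])
    moreover have "sg (c (deg \<beta>)) (mon \<alpha> \<otimes> sg (cr (deg \<alpha>)) m)
      = c (deg \<beta>) (deg \<alpha>) \<odot> (mon \<alpha> \<otimes> sg (c (deg \<beta>)) (sg (cr (deg \<alpha>)) m))"
      using kf mc by (intro sg_char_mult_homog[OF c_left_char deg_closed mon_homog]) auto
    moreover have "sg (c (deg \<beta>)) (sg (cr (deg \<alpha>)) m) = sg (cr y) m"
    proof -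
      have "sg (c (deg \<beta>)) (sg (cr (deg \<alpha>)) m) = sg (\<lambda>z. c (deg \<beta>) z \<otimes>\<^bsub>K\<^esub> c z (deg \<alpha>)) m"
        using kf(2,1) mc by (rule sg_sg)
      also have "\<dots> = sg (cr y) m"
      proof (rule sg_cong[OF kfun_mult[OF kf(2,1)] kf(3) mc])
        fix z assume "z \<in> supp m"
        then have z: "z \<in> carrier G" using supp_subset[OF mc] by blast
        have "c (deg \<beta>) z \<otimes>\<^bsub>K\<^esub> c z (deg \<alpha>) = (c (deg \<beta>) z \<otimes>\<^bsub>K\<^esub> c z (deg \<beta>)) \<otimes>\<^bsub>K\<^esub> c z y"
          unfolding ab(3)[symmetric] using z yG by (simp add: c_mult_right K.m_ac)
        then show "c (deg \<beta>) z \<otimes>\<^bsub>K\<^esub> c z (deg \<alpha>) = c z y" using c_skew[OF deg_closed z] z yG by simp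
      qed
      finally show ?thesis .
    qed
    ultimately have "mon \<beta> \<otimes> (c (deg \<beta>) (deg \<alpha>) \<odot> (mon \<alpha> \<otimes> sg (cr y) m)) \<in> P" using IP by auto
    then have "c (deg \<beta>) (deg \<alpha>) \<odot> (mon \<alpha> \<otimes> sg (cr y) m) \<in> P"
      using stratum_primeD[of "mon \<beta>"] stratum_mon[OF ab(2)] kf(3) mc by auto
    then have "mon \<alpha> \<otimes> sg (cr y) m \<in> P"
      using subspace_cancel[OF stratum_subspace, of "mon \<alpha> \<otimes> sg (cr y) m" "c (deg \<beta>) (deg \<alpha>)"] c_nonzero kf(3) mc by auto
    then show "sg (cr y) m \<in> P"
      using stratum_primeD[of "mon \<alpha>"] stratum_mon[OF ab(1)] kf(3) mc by auto
  qed
qed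

text \<open>An element outside the core has a part outside P. \<open>localized_part\<close> puts a
  monomial multiple of this part into I, which is still outside P and still has its degrees in one
  class.\<close>

lemma tideal_witness:
  assumes I: "tideal I" and nI: "\<not> I \<subseteq> core P"
  shows "\<exists>a\<in>I. a \<notin> P \<and> (\<exists>s\<in>S. \<forall>z\<in>supp a. E z s)"
proof -
  obtain m where m: "m \<in> I" "m \<notin> core P" using nI by blast
  have mc: "m \<in> carrier R" using m(1) subspaceD(1)[OF tideal_subspace[OF I]] by blast
  obtain x where x: "x \<in> carrier G" "part x m \<notin> P" using parts_core[OF mc] m(2) by blast
  obtain \<alpha> where a: "\<alpha> \<in> off" "mon \<alpha> \<otimes> sg (c (deg \<alpha>)) (part x m) \<in> I" using localized_part[OF I m(1) x(1)] by blast
  have pc: "part x m \<in> carrier R" using mc by simp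
  have psup: "E z x" if "z \<in> supp (part x m)" for z using part_supp[OF mc] that by blast
  \<comment> \<open>Elements without any degree in G_w lie in P, so the part has a degree in G_w.
    This degree represents its class.\<close>
  obtain s where s: "s \<in> S" "s \<in> supp (part x m)" using stratum_outside_supp[OF pc] x(2) by blast
  have sG: "s \<in> carrier G" using S_closed[OF s(1)] .
  have "sg (c (deg \<alpha>)) (part x m) = c (deg \<alpha>) x \<odot> part x m"
    using sg_class(2)[OF pc x(1) psup deg_S[OF a(1)]] .
  then have eq: "mon \<alpha> \<otimes> sg (c (deg \<alpha>)) (part x m) = c (deg \<alpha>) x \<odot> (mon \<alpha> \<otimes> part x m)"
    using pc x(1) by (simp add: smult_mult_right)
  have kc: "c (deg \<alpha>) x \<in> carrier K" using x(1) by simp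
  let ?a = "mon \<alpha> \<otimes> sg (c (deg \<alpha>)) (part x m)"
  have "mon \<alpha> \<otimes> part x m \<notin> P" using stratum_primeD[OF mon_closed pc] stratum_mon[OF a(1)] x(2) by blast
  then have nP: "?a \<notin> P"
    unfolding eq using subspace_cancel[OF stratum_subspace R.m_closed[OF mon_closed pc] kc] c_nonzero x(1) by auto
  have "E z (deg \<alpha> \<otimes>\<^bsub>G\<^esub> s)" if "z \<in> supp ?a" for z
  proof -
    have "z \<in> supp (mon \<alpha> \<otimes> part x m)"
      using that supp_smult[OF kc R.m_closed[OF mon_closed pc]] unfolding eq by blast
    then obtain u v where uv: "z = u \<otimes>\<^bsub>G\<^esub> v" "u \<in> supp (mon \<alpha>)" "v \<in> supp (part x m)"
      using supp_mult[OF mon_closed pc] by blast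
    have u: "u = deg \<alpha>" using uv(2) supp_homog[OF deg_closed mon_homog] by blast
    have "E v s" using psup[OF uv(3)] psup[OF s(2)] E_sym E_trans by blast
    moreover have "v \<in> carrier G" using uv(3) supp_subset[OF pc] by blast
    ultimately show ?thesis unfolding uv(1) u using sG E_refl by (intro E_mult) auto
  qed
  then show ?thesis using nP a(2) S_mult[OF deg_S[OF a(1)] s(1)] by blast
qed

text \<open>Two ideals not contained in the core supply elements a and b outside P, each with
  degrees in one class. Modulo P their product in \<open>A\<close> is the nonzero multiple c(s, t)
  of a b, and a b is outside P since P is prime in \<open>R\<close>.\<close>

lemma core_prime: "prime_ideal (\<tau> ` core P) A"
  unfolding prime_ideal_def
proof (intro conjI allI impI)
  show "ideal (\<tau> ` core P) A" using core_tideal unfolding tideal_def by blast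
  show "\<tau> ` core P \<noteq> carrier A"
  proof
    assume "\<tau> ` core P = carrier A"
    then have "\<tau> \<one> \<in> \<tau> ` core P" by simp
    then have "\<one> \<in> core P" using tau_mem[OF core_carrier] by simp
    then show False using core_subset stratum_one by blast
  qed
  fix I J assume I: "ideal I A" and J: "ideal J A" and IJ: "ideal_prod A I J \<subseteq> \<tau> ` core P"
  let ?I = "{a \<in> carrier R. \<tau> a \<in> I}" and ?J = "{a \<in> carrier R. \<tau> a \<in> J}"
  note tI = tideal_preimage[OF I] and tJ = tideal_preimage[OF J]
  show "I \<subseteq> \<tau> ` core P \<or> J \<subseteq> \<tau> ` core P"
  proof (rule ccontr)
    assume not: "\<not> (I \<subseteq> \<tau> ` core P \<or> J \<subseteq> \<tau> ` core P)"
    have "\<not> ?I \<subseteq> core P" "\<not> ?J \<subseteq> core P" using not tI(2) tJ(2) by blast+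
    note nc = this
    obtain a s where a: "a \<in> ?I" "a \<notin> P" "s \<in> S" "\<forall>z\<in>supp a. E z s"
      using tideal_witness[OF tI(1) nc(1)] by (elim bexE conjE)
    obtain b t where b: "b \<in> ?J" "b \<notin> P" "t \<in> S" "\<forall>z\<in>supp b. E z t"
      using tideal_witness[OF tJ(1) nc(2)] by (elim bexE conjE)
    have c: "a \<in> carrier R" "b \<in> carrier R" using a b by auto
    have G: "s \<in> carrier G" "t \<in> carrier G" using a b S_closed by auto
    have "\<exists>p\<in>carrier R. \<tau> p = \<tau> a \<otimes>\<^bsub>A\<^esub> \<tau> b \<and> p \<ominus> c s t \<odot> (a \<otimes> b) \<in> P"
      by (rule class_product[OF stratum_ideal _ c(1) _ c(2) _ G(1) b(3)]) (use stratum_outside a(4) b(4) in auto)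
    then obtain p where p: "p \<in> carrier R" "\<tau> p = \<tau> a \<otimes>\<^bsub>A\<^esub> \<tau> b" "p \<ominus> c s t \<odot> (a \<otimes> b) \<in> P"
      by (elim bexE conjE)
    have "\<tau> a \<otimes>\<^bsub>A\<^esub> \<tau> b \<in> ideal_prod A I J" using a b by (intro ideal_prod.prod) auto
    then have "\<tau> p \<in> \<tau> ` core P" using IJ p(2) by auto
    then have "p \<in> P" using tau_mem[OF core_carrier p(1)] core_subset by blast
    then have "p \<ominus> (p \<ominus> c s t \<odot> (a \<otimes> b)) \<in> P" using p(3) by (rule subspace_minus[OF stratum_subspace])
    moreover have "p \<ominus> (p \<ominus> c s t \<odot> (a \<otimes> b)) = c s t \<odot> (a \<otimes> b)"
      using p(1) c G by (simp add: R.minus_eq R.minus_add R.r_neg1 R.r_neg2)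
    ultimately have "c s t \<odot> (a \<otimes> b) \<in> P" by simp
    then have "a \<otimes> b \<in> P" using subspace_cancel[OF stratum_subspace] c G c_nonzero by (metis R.m_closed c_closed)
    then show False using stratum_primeD[OF c] a(2) b(2) by blast
  qed
qed

lemma core_tprime: "tprime (core P)"
  using core_prime core_carrier unfolding tprime_def by blast

lemma core_r: "i \<in> {1..n} \<Longrightarrow> r i \<in> core P \<longleftrightarrow> i \<in> w"
proof -
  assume i: "i \<in> {1..n}"
  have "r i \<in> core P" if "r i \<in> P"
    using supp_homog[OF delta_closed[OF i] r_homog[OF i]] E_refl delta_closed[OF i]
    by (intro class_core[OF that delta_closed[OF i]]) auto
  then show ?thesis using core_subset stratum_r[OF i] by blast
qed

text \<open>Equivalent elements of G_w differ by an element of the radical, where h is 1, so h is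
  constant on each class within G_w. A function that is constant on entire classes preserves
  membership by reassembly from the parts, and modulo P only the degrees in G_w count.\<close>

lemma perp_stable:
  assumes h: "h \<in> perp G K (stratum_rad G K c n \<delta> w)" and m: "m \<in> core P"
  shows "sg h m \<in> P"
proof -
  have hc: "h \<in> chars G K" and hN: "\<And>x. x \<in> S \<Longrightarrow> (\<And>y. y \<in> S \<Longrightarrow> c x y = \<one>\<^bsub>K\<^esub>) \<Longrightarrow> h x = \<one>\<^bsub>K\<^esub>"
    using h unfolding perp_def stratum_rad_def by auto
  have mc: "m \<in> carrier R" using m core_carrier by blast
  have kh: "kfun h" using chars_kfun[OF hc] .
  have hE: "h x = h y" if xy: "x \<in> S" "y \<in> S" "E x y" for x y
  proof -
    have G: "x \<in> carrier G" "y \<in> carrier G" using xy S_closed by auto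
    have "h (x \<otimes>\<^bsub>G\<^esub> inv\<^bsub>G\<^esub> y) = \<one>\<^bsub>K\<^esub>"
    proof (rule hN)
      show "x \<otimes>\<^bsub>G\<^esub> inv\<^bsub>G\<^esub> y \<in> S" using xy S_mult S_inv by blast
      fix z assume z: "z \<in> S"
      have iG: "inv\<^bsub>G\<^esub> y \<in> carrier G" using G by simp
      have "c (x \<otimes>\<^bsub>G\<^esub> inv\<^bsub>G\<^esub> y) z = c x z \<otimes>\<^bsub>K\<^esub> c (inv\<^bsub>G\<^esub> y) z"
        by (rule c_mult_left[OF G(1) iG S_closed[OF z]])
      also have "c x z = c y z" using xy(3) z unfolding E_def by blast
      also have "c y z \<otimes>\<^bsub>K\<^esub> c (inv\<^bsub>G\<^esub> y) z = c (y \<otimes>\<^bsub>G\<^esub> inv\<^bsub>G\<^esub> y) z"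
        by (rule c_mult_left[OF G(2) iG S_closed[OF z], symmetric])
      finally have "c (x \<otimes>\<^bsub>G\<^esub> inv\<^bsub>G\<^esub> y) z = c (y \<otimes>\<^bsub>G\<^esub> inv\<^bsub>G\<^esub> y) z" .
      then show "c (x \<otimes>\<^bsub>G\<^esub> inv\<^bsub>G\<^esub> y) z = \<one>\<^bsub>K\<^esub>" using G c_one_left[OF S_closed[OF z]] by simp
    qed
    moreover have "h x = h ((x \<otimes>\<^bsub>G\<^esub> inv\<^bsub>G\<^esub> y) \<otimes>\<^bsub>G\<^esub> y)" using G by (simp add: G.m_assoc)
    ultimately show ?thesis using chars_mult[OF hc, of "x \<otimes>\<^bsub>G\<^esub> inv\<^bsub>G\<^esub> y" y] G kfunD[OF kh G(2)] by simp
  qed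
  \<comment> \<open>The class function that agrees with h on G_w; classes that do not meet G_w
    receive the arbitrary value 1.\<close>
  define \<phi> where "\<phi> x = (if \<exists>s\<in>S. E x s then h (SOME s. s \<in> S \<and> E x s) else \<one>\<^bsub>K\<^esub>)" for x
  have phi: "\<phi> x = h s" if "s \<in> S" "E x s" for x s
  proof -
    have "s \<in> S \<and> E x s" using that by simp
    then have "(SOME s. s \<in> S \<and> E x s) \<in> S \<and> E x (SOME s. s \<in> S \<and> E x s)" by (rule someI)
    then have "h (SOME s. s \<in> S \<and> E x s) = h s" using hE that E_sym E_trans by blast
    then show ?thesis unfolding \<phi>_def using that by auto
  qed
  have kp: "kfun \<phi>"
    unfolding kfun_def
  proof
    fix x assume "x \<in> carrier G"
    show "\<phi> x \<in> carrier K"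
    proof (cases "\<exists>s\<in>S. E x s")
      case True
      then show ?thesis using phi kfunD[OF kh] S_closed by auto
    next
      case False
      then show ?thesis unfolding \<phi>_def by simp
    qed
  qed
  have "sg \<phi> m \<in> P"
  proof (rule part_reassembly[OF stratum_subspace kp _ mc])
    show "\<phi> x = \<phi> y" if "E x y" for x y
    proof (cases "\<exists>s\<in>S. E x s")
      case True
      then obtain s where "s \<in> S" "E x s" by blast
      then show ?thesis using phi that E_sym E_trans by metis
    next
      case False
      then have "\<not> (\<exists>s\<in>S. E y s)" using that E_trans by blast
      then show ?thesis unfolding \<phi>_def using False by simp
    qed
    show "part x m \<in> P" if "x \<in> carrier G" for x using core_part[OF m that] .
  qed
  moreover have "sg h m \<ominus> sg \<phi> m \<in> P"
  proof (rule stratum_outside_supp)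
    show "sg h m \<ominus> sg \<phi> m \<in> carrier R" using kh kp mc by simp
    fix x assume x: "x \<in> supp (sg h m \<ominus> sg \<phi> m)"
    have xG: "x \<in> carrier G" using x supp_subset[of "sg h m \<ominus> sg \<phi> m"] kh kp mc by auto
    show "x \<notin> S"
    proof
      assume xS: "x \<in> S"
      have "\<phi> x = h x" using phi[OF xS E_refl] .
      then have "cmp (sg h m) x = cmp (sg \<phi> m) x" using sg_cmp(2)[OF kh mc xG] sg_cmp(2)[OF kp mc xG] by simp
      moreover have "cmp (sg h m \<ominus> sg \<phi> m) x = cmp (sg h m) x \<oplus> cmp (\<ominus> sg \<phi> m) x"
        unfolding R.minus_eq using kh kp mc by (intro cmp_add) auto
      moreover have "cmp (\<ominus> sg \<phi> m) x = \<ominus> cmp (sg \<phi> m) x"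
        using kp mc by (simp add: neg_smult cmp_smult)
      ultimately have "cmp (sg h m \<ominus> sg \<phi> m) x = \<zero>" using kp mc by (simp add: R.r_neg)
      then show False using x unfolding supp_def by simp
    qed
  qed
  ultimately have "(sg h m \<ominus> sg \<phi> m) \<oplus> sg \<phi> m \<in> P" using subspaceD(3)[OF stratum_subspace] by blast
  then show ?thesis using R.cancel_simps(1)[of "sg h m" "sg \<phi> m"] kh kp mc by simp
qed

lemma c_perp:
  assumes y: "y \<in> S" shows "c y \<in> perp G K (stratum_rad G K c n \<delta> w)"
  unfolding perp_def
proof (intro CollectI conjI ballI)
  have yG: "y \<in> carrier G" using S_closed[OF y] .
  show "c y \<in> chars G K" using c_left_char[OF yG] .
  fix x assume "x \<in> stratum_rad G K c n \<delta> w"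
  then have x: "x \<in> S" "c x y = \<one>\<^bsub>K\<^esub>" using y unfolding stratum_rad_def by auto
  show "c y x = \<one>\<^bsub>K\<^esub>" using c_skew[of x y] x S_closed[OF x(1)] yG by simp
qed

lemma perp_inverse:
  assumes "h \<in> perp G K (stratum_rad G K c n \<delta> w)"
  shows "(\<lambda>x. inv\<^bsub>K\<^esub> h x) \<in> perp G K (stratum_rad G K c n \<delta> w)"
  using assms chars_inverse unfolding perp_def by auto

text \<open>One inclusion holds because the characters c(y, -) with y in G_w annihilate the radical,
  the other by \<open>perp_stable\<close> applied to inverse characters.\<close>

lemma core_eq_char_core: "char_core G R \<G> P (perp G K (stratum_rad G K c n \<delta> w)) = core P"
proof
  let ?T = "perp G K (stratum_rad G K c n \<delta> w)"
  have Tc: "h \<in> chars G K" if "h \<in> ?T" for h using that unfolding perp_def by blast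
  show "char_core G R \<G> P ?T \<subseteq> core P"
  proof
    fix m assume m: "m \<in> char_core G R \<G> P ?T"
    have mem: "m \<in> carrier R \<and> sg (\<lambda>x. inv\<^bsub>K\<^esub> h x) m \<in> P" if "h \<in> ?T" for h
      using m that sg_image[OF Tc[OF that] stratum_subset] unfolding char_core_def by blast
    have mc: "m \<in> carrier R" using mem[OF c_perp[OF S_one]] by blast
    have "sg (cr y) m \<in> P" if y: "y \<in> S" for y
    proof -
      have yG: "y \<in> carrier G" using S_closed[OF y] .
      have "sg (\<lambda>x. inv\<^bsub>K\<^esub> c y x) m = sg (cr y) m"
        using supp_subset[OF mc] c_inv[OF yG] yG
        by (intro sg_cong[OF chars_kfun[OF chars_inverse[OF c_left_char[OF yG]]] kfun_cr[OF yG] mc]) auto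
      then show ?thesis using mem[OF c_perp[OF y]] by simp
    qed
    then show "m \<in> core P" unfolding core_def using mc by blast
  qed
  show "core P \<subseteq> char_core G R \<G> P ?T"
  proof
    fix m assume m: "m \<in> core P"
    have mc: "m \<in> carrier R" using m core_carrier by blast
    have "m \<in> sg h ` P" if h: "h \<in> ?T" for h
      unfolding sg_image[OF Tc[OF h] stratum_subset]
      using mc perp_stable[OF perp_inverse[OF h] m] by blast
    then show "m \<in> char_core G R \<G> P ?T" unfolding char_core_def by blast
  qed
qed

end

subsection \<open>Every prime of the twist arises\<close>

context
  fixes Q assumes Q: "tprime Q" and Qr: "\<And>i. i \<in> {1..n} \<Longrightarrow> r i \<in> Q \<longleftrightarrow> i \<in> w"
begin

lemma tprime_subspace: "subspace Q" by (rule tideal_subspace[OF tprime_tideal[OF Q]])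

lemma tprime_carrier: "Q \<subseteq> carrier R" using subspaceD(1)[OF tprime_subspace] .

lemma tprime_mon: "\<alpha> \<in> off \<Longrightarrow> mon \<alpha> \<notin> Q"
  by (rule mon_notin) (use tprime_one[OF Q] tprime_homog_both[OF Q] Qr in auto)

lemma tprime_mon_in:
  assumes "\<alpha> \<in> exps n" "\<alpha> \<notin> off" shows "mon \<alpha> \<in> Q"
proof -
  obtain i where i: "i \<in> w" "mon \<alpha> = mon (\<alpha>(i := \<alpha> i - 1)) \<otimes> r i" using mon_off_or[OF assms] by blast
  have iI: "i \<in> {1..n}" using i(1) w_subset by blast
  let ?\<beta> = "\<alpha>(i := \<alpha> i - 1)"
  have "mon ?\<beta> \<otimes> sg (c (deg ?\<beta>)) (r i) \<in> Q"
    using Qr[OF iI] i(1) by (intro tideal_mult(1)[OF tprime_tideal[OF Q] deg_closed mon_homog]) auto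
  moreover have "sg (c (deg ?\<beta>)) (r i) = c (deg ?\<beta>) (\<delta> i) \<odot> r i"
    by (rule sg_homog[OF kfun_cl[OF deg_closed] delta_closed[OF iI] r_homog[OF iI]])
  ultimately have "c (deg ?\<beta>) (\<delta> i) \<odot> mon \<alpha> \<in> Q"
    unfolding i(2) using delta_closed[OF iI] r_closed[OF iI] by (simp add: smult_mult_right)
  then show ?thesis using delta_closed[OF iI] c_nonzero subspace_cancel[OF tprime_subspace mon_closed] by (metis c_closed deg_closed)
qed

lemma tprime_outside: "x \<in> carrier G \<Longrightarrow> x \<notin> S \<Longrightarrow> a \<in> \<G> x \<Longrightarrow> a \<in> Q"
  by (rule outside_mem[OF tprime_subspace tprime_mon_in])

text \<open>The monomial left over by \<open>localized_part\<close> is homogeneous and outside Q, so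
  primality in \<open>A\<close> cancels it.\<close>

lemma tprime_part:
  assumes m: "m \<in> Q" and x: "x \<in> carrier G" shows "part x m \<in> Q"
proof -
  obtain \<alpha> where a: "\<alpha> \<in> off" "mon \<alpha> \<otimes> sg (c (deg \<alpha>)) (part x m) \<in> Q"
    using localized_part[OF tprime_tideal[OF Q] m x] by blast
  have "part x m \<in> carrier R" using m tprime_carrier by auto
  then show ?thesis using tprime_homog(1)[OF Q deg_closed mon_homog _ a(2)] tprime_mon[OF a(1)] by blast
qed

lemma tprime_sg:
  assumes p: "kfun \<phi>" "\<And>x y. x \<in> carrier G \<Longrightarrow> y \<in> carrier G \<Longrightarrow> E x y \<Longrightarrow> \<phi> x = \<phi> y" and m: "m \<in> Q"
  shows "sg \<phi> m \<in> Q"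
proof (rule part_reassembly[OF tprime_subspace p(1)])
  show "\<phi> x = \<phi> y" if "x \<in> carrier G" "y \<in> carrier G" "E x y" for x y using that by (rule p(2))
  show "m \<in> carrier R" using m tprime_carrier by blast
  show "part x m \<in> Q" if "x \<in> carrier G" for x using tprime_part[OF m that] .
qed

lemma tprime_sg_cr: "y \<in> S \<Longrightarrow> m \<in> Q \<Longrightarrow> sg (cr y) m \<in> Q"
  by (rule tprime_sg[OF kfun_cr[OF S_closed]]) (auto simp: E_def)

lemma tprime_sg_cl: "y \<in> S \<Longrightarrow> m \<in> Q \<Longrightarrow> sg (c y) m \<in> Q"
  by (rule tprime_sg[OF kfun_cl[OF S_closed]]) (auto intro: E_left)

text \<open>The rescaling that a product in \<open>A\<close> brings along can be undone beforehand,
  since Q is stable under the characters of G_w. A multiplier of degree z outside G_w is itself in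
  Q.\<close>

lemma tprime_ideal: "ideal Q R"
  unfolding R.left_ideal_iff[symmetric] left_ideal_def
proof (intro conjI ballI)
  note W = subspaceD[OF tprime_subspace]
  show "Q \<subseteq> carrier R" "\<zero> \<in> Q" using W by auto
  show "a \<oplus> b \<in> Q" if "a \<in> Q" "b \<in> Q" for a b using W(3) that .
  show "a \<otimes> m \<in> Q" if a: "a \<in> carrier R" and m: "m \<in> Q" for a m
    using a
  proof (induction a rule: graded_induct)
    case zero
    then show ?case using m W(1,2) by auto
  next
    case (homog z b)
    have mc: "m \<in> carrier R" using m W(1) by blast
    have bc: "b \<in> carrier R" using homog_closed[OF homog] .
    have kc: "sg (cr z) m \<in> carrier R" using kfun_cr[OF homog(1)] mc by simp
    \<comment> \<open>The left factor rescales by c(z, -), which cancels the rescaling by c(-, z)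
      made in advance: the element is b m.\<close>
    have "b \<otimes> sg (c z) (sg (cr z) m) \<in> Q"
    proof (cases "z \<in> S")
      case True
      then show ?thesis using tprime_sg_cr m by (intro tideal_mult(1)[OF tprime_tideal[OF Q] homog]) auto
    next
      case False
      then have bQ: "b \<in> Q" using tprime_outside homog by blast
      interpret I: ideal "\<tau> ` Q" A using tprime_tideal[OF Q] unfolding tideal_def by blast
      have "\<tau> b \<otimes>\<^bsub>A\<^esub> \<tau> (sg (cr z) m) \<in> \<tau> ` Q" using bQ kc by (intro I.I_r_closed) auto
      then show ?thesis
        unfolding tau_mult_left[OF homog kc] using tau_mem[OF W(1)] bc kc kfun_cl[OF homog(1)] by simp
    qed
    then show ?case using sg_cl_cr[OF homog(1) mc] by simp
  next
    case (add a b)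
    have "m \<in> carrier R" using m W(1) by blast
    then show ?case using add W(3) by (simp add: R.l_distr)
  qed
qed

definition separating :: "'r set" where
  "separating = {s \<in> carrier R. s \<notin> Q \<and> (\<exists>x\<in>S. \<forall>z\<in>supp s. E z x)}"

text \<open>Suppose s t is in Q. Modulo Q the product of s and t in \<open>A\<close> is a scalar
  multiple of s t, so it vanishes as well. A homogeneous element e between them either has degree in
  G_w and moves past s up to a scalar, or lies in Q. So s A t vanishes modulo Q, against
  primality.\<close>

lemma separating_mult:
  assumes s: "s \<in> separating" and t: "t \<in> separating" shows "s \<otimes> t \<in> separating"
proof -
  obtain x y where x: "x \<in> S" "\<forall>z\<in>supp s. E z x" and y: "y \<in> S" "\<forall>z\<in>supp t. E z y"
    and c: "s \<in> carrier R" "t \<in> carrier R" and nQ: "s \<notin> Q" "t \<notin> Q"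
    using s t unfolding separating_def by blast
  have G: "x \<in> carrier G" "y \<in> carrier G" using x y S_closed by auto
  note W = subspaceD[OF tprime_subspace]
  have pr: "prime_ideal (\<tau> ` Q) A" using Q unfolding tprime_def by blast
  interpret I: ideal "\<tau> ` Q" A using pr unfolding prime_ideal_def by blast
  have "\<exists>p\<in>carrier R. \<tau> p = \<tau> s \<otimes>\<^bsub>A\<^esub> \<tau> t \<and> p \<ominus> c x y \<odot> (s \<otimes> t) \<in> Q"
    by (rule class_product[OF tprime_ideal _ c(1) _ c(2) _ G(1) y(1)]) (use tprime_outside x(2) y(2) in auto)
  then obtain p where p: "p \<in> carrier R" "\<tau> p = \<tau> s \<otimes>\<^bsub>A\<^esub> \<tau> t" "p \<ominus> c x y \<odot> (s \<otimes> t) \<in> Q"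
    by (elim bexE conjE)
  have "s \<otimes> t \<notin> Q"
  proof
    assume "s \<otimes> t \<in> Q"
    then have "c x y \<odot> (s \<otimes> t) \<in> Q" using W(4) G by simp
    then have "(p \<ominus> c x y \<odot> (s \<otimes> t)) \<oplus> c x y \<odot> (s \<otimes> t) \<in> Q" using W(3) p(3) by blast
    then have "p \<in> Q" using R.cancel_simps(1)[of p "c x y \<odot> (s \<otimes> t)"] p(1) c G by simp
    then have st: "\<tau> s \<otimes>\<^bsub>A\<^esub> \<tau> t \<in> \<tau> ` Q" using p(2) by (metis imageI)
    have set: "\<tau> s \<otimes>\<^bsub>A\<^esub> \<tau> e \<otimes>\<^bsub>A\<^esub> \<tau> t \<in> \<tau> ` Q" if "e \<in> carrier R" for e
      using that
    proof (induction e rule: graded_induct)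
      case zero
      then show ?case using c I.zero_closed by (simp add: tau_zero)
    next
      case (homog j e)
      have ec: "e \<in> carrier R" using homog_closed[OF homog] .
      show ?case
      proof (cases "j \<in> S")
        case True
        have k: "c x j \<otimes>\<^bsub>K\<^esub> c x j \<in> carrier K" using G homog(1) by simp
        have sE: "\<And>z. z \<in> supp s \<Longrightarrow> E z x" using x(2) by blast
        have se: "\<tau> s \<otimes>\<^bsub>A\<^esub> \<tau> e = \<tau> ((c x j \<otimes>\<^bsub>K\<^esub> c x j) \<odot> \<one>) \<otimes>\<^bsub>A\<^esub> (\<tau> e \<otimes>\<^bsub>A\<^esub> \<tau> s)"
          using c(1) G(1) sE True homog(2) by (rule class_commute)
        have "\<tau> s \<otimes>\<^bsub>A\<^esub> \<tau> e \<otimes>\<^bsub>A\<^esub> \<tau> t = (\<tau> ((c x j \<otimes>\<^bsub>K\<^esub> c x j) \<odot> \<one>) \<otimes>\<^bsub>A\<^esub> \<tau> e) \<otimes>\<^bsub>A\<^esub> (\<tau> s \<otimes>\<^bsub>A\<^esub> \<tau> t)"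
          unfolding se using k ec c by (simp add: A.m_assoc)
        then show ?thesis using st k ec by (simp add: I.I_l_closed)
      next
        case False
        then have "\<tau> e \<in> \<tau> ` Q" using tprime_outside homog by blast
        then have "\<tau> s \<otimes>\<^bsub>A\<^esub> \<tau> e \<in> \<tau> ` Q" using c(1) by (rule I.I_l_closed[OF _ tau_closed])
        then show ?thesis using c(2) by (rule I.I_r_closed[OF _ tau_closed])
      qed
    next
      case (add e e')
      then show ?case using c I.a_closed by (simp add: tau_add A.l_distr A.r_distr)
    qed
    have "\<tau> s \<in> \<tau> ` Q \<or> \<tau> t \<in> \<tau> ` Q"
    proof (rule A.prime_ideal_elementwise[OF pr])
      fix y assume "y \<in> carrier A"
      then show "\<tau> s \<otimes>\<^bsub>A\<^esub> y \<otimes>\<^bsub>A\<^esub> \<tau> t \<in> \<tau> ` Q" using set tau_surj by blast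
    qed (use c in auto)
    then show False using tau_mem[OF tprime_carrier] c nQ by blast
  qed
  moreover have "E z (x \<otimes>\<^bsub>G\<^esub> y)" if z: "z \<in> supp (s \<otimes> t)" for z
  proof -
    obtain u v where uv: "z = u \<otimes>\<^bsub>G\<^esub> v" "u \<in> supp s" "v \<in> supp t" using supp_mult[OF c] z by blast
    then show ?thesis unfolding uv(1) using x(2) y(2) G supp_subset[OF c(1)] supp_subset[OF c(2)] by (intro E_mult) auto
  qed
  ultimately show ?thesis unfolding separating_def using c S_mult[OF x(1) y(1)] by blast
qed

lemma separating_homog: "x \<in> S \<Longrightarrow> a \<in> \<G> x \<Longrightarrow> a \<notin> Q \<Longrightarrow> a \<in> separating"
  unfolding separating_def using supp_homog[OF S_closed] homog_closed[OF S_closed] E_refl by blast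

text \<open>An ideal maximal among those that avoid a multiplicatively closed set is prime. A part
  of an element of the core lies in P and is therefore not in \<open>separating\<close>: if it has a
  degree in G_w it must lie in Q, and otherwise its degrees put it there.\<close>

lemma exists_prime_above: "\<exists>P\<in>spec_stratum R n r w. core P = Q"
proof -
  have "left_ideal Q R" using tprime_ideal R.left_ideal_iff by blast
  moreover have "Q \<inter> separating = {}" unfolding separating_def by blast
  ultimately obtain P where P: "left_ideal P R" "Q \<subseteq> P" "P \<inter> separating = {}"
    and max: "\<And>N. left_ideal N R \<Longrightarrow> P \<subseteq> N \<Longrightarrow> N \<inter> separating = {} \<Longrightarrow> N = P"
    using R.left_ideal_maximal_avoiding[of Q separating] by metis
  have idP: "ideal P R" using P(1) R.left_ideal_iff by blast
  interpret IP: ideal P R by (rule idP)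
  have one: "\<one> \<in> separating" using separating_homog[OF S_one one_homog tprime_one[OF Q]] .
  then have nP: "\<one> \<notin> P" using P(3) by blast
  have meet: "\<exists>x p. x \<in> carrier R \<and> p \<in> P \<and> x \<otimes> a \<oplus> p \<in> separating" if a: "a \<in> carrier R" "a \<notin> P" for a
  proof -
    let ?N = "{x \<otimes> a \<oplus> p | x p. x \<in> carrier R \<and> p \<in> P}"
    have N: "left_ideal ?N R" using P(1) a(1) by (rule R.left_ideal_sum_cyclic)
    have "p = \<zero> \<otimes> a \<oplus> p" if "p \<in> P" for p using a that IP.Icarr by simp
    then have "P \<subseteq> ?N" by blast
    moreover have "a = \<one> \<otimes> a \<oplus> \<zero>" using a by simp
    then have "a \<in> ?N" using IP.zero_closed by blast
    ultimately have "?N \<inter> separating \<noteq> {}" using max[OF N] a(2) by blast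
    then show ?thesis by blast
  qed
  have "primeideal P R"
  proof (rule primeidealI[OF idP R.cring_axioms])
    show "carrier R \<noteq> P" using nP by blast
    fix a b assume ab: "a \<in> carrier R" "b \<in> carrier R" "a \<otimes> b \<in> P"
    show "a \<in> P \<or> b \<in> P"
    proof (rule ccontr)
      assume "\<not> (a \<in> P \<or> b \<in> P)"
      then obtain x p y q where xy: "x \<in> carrier R" "p \<in> P" "x \<otimes> a \<oplus> p \<in> separating"
        "y \<in> carrier R" "q \<in> P" "y \<otimes> b \<oplus> q \<in> separating" using meet[OF ab(1)] meet[OF ab(2)] by blast
      have pq: "p \<in> carrier R" "q \<in> carrier R" using xy IP.Icarr by auto
      have "(x \<otimes> a \<oplus> p) \<otimes> (y \<otimes> b \<oplus> q) = (x \<otimes> y) \<otimes> (a \<otimes> b) \<oplus> (p \<otimes> (y \<otimes> b) \<oplus> ((x \<otimes> a) \<otimes> q \<oplus> p \<otimes> q))"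
        using xy ab pq by (simp add: R.l_distr R.r_distr R.m_ac R.a_ac)
      moreover have "(x \<otimes> y) \<otimes> (a \<otimes> b) \<in> P" "p \<otimes> (y \<otimes> b) \<in> P" "(x \<otimes> a) \<otimes> q \<in> P" "p \<otimes> q \<in> P"
        using xy ab pq IP.I_l_closed IP.I_r_closed by auto
      ultimately have "(x \<otimes> a \<oplus> p) \<otimes> (y \<otimes> b \<oplus> q) \<in> P" using IP.a_closed by simp
      then show False using separating_mult[OF xy(3,6)] P(3) by blast
    qed
  qed
  then have "P \<in> spec R" unfolding R.spec_commutative by simp
  moreover have "r i \<in> P \<longleftrightarrow> i \<in> w" if i: "i \<in> {1..n}" for i
  proof
    assume rP: "r i \<in> P"
    show "i \<in> w"
    proof (rule ccontr)
      assume iw: "i \<notin> w"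
      then have "r i \<in> separating" using separating_homog[OF delta_S r_homog[OF i]] Qr[OF i] i by blast
      then show False using rP P(3) by blast
    qed
  qed (use Qr[OF i] P(2) in blast)
  ultimately have PS: "P \<in> spec_stratum R n r w" unfolding spec_stratum_def by blast
  have "core P \<subseteq> Q"
  proof
    fix m assume m: "m \<in> core P"
    have mc: "m \<in> carrier R" using m core_carrier[OF PS] by blast
    show "m \<in> Q"
    proof (rule parts_in_imp[OF tprime_subspace mc])
      fix x assume x: "x \<in> carrier G"
      have pP: "part x m \<in> P" using core_part[OF PS m x] .
      have pc: "part x m \<in> carrier R" using mc by simp
      show "part x m \<in> Q"
      proof (cases "\<exists>s\<in>S. s \<in> supp (part x m)")
        case True
        then obtain s where s: "s \<in> S" "s \<in> supp (part x m)" by blast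
        have "E z s" if "z \<in> supp (part x m)" for z
          using part_supp[OF mc, of x] that s(2) E_sym E_trans by blast
        then have "part x m \<in> separating \<or> part x m \<in> Q" unfolding separating_def using pc s(1) by blast
        then show ?thesis using pP P(3) by blast
      next
        case False
        then show ?thesis by (intro outside_supp_mem[OF tprime_subspace tprime_outside pc]) auto
      qed
    qed
  qed
  moreover have "Q \<subseteq> core P" using core_largest[OF PS tprime_tideal[OF Q] P(2)] .
  ultimately show ?thesis using PS by blast
qed

end

end

section \<open>Maximal ideals and primitive ideals\<close>

context graded_algebra
begin

definition cg :: "'r set \<Rightarrow> 'r \<Rightarrow> 'r \<Rightarrow> bool" where
  "cg W a b \<longleftrightarrow> a \<in> carrier R \<and> b \<in> carrier R \<and> a \<ominus> b \<in> W"

lemma cgD: "cg W a b \<Longrightarrow> a \<in> carrier R" "cg W a b \<Longrightarrow> b \<in> carrier R" "cg W a b \<Longrightarrow> a \<ominus> b \<in> W"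
  unfolding cg_def by auto

lemma sg_minus:
  assumes "kfun \<phi>" "a \<in> carrier R" "b \<in> carrier R" shows "sg \<phi> (a \<ominus> b) = sg \<phi> a \<ominus> sg \<phi> b"
  using assms by (simp add: R.minus_eq sg_add neg_smult sg_smult)

context
  fixes W assumes W: "subspace W"
begin

lemma cg_refl: "a \<in> carrier R \<Longrightarrow> cg W a a"
  unfolding cg_def using subspaceD(2)[OF W] by (simp add: R.minus_eq R.r_neg)

lemma cg_zero: "a \<in> carrier R \<Longrightarrow> cg W a \<zero> \<longleftrightarrow> a \<in> W"
  unfolding cg_def by (simp add: R.minus_eq)

lemma cg_sym: assumes "cg W a b" shows "cg W b a"
proof -
  note c = cgD[OF assms]
  have "\<zero> \<ominus> (a \<ominus> b) \<in> W" using subspace_minus[OF W subspaceD(2)[OF W] c(3)] .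
  moreover have "\<zero> \<ominus> (a \<ominus> b) = b \<ominus> a" using c by (simp add: R.minus_eq R.minus_add R.a_comm)
  ultimately show ?thesis unfolding cg_def using c by simp
qed

lemma cg_zero_minus:
  assumes a: "a \<in> carrier R" and b: "b \<in> carrier R" and z: "cg W \<zero> (a \<ominus> b)" shows "cg W a b"
proof -
  have "cg W (a \<ominus> b) \<zero>" using z by (rule cg_sym)
  then have "a \<ominus> b \<in> W" using cg_zero[of "a \<ominus> b"] a b by simp
  then show ?thesis unfolding cg_def using a b by simp
qed

lemma cg_add: assumes "cg W a b" "cg W a' b'" shows "cg W (a \<oplus> a') (b \<oplus> b')"
proof -
  note c = cgD[OF assms(1)] cgD[OF assms(2)]
  have "(a \<oplus> a') \<ominus> (b \<oplus> b') = (a \<ominus> b) \<oplus> (a' \<ominus> b')" using c by (simp add: R.minus_eq R.minus_add R.a_ac)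
  then show ?thesis unfolding cg_def using c subspaceD(3)[OF W c(3,6)] by simp
qed

lemma cg_trans: assumes "cg W a b" "cg W b d" shows "cg W a d"
proof -
  note c = cgD[OF assms(1)] cgD[OF assms(2)]
  have "(a \<ominus> b) \<oplus> (b \<ominus> d) = a \<ominus> d" using c by (simp add: R.minus_eq R.a_assoc R.r_neg1)
  then show ?thesis unfolding cg_def using c subspaceD(3)[OF W c(3,6)] by simp
qed

lemma cg_smult: assumes "k \<in> carrier K" "cg W a b" shows "cg W (k \<odot> a) (k \<odot> b)"
proof -
  note c = cgD[OF assms(2)]
  have "k \<odot> (a \<ominus> b) = k \<odot> a \<ominus> k \<odot> b" using c assms(1) by (simp add: R.minus_eq Alg.smult_r_distr Alg.smult_r_minus)
  then show ?thesis unfolding cg_def using c assms(1) subspaceD(4)[OF W assms(1) c(3)] by simp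
qed

lemma cg_mem: "cg W a b \<Longrightarrow> a \<in> W \<longleftrightarrow> b \<in> W"
  using cg_trans cg_sym cg_zero cgD(1,2) by metis

lemma cg_scalar_unique:
  assumes one: "\<one> \<notin> W" and k: "k \<in> carrier K" "l \<in> carrier K" and eq: "cg W (k \<odot> \<one>) (l \<odot> \<one>)"
  shows "k = l"
proof (rule ccontr)
  assume ne: "k \<noteq> l"
  have "(k \<ominus>\<^bsub>K\<^esub> l) \<odot> \<one> = k \<odot> \<one> \<ominus> l \<odot> \<one>"
    using k by (simp add: K.minus_eq R.minus_eq Alg.smult_l_distr Alg.smult_l_minus)
  then have "(k \<ominus>\<^bsub>K\<^esub> l) \<odot> \<one> \<in> W" using cgD(3)[OF eq] by simp
  moreover have "k \<ominus>\<^bsub>K\<^esub> l \<noteq> \<zero>\<^bsub>K\<^esub>" using K.cancel_simps(1)[of k l] k ne by auto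
  ultimately show False using subspace_cancel[OF W R.one_closed, of "k \<ominus>\<^bsub>K\<^esub> l"] k one by simp
qed

end

end

text \<open>\<open>R\<close> as a twist of itself. Statements about twists thereby apply to
  \<open>R\<close> too: \<open>residue_scalar\<close> and the construction of maximal ideals in
  \<open>exists_maximal_above\<close> rely on it.\<close>

lemma (in generated_algebra) trivial_twist:
  "twisted_algebra R K G \<G> n r \<delta> (\<lambda>_ _. \<one>\<^bsub>K\<^esub>) R id"
proof (intro twisted_algebra.intro twisted_algebra_axioms.intro)
  show "generated_algebra R K G \<G> n r \<delta>" by (rule generated_algebra_axioms)
  show "alternating_bicharacter G K (\<lambda>_ _. \<one>\<^bsub>K\<^esub>)" unfolding alternating_bicharacter_def by simp
  have "assoc_algebra K R"
    by (intro assoc_algebra.intro assoc_algebra_axioms.intro Alg.module_axioms R.ring_axioms)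
      (auto simp: Alg.smult_assoc2 smult_mult_right)
  moreover have "r \<in> carrier R" if "x \<in> carrier G" "r \<in> \<G> x" for x r using homog_closed that .
  ultimately show "is_twist G K R \<G> (\<lambda>_ _. \<one>\<^bsub>K\<^esub>) R id" unfolding is_twist_def by auto
qed

text \<open>Hilbert's Nullstellensatz, as the case of the trivial twist of \<open>simple_module_scalar\<close>.\<close>

lemma (in generated_algebra) residue_scalar:
  assumes M: "maximalideal M R" and m: "m \<in> carrier R"
  shows "\<exists>k\<in>carrier K. m \<ominus> k \<odot> \<one> \<in> M"
proof -
  interpret M: maximalideal M R by (rule M)
  interpret T: twisted_algebra R K G \<G> n r \<delta> "\<lambda>_ _. \<one>\<^bsub>K\<^esub>" R id by (rule trivial_twist)
  have L: "left_ideal M R" using M.ideal_axioms R.left_ideal_iff by blast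
  have one: "\<one> \<notin> M" using M.I_notcarr M.one_imp_carrier by blast
  have max: "N = M" if "left_ideal N R" "M \<subseteq> N" "\<one> \<notin> N" for N
  proof -
    have N: "ideal N R" using that(1) R.left_ideal_iff by blast
    have "N \<subseteq> carrier R" using left_ideal_subset[OF that(1)] .
    then have "N = M \<or> N = carrier R" using M.I_maximal[OF N that(2)] by blast
    then show ?thesis using that(3) by auto
  qed
  have "\<exists>(V :: ('r, 'r) module) \<rho>. simple_module R V \<and> \<rho> ` carrier R = carrier V \<and>
    (\<forall>a\<in>carrier R. \<forall>b\<in>carrier R. \<rho> (a \<oplus> b) = \<rho> a \<oplus>\<^bsub>V\<^esub> \<rho> b \<and> \<rho> (a \<otimes> b) = a \<odot>\<^bsub>V\<^esub> \<rho> b) \<and>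
    (\<forall>a\<in>carrier R. \<rho> a = \<zero>\<^bsub>V\<^esub> \<longleftrightarrow> a \<in> M)"
    using L one max by (rule R.simple_quotient)
  then obtain V :: "('r, 'r) module" and \<rho> where V: "simple_module R V" and rho: "\<rho> ` carrier R = carrier V"
    and lin: "\<forall>a\<in>carrier R. \<forall>b\<in>carrier R. \<rho> (a \<oplus> b) = \<rho> a \<oplus>\<^bsub>V\<^esub> \<rho> b \<and> \<rho> (a \<otimes> b) = a \<odot>\<^bsub>V\<^esub> \<rho> b"
    and ker: "\<forall>a\<in>carrier R. \<rho> a = \<zero>\<^bsub>V\<^esub> \<longleftrightarrow> a \<in> M"
    by (elim exE conjE)
  interpret V: simple_module R V by (rule V)
  \<comment> \<open>Since \<open>R\<close> is commutative, multiplication by m is an endomorphism of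
    the simple module obtained from \<open>R\<close> modulo M.\<close>
  have "\<exists>k\<in>carrier K. \<forall>v\<in>carrier V. m \<odot>\<^bsub>V\<^esub> v = id (k \<odot> \<one>) \<odot>\<^bsub>V\<^esub> v"
  proof (rule T.simple_module_scalar[OF V])
    show "m \<odot>\<^bsub>V\<^esub> v \<in> carrier V" if "v \<in> carrier V" for v using V.smult_closed[OF m that] .
    show "m \<odot>\<^bsub>V\<^esub> (u \<oplus>\<^bsub>V\<^esub> v) = m \<odot>\<^bsub>V\<^esub> u \<oplus>\<^bsub>V\<^esub> m \<odot>\<^bsub>V\<^esub> v" if "u \<in> carrier V" "v \<in> carrier V" for u v
      using V.smult_r_distr[OF m that] .
    show "m \<odot>\<^bsub>V\<^esub> (a \<odot>\<^bsub>V\<^esub> v) = a \<odot>\<^bsub>V\<^esub> (m \<odot>\<^bsub>V\<^esub> v)" if "a \<in> carrier R" "v \<in> carrier V" for a v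
      using V.smult_assoc[OF m that] V.smult_assoc[OF that(1) m that(2)] R.m_comm[OF m that(1)] by simp
  qed
  then obtain k where k: "k \<in> carrier K" "\<forall>v\<in>carrier V. m \<odot>\<^bsub>V\<^esub> v = (k \<odot> \<one>) \<odot>\<^bsub>V\<^esub> v" by auto
  have r1: "\<rho> \<one> \<in> carrier V" using rho by blast
  have rc: "\<rho> a \<in> carrier V" if "a \<in> carrier R" for a using rho that by blast
  have "\<rho> m = \<rho> (k \<odot> \<one>)"
  proof -
    have "\<rho> (m \<otimes> \<one>) = m \<odot>\<^bsub>V\<^esub> \<rho> \<one>" "\<rho> ((k \<odot> \<one>) \<otimes> \<one>) = (k \<odot> \<one>) \<odot>\<^bsub>V\<^esub> \<rho> \<one>" using lin m k(1) by blast+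
    then show ?thesis using k r1 m by simp
  qed
  moreover have "\<rho> ((m \<ominus> k \<odot> \<one>) \<oplus> k \<odot> \<one>) = \<rho> (m \<ominus> k \<odot> \<one>) \<oplus>\<^bsub>V\<^esub> \<rho> (k \<odot> \<one>)" using lin m k by auto
  ultimately have "\<rho> (k \<odot> \<one>) = \<rho> (m \<ominus> k \<odot> \<one>) \<oplus>\<^bsub>V\<^esub> \<rho> (k \<odot> \<one>)"
    using R.cancel_simps(1)[of m "k \<odot> \<one>"] m k by simp
  then have "\<rho> (m \<ominus> k \<odot> \<one>) = \<zero>\<^bsub>V\<^esub>"
    using rc[of "m \<ominus> k \<odot> \<one>"] rc[of "k \<odot> \<one>"] m k by (simp add: V.M.add.r_cancel_one)
  then show ?thesis using ker m k by auto
qed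

section \<open>The left ideal generated by u - \<mu> and Q is proper\<close>

context twisted_algebra
begin

text \<open>Comparing the components of an identity \<open>1 = b u - \<mu> b + q\<close> over the classes of the powers
  of \<open>y\<close>.\<close>

lemma shifted_left_ideal_proper:
  fixes E :: "'g \<Rightarrow> 'g \<Rightarrow> bool"
  assumes Q: "tideal Q" and one: "\<one> \<notin> Q"
    and E_sym: "\<And>x z. E x z \<Longrightarrow> E z x" and E_trans: "\<And>x x' z. E x x' \<Longrightarrow> E x' z \<Longrightarrow> E x z"
    and E_mult: "\<And>x x' z. x \<in> carrier G \<Longrightarrow> x' \<in> carrier G \<Longrightarrow> z \<in> carrier G \<Longrightarrow> E x x' \<Longrightarrow> E (z \<otimes>\<^bsub>G\<^esub> x) (z \<otimes>\<^bsub>G\<^esub> x')"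
    and E_one: "E \<one>\<^bsub>G\<^esub> \<one>\<^bsub>G\<^esub>"
    and parts: "\<And>m x. m \<in> Q \<Longrightarrow> x \<in> carrier G \<Longrightarrow> sg (ind (\<lambda>z. E z x)) m \<in> Q"
    and y: "y \<in> carrier G" and u: "u \<in> \<G> y"
    and reg: "\<And>b. b \<in> carrier R \<Longrightarrow> u \<otimes> sg (\<lambda>z. c z y) b \<in> Q \<Longrightarrow> b \<in> Q"
    and fin: "\<And>s. 0 < s \<Longrightarrow> E (y [^]\<^bsub>G\<^esub> (s::nat)) \<one>\<^bsub>G\<^esub> \<Longrightarrow> \<exists>l\<in>carrier K - {\<zero>\<^bsub>K\<^esub>}. u [^] s \<ominus> l \<odot> \<one> \<in> Q"
  shows "\<exists>\<mu>\<in>carrier K - {\<zero>\<^bsub>K\<^esub>}. \<forall>b\<in>carrier R. \<one> \<ominus> (u \<otimes> sg (\<lambda>z. c z y) b \<ominus> \<mu> \<odot> b) \<notin> Q"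
proof (rule ccontr)
  assume "\<not> ?thesis"
  then have contra: "\<And>\<mu>. \<mu> \<in> carrier K - {\<zero>\<^bsub>K\<^esub>} \<Longrightarrow> \<exists>b\<in>carrier R. \<one> \<ominus> (u \<otimes> sg (\<lambda>z. c z y) b \<ominus> \<mu> \<odot> b) \<in> Q" by blast
  \<comment> \<open>\<open>T\<close> is right multiplication by u in \<open>A\<close>, transported
    to \<open>R\<close>. It shifts classes of degrees by y.\<close>
  define T where "T b = u \<otimes> sg (\<lambda>z. c z y) b" for b
  define pt where "pt x = sg (ind (\<lambda>z. E z x))" for x
  have W: "subspace Q" using Q by (rule tideal_subspace)
  have kc: "kfun (\<lambda>z. c z y)" using chars_kfun[OF c_right_char[OF y]] .
  have uc: "u \<in> carrier R" using homog_closed[OF y u] .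
  have Tc: "T b \<in> carrier R" if "b \<in> carrier R" for b unfolding T_def using uc kc that by simp
  have ptc: "pt x b \<in> carrier R" if "b \<in> carrier R" for x b unfolding pt_def using that by simp
  have Tminus: "T (a \<ominus> b) = T a \<ominus> T b" if "a \<in> carrier R" "b \<in> carrier R" for a b
    unfolding T_def sg_minus[OF kc that] using uc kc that by (simp add: R.minus_eq R.r_distr R.r_minus)
  have Tsmult: "T (k \<odot> b) = k \<odot> T b" if "k \<in> carrier K" "b \<in> carrier R" for k b
    unfolding T_def using uc kc that by (simp add: sg_smult smult_mult_right)
  have TQ: "T b \<in> Q" if "b \<in> Q" for b unfolding T_def using tideal_mult(2)[OF Q y u that] .
  have Tcg: "cg Q (T a) (T b)" if "cg Q a b" for a b
    using cgD[OF that] Tc TQ[OF cgD(3)[OF that]] unfolding cg_def by (simp add: Tminus)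
  have yp: "y [^]\<^bsub>G\<^esub> (j::nat) \<in> carrier G" for j using y by simp
  have cyj: "c (y [^]\<^bsub>G\<^esub> (j::nat)) y = \<one>\<^bsub>K\<^esub>" for j
    by (induction j) (use y in \<open>auto simp: c_one_left c_mult_left c_self\<close>)
  have Tpow: "T (u [^] (j::nat)) = u [^] Suc j" for j
    unfolding T_def using sg_homog[OF kc yp pow_homog[OF y u]] cyj uc by (simp add: R.m_comm)
  have E_cancel: "E x x'" if "x \<in> carrier G" "x' \<in> carrier G" "E (y \<otimes>\<^bsub>G\<^esub> x) (y \<otimes>\<^bsub>G\<^esub> x')" for x x'
    using E_mult[of "y \<otimes>\<^bsub>G\<^esub> x" "y \<otimes>\<^bsub>G\<^esub> x'" "inv\<^bsub>G\<^esub> y"] that y by (simp flip: G.m_assoc)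
  have pt_T: "pt (y \<otimes>\<^bsub>G\<^esub> x) (T b) = T (pt x b)" if x: "x \<in> carrier G" and b: "b \<in> carrier R" for x b
  proof -
    have sb: "sg (\<lambda>z. c z y) b \<in> carrier R" using kc b by simp
    have "pt (y \<otimes>\<^bsub>G\<^esub> x) (T b) = u \<otimes> sg (\<lambda>z. ind (\<lambda>z. E z (y \<otimes>\<^bsub>G\<^esub> x)) (y \<otimes>\<^bsub>G\<^esub> z)) (sg (\<lambda>z. c z y) b)"
      unfolding pt_def T_def using y u sb by (intro sg_mult_homog) auto
    also have "sg (\<lambda>z. ind (\<lambda>z. E z (y \<otimes>\<^bsub>G\<^esub> x)) (y \<otimes>\<^bsub>G\<^esub> z)) (sg (\<lambda>z. c z y) b) = sg (ind (\<lambda>z. E z x)) (sg (\<lambda>z. c z y) b)"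
    proof (rule sg_cong[OF _ kfun_ind sb])
      show "kfun (\<lambda>z. ind (\<lambda>z. E z (y \<otimes>\<^bsub>G\<^esub> x)) (y \<otimes>\<^bsub>G\<^esub> z))" unfolding kfun_def ind_def by simp
      fix z assume "z \<in> supp (sg (\<lambda>z. c z y) b)"
      then have "z \<in> carrier G" using supp_subset[OF sb] by blast
      then have "E (y \<otimes>\<^bsub>G\<^esub> z) (y \<otimes>\<^bsub>G\<^esub> x) \<longleftrightarrow> E z x" using E_mult E_cancel x y by blast
      then show "ind (\<lambda>z. E z (y \<otimes>\<^bsub>G\<^esub> x)) (y \<otimes>\<^bsub>G\<^esub> z) = ind (\<lambda>z. E z x) z" unfolding ind_def by simp
    qed
    also have "\<dots> = sg (\<lambda>z. c z y) (sg (ind (\<lambda>z. E z x)) b)" using kc b by (intro sg_comm) auto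
    finally show ?thesis unfolding T_def pt_def .
  qed
  have one_supp: "supp \<one> \<subseteq> {\<one>\<^bsub>G\<^esub>}" using supp_homog[OF G.one_closed one_homog] .
  have pt_one: "pt x \<one> = \<one>" if "E \<one>\<^bsub>G\<^esub> x" for x
    unfolding pt_def using that one_supp by (intro sg_ind_all) auto
  have pt_one': "pt x \<one> = \<zero>" if "\<not> E \<one>\<^bsub>G\<^esub> x" for x
    unfolding pt_def using that one_supp by (intro sg_zero_if) (auto simp: ind_def)
  \<comment> \<open>The part of 1 = T b - \<mu> b + q at the class of y x. Since T shifts by y, it
    links the parts of b at x and at y x modulo Q, with a source term only where the class of 1 is
    met.\<close>
  have compare: "\<one> \<ominus> (T b \<ominus> \<mu> \<odot> b) \<in> Q \<Longrightarrow> cg Q (pt (y \<otimes>\<^bsub>G\<^esub> x) \<one>) (T (pt x b) \<ominus> \<mu> \<odot> pt (y \<otimes>\<^bsub>G\<^esub> x) b)"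
    if "b \<in> carrier R" "\<mu> \<in> carrier K" "x \<in> carrier G" for b \<mu> x
  proof -
    assume q: "\<one> \<ominus> (T b \<ominus> \<mu> \<odot> b) \<in> Q"
    have yx: "y \<otimes>\<^bsub>G\<^esub> x \<in> carrier G" using y that by simp
    have "pt (y \<otimes>\<^bsub>G\<^esub> x) (\<one> \<ominus> (T b \<ominus> \<mu> \<odot> b)) \<in> Q" unfolding pt_def using parts[OF q yx] .
    moreover have "pt (y \<otimes>\<^bsub>G\<^esub> x) (\<one> \<ominus> (T b \<ominus> \<mu> \<odot> b))
      = pt (y \<otimes>\<^bsub>G\<^esub> x) \<one> \<ominus> (pt (y \<otimes>\<^bsub>G\<^esub> x) (T b) \<ominus> \<mu> \<odot> pt (y \<otimes>\<^bsub>G\<^esub> x) b)"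
      unfolding pt_def using that Tc by (simp add: sg_minus sg_smult)
    ultimately show ?thesis unfolding cg_def using pt_T[OF that(3,1)] that Tc ptc by simp
  qed
  have powQ: "u [^] (j::nat) \<notin> Q" for j
  proof (induction j)
    case 0
    then show ?case using one by simp
  next
    case (Suc j)
    then show ?case using reg[of "u [^] j"] Tpow[of j] uc unfolding T_def by auto
  qed
  have pow_Suc: "y \<otimes>\<^bsub>G\<^esub> y [^]\<^bsub>G\<^esub> j = y [^]\<^bsub>G\<^esub> Suc j" for j :: nat using y by (simp add: G.m_comm)
  show False
  proof (cases "\<exists>s::nat. 0 < s \<and> E (y [^]\<^bsub>G\<^esub> s) \<one>\<^bsub>G\<^esub>")
    case True
    define s :: nat where "s = (LEAST s. 0 < s \<and> E (y [^]\<^bsub>G\<^esub> s) \<one>\<^bsub>G\<^esub>)"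
    have s: "0 < s" "E (y [^]\<^bsub>G\<^esub> s) \<one>\<^bsub>G\<^esub>" using LeastI_ex[OF True] unfolding s_def by auto
    have least: "\<not> E \<one>\<^bsub>G\<^esub> (y [^]\<^bsub>G\<^esub> j)" if "0 < j" "j < s" for j :: nat
      using not_less_Least[of j "\<lambda>s. 0 < s \<and> E (y [^]\<^bsub>G\<^esub> s) \<one>\<^bsub>G\<^esub>"] that E_sym unfolding s_def by blast
    obtain l where l: "l \<in> carrier K" "l \<noteq> \<zero>\<^bsub>K\<^esub>" "u [^] s \<ominus> l \<odot> \<one> \<in> Q" using fin[OF s] by blast
    \<comment> \<open>Going once round the s classes multiplies by u^s on one side and by \<mu>^s on
      the other. Both equal l modulo Q for this choice, so that only the source term
      survives.\<close>
    obtain \<mu> where mu: "\<mu> \<in> carrier K" "\<mu> \<noteq> \<zero>\<^bsub>K\<^esub>" "\<mu> [^]\<^bsub>K\<^esub> s = l" using K.exists_nth_root[OF l(1,2) s(1)] by blast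
    obtain b where b: "b \<in> carrier R" "\<one> \<ominus> (T b \<ominus> \<mu> \<odot> b) \<in> Q" using contra[of \<mu>] mu unfolding T_def by blast
    define D where "D j = pt (y [^]\<^bsub>G\<^esub> j) b" for j :: nat
    have Dc: "D j \<in> carrier R" for j unfolding D_def using ptc b(1) .
    have Tjc: "(T ^^ j) a \<in> carrier R" if "a \<in> carrier R" for a and j :: nat
      using that Tc by (induction j) auto
    have mp: "\<mu> [^]\<^bsub>K\<^esub> (j::nat) \<in> carrier K" for j using mu(1) by simp
    \<comment> \<open>For 0 < j < s the class of y^j does not contain the neutral degree, so there
      is no source term before the cycle closes.\<close>
    have step: "cg Q ((T ^^ j) (D 0)) (\<mu> [^]\<^bsub>K\<^esub> j \<odot> D j)" if "j < s" for j
      using that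
    proof (induction j)
      case 0
      then show ?case using Dc[of 0] by (simp add: cg_refl[OF W])
    next
      case (Suc j)
      have "cg Q (pt (y [^]\<^bsub>G\<^esub> Suc j) \<one>) (T (D j) \<ominus> \<mu> \<odot> D (Suc j))"
        using compare[OF b(1) mu(1) yp b(2), of j] unfolding pow_Suc D_def .
      then have "cg Q (T (D j) \<ominus> \<mu> \<odot> D (Suc j)) \<zero>"
        using pt_one'[OF least[of "Suc j"]] Suc.prems cg_sym[OF W] by simp
      then have "T (D j) \<ominus> \<mu> \<odot> D (Suc j) \<in> Q" using cg_zero[OF W] cgD(1) by blast
      then have 1: "cg Q (T (D j)) (\<mu> \<odot> D (Suc j))" unfolding cg_def using Tc Dc mu by auto
      have "cg Q (T ((T ^^ j) (D 0))) (T (\<mu> [^]\<^bsub>K\<^esub> j \<odot> D j))" using Suc by (intro Tcg) simp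
      then have "cg Q ((T ^^ Suc j) (D 0)) (\<mu> [^]\<^bsub>K\<^esub> j \<odot> T (D j))" using Tsmult[OF mp Dc] by simp
      moreover have "cg Q (\<mu> [^]\<^bsub>K\<^esub> j \<odot> T (D j)) (\<mu> [^]\<^bsub>K\<^esub> j \<odot> (\<mu> \<odot> D (Suc j)))"
        using cg_smult[OF W mp 1] .
      moreover have "\<mu> [^]\<^bsub>K\<^esub> j \<odot> (\<mu> \<odot> D (Suc j)) = \<mu> [^]\<^bsub>K\<^esub> Suc j \<odot> D (Suc j)"
        using Alg.smult_assoc1[OF mp mu(1) Dc, of j "Suc j"] by simp
      ultimately show ?case using cg_trans[OF W] by metis
    qed
    obtain s' where s': "s = Suc s'" using s(1) gr0_implies_Suc by blast
    have same: "pt (y [^]\<^bsub>G\<^esub> s) b = D 0"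
    proof -
      have "E z (y [^]\<^bsub>G\<^esub> s) \<longleftrightarrow> E z (y [^]\<^bsub>G\<^esub> (0::nat))" for z
        using s(2) E_sym E_trans by (metis G.nat_pow_0)
      then show ?thesis unfolding D_def pt_def by presburger
    qed
    \<comment> \<open>The last step leads back to the class of the neutral degree, where the part of
      1 is 1. It follows that T^s (D 0) is congruent to \<mu>^(s - 1) + l (D 0).\<close>
    have "cg Q (pt (y [^]\<^bsub>G\<^esub> s) \<one>) (T (D s') \<ominus> \<mu> \<odot> pt (y [^]\<^bsub>G\<^esub> s) b)"
      using compare[OF b(1) mu(1) yp b(2), of s'] unfolding pow_Suc s' D_def .
    then have "cg Q \<one> (T (D s') \<ominus> \<mu> \<odot> D 0)" using pt_one[OF E_sym[OF s(2)]] same by simp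
    then have "cg Q (\<one> \<oplus> \<mu> \<odot> D 0) ((T (D s') \<ominus> \<mu> \<odot> D 0) \<oplus> \<mu> \<odot> D 0)"
      using mu Dc by (intro cg_add[OF W] cg_refl[OF W]) auto
    then have "cg Q (\<one> \<oplus> \<mu> \<odot> D 0) (T (D s'))" using R.cancel_simps(1)[of "T (D s')" "\<mu> \<odot> D 0" \<zero>] mu Dc Tc by simp
    then have 2: "cg Q (\<mu> [^]\<^bsub>K\<^esub> s' \<odot> T (D s')) (\<mu> [^]\<^bsub>K\<^esub> s' \<odot> (\<one> \<oplus> \<mu> \<odot> D 0))"
      using cg_smult[OF W mp] cg_sym[OF W] by blast
    have "cg Q (T ((T ^^ s') (D 0))) (T (\<mu> [^]\<^bsub>K\<^esub> s' \<odot> D s'))" using step[of s'] s' by (intro Tcg) simp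
    then have 3: "cg Q ((T ^^ s) (D 0)) (\<mu> [^]\<^bsub>K\<^esub> s' \<odot> T (D s'))" using Tsmult[OF mp Dc] s' by simp
    have "\<mu> [^]\<^bsub>K\<^esub> s' \<odot> (\<one> \<oplus> \<mu> \<odot> D 0) = \<mu> [^]\<^bsub>K\<^esub> s' \<odot> \<one> \<oplus> l \<odot> D 0"
    proof -
      have "\<mu> [^]\<^bsub>K\<^esub> s' \<otimes>\<^bsub>K\<^esub> \<mu> = l" using mu(3) s' by simp
      then show ?thesis
        using Alg.smult_assoc1[OF mp[of s'] mu(1) Dc[of 0]] Alg.smult_r_distr[OF mp[of s'], of \<one> "\<mu> \<odot> D 0"] mu(1) Dc by simp
    qed
    then have 4: "cg Q ((T ^^ s) (D 0)) (\<mu> [^]\<^bsub>K\<^esub> s' \<odot> \<one> \<oplus> l \<odot> D 0)" using cg_trans[OF W 3 2] by metis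
    have Tj: "(T ^^ j) a \<in> carrier R \<and> \<tau> ((T ^^ j) a) = \<tau> a \<otimes>\<^bsub>A\<^esub> \<tau> (u [^] j)" if a: "a \<in> carrier R" for a and j :: nat
    proof (induction j)
      case 0
      then show ?case using a tau_one by simp
    next
      case (Suc j)
      then have IH: "(T ^^ j) a \<in> carrier R" "\<tau> ((T ^^ j) a) = \<tau> a \<otimes>\<^bsub>A\<^esub> \<tau> (u [^] j)" by auto
      have "\<tau> (T ((T ^^ j) a)) = \<tau> ((T ^^ j) a) \<otimes>\<^bsub>A\<^esub> \<tau> u"
        using tau_mult_right[OF y u IH(1)] by (simp add: T_def)
      also have "\<dots> = \<tau> a \<otimes>\<^bsub>A\<^esub> (\<tau> (u [^] j) \<otimes>\<^bsub>A\<^esub> \<tau> u)" unfolding IH(2) using a uc by (simp add: A.m_assoc)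
      also have "\<tau> (u [^] j) \<otimes>\<^bsub>A\<^esub> \<tau> u = \<tau> (T (u [^] j))"
        using tau_mult_right[OF y u, of "u [^] j"] uc by (simp add: T_def)
      finally show ?case using Tpow[of j] Tc IH(1) by simp
    qed
    interpret I: ideal "\<tau> ` Q" A using Q unfolding tideal_def by blast
    \<comment> \<open>On the other hand T^s is right multiplication by u^s, so T^s (D 0) is
      congruent to l (D 0). Subtracting puts the nonzero scalar \<mu>^(s - 1) into Q.\<close>
    have "\<tau> (D 0) \<otimes>\<^bsub>A\<^esub> \<tau> (u [^] s \<ominus> l \<odot> \<one>) \<in> \<tau> ` Q" using l(3) Dc by (intro I.I_l_closed[OF imageI tau_closed])
    moreover have "\<tau> (D 0) \<otimes>\<^bsub>A\<^esub> \<tau> (u [^] s \<ominus> l \<odot> \<one>) = \<tau> ((T ^^ s) (D 0) \<ominus> l \<odot> D 0)"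
      using Tj[OF Dc, of s 0] l(1) uc Dc tau_smult_one_right[OF l(1) Dc[of 0]]
      by (simp add: tau_minus) (simp add: A.minus_eq A.r_distr A.r_minus)
    ultimately have "cg Q ((T ^^ s) (D 0)) (l \<odot> D 0)"
      unfolding cg_def using tau_mem[OF subspaceD(1)[OF W]] Tjc[OF Dc] l(1) Dc by auto
    then have "cg Q (\<mu> [^]\<^bsub>K\<^esub> s' \<odot> \<one> \<oplus> l \<odot> D 0) (l \<odot> D 0)" by (rule cg_trans[OF W cg_sym[OF W 4]])
    then have "(\<mu> [^]\<^bsub>K\<^esub> s' \<odot> \<one> \<oplus> l \<odot> D 0) \<ominus> l \<odot> D 0 \<in> Q" by (rule cgD(3))
    moreover have "(\<mu> [^]\<^bsub>K\<^esub> s' \<odot> \<one> \<oplus> l \<odot> D 0) \<ominus> l \<odot> D 0 = \<mu> [^]\<^bsub>K\<^esub> s' \<odot> \<one>"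
      using mp l(1) Dc by (simp add: R.minus_eq R.a_assoc R.r_neg)
    ultimately have "\<mu> [^]\<^bsub>K\<^esub> s' \<odot> \<one> \<in> Q" by simp
    moreover have "\<mu> [^]\<^bsub>K\<^esub> s' \<noteq> \<zero>\<^bsub>K\<^esub>"
      by (induction s') (use mu in \<open>auto simp: K.integral_iff\<close>)
    ultimately show False using subspace_cancel[OF W R.one_closed mp] one by blast
  next
    case False
    then have inf: "\<not> E (y [^]\<^bsub>G\<^esub> s) \<one>\<^bsub>G\<^esub>" if "0 < s" for s :: nat using that by blast
    \<comment> \<open>No power of y returns to the class of the neutral degree, so no cycle has to
      be matched and \<mu> = 1 will do.\<close>
    obtain b where b: "b \<in> carrier R" "\<one> \<ominus> (T b \<ominus> \<one>\<^bsub>K\<^esub> \<odot> b) \<in> Q" using contra[of "\<one>\<^bsub>K\<^esub>"] unfolding T_def by auto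
    \<comment> \<open>The support of b is finite and cannot meet infinitely many distinct classes.
      Index 0 is excluded because the descent below has to start strictly on the negative
      side.\<close>
    have vanish: "\<exists>i>0. pt (g i) b = \<zero>" if g: "\<And>i j. i < j \<Longrightarrow> \<not> E (g i) (g j)" for g :: "nat \<Rightarrow> 'g"
    proof (rule ccontr)
      assume "\<not> ?thesis"
      then have nz: "pt (g i) b \<noteq> \<zero>" if "0 < i" for i using that by blast
      have "\<exists>z. z \<in> supp b \<and> E z (g i)" if i: "0 < i" for i
      proof (rule ccontr)
        assume no: "\<nexists>z. z \<in> supp b \<and> E z (g i)"
        have "pt (g i) b = \<zero>" unfolding pt_def using b(1) no by (intro sg_zero_if) (auto simp: ind_def)
        then show False using nz[OF i] by simp
      qed
      then obtain f where f: "\<And>i. 0 < i \<Longrightarrow> f i \<in> supp b \<and> E (f i) (g i)" by metis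
      have "inj_on f {0<..}"
      proof (rule linorder_inj_onI)
        fix i j :: nat assume "i < j" "i \<in> {0<..}" "j \<in> {0<..}"
        then show "f i \<noteq> f j" using f[of i] f[of j] g[of i j] E_sym E_trans by (metis greaterThan_iff)
      qed auto
      moreover have "finite (f ` {0<..})"
        by (rule finite_subset[OF _ supp_finite[OF b(1)]]) (use f in auto)
      ultimately have "finite {0::nat<..}" by (rule finite_imageD[rotated])
      then show False using infinite_Ioi by blast
    qed
    have iy: "inv\<^bsub>G\<^esub> (y [^]\<^bsub>G\<^esub> (j::nat)) \<in> carrier G" for j using yp by simp
    have "\<exists>J>0. pt (inv\<^bsub>G\<^esub> (y [^]\<^bsub>G\<^esub> (J::nat))) b = \<zero>"
    proof (rule vanish[of "\<lambda>J::nat. inv\<^bsub>G\<^esub> (y [^]\<^bsub>G\<^esub> J)"])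
      fix i j :: nat assume ij: "i < j"
      show "\<not> E (inv\<^bsub>G\<^esub> (y [^]\<^bsub>G\<^esub> i)) (inv\<^bsub>G\<^esub> (y [^]\<^bsub>G\<^esub> j))"
      proof
        assume "E (inv\<^bsub>G\<^esub> (y [^]\<^bsub>G\<^esub> i)) (inv\<^bsub>G\<^esub> (y [^]\<^bsub>G\<^esub> j))"
        then have "E (y [^]\<^bsub>G\<^esub> j \<otimes>\<^bsub>G\<^esub> inv\<^bsub>G\<^esub> (y [^]\<^bsub>G\<^esub> i)) (y [^]\<^bsub>G\<^esub> j \<otimes>\<^bsub>G\<^esub> inv\<^bsub>G\<^esub> (y [^]\<^bsub>G\<^esub> j))"
          using iy yp by (intro E_mult) auto
        moreover have "y [^]\<^bsub>G\<^esub> j = y [^]\<^bsub>G\<^esub> (j - i) \<otimes>\<^bsub>G\<^esub> y [^]\<^bsub>G\<^esub> i" using ij y by (simp add: G.nat_pow_mult)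
        then have "y [^]\<^bsub>G\<^esub> j \<otimes>\<^bsub>G\<^esub> inv\<^bsub>G\<^esub> (y [^]\<^bsub>G\<^esub> i) = y [^]\<^bsub>G\<^esub> (j - i)" using y by (simp add: G.m_assoc)
        ultimately show False using inf[of "j - i"] ij yp by simp
      qed
    qed
    then obtain J :: nat where J: "0 < J" "pt (inv\<^bsub>G\<^esub> (y [^]\<^bsub>G\<^esub> J)) b = \<zero>" by blast
    have shift: "y \<otimes>\<^bsub>G\<^esub> inv\<^bsub>G\<^esub> (y [^]\<^bsub>G\<^esub> Suc k) = inv\<^bsub>G\<^esub> (y [^]\<^bsub>G\<^esub> k)" for k :: nat
      using y by (simp add: G.inv_mult G.m_ac flip: G.m_assoc)
    \<comment> \<open>Starting at a negative power of y where the part of b vanishes, the recursion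
      without source term propagates membership in Q upwards, as far as the power -1.\<close>
    have neg: "pt (inv\<^bsub>G\<^esub> (y [^]\<^bsub>G\<^esub> (J - d))) b \<in> Q" if "d < J" for d
      using that
    proof (induction d)
      case 0
      then show ?case using J(2) subspaceD(2)[OF W] by simp
    next
      case (Suc d)
      let ?k = "J - Suc d"
      have k: "J - d = Suc ?k" "0 < ?k" using Suc.prems by auto
      have "\<not> E \<one>\<^bsub>G\<^esub> (inv\<^bsub>G\<^esub> (y [^]\<^bsub>G\<^esub> ?k))"
      proof
        assume "E \<one>\<^bsub>G\<^esub> (inv\<^bsub>G\<^esub> (y [^]\<^bsub>G\<^esub> ?k))"
        then have "E (y [^]\<^bsub>G\<^esub> ?k \<otimes>\<^bsub>G\<^esub> \<one>\<^bsub>G\<^esub>) (y [^]\<^bsub>G\<^esub> ?k \<otimes>\<^bsub>G\<^esub> inv\<^bsub>G\<^esub> (y [^]\<^bsub>G\<^esub> ?k))"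
          using iy yp by (intro E_mult) auto
        then show False using inf[OF k(2)] yp by simp
      qed
      then have "cg Q \<zero> (T (pt (inv\<^bsub>G\<^esub> (y [^]\<^bsub>G\<^esub> Suc ?k)) b) \<ominus> \<one>\<^bsub>K\<^esub> \<odot> pt (inv\<^bsub>G\<^esub> (y [^]\<^bsub>G\<^esub> ?k)) b)"
        using compare[OF b(1) K.one_closed iy b(2), of "Suc ?k"] unfolding shift by (simp add: pt_one')
      then have "cg Q \<zero> (T (pt (inv\<^bsub>G\<^esub> (y [^]\<^bsub>G\<^esub> Suc ?k)) b) \<ominus> pt (inv\<^bsub>G\<^esub> (y [^]\<^bsub>G\<^esub> ?k)) b)"
        using ptc[OF b(1)] by (simp del: G.nat_pow_Suc)
      then have "cg Q (T (pt (inv\<^bsub>G\<^esub> (y [^]\<^bsub>G\<^esub> Suc ?k)) b)) (pt (inv\<^bsub>G\<^esub> (y [^]\<^bsub>G\<^esub> ?k)) b)"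
        by (rule cg_zero_minus[OF W Tc[OF ptc[OF b(1)]] ptc[OF b(1)]])
      moreover have "T (pt (inv\<^bsub>G\<^esub> (y [^]\<^bsub>G\<^esub> Suc ?k)) b) \<in> Q" using Suc k(1) by (intro TQ) simp
      ultimately show ?case using cg_mem[OF W] by blast
    qed
    \<comment> \<open>The source term 1 enters at the power 0, where the part of b becomes -1.
      Afterwards it is carried along as -u^i and never dies out modulo Q, which contradicts the
      finite support of b.\<close>
    have pos: "cg Q (pt (y [^]\<^bsub>G\<^esub> i) b) (\<ominus> (u [^] i))" for i :: nat
    proof (induction i)
      case 0
      have 1: "inv\<^bsub>G\<^esub> (y [^]\<^bsub>G\<^esub> (0::nat)) = \<one>\<^bsub>G\<^esub>" by simp
      have 2: "cg Q \<one> (T (pt (inv\<^bsub>G\<^esub> (y [^]\<^bsub>G\<^esub> Suc 0)) b) \<ominus> \<one>\<^bsub>K\<^esub> \<odot> pt \<one>\<^bsub>G\<^esub> b)"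
        using compare[OF b(1) K.one_closed iy b(2), of "Suc 0"] pt_one[OF E_one] unfolding shift 1 by simp
      have "T (pt (inv\<^bsub>G\<^esub> (y [^]\<^bsub>G\<^esub> Suc 0)) b) \<in> Q" using neg[of "J - 1"] J(1) by (intro TQ) simp
      then have 3: "cg Q (T (pt (inv\<^bsub>G\<^esub> (y [^]\<^bsub>G\<^esub> Suc 0)) b) \<oplus> \<ominus> pt \<one>\<^bsub>G\<^esub> b) (\<zero> \<oplus> \<ominus> pt \<one>\<^bsub>G\<^esub> b)"
        using Tc ptc b(1) by (intro cg_add[OF W] cg_refl[OF W]) (auto simp: cg_zero[OF W])
      have "T (pt (inv\<^bsub>G\<^esub> (y [^]\<^bsub>G\<^esub> Suc 0)) b) \<ominus> \<one>\<^bsub>K\<^esub> \<odot> pt \<one>\<^bsub>G\<^esub> b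
        = T (pt (inv\<^bsub>G\<^esub> (y [^]\<^bsub>G\<^esub> Suc 0)) b) \<oplus> \<ominus> pt \<one>\<^bsub>G\<^esub> b"
        using ptc[OF b(1)] by (simp add: R.minus_eq)
      moreover have "\<zero> \<oplus> \<ominus> pt \<one>\<^bsub>G\<^esub> b = \<ominus> pt \<one>\<^bsub>G\<^esub> b" using ptc[OF b(1)] by simp
      ultimately have "cg Q \<one> (\<ominus> pt \<one>\<^bsub>G\<^esub> b)" using cg_trans[OF W 2] 3 by metis
      then have "cg Q (\<ominus>\<^bsub>K\<^esub> \<one>\<^bsub>K\<^esub> \<odot> \<one>) (\<ominus>\<^bsub>K\<^esub> \<one>\<^bsub>K\<^esub> \<odot> (\<ominus> pt \<one>\<^bsub>G\<^esub> b))" by (intro cg_smult[OF W]) auto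
      then have "cg Q (\<ominus> \<one>) (pt \<one>\<^bsub>G\<^esub> b)" using neg_smult[of \<one>] neg_smult[of "\<ominus> pt \<one>\<^bsub>G\<^esub> b"] ptc[OF b(1)] by simp
      then show ?case using cg_sym[OF W] by simp
    next
      case (Suc i)
      have ne: "\<not> E \<one>\<^bsub>G\<^esub> (y [^]\<^bsub>G\<^esub> Suc i)" using inf[of "Suc i"] E_sym by blast
      have "cg Q \<zero> (T (pt (y [^]\<^bsub>G\<^esub> i) b) \<ominus> \<one>\<^bsub>K\<^esub> \<odot> pt (y [^]\<^bsub>G\<^esub> Suc i) b)"
        using compare[OF b(1) K.one_closed yp b(2), of i] pt_one'[OF ne] unfolding pow_Suc by simp
      then have "cg Q \<zero> (T (pt (y [^]\<^bsub>G\<^esub> i) b) \<ominus> pt (y [^]\<^bsub>G\<^esub> Suc i) b)"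
        using ptc[OF b(1)] by (simp del: G.nat_pow_Suc)
      then have "cg Q (T (pt (y [^]\<^bsub>G\<^esub> i) b)) (pt (y [^]\<^bsub>G\<^esub> Suc i) b)"
        by (rule cg_zero_minus[OF W Tc[OF ptc[OF b(1)]] ptc[OF b(1)]])
      moreover have "cg Q (T (pt (y [^]\<^bsub>G\<^esub> i) b)) (T (\<ominus> (u [^] i)))" using Suc by (rule Tcg)
      moreover have "T (\<ominus> (u [^] i)) = \<ominus> (u [^] Suc i)"
        using Tsmult[of "\<ominus>\<^bsub>K\<^esub> \<one>\<^bsub>K\<^esub>" "u [^] i"] Tpow[of i] neg_smult[of "u [^] i"] neg_smult[of "u [^] Suc i"] uc by simp
      ultimately show ?case using cg_trans[OF W cg_sym[OF W]] by metis
    qed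
    have "\<exists>i>0. pt (y [^]\<^bsub>G\<^esub> (i::nat)) b = \<zero>"
    proof (rule vanish[of "\<lambda>i::nat. y [^]\<^bsub>G\<^esub> i"])
      fix i j :: nat assume ij: "i < j"
      show "\<not> E (y [^]\<^bsub>G\<^esub> i) (y [^]\<^bsub>G\<^esub> j)"
      proof
        assume "E (y [^]\<^bsub>G\<^esub> i) (y [^]\<^bsub>G\<^esub> j)"
        then have "E (inv\<^bsub>G\<^esub> (y [^]\<^bsub>G\<^esub> i) \<otimes>\<^bsub>G\<^esub> y [^]\<^bsub>G\<^esub> i) (inv\<^bsub>G\<^esub> (y [^]\<^bsub>G\<^esub> i) \<otimes>\<^bsub>G\<^esub> y [^]\<^bsub>G\<^esub> j)"
          using iy yp by (intro E_mult) auto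
        moreover have "y [^]\<^bsub>G\<^esub> j = y [^]\<^bsub>G\<^esub> i \<otimes>\<^bsub>G\<^esub> y [^]\<^bsub>G\<^esub> (j - i)" using ij y by (simp add: G.nat_pow_mult)
        then have "inv\<^bsub>G\<^esub> (y [^]\<^bsub>G\<^esub> i) \<otimes>\<^bsub>G\<^esub> y [^]\<^bsub>G\<^esub> j = y [^]\<^bsub>G\<^esub> (j - i)" using y by (simp flip: G.m_assoc)
        ultimately show False using inf[of "j - i"] ij yp E_sym by simp
      qed
    qed
    then obtain i :: nat where "pt (y [^]\<^bsub>G\<^esub> i) b = \<zero>" by blast
    then have "cg Q (\<ominus> (u [^] i)) \<zero>" using pos[of i] cg_sym[OF W] by simp
    then have "\<ominus> (u [^] i) \<in> Q" using cg_zero[OF W] cgD(1) by blast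
    then have "\<ominus>\<^bsub>K\<^esub> \<one>\<^bsub>K\<^esub> \<odot> (\<ominus> (u [^] i)) \<in> Q" by (intro subspaceD(4)[OF W]) auto
    then have "u [^] i \<in> Q" using neg_smult[of "\<ominus> (u [^] i)"] uc by simp
    then show False using powQ by blast
  qed
qed

end

lemma (in abelian_group) add_minus_cancel:
  "a \<in> carrier G \<Longrightarrow> b \<in> carrier G \<Longrightarrow> (a \<oplus> b) \<ominus> a = b"
  by (simp add: minus_eq a_comm[of "a \<oplus> b"] r_neg1)

lemma (in ring) maximal_left_ideal_containing:
  assumes I: "left_ideal I R" and z: "z \<in> carrier R"
    and proper: "\<And>a i. a \<in> carrier R \<Longrightarrow> i \<in> I \<Longrightarrow> a \<otimes> z \<oplus> i \<noteq> \<one>"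
  shows "\<exists>L. left_ideal L R \<and> I \<subseteq> L \<and> z \<in> L \<and> \<one> \<notin> L \<and>
    (\<forall>N. left_ideal N R \<longrightarrow> L \<subseteq> N \<longrightarrow> \<one> \<notin> N \<longrightarrow> N = L)"
proof -
  let ?N = "{a \<otimes> z \<oplus> i | a i. a \<in> carrier R \<and> i \<in> I}"
  have N: "left_ideal ?N R" using I z by (rule left_ideal_sum_cyclic)
  have N1: "?N \<inter> {\<one>} = {}" using proper by fastforce
  obtain L where L: "left_ideal L R" "?N \<subseteq> L" "L \<inter> {\<one>} = {}"
    and max: "\<forall>N. left_ideal N R \<longrightarrow> L \<subseteq> N \<longrightarrow> N \<inter> {\<one>} = {} \<longrightarrow> N = L"
    using left_ideal_maximal_avoiding[OF N N1] by (elim exE conjE)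
  have "i = \<zero> \<otimes> z \<oplus> i" if "i \<in> I" for i using that z left_ideal_subset[OF I] by auto
  then have "I \<subseteq> ?N" by blast
  moreover have "z = \<one> \<otimes> z \<oplus> \<zero>" using z by simp
  then have "z \<in> ?N" using left_ideal_zero[OF I] by blast
  ultimately show ?thesis using L max by blast
qed

section \<open>Simple modules and maximal ideals within one stratum\<close>

context stratum_algebra
begin

text \<open>Homogeneous components are combinations of monomials of the same degree, so an element
  with degrees in one class lies in W as soon as all monomials of that class do.\<close>

lemma monomial_in_class:
  assumes m: "m \<in> carrier R" and sup: "\<And>z. z \<in> supp m \<Longrightarrow> E z x" and W: "subspace W" and mW: "m \<notin> W"
  shows "\<exists>\<alpha>\<in>exps n. E (deg \<alpha>) x \<and> mon \<alpha> \<notin> W"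
proof (rule ccontr)
  assume no: "\<not> ?thesis"
  have "m \<in> W"
  proof (rule subspace_cmps[OF W m])
    fix z assume z: "z \<in> supp m"
    have zG: "z \<in> carrier G" using z supp_subset[OF m] by blast
    show "cmp m z \<in> W"
    proof (rule homogeneous_monomials_span[OF W zG cmp_in[OF m zG]])
      fix \<alpha> assume "\<alpha> \<in> exps n" "deg \<alpha> = z"
      then show "mon \<alpha> \<in> W" using no sup[OF z] by blast
    qed
  qed
  then show False using mW by blast
qed

text \<open>The exponent of the product u of the \<open>r i\<close> with i outside w: an ideal that
  avoids this single monomial contains none of these \<open>r i\<close>.\<close>

definition off_exp :: "nat \<Rightarrow> nat" where
  "off_exp i = (if i \<in> {1..n} - w then 1 else 0)"

lemma off_exp_off: "off_exp \<in> off"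
  unfolding off_def exps_def off_exp_def by auto

lemma mon_off_exp_factor:
  "i \<in> {1..n} - w \<Longrightarrow> mon off_exp = mon (off_exp(i := off_exp i - 1)) \<otimes> r i"
  by (rule mon_factor) (auto simp: off_exp_def)

text \<open>In \<open>A\<close>, too, u is a multiple of each of its factors \<open>r i\<close>, up
  to a unit.\<close>

lemma mon_off_exp_mem:
  assumes I: "tideal I" and i: "i \<in> {1..n} - w" and ri: "r i \<in> I"
  shows "mon off_exp \<in> I"
proof -
  have iI: "i \<in> {1..n}" using i by blast
  let ?\<beta> = "off_exp(i := off_exp i - 1)"
  have "mon ?\<beta> \<otimes> sg (c (deg ?\<beta>)) (r i) \<in> I"
    using ri by (rule tideal_mult(1)[OF I deg_closed mon_homog])
  moreover have "sg (c (deg ?\<beta>)) (r i) = c (deg ?\<beta>) (\<delta> i) \<odot> r i"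
    by (rule sg_homog[OF kfun_cl[OF deg_closed] delta_closed[OF iI] r_homog[OF iI]])
  ultimately have "c (deg ?\<beta>) (\<delta> i) \<odot> mon off_exp \<in> I"
    unfolding mon_off_exp_factor[OF i] using delta_closed[OF iI] r_closed[OF iI] by (simp add: smult_mult_right)
  then show ?thesis
    using delta_closed[OF iI] c_nonzero subspace_cancel[OF tideal_subspace[OF I] mon_closed] by (metis c_closed deg_closed)
qed

context
  fixes V :: "('a, 'v, 'm) module_scheme" and Q
  assumes V: "simple_module A V" and Qdef: "Q = {m \<in> carrier R. \<tau> m \<in> annihilator A V}"
    and Qr: "\<And>i. i \<in> {1..n} \<Longrightarrow> r i \<in> Q \<longleftrightarrow> i \<in> w"
begin

lemma annihilator_image: "\<tau> ` Q = annihilator A V"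
proof -
  interpret V: simple_module A V by (rule V)
  show ?thesis unfolding Qdef using V.annihilator_ideal by (rule tideal_preimage(2))
qed

lemma annihilator_tprime: "tprime Q"
proof -
  interpret V: simple_module A V by (rule V)
  show ?thesis
    unfolding tprime_def annihilator_image using V.annihilator_prime unfolding Qdef by blast
qed

lemma annihilator_mem:
  "m \<in> carrier R \<Longrightarrow> m \<in> Q \<longleftrightarrow> (\<forall>v\<in>carrier V. \<tau> m \<odot>\<^bsub>V\<^esub> v = \<zero>\<^bsub>V\<^esub>)"
  unfolding Qdef annihilator_def by simp

text \<open>Elements with degrees in one class act on V semilinearly with respect to one
  automorphism, the scaling by c(x, -)^2; degrees outside G_w act as zero. So t acts bijectively by
  Schur's lemma, and the action of s composed with the inverse of that of t is linear, hence
  scalar.\<close>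

lemma class_scalar:
  assumes x: "x \<in> carrier G" and s: "s \<in> carrier R" "\<And>z. z \<in> supp s \<Longrightarrow> E z x"
    and t: "t \<in> carrier R" "\<And>z. z \<in> supp t \<Longrightarrow> E z x" "t \<notin> Q"
  shows "\<exists>k\<in>carrier K. s \<ominus> k \<odot> t \<in> Q"
proof -
  interpret V: simple_module A V by (rule V)
  define \<phi> where "\<phi> = (\<lambda>z. c x z \<otimes>\<^bsub>K\<^esub> c x z)"
  have ch: "\<phi> \<in> chars G K" unfolding \<phi>_def by (rule chars_prod[OF c_left_char[OF x] c_left_char[OF x]])
  note kf = chars_kfun[OF ch] and kf' = chars_kfun[OF chars_inverse[OF ch]]
  have comm: "\<tau> p \<odot>\<^bsub>V\<^esub> (\<tau> a \<odot>\<^bsub>V\<^esub> v) = \<tau> (sg \<phi> a) \<odot>\<^bsub>V\<^esub> (\<tau> p \<odot>\<^bsub>V\<^esub> v)"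
    if p: "p \<in> carrier R" "\<And>z. z \<in> supp p \<Longrightarrow> E z x" and a: "a \<in> carrier R" and v: "v \<in> carrier V" for p a v
    using a
  proof (induction a rule: graded_induct)
    case zero
    then show ?case using p(1) v kf by (simp add: sg_zero tau_zero V.smult_zero_left V.smult_zero_right V.smult_closed)
  next
    case (homog j b)
    have bc: "b \<in> carrier R" using homog_closed[OF homog] .
    have kj: "\<phi> j \<in> carrier K" using kfunD[OF kf homog(1)] .
    have sb: "sg \<phi> b = \<phi> j \<odot> b" using sg_homog[OF kf homog] .
    have sbc: "sg \<phi> b \<in> carrier R" using kf bc by simp
    have pv: "\<tau> p \<odot>\<^bsub>V\<^esub> v \<in> carrier V" using p(1) v by (simp add: V.smult_closed)
    show ?case
    proof (cases "j \<in> S")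
      case True
      have "\<tau> p \<otimes>\<^bsub>A\<^esub> \<tau> b = \<tau> (\<phi> j \<odot> \<one>) \<otimes>\<^bsub>A\<^esub> (\<tau> b \<otimes>\<^bsub>A\<^esub> \<tau> p)"
        unfolding \<phi>_def using p(1) x p(2) True homog(2) by (rule class_commute)
      also have "\<dots> = (\<tau> (\<phi> j \<odot> \<one>) \<otimes>\<^bsub>A\<^esub> \<tau> b) \<otimes>\<^bsub>A\<^esub> \<tau> p" using kj bc p(1) by (simp add: A.m_assoc)
      also have "\<dots> = \<tau> (sg \<phi> b) \<otimes>\<^bsub>A\<^esub> \<tau> p" unfolding sb tau_smult_one[OF kj bc] ..
      finally have "(\<tau> p \<otimes>\<^bsub>A\<^esub> \<tau> b) \<odot>\<^bsub>V\<^esub> v = (\<tau> (sg \<phi> b) \<otimes>\<^bsub>A\<^esub> \<tau> p) \<odot>\<^bsub>V\<^esub> v" by simp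
      then show ?thesis using p(1) bc sbc v by (simp add: V.smult_assoc)
    next
      case False
      have bQ: "b \<in> Q" by (rule tprime_outside[OF annihilator_tprime Qr homog(1) False homog(2)])
      then have "sg \<phi> b \<in> Q" unfolding sb using kj subspaceD(4)[OF tideal_subspace[OF tprime_tideal[OF annihilator_tprime]]] by blast
      then have "\<tau> (sg \<phi> b) \<odot>\<^bsub>V\<^esub> (\<tau> p \<odot>\<^bsub>V\<^esub> v) = \<zero>\<^bsub>V\<^esub>" using annihilator_mem[OF sbc] pv by blast
      moreover have "\<tau> b \<odot>\<^bsub>V\<^esub> v = \<zero>\<^bsub>V\<^esub>" using annihilator_mem[OF bc] bQ v by blast
      ultimately show ?thesis using p(1) by (simp add: V.smult_zero_right)
    qed
  next
    case (add a b)
    then show ?case using p(1) v kf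
      by (simp add: sg_add tau_add V.smult_l_distr V.smult_r_distr V.smult_closed)
  qed
  have act: "\<exists>b\<in>carrier A. \<forall>v\<in>carrier V. a \<odot>\<^bsub>V\<^esub> (\<tau> s \<odot>\<^bsub>V\<^esub> v) = \<tau> s \<odot>\<^bsub>V\<^esub> (b \<odot>\<^bsub>V\<^esub> v) \<and>
      a \<odot>\<^bsub>V\<^esub> (\<tau> t \<odot>\<^bsub>V\<^esub> v) = \<tau> t \<odot>\<^bsub>V\<^esub> (b \<odot>\<^bsub>V\<^esub> v)" if a: "a \<in> carrier A" for a
  proof -
    obtain a' where a': "a' \<in> carrier R" "a = \<tau> a'" using tau_surj[OF a] by blast
    let ?b = "sg (\<lambda>z. inv\<^bsub>K\<^esub> \<phi> z) a'"
    have bc: "?b \<in> carrier R" using kf' a' by simp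
    have "a \<odot>\<^bsub>V\<^esub> (\<tau> s \<odot>\<^bsub>V\<^esub> v) = \<tau> s \<odot>\<^bsub>V\<^esub> (\<tau> ?b \<odot>\<^bsub>V\<^esub> v) \<and>
      a \<odot>\<^bsub>V\<^esub> (\<tau> t \<odot>\<^bsub>V\<^esub> v) = \<tau> t \<odot>\<^bsub>V\<^esub> (\<tau> ?b \<odot>\<^bsub>V\<^esub> v)" if "v \<in> carrier V" for v
      using comm[OF s bc that] comm[OF t(1,2) bc that] sg_char_inverse(1)[OF ch a'(1)] a'(2) by simp
    then show ?thesis using bc by (intro bexI[of _ "\<tau> ?b"]) auto
  qed
  define f g where "f v = \<tau> t \<odot>\<^bsub>V\<^esub> v" and "g v = \<tau> s \<odot>\<^bsub>V\<^esub> v" for v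
  have fc: "f v \<in> carrier V" and gc: "g v \<in> carrier V" if "v \<in> carrier V" for v
    unfolding f_def g_def using s t that by (auto simp: V.smult_closed)
  have fadd: "f (u \<oplus>\<^bsub>V\<^esub> v) = f u \<oplus>\<^bsub>V\<^esub> f v" and gadd: "g (u \<oplus>\<^bsub>V\<^esub> v) = g u \<oplus>\<^bsub>V\<^esub> g v"
    if "u \<in> carrier V" "v \<in> carrier V" for u v
    unfolding f_def g_def using s t that by (auto simp: V.smult_r_distr)
  have fg: "\<exists>b\<in>carrier A. \<forall>v\<in>carrier V. a \<odot>\<^bsub>V\<^esub> g v = g (b \<odot>\<^bsub>V\<^esub> v) \<and> a \<odot>\<^bsub>V\<^esub> f v = f (b \<odot>\<^bsub>V\<^esub> v)"
    if "a \<in> carrier A" for a unfolding f_def g_def using act[OF that] .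
  obtain v0 where v0: "v0 \<in> carrier V" "f v0 \<noteq> \<zero>\<^bsub>V\<^esub>" unfolding f_def using annihilator_mem[OF t(1)] t(3) by blast
  have bij: "bij_betw f (carrier V) (carrier V)"
  proof (rule V.bij_betw_if[OF fc fadd _ _ v0])
    show "f (a \<odot>\<^bsub>V\<^esub> v) = \<zero>\<^bsub>V\<^esub>" if a: "a \<in> carrier A" and v: "v \<in> carrier V" and 0: "f v = \<zero>\<^bsub>V\<^esub>" for a v
    proof -
      obtain a' where a': "a' \<in> carrier R" "a = \<tau> a'" using tau_surj[OF a] by blast
      have "f (a \<odot>\<^bsub>V\<^esub> v) = \<tau> (sg \<phi> a') \<odot>\<^bsub>V\<^esub> f v" unfolding f_def a'(2) using comm[OF t(1,2) a'(1) v] .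
      then show ?thesis unfolding 0 using a'(1) kf by (simp add: V.smult_zero_right)
    qed
    show "\<exists>u\<in>carrier V. a \<odot>\<^bsub>V\<^esub> f v = f u" if a: "a \<in> carrier A" and v: "v \<in> carrier V" for a v
    proof -
      obtain b where "b \<in> carrier A" "a \<odot>\<^bsub>V\<^esub> f v = f (b \<odot>\<^bsub>V\<^esub> v)" using fg[OF a] v by blast
      then show ?thesis using V.smult_closed v by blast
    qed
  qed
  \<comment> \<open>The action of s after the inverse of the action of t: the two semilinearities
    cancel.\<close>
  define \<theta> where "\<theta> v = g (inv_into (carrier V) f v)" for v
  have theta: "\<theta> (f u) = g u" if "u \<in> carrier V" for u
    unfolding \<theta>_def using inv_into_f_f[OF bij_betw_imp_inj_on[OF bij] that] by simp
  have surj: "\<exists>u\<in>carrier V. v = f u" if "v \<in> carrier V" for v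
    using bij that unfolding bij_betw_def by blast
  have "\<exists>k\<in>carrier K. \<forall>v\<in>carrier V. \<theta> v = \<tau> (k \<odot> \<one>) \<odot>\<^bsub>V\<^esub> v"
  proof (rule simple_module_scalar[OF V])
    show "\<theta> v \<in> carrier V" if v: "v \<in> carrier V" for v
    proof -
      obtain u where "u \<in> carrier V" "v = f u" using surj[OF v] by blast
      then show ?thesis using theta gc by simp
    qed
    show "\<theta> (v \<oplus>\<^bsub>V\<^esub> v') = \<theta> v \<oplus>\<^bsub>V\<^esub> \<theta> v'" if v: "v \<in> carrier V" "v' \<in> carrier V" for v v'
    proof -
      obtain u u' where u: "u \<in> carrier V" "v = f u" "u' \<in> carrier V" "v' = f u'" using surj[OF v(1)] surj[OF v(2)] by blast
      then have "v \<oplus>\<^bsub>V\<^esub> v' = f (u \<oplus>\<^bsub>V\<^esub> u')" using fadd by simp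
      then show ?thesis using theta[of "u \<oplus>\<^bsub>V\<^esub> u'"] theta[of u] theta[of u'] u gadd by simp
    qed
    show "\<theta> (a \<odot>\<^bsub>V\<^esub> v) = a \<odot>\<^bsub>V\<^esub> \<theta> v" if a: "a \<in> carrier A" and v: "v \<in> carrier V" for a v
    proof -
      obtain u where u: "u \<in> carrier V" "v = f u" using surj[OF v] by blast
      obtain b where b: "b \<in> carrier A" "a \<odot>\<^bsub>V\<^esub> g u = g (b \<odot>\<^bsub>V\<^esub> u)" "a \<odot>\<^bsub>V\<^esub> f u = f (b \<odot>\<^bsub>V\<^esub> u)"
        using fg[OF a] u(1) by blast
      have "b \<odot>\<^bsub>V\<^esub> u \<in> carrier V" using b(1) u(1) by (rule V.smult_closed)
      then show ?thesis using theta[of "b \<odot>\<^bsub>V\<^esub> u"] theta[OF u(1)] b u(2) by simp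
    qed
  qed
  then obtain k where k: "k \<in> carrier K" "\<And>v. v \<in> carrier V \<Longrightarrow> \<theta> v = \<tau> (k \<odot> \<one>) \<odot>\<^bsub>V\<^esub> v" by blast
  have "\<tau> (s \<ominus> k \<odot> t) \<odot>\<^bsub>V\<^esub> u = \<zero>\<^bsub>V\<^esub>" if u: "u \<in> carrier V" for u
  proof -
    have "\<tau> s \<odot>\<^bsub>V\<^esub> u = \<tau> (k \<odot> \<one>) \<odot>\<^bsub>V\<^esub> (\<tau> t \<odot>\<^bsub>V\<^esub> u)"
      using theta[OF u] k(2)[OF fc[OF u]] unfolding f_def g_def by simp
    also have "\<dots> = (\<tau> (k \<odot> \<one>) \<otimes>\<^bsub>A\<^esub> \<tau> t) \<odot>\<^bsub>V\<^esub> u" using k(1) t(1) u by (simp add: V.smult_assoc)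
    also have "\<dots> = \<tau> (k \<odot> t) \<odot>\<^bsub>V\<^esub> u" using tau_smult_one[OF k(1) t(1)] by simp
    finally have eq: "\<tau> s \<odot>\<^bsub>V\<^esub> u = \<tau> (k \<odot> t) \<odot>\<^bsub>V\<^esub> u" .
    have kt: "\<tau> (k \<odot> t) \<in> carrier A" "\<tau> (k \<odot> t) \<odot>\<^bsub>V\<^esub> u \<in> carrier V" using k(1) t(1) u by (auto simp: V.smult_closed)
    have "\<tau> (s \<ominus> k \<odot> t) = \<tau> s \<oplus>\<^bsub>A\<^esub> \<ominus>\<^bsub>A\<^esub> \<tau> (k \<odot> t)" using s(1) k(1) t(1) by (simp add: tau_minus A.minus_eq)
    then have "\<tau> (s \<ominus> k \<odot> t) \<odot>\<^bsub>V\<^esub> u = \<tau> s \<odot>\<^bsub>V\<^esub> u \<oplus>\<^bsub>V\<^esub> \<ominus>\<^bsub>V\<^esub> (\<tau> (k \<odot> t) \<odot>\<^bsub>V\<^esub> u)"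
      using s(1) kt(1) u by (simp add: V.smult_l_distr V.smult_neg_left)
    then show ?thesis unfolding eq using kt(2) by (simp add: V.M.r_neg)
  qed
  then have "s \<ominus> k \<odot> t \<in> Q" using annihilator_mem[of "s \<ominus> k \<odot> t"] s(1) t(1) k(1) by simp
  then show ?thesis using k(1) by blast
qed

text \<open>By \<open>shifted_left_ideal_proper\<close> for the trivial twist, Q and u - \<mu> lie
  in a maximal ideal M of \<open>R\<close>. It misses u because \<mu> is nonzero, which fixes the
  stratum of M.\<close>

lemma exists_maximal_above: "\<exists>M\<in>max_stratum R n r w. core M = Q"
proof -
  note tQ = annihilator_tprime
  note tiQ = tprime_tideal[OF tQ]
  note W = tideal_subspace[OF tiQ]
  have Qc: "Q \<subseteq> carrier R" using subspaceD(1)[OF W] .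
  have idQ: "ideal Q R" by (rule tprime_ideal[OF tQ Qr])
  have one: "\<one> \<notin> Q" using tQ by (rule tprime_one)
  interpret T: twisted_algebra R K G \<G> n r \<delta> "\<lambda>_ _. \<one>\<^bsub>K\<^esub>" R id by (rule trivial_twist)
  define u y where "u = mon off_exp" and "y = deg off_exp"
  have yG: "y \<in> carrier G" and u: "u \<in> \<G> y" and uc: "u \<in> carrier R" unfolding u_def y_def using mon_homog by auto
  have uQ: "u \<notin> Q" unfolding u_def by (rule tprime_mon[OF tQ Qr off_exp_off])
  have yS: "y \<in> S" unfolding y_def using off_exp_off by (rule deg_S)
  have upow: "u [^] s \<notin> Q" for s :: nat
  proof (induction s)
    case (Suc s)
    then show ?case
      using tprime_homog_both[OF tQ G.nat_pow_closed[OF yG] yG pow_homog[OF yG u] u] uQ by auto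
  qed (use one in simp)
  have TQ: "T.tideal Q" unfolding T.tideal_def using Qc idQ by simp
  have "\<exists>\<mu>\<in>carrier K - {\<zero>\<^bsub>K\<^esub>}. \<forall>b\<in>carrier R. \<one> \<ominus> (u \<otimes> sg (\<lambda>z. \<one>\<^bsub>K\<^esub>) b \<ominus> \<mu> \<odot> b) \<notin> Q"
  proof (rule T.shifted_left_ideal_proper[OF TQ one, of E y u])
    show "E z x" if "E x z" for x z using that by (rule E_sym)
    show "E x z" if "E x x'" "E x' z" for x x' z using that by (rule E_trans)
    show "E (z \<otimes>\<^bsub>G\<^esub> x) (z \<otimes>\<^bsub>G\<^esub> x')" if "x \<in> carrier G" "x' \<in> carrier G" "z \<in> carrier G" "E x x'" for x x' z
      using that(3,3,1,2) E_refl that(4) by (rule E_mult)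
    show "E \<one>\<^bsub>G\<^esub> \<one>\<^bsub>G\<^esub>" by (rule E_refl)
    show "part x m \<in> Q" if "m \<in> Q" "x \<in> carrier G" for m x by (rule tprime_part[OF tQ Qr that])
    show "y \<in> carrier G" by (rule yG)
    show "u \<in> \<G> y" by (rule u)
    \<comment> \<open>The product u b of \<open>R\<close> is the product of \<open>A\<close> with b
      rescaled by c(-, y). Primality in \<open>A\<close> puts the rescaled element into Q, and Q is
      stable under c(y, -).\<close>
    show "b \<in> Q" if b: "b \<in> carrier R" and ub: "u \<otimes> sg (\<lambda>z. \<one>\<^bsub>K\<^esub>) b \<in> Q" for b
    proof -
      have cb: "sg (cr y) b \<in> carrier R" using kfun_cr[OF yG] b by simp
      have "u \<otimes> sg (c y) (sg (cr y) b) \<in> Q" using ub sg_one[OF b] sg_cl_cr[OF yG b] by simp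
      then have sQ: "sg (cr y) b \<in> Q" using tprime_homog(1)[OF tQ yG u cb] uQ by blast
      have "sg (c y) (sg (cr y) b) \<in> Q" by (rule tprime_sg_cl[OF tQ Qr yS sQ])
      then show ?thesis using sg_cl_cr[OF yG b] by simp
    qed
    \<comment> \<open>Both u^s and 1 have their degree in the neutral class, so
      \<open>class_scalar\<close> makes them proportional modulo Q.\<close>
    show "\<exists>l\<in>carrier K - {\<zero>\<^bsub>K\<^esub>}. u [^] s \<ominus> l \<odot> \<one> \<in> Q"
      if s: "0 < s" "E (y [^]\<^bsub>G\<^esub> s) \<one>\<^bsub>G\<^esub>" for s :: nat
    proof -
      have usup: "E z \<one>\<^bsub>G\<^esub>" if "z \<in> supp (u [^] s)" for z
        using supp_homog[OF G.nat_pow_closed[OF yG] pow_homog[OF yG u, of s]] that s(2) by blast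
      have osup: "E z \<one>\<^bsub>G\<^esub>" if "z \<in> supp \<one>" for z
        using supp_homog[OF G.one_closed one_homog] that E_refl by blast
      have "\<exists>l\<in>carrier K. u [^] s \<ominus> l \<odot> \<one> \<in> Q"
        using G.one_closed _ usup R.one_closed osup one by (rule class_scalar) (use uc in auto)
      then obtain l where l: "l \<in> carrier K" "u [^] s \<ominus> l \<odot> \<one> \<in> Q" by blast
      have "l \<noteq> \<zero>\<^bsub>K\<^esub>"
      proof
        assume "l = \<zero>\<^bsub>K\<^esub>"
        then have "u [^] s \<in> Q" using l(2) uc by (simp add: Alg.smult_l_null R.minus_eq)
        then show False using upow by blast
      qed
      then show ?thesis using l by blast
    qed
  qed
  then obtain \<mu> where mu: "\<mu> \<in> carrier K" "\<mu> \<noteq> \<zero>\<^bsub>K\<^esub>"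
    and proper: "\<And>b. b \<in> carrier R \<Longrightarrow> \<one> \<ominus> (u \<otimes> b \<ominus> \<mu> \<odot> b) \<notin> Q" using sg_one by auto
  let ?z = "u \<ominus> \<mu> \<odot> \<one>"
  have zc: "?z \<in> carrier R" using uc mu by simp
  have lQ: "left_ideal Q R" using idQ R.left_ideal_iff by blast
  have ne: "a \<otimes> ?z \<oplus> q \<noteq> \<one>" if a: "a \<in> carrier R" and q: "q \<in> Q" for a q
  proof
    assume eq: "a \<otimes> ?z \<oplus> q = \<one>"
    have qc: "q \<in> carrier R" using q Qc by blast
    have "a \<otimes> ?z = u \<otimes> a \<ominus> \<mu> \<odot> a"
      using a uc mu(1) smult_mult_right[OF mu(1) a R.one_closed] R.m_comm[OF a uc]
      by (simp add: R.minus_eq R.r_distr R.r_minus)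
    then have "\<one> \<ominus> (u \<otimes> a \<ominus> \<mu> \<odot> a) = (a \<otimes> ?z \<oplus> q) \<ominus> a \<otimes> ?z" using eq by simp
    also have "\<dots> = q" using qc a zc by (intro R.add_minus_cancel) auto
    finally show False using proper[OF a] q by simp
  qed
  have "\<exists>L. left_ideal L R \<and> Q \<subseteq> L \<and> ?z \<in> L \<and> \<one> \<notin> L \<and>
    (\<forall>N. left_ideal N R \<longrightarrow> L \<subseteq> N \<longrightarrow> \<one> \<notin> N \<longrightarrow> N = L)"
    by (rule R.maximal_left_ideal_containing[OF lQ zc ne])
  then obtain M where M: "left_ideal M R" "Q \<subseteq> M" "?z \<in> M" "\<one> \<notin> M"
    and max: "\<forall>N. left_ideal N R \<longrightarrow> M \<subseteq> N \<longrightarrow> \<one> \<notin> N \<longrightarrow> N = M"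
    by (elim exE conjE)
  have idM: "ideal M R" using M(1) R.left_ideal_iff by blast
  interpret M: ideal M R by (rule idM)
  have maxM: "maximalideal M R"
  proof (rule maximalidealI[OF idM])
    show "carrier R \<noteq> M" using M(4) by blast
    fix J assume J: "ideal J R" "M \<subseteq> J" "J \<subseteq> carrier R"
    have "\<one> \<in> J \<Longrightarrow> J = carrier R" using ideal.one_imp_carrier[OF J(1)] .
    then show "J = M \<or> J = carrier R" using max J R.left_ideal_iff by blast
  qed
  have uM: "u \<notin> M"
  proof
    assume "u \<in> M"
    then have "u \<ominus> ?z \<in> M" using M(3) by (rule subspace_minus[OF ideal_subspace[OF idM]])
    moreover have "u \<ominus> ?z = \<mu> \<odot> \<one>" using uc mu by (simp add: R.minus_eq R.minus_add R.r_neg1 R.r_neg2)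
    ultimately have "\<mu> \<odot> \<one> \<in> M" by simp
    then show False using subspace_cancel[OF ideal_subspace[OF idM] R.one_closed mu] M(4) by blast
  qed
  have "r i \<in> M \<longleftrightarrow> i \<in> w" if i: "i \<in> {1..n}" for i
  proof
    assume ri: "r i \<in> M"
    show "i \<in> w"
    proof (rule ccontr)
      assume "i \<notin> w"
      then have "u = mon (off_exp(i := off_exp i - 1)) \<otimes> r i" unfolding u_def using i by (intro mon_off_exp_factor) blast
      then show False using ri uM M.I_l_closed by simp
    qed
  qed (use Qr[OF i] M(2) in blast)
  moreover have "primeideal M R" using maxM by (rule R.maximalideal_prime)
  ultimately have MS: "M \<in> max_stratum R n r w"
    unfolding max_stratum_def max_spec_def spec_stratum_def R.spec_commutative using maxM by blast
  then have MP: "M \<in> spec_stratum R n r w" unfolding max_stratum_def by blast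
  have "core M \<subseteq> Q"
  proof
    fix m assume m: "m \<in> core M"
    have mc: "m \<in> carrier R" using m core_carrier[OF MP] by blast
    show "m \<in> Q"
    proof (rule parts_in_imp[OF W mc], rule ccontr)
      fix x assume x: "x \<in> carrier G" and nQ: "part x m \<notin> Q"
      have pM: "part x m \<in> M" using core_part[OF MP m x] .
      have pc: "part x m \<in> carrier R" using mc by simp
      have psup: "E z x" if "z \<in> supp (part x m)" for z using part_supp[OF mc] that by blast
      \<comment> \<open>A monomial of the same class outside Q is proportional to the part modulo Q
        and would lie in M with it. But it involves only \<open>r i\<close> with i outside w, and M
        contains no such monomial.\<close>
      obtain \<alpha> where a: "\<alpha> \<in> exps n" "E (deg \<alpha>) x" "mon \<alpha> \<notin> Q"
        using monomial_in_class[OF pc psup W nQ] by blast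
      have ao: "\<alpha> \<in> off" using tprime_mon_in[OF tQ Qr a(1)] a(3) by blast
      have asup: "E z x" if "z \<in> supp (mon \<alpha>)" for z
        using supp_homog[OF deg_closed mon_homog, of \<alpha>] that a(2) by blast
      have "\<exists>k\<in>carrier K. mon \<alpha> \<ominus> k \<odot> part x m \<in> Q"
        using x mon_closed asup pc psup nQ by (rule class_scalar)
      then obtain k where k: "k \<in> carrier K" "mon \<alpha> \<ominus> k \<odot> part x m \<in> Q" by blast
      have "(mon \<alpha> \<ominus> k \<odot> part x m) \<oplus> k \<odot> part x m \<in> M"
        using k M(2) subspaceD(3,4)[OF ideal_subspace[OF idM]] pM by blast
      then have "mon \<alpha> \<in> M" using R.cancel_simps(1)[of "mon \<alpha>" "k \<odot> part x m" \<zero>] k(1) pc by simp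
      then show False using stratum_mon[OF MP ao] by blast
    qed
  qed
  moreover have "Q \<subseteq> core M" using tiQ M(2) by (rule core_largest[OF MP])
  ultimately show ?thesis using MS by blast
qed

end

text \<open>A maximal left ideal L above Q and u - \<mu> gives a simple module whose annihilator Q0
  contains Q. If Q0 contained u, the nonzero scalar \<mu> would be in L; so Q0 lies in the same
  stratum, where monomials of this stratum stay outside Q0 and force Q0 = Q.\<close>

lemma core_primitive:
  assumes MS: "M \<in> max_stratum R n r w" shows "\<tau> ` core M \<in> prim A"
proof -
  have MP: "M \<in> spec_stratum R n r w" and maxM: "maximalideal M R"
    using MS unfolding max_stratum_def max_spec_def by auto
  define Q where "Q = core M"
  have tQ: "tprime Q" unfolding Q_def using MP by (rule core_tprime)
  note tiQ = tprime_tideal[OF tQ]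
  note W = tideal_subspace[OF tiQ]
  have Qc: "Q \<subseteq> carrier R" using subspaceD(1)[OF W] .
  note WM = stratum_subspace[OF MP]
  have one: "\<one> \<notin> Q" using tQ by (rule tprime_one)
  define u y where "u = mon off_exp" and "y = deg off_exp"
  have yG: "y \<in> carrier G" and u: "u \<in> \<G> y" and uc: "u \<in> carrier R" unfolding u_def y_def using mon_homog by auto
  have uM: "u \<notin> M" unfolding u_def using off_exp_off by (rule stratum_mon[OF MP])
  then have uQ: "u \<notin> Q" unfolding Q_def using core_subset[OF MP] by blast
  have yS: "y \<in> S" unfolding y_def using off_exp_off by (rule deg_S)
  have upow: "u [^] s \<notin> M" for s :: nat
  proof (induction s)
    case (Suc s)
    then show ?case using stratum_primeD[OF MP, of "u [^] s" u] uM uc by auto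
  qed (use stratum_one[OF MP] in simp)
  have "\<exists>\<mu>\<in>carrier K - {\<zero>\<^bsub>K\<^esub>}. \<forall>b\<in>carrier R. \<one> \<ominus> (u \<otimes> sg (cr y) b \<ominus> \<mu> \<odot> b) \<notin> Q"
  proof (rule shifted_left_ideal_proper[OF tiQ one, of E y u])
    show "E z x" if "E x z" for x z using that by (rule E_sym)
    show "E x z" if "E x x'" "E x' z" for x x' z using that by (rule E_trans)
    show "E (z \<otimes>\<^bsub>G\<^esub> x) (z \<otimes>\<^bsub>G\<^esub> x')" if "x \<in> carrier G" "x' \<in> carrier G" "z \<in> carrier G" "E x x'" for x x' z
      using that(3,3,1,2) E_refl that(4) by (rule E_mult)
    show "E \<one>\<^bsub>G\<^esub> \<one>\<^bsub>G\<^esub>" by (rule E_refl)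
    show "part x m \<in> Q" if "m \<in> Q" "x \<in> carrier G" for m x using that unfolding Q_def by (rule core_part_core[OF MP])
    show "y \<in> carrier G" by (rule yG)
    show "u \<in> \<G> y" by (rule u)
    show "b \<in> Q" if "b \<in> carrier R" "u \<otimes> sg (cr y) b \<in> Q" for b
      using tprime_homog(2)[OF tQ yG u that] uQ by blast
    \<comment> \<open>Modulo M the power u^s is a scalar l by the Nullstellensatz. The difference
      has its degrees in the neutral class, so it lies even in the core.\<close>
    show "\<exists>l\<in>carrier K - {\<zero>\<^bsub>K\<^esub>}. u [^] s \<ominus> l \<odot> \<one> \<in> Q"
      if s: "0 < s" "E (y [^]\<^bsub>G\<^esub> s) \<one>\<^bsub>G\<^esub>" for s :: nat
    proof -
      have pc: "u [^] s \<in> carrier R" using uc by simp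
      obtain l where l: "l \<in> carrier K" "u [^] s \<ominus> l \<odot> \<one> \<in> M" using residue_scalar[OF maxM pc] by blast
      have lc: "l \<odot> \<one> \<in> carrier R" using l(1) by simp
      have usup: "E z \<one>\<^bsub>G\<^esub>" if "z \<in> supp (u [^] s)" for z
        using supp_homog[OF G.nat_pow_closed[OF yG] pow_homog[OF yG u, of s]] that s(2) by blast
      have osup: "E z \<one>\<^bsub>G\<^esub>" if "z \<in> supp (l \<odot> \<one>)" for z
        using supp_homog[OF G.one_closed one_homog] supp_smult[OF l(1) R.one_closed] that E_refl by blast
      have "E z \<one>\<^bsub>G\<^esub>" if "z \<in> supp (u [^] s \<ominus> l \<odot> \<one>)" for z
        using supp_minus[OF pc lc] that usup osup by blast
      then have "u [^] s \<ominus> l \<odot> \<one> \<in> Q" unfolding Q_def by (rule class_core[OF MP l(2) G.one_closed])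
      moreover have "l \<noteq> \<zero>\<^bsub>K\<^esub>"
      proof
        assume "l = \<zero>\<^bsub>K\<^esub>"
        then have "u [^] s \<in> M" using l(2) uc by (simp add: Alg.smult_l_null R.minus_eq)
        then show False using upow by blast
      qed
      ultimately show ?thesis using l by blast
    qed
  qed
  then obtain \<mu> where mu: "\<mu> \<in> carrier K" "\<mu> \<noteq> \<zero>\<^bsub>K\<^esub>"
    and proper: "\<And>b. b \<in> carrier R \<Longrightarrow> \<one> \<ominus> (u \<otimes> sg (cr y) b \<ominus> \<mu> \<odot> b) \<notin> Q" by blast
  let ?z = "\<tau> u \<ominus>\<^bsub>A\<^esub> \<tau> (\<mu> \<odot> \<one>)"
  have zc: "?z \<in> carrier A" using uc mu by simp
  interpret I: ideal "\<tau> ` Q" A using tiQ unfolding tideal_def by blast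
  have lQ: "left_ideal (\<tau> ` Q) A"
    unfolding left_ideal_def using I.Icarr I.zero_closed I.a_closed I.I_l_closed by auto
  have ne: "a \<otimes>\<^bsub>A\<^esub> ?z \<oplus>\<^bsub>A\<^esub> i \<noteq> \<one>\<^bsub>A\<^esub>" if a: "a \<in> carrier A" and i: "i \<in> \<tau> ` Q" for a i
  proof
    assume eq: "a \<otimes>\<^bsub>A\<^esub> ?z \<oplus>\<^bsub>A\<^esub> i = \<one>\<^bsub>A\<^esub>"
    obtain b where b: "b \<in> carrier R" "a = \<tau> b" using tau_surj[OF a] by blast
    obtain q where q: "q \<in> Q" "i = \<tau> q" using i by blast
    have qc: "q \<in> carrier R" using q Qc by blast
    have sc: "sg (cr y) b \<in> carrier R" using kfun_cr[OF yG] b by simp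
    let ?d = "u \<otimes> sg (cr y) b \<ominus> \<mu> \<odot> b"
    have dc: "?d \<in> carrier R" using uc sc mu b by simp
    have "a \<otimes>\<^bsub>A\<^esub> ?z = \<tau> b \<otimes>\<^bsub>A\<^esub> \<tau> u \<ominus>\<^bsub>A\<^esub> \<tau> b \<otimes>\<^bsub>A\<^esub> \<tau> (\<mu> \<odot> \<one>)"
      unfolding b(2) using b(1) uc mu by (simp add: A.minus_eq A.r_distr A.r_minus)
    also have "\<dots> = \<tau> ?d"
      using tau_mult_right[OF yG u b(1)] tau_smult_one_right[OF mu(1) b(1)] uc sc mu b by (simp add: tau_minus)
    finally have "\<tau> (?d \<oplus> q) = \<tau> \<one>" using eq q(2) dc qc by (simp add: tau_add tau_one)
    then have "?d \<oplus> q = \<one>" using dc qc by (intro tau_inj) auto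
    then have "\<one> \<ominus> ?d = (?d \<oplus> q) \<ominus> ?d" by simp
    also have "\<dots> = q" using dc qc by (rule R.add_minus_cancel)
    finally show False using proper[OF b(1)] q(1) by simp
  qed
  have "\<exists>L. left_ideal L A \<and> \<tau> ` Q \<subseteq> L \<and> ?z \<in> L \<and> \<one>\<^bsub>A\<^esub> \<notin> L \<and>
    (\<forall>N. left_ideal N A \<longrightarrow> L \<subseteq> N \<longrightarrow> \<one>\<^bsub>A\<^esub> \<notin> N \<longrightarrow> N = L)"
    by (rule A.maximal_left_ideal_containing[OF lQ zc ne])
  then obtain L where L: "left_ideal L A" "\<tau> ` Q \<subseteq> L" "?z \<in> L" "\<one>\<^bsub>A\<^esub> \<notin> L"
    and max: "\<forall>N. left_ideal N A \<longrightarrow> L \<subseteq> N \<longrightarrow> \<one>\<^bsub>A\<^esub> \<notin> N \<longrightarrow> N = L"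
    by (elim exE conjE)
  have "\<exists>(V :: ('a, 'a) module) \<rho>. simple_module A V \<and> \<rho> ` carrier A = carrier V \<and>
    (\<forall>a\<in>carrier A. \<forall>b\<in>carrier A. \<rho> (a \<oplus>\<^bsub>A\<^esub> b) = \<rho> a \<oplus>\<^bsub>V\<^esub> \<rho> b \<and> \<rho> (a \<otimes>\<^bsub>A\<^esub> b) = a \<odot>\<^bsub>V\<^esub> \<rho> b) \<and>
    (\<forall>a\<in>carrier A. \<rho> a = \<zero>\<^bsub>V\<^esub> \<longleftrightarrow> a \<in> L)"
    by (rule A.simple_quotient[OF L(1,4)]) (use max in blast)
  then obtain V :: "('a, 'a) module" and \<rho> where V: "simple_module A V" and rho: "\<rho> ` carrier A = carrier V"
    and lin: "\<forall>a\<in>carrier A. \<forall>b\<in>carrier A. \<rho> (a \<oplus>\<^bsub>A\<^esub> b) = \<rho> a \<oplus>\<^bsub>V\<^esub> \<rho> b \<and> \<rho> (a \<otimes>\<^bsub>A\<^esub> b) = a \<odot>\<^bsub>V\<^esub> \<rho> b"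
    and ker: "\<forall>a\<in>carrier A. \<rho> a = \<zero>\<^bsub>V\<^esub> \<longleftrightarrow> a \<in> L"
    by (elim exE conjE)
  interpret V: simple_module A V by (rule V)
  define Q0 where "Q0 = {m \<in> carrier R. \<tau> m \<in> annihilator A V}"
  have annL: "a \<in> L" if "a \<in> annihilator A V" for a
  proof -
    have ac: "a \<in> carrier A" using that unfolding annihilator_def by blast
    have "\<rho> \<one>\<^bsub>A\<^esub> \<in> carrier V" using rho by blast
    then have "a \<odot>\<^bsub>V\<^esub> \<rho> \<one>\<^bsub>A\<^esub> = \<zero>\<^bsub>V\<^esub>" using that unfolding annihilator_def by blast
    moreover have "\<rho> (a \<otimes>\<^bsub>A\<^esub> \<one>\<^bsub>A\<^esub>) = a \<odot>\<^bsub>V\<^esub> \<rho> \<one>\<^bsub>A\<^esub>" using lin ac A.one_closed by blast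
    ultimately show ?thesis using ker ac by simp
  qed
  have annQ: "\<tau> q \<in> annihilator A V" if q: "q \<in> Q" for q
    unfolding annihilator_def
  proof (intro CollectI conjI ballI)
    show qA: "\<tau> q \<in> carrier A" using q Qc by auto
    fix v assume "v \<in> carrier V"
    then obtain b where b: "b \<in> carrier A" "v = \<rho> b" using rho by blast
    have "\<tau> q \<otimes>\<^bsub>A\<^esub> b \<in> L" using I.I_r_closed[OF imageI[OF q] b(1)] L(2) by blast
    then have "\<rho> (\<tau> q \<otimes>\<^bsub>A\<^esub> b) = \<zero>\<^bsub>V\<^esub>" using ker qA b(1) by blast
    then show "\<tau> q \<odot>\<^bsub>V\<^esub> v = \<zero>\<^bsub>V\<^esub>" using lin qA b by metis
  qed
  then have QQ0: "Q \<subseteq> Q0" unfolding Q0_def using Qc by blast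
  have uQ0: "u \<notin> Q0"
  proof
    assume "u \<in> Q0"
    then have uL: "\<tau> u \<in> L" unfolding Q0_def using annL by blast
    have mc: "\<tau> (\<mu> \<odot> \<one>) \<in> carrier A" "\<tau> u \<in> carrier A" using mu uc by auto
    have "\<tau> u \<oplus>\<^bsub>A\<^esub> (\<ominus>\<^bsub>A\<^esub> ?z) \<in> L" using A.left_ideal_neg[OF L(1,3)] left_ideal_add[OF L(1) uL] by blast
    moreover have "\<tau> u \<oplus>\<^bsub>A\<^esub> (\<ominus>\<^bsub>A\<^esub> ?z) = \<tau> (\<mu> \<odot> \<one>)"
      using mc by (simp add: A.minus_eq A.minus_add A.r_neg1 A.r_neg2)
    ultimately have "\<tau> (inv\<^bsub>K\<^esub> \<mu> \<odot> \<one>) \<otimes>\<^bsub>A\<^esub> \<tau> (\<mu> \<odot> \<one>) \<in> L"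
      using mu Units_K by (intro left_ideal_mult[OF L(1)]) auto
    moreover have "inv\<^bsub>K\<^esub> \<mu> \<odot> (\<mu> \<odot> \<one>) = \<one>"
      using mu Units_K Alg.smult_assoc1[of "inv\<^bsub>K\<^esub> \<mu>" \<mu> \<one>] by simp
    ultimately have "\<one>\<^bsub>A\<^esub> \<in> L" using tau_smult_one[of "inv\<^bsub>K\<^esub> \<mu>" "\<mu> \<odot> \<one>"] mu Units_K tau_one by simp
    then show False using L(4) by blast
  qed
  have tiQ0: "tideal Q0" unfolding Q0_def using V.annihilator_ideal by (rule tideal_preimage(1))
  have Q0r: "r i \<in> Q0 \<longleftrightarrow> i \<in> w" if i: "i \<in> {1..n}" for i
  proof
    assume "r i \<in> Q0"
    then show "i \<in> w" using mon_off_exp_mem[OF tiQ0, of i] i uQ0 unfolding u_def by blast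
  next
    assume "i \<in> w"
    then show "r i \<in> Q0" using core_r[OF MP i] QQ0 unfolding Q_def by blast
  qed
  have tQ0: "tprime Q0" using V Q0_def Q0r by (rule annihilator_tprime)
  have W0: "subspace Q0" using tiQ0 by (rule tideal_subspace)
  have Q0c: "Q0 \<subseteq> carrier R" unfolding Q0_def by blast
  have "Q0 \<subseteq> Q"
  proof
    fix m assume m: "m \<in> Q0"
    have mc: "m \<in> carrier R" using m Q0c by blast
    show "m \<in> Q"
      unfolding Q_def
    proof (rule parts_core[OF MP mc], rule ccontr)
      fix x assume x: "x \<in> carrier G" and nM: "part x m \<notin> M"
      define p where "p = part x m"
      have pQ: "p \<in> Q0" unfolding p_def by (rule tprime_part[OF tQ0 Q0r m x])
      have pc: "p \<in> carrier R" unfolding p_def using mc by simp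
      have psup: "E z x" if "z \<in> supp p" for z using part_supp[OF mc] that unfolding p_def by blast
      obtain \<alpha> where a: "\<alpha> \<in> exps n" "E (deg \<alpha>) x" "mon \<alpha> \<notin> M"
        using monomial_in_class[OF pc psup WM] nM unfolding p_def by blast
      have ao: "\<alpha> \<in> off" using stratum_mon_in[OF MP a(1)] a(3) by blast
      have asup: "E z x" if "z \<in> supp (mon \<alpha>)" for z
        using supp_homog[OF deg_closed mon_homog, of \<alpha>] that a(2) by blast
      \<comment> \<open>Modulo M both p and the monomial are scalars k and l, so k times the
        monomial minus l times p lies in M. Its degrees are in one class, hence it lies in the core
        and in Q0. Since k is nonzero and p is in Q0, the monomial would be in Q0.\<close>
      obtain k where k: "k \<in> carrier K" "p \<ominus> k \<odot> \<one> \<in> M" using residue_scalar[OF maxM pc] by blast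
      obtain l where l: "l \<in> carrier K" "mon \<alpha> \<ominus> l \<odot> \<one> \<in> M" using residue_scalar[OF maxM mon_closed] by blast
      have k0: "k \<noteq> \<zero>\<^bsub>K\<^esub>"
      proof
        assume "k = \<zero>\<^bsub>K\<^esub>"
        then have "p \<in> M" using k(2) pc by (simp add: Alg.smult_l_null R.minus_eq)
        then show False using nM unfolding p_def by blast
      qed
      have "cg M p (k \<odot> \<one>)" "cg M (mon \<alpha>) (l \<odot> \<one>)" unfolding cg_def using k l pc by auto
      then have "cg M (l \<odot> p) (l \<odot> (k \<odot> \<one>))" "cg M (k \<odot> mon \<alpha>) (k \<odot> (l \<odot> \<one>))"
        using cg_smult[OF WM] k(1) l(1) by blast+
      moreover have "l \<odot> (k \<odot> \<one>) = k \<odot> (l \<odot> \<one>)" using k l by (intro smult_comm) auto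
      ultimately have "cg M (k \<odot> mon \<alpha>) (l \<odot> p)" using cg_trans[OF WM] cg_sym[OF WM] by metis
      then have dM: "k \<odot> mon \<alpha> \<ominus> l \<odot> p \<in> M" by (rule cgD(3))
      have kc: "k \<odot> mon \<alpha> \<in> carrier R" "l \<odot> p \<in> carrier R" using k l pc by auto
      have "E z x" if "z \<in> supp (k \<odot> mon \<alpha> \<ominus> l \<odot> p)" for z
        using supp_minus[OF kc] supp_smult[OF k(1) mon_closed] supp_smult[OF l(1) pc] that asup psup by blast
      then have "k \<odot> mon \<alpha> \<ominus> l \<odot> p \<in> core M" by (rule class_core[OF MP dM x])
      then have "(k \<odot> mon \<alpha> \<ominus> l \<odot> p) \<oplus> l \<odot> p \<in> Q0"
        using QQ0 pQ l(1) subspaceD(3,4)[OF W0] unfolding Q_def by blast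
      then have "k \<odot> mon \<alpha> \<in> Q0" using R.cancel_simps(1)[OF kc R.zero_closed] by simp
      then have "mon \<alpha> \<in> Q0" using k(1) k0 subspace_cancel[OF W0 mon_closed] by blast
      then show False using tprime_mon[OF tQ0 Q0r ao] by blast
    qed
  qed
  then have "Q = Q0" using QQ0 by blast
  moreover have "\<tau> ` Q0 = annihilator A V" using V Q0_def Q0r by (rule annihilator_image)
  moreover have "annihilator A V \<in> prim A"
    by (rule annihilator_in_prim) (use V irreducible_module_iff in blast)
  ultimately show ?thesis unfolding Q_def by simp
qed

end

section \<open>Orbits of characters\<close>

lemma (in comm_monoid) inv_mult_Units:
  assumes "a \<in> Units G" "b \<in> Units G" shows "inv (a \<otimes> b) = inv a \<otimes> inv b"
proof -
  note c = assms[THEN Units_closed] assms[THEN Units_inv_closed]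
  have "(a \<otimes> b) \<otimes> (inv a \<otimes> inv b) = (a \<otimes> inv a) \<otimes> (b \<otimes> inv b)"
    using c by (simp only: m_ac m_closed)
  also have "\<dots> = \<one>" using assms by simp
  finally show ?thesis using c by (intro comm_inv_char) auto
qed

lemma (in comm_monoid) ratio_eq:
  assumes a: "a \<in> Units G" and b: "b \<in> Units G" and x: "x \<in> carrier G" and y: "y \<in> carrier G"
    and eq: "b \<otimes> x = a \<otimes> y"
  shows "x \<otimes> inv a = y \<otimes> inv b"
proof -
  note c = Units_closed[OF a] Units_closed[OF b] Units_inv_closed[OF a] Units_inv_closed[OF b]
  have "x \<otimes> inv a = inv b \<otimes> (b \<otimes> x) \<otimes> inv a" using a b c x by (simp flip: m_assoc)
  also have "\<dots> = (y \<otimes> inv b) \<otimes> (a \<otimes> inv a)" unfolding eq using c y by (simp only: m_ac m_closed)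
  also have "\<dots> = y \<otimes> inv b" using a b y by simp
  finally show ?thesis .
qed

section \<open>The action of characters on prime and maximal ideals of \<open>R\<close>\<close>

context graded_algebra
begin

lemma cg_mult:
  assumes P: "ideal P R" and a: "cg P a b" and d: "cg P d e" shows "cg P (a \<otimes> d) (b \<otimes> e)"
proof -
  interpret P: ideal P R by (rule P)
  note c = cgD(1,2)[OF a] cgD(1,2)[OF d]
  have "(a \<ominus> b) \<otimes> d \<oplus> b \<otimes> (d \<ominus> e) = (a \<otimes> d \<ominus> b \<otimes> d) \<oplus> (b \<otimes> d \<ominus> b \<otimes> e)"
    using c by (simp add: R.minus_eq R.l_distr R.r_distr R.l_minus R.r_minus)
  also have "\<dots> = a \<otimes> d \<ominus> b \<otimes> e" using c by (simp add: R.minus_eq R.a_assoc R.r_neg1)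
  finally show ?thesis
    unfolding cg_def using c P.a_closed[OF P.I_r_closed[OF cgD(3)[OF a] c(3)] P.I_l_closed[OF cgD(3)[OF d] c(2)]] by simp
qed

lemma scalar_mult: "k \<in> carrier K \<Longrightarrow> l \<in> carrier K \<Longrightarrow> (k \<odot> \<one>) \<otimes> (l \<odot> \<one>) = (k \<otimes>\<^bsub>K\<^esub> l) \<odot> \<one>"
  using smult_mult_right[of l "k \<odot> \<one>" \<one>] Alg.smult_assoc1[of l k \<one>] K.m_comm[of k l] by simp

lemma sg_ring_hom: assumes h: "h \<in> chars G K" shows "ring_hom_ring R R (sg h)"
proof (rule ring_hom_ringI2[OF R.ring_axioms R.ring_axioms])
  show "sg h \<in> ring_hom R R"
  proof (rule ring_hom_memI)
    show "sg h \<one> = \<one>"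
      using sg_homog[OF chars_kfun[OF h] G.one_closed one_homog] chars_one[OF h] by simp
  qed (use chars_kfun[OF h] sg_char_mult[OF h] sg_add in auto)
qed

lemma image_ideal:
  assumes h: "h \<in> chars G K" and P: "ideal P R" shows "ideal (sg h ` P) R"
proof -
  interpret P: ideal P R by (rule P)
  show ?thesis unfolding sg_image[OF h P.a_subset]
    using ring_hom_ring.ideal_vimage[OF sg_ring_hom[OF chars_inverse[OF h]] P] .
qed

lemma image_prime:
  assumes h: "h \<in> chars G K" and P: "primeideal P R" shows "primeideal (sg h ` P) R"
proof -
  interpret P: primeideal P R by (rule P)
  show ?thesis unfolding sg_image[OF h P.a_subset]
    using ring_hom_ring.primeideal_vimage[OF sg_ring_hom[OF chars_inverse[OF h]] R.cring_axioms P] .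
qed

lemma image_inverse:
  assumes h: "h \<in> chars G K" and P: "P \<subseteq> carrier R"
  shows "sg h ` sg (\<lambda>x. inv\<^bsub>K\<^esub> h x) ` P = P" "sg (\<lambda>x. inv\<^bsub>K\<^esub> h x) ` sg h ` P = P"
proof -
  have "(\<lambda>m. sg h (sg (\<lambda>x. inv\<^bsub>K\<^esub> h x) m)) ` P = (\<lambda>m. m) ` P"
    using P sg_char_inverse(1)[OF h] by (intro image_cong) auto
  moreover have "(\<lambda>m. sg (\<lambda>x. inv\<^bsub>K\<^esub> h x) (sg h m)) ` P = (\<lambda>m. m) ` P"
    using P sg_char_inverse(2)[OF h] by (intro image_cong) auto
  ultimately show "sg h ` sg (\<lambda>x. inv\<^bsub>K\<^esub> h x) ` P = P" "sg (\<lambda>x. inv\<^bsub>K\<^esub> h x) ` sg h ` P = P"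
    by (simp_all add: image_image)
qed

lemma image_carrier:
  assumes h: "h \<in> chars G K" shows "sg h ` carrier R = carrier R"
  unfolding sg_image[OF h subset_refl] using chars_kfun[OF chars_inverse[OF h]] by auto

lemma image_maximal:
  assumes h: "h \<in> chars G K" and P: "maximalideal P R" shows "maximalideal (sg h ` P) R"
proof -
  interpret P: maximalideal P R by (rule P)
  show ?thesis
  proof (rule maximalidealI[OF image_ideal[OF h P.ideal_axioms]])
    show "carrier R \<noteq> sg h ` P"
      using image_inverse(2)[OF h P.a_subset] image_carrier[OF chars_inverse[OF h]] P.I_notcarr by metis
    fix J assume J: "ideal J R" "sg h ` P \<subseteq> J" "J \<subseteq> carrier R"
    let ?J = "sg (\<lambda>x. inv\<^bsub>K\<^esub> h x) ` J"
    have id: "ideal ?J R" using chars_inverse[OF h] J(1) by (rule image_ideal)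
    have "P \<subseteq> ?J" using image_mono[OF J(2), of "sg (\<lambda>x. inv\<^bsub>K\<^esub> h x)"] image_inverse(2)[OF h P.a_subset] by simp
    moreover have "?J \<subseteq> carrier R" using J(3) chars_kfun[OF chars_inverse[OF h]] by auto
    ultimately have "?J = P \<or> ?J = carrier R" by (rule P.I_maximal[OF id])
    then show "J = sg h ` P \<or> J = carrier R"
      using image_inverse(1)[OF h J(3)] image_carrier[OF h] by metis
  qed
qed

end

section \<open>Cores along orbits, and maximal ideals with equal cores\<close>

context stratum_algebra
begin

text \<open>A character multiplies each homogeneous generator by a unit, so it does not change which
  generators the ideal contains.\<close>

lemma image_spec_stratum:
  assumes h: "h \<in> chars G K" and P: "P \<in> spec_stratum R n r w"
  shows "sg h ` P \<in> spec_stratum R n r w"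
proof -
  have "r i \<in> sg h ` P \<longleftrightarrow> i \<in> w" if i: "i \<in> {1..n}" for i
  proof -
    let ?h = "\<lambda>x. inv\<^bsub>K\<^esub> h x"
    have u: "?h (\<delta> i) \<in> Units K" using chars_Units[OF chars_inverse[OF h] delta_closed[OF i]] .
    have "sg ?h (r i) = ?h (\<delta> i) \<odot> r i"
      using sg_homog[OF chars_kfun[OF chars_inverse[OF h]] delta_closed[OF i] r_homog[OF i]] .
    moreover have "?h (\<delta> i) \<odot> r i \<in> P \<longleftrightarrow> r i \<in> P"
      using subspace_cancel[OF stratum_subspace[OF P] r_closed[OF i], of "?h (\<delta> i)"] subspaceD(4)[OF stratum_subspace[OF P]] u Units_K
      by blast
    ultimately show ?thesis
      using sg_image[OF h stratum_subset[OF P]] r_closed[OF i] stratum_r[OF P i] by auto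
  qed
  then show ?thesis
    using image_prime[OF h stratum_prime[OF P]] unfolding spec_stratum_def R.spec_commutative by blast
qed

text \<open>All rescalings of components commute, so the conditions that define the core are merely
  transported.\<close>

lemma core_image:
  assumes h: "h \<in> chars G K" and P: "P \<in> spec_stratum R n r w"
  shows "core (sg h ` P) = sg h ` core P"
proof -
  note k = chars_kfun[OF chars_inverse[OF h]]
  have "sg (\<lambda>x. inv\<^bsub>K\<^esub> h x) (sg (cr y) m) = sg (cr y) (sg (\<lambda>x. inv\<^bsub>K\<^esub> h x) m)" if "y \<in> S" "m \<in> carrier R" for y m
    using k kfun_cr[OF S_closed[OF that(1)]] that(2) by (rule sg_comm)
  then show ?thesis
    unfolding sg_image[OF h core_carrier[OF P]] sg_image[OF h stratum_subset[OF P]]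
    unfolding core_def using k kfun_cr S_closed by auto
qed

text \<open>The core is stable under the characters c(-, y), so \<open>perp_stable\<close> can be
  applied after them: for P with the inverse of t, and for the translate with t.\<close>

lemma core_orbit:
  assumes t: "t \<in> perp G K (stratum_rad G K c n \<delta> w)" and P: "P \<in> spec_stratum R n r w"
  shows "core (sg t ` P) = core P"
proof
  have tc: "t \<in> chars G K" using t unfolding perp_def by blast
  note tP = image_spec_stratum[OF tc P]
  have stable: "sg (cr y) m \<in> core P" if P: "P \<in> spec_stratum R n r w" and m: "m \<in> core P" and y: "y \<in> S" for y m P
  proof -
    have mc: "m \<in> carrier R" using m unfolding core_def by blast
    show ?thesis
      unfolding core_def
    proof (intro CollectI conjI ballI)
      show "sg (cr y) m \<in> carrier R" using kfun_cr[OF S_closed[OF y]] mc by simp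
      fix x assume x: "x \<in> S"
      show "sg (cr x) (sg (cr y) m) \<in> P"
        unfolding sg_cr_cr[OF S_closed[OF y] S_closed[OF x] mc] using m S_mult[OF x y] unfolding core_def by blast
    qed
  qed
  show "core P \<subseteq> core (sg t ` P)"
  proof
    fix m assume m: "m \<in> core P"
    have mc: "m \<in> carrier R" using m unfolding core_def by blast
    have "sg (cr y) m \<in> sg t ` P" if y: "y \<in> S" for y
      using perp_stable[OF P perp_inverse[OF P t] stable[OF P m y]] kfun_cr[OF S_closed[OF y]] mc
      unfolding sg_image[OF tc stratum_subset[OF P]] by simp
    then show "m \<in> core (sg t ` P)" unfolding core_def[of "sg t ` P"] using mc by blast
  qed
  show "core (sg t ` P) \<subseteq> core P"
  proof
    fix m assume m: "m \<in> core (sg t ` P)"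
    have mc: "m \<in> carrier R" using m unfolding core_def by blast
    have "sg (cr y) m \<in> P" if y: "y \<in> S" for y
    proof -
      have yc: "sg (cr y) m \<in> carrier R" using kfun_cr[OF S_closed[OF y]] mc by simp
      have "sg t (sg (cr y) m) \<in> sg t ` P" using perp_stable[OF tP t stable[OF tP m y]] .
      then show ?thesis
        unfolding sg_image[OF tc stratum_subset[OF P]] using sg_char_inverse(2)[OF tc yc] by simp
    qed
    then show "m \<in> core P" unfolding core_def[of P] using mc by blast
  qed
qed

text \<open>The residues of the monomials modulo \<open>M\<close> and modulo \<open>N\<close> differ by a partial character of
  \<open>G\<^sub>w\<close> that is trivial on the radical, and it extends to \<open>G\<close> since \<open>K\<^sup>\<times>\<close> is divisible.\<close>

lemma same_core_orbit:
  assumes M: "M \<in> max_stratum R n r w" and N: "N \<in> max_stratum R n r w" and eq: "core M = core N"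
  shows "\<exists>t\<in>perp G K (stratum_rad G K c n \<delta> w). M = sg t ` N"
proof -
  have spec: "P \<in> spec_stratum R n r w" and maxi: "maximalideal P R" if "P \<in> max_stratum R n r w" for P
    using that unfolding max_stratum_def max_spec_def by auto
  \<comment> \<open>The residue of a monomial modulo a maximal ideal, which is a scalar by the
    Nullstellensatz. It is nonzero exactly where division is required, namely for exponents in
    \<open>off\<close>.\<close>
  define f where "f P \<alpha> = (SOME k. k \<in> carrier K \<and> cg P (mon \<alpha>) (k \<odot> \<one>))" for P \<alpha>
  have f: "f P \<alpha> \<in> carrier K \<and> cg P (mon \<alpha>) (f P \<alpha> \<odot> \<one>)" if P: "P \<in> max_stratum R n r w" for P \<alpha>
  proof -
    obtain k where "k \<in> carrier K" "mon \<alpha> \<ominus> k \<odot> \<one> \<in> P" using residue_scalar[OF maxi[OF P] mon_closed] by blast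
    then have "k \<in> carrier K \<and> cg P (mon \<alpha>) (k \<odot> \<one>)" unfolding cg_def by simp
    then show ?thesis unfolding f_def by (rule someI)
  qed
  have fc: "f P \<alpha> \<in> carrier K" and fcg: "cg P (mon \<alpha>) (f P \<alpha> \<odot> \<one>)" if "P \<in> max_stratum R n r w" for P \<alpha>
    using f[OF that] by auto
  have W: "subspace P" and one: "\<one> \<notin> P" and idP: "ideal P R" if "P \<in> max_stratum R n r w" for P
    using stratum_subspace[OF spec[OF that]] stratum_one[OF spec[OF that]] stratum_ideal[OF spec[OF that]] by auto
  have unique: "k = l" if "P \<in> max_stratum R n r w" "cg P m (k \<odot> \<one>)" "cg P m (l \<odot> \<one>)" "k \<in> carrier K" "l \<in> carrier K" for P m k l
    using cg_scalar_unique[OF W[OF that(1)] one[OF that(1)] that(4,5)]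
      cg_trans[OF W[OF that(1)] cg_sym[OF W[OF that(1)] that(2)] that(3)] by blast
  have fU: "f P \<alpha> \<in> Units K" if P: "P \<in> max_stratum R n r w" and a: "\<alpha> \<in> off" for P \<alpha>
  proof -
    have "f P \<alpha> \<noteq> \<zero>\<^bsub>K\<^esub>"
    proof
      assume "f P \<alpha> = \<zero>\<^bsub>K\<^esub>"
      then have "cg P (mon \<alpha>) \<zero>" using fcg[OF P, of \<alpha>] by (simp add: Alg.smult_l_null)
      then have "mon \<alpha> \<in> P" using cg_zero[OF W[OF P] mon_closed] by blast
      then show False using stratum_mon[OF spec[OF P] a] by blast
    qed
    then show ?thesis using fc[OF P] Units_K by blast
  qed
  have fmult: "f P (\<lambda>i. \<alpha> i + \<beta> i) = f P \<alpha> \<otimes>\<^bsub>K\<^esub> f P \<beta>" if P: "P \<in> max_stratum R n r w" for P \<alpha> \<beta>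
  proof (rule unique[OF P])
    show "cg P (mon (\<lambda>i. \<alpha> i + \<beta> i)) ((f P \<alpha> \<otimes>\<^bsub>K\<^esub> f P \<beta>) \<odot> \<one>)"
      using cg_mult[OF idP[OF P] fcg[OF P] fcg[OF P], of \<alpha> \<beta>] scalar_mult[OF fc[OF P] fc[OF P]] by (simp add: mon_add)
  qed (use fc[OF P] fcg[OF P] in auto)
  have f0: "f P (\<lambda>_. 0) = \<one>\<^bsub>K\<^esub>" if P: "P \<in> max_stratum R n r w" for P
    using unique[OF P fcg[OF P], of "\<lambda>_. 0" "\<one>\<^bsub>K\<^esub>"] fc[OF P] cg_refl[OF W[OF P] R.one_closed] by (simp add: mon_zero)
  define v where "v \<alpha> = f N \<alpha> \<otimes>\<^bsub>K\<^esub> inv\<^bsub>K\<^esub> f M \<alpha>" for \<alpha>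
  \<comment> \<open>Cross-multiplied with its residues, the difference of two monomials of one class
    lies in M, hence in the core of M, which is the core of N. So the two residues modulo N have the
    same ratio as those modulo M.\<close>
  have v_deg: "v \<alpha> = v \<beta>" if a: "\<alpha> \<in> off" and b: "\<beta> \<in> off" and E: "E (deg \<alpha>) (deg \<beta>)" for \<alpha> \<beta>
  proof -
    have EM: "cg P (f M \<beta> \<odot> mon \<alpha>) (f M \<beta> \<odot> (f P \<alpha> \<odot> \<one>))" "cg P (f M \<alpha> \<odot> mon \<beta>) (f M \<alpha> \<odot> (f P \<beta> \<odot> \<one>))"
      if P: "P \<in> max_stratum R n r w" for P
      using cg_smult[OF W[OF P] fc[OF M] fcg[OF P]] by auto
    have as: "f k \<alpha> \<odot> (f l \<beta> \<odot> \<one>) = (f k \<alpha> \<otimes>\<^bsub>K\<^esub> f l \<beta>) \<odot> \<one>"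
      if "k \<in> max_stratum R n r w" "l \<in> max_stratum R n r w" for k l \<alpha> \<beta>
      using Alg.smult_assoc1[OF fc[OF that(1)] fc[OF that(2)] R.one_closed] by simp
    have "cg M (f M \<beta> \<odot> mon \<alpha>) (f M \<alpha> \<odot> mon \<beta>)"
    proof -
      have "f M \<beta> \<odot> (f M \<alpha> \<odot> \<one>) = f M \<alpha> \<odot> (f M \<beta> \<odot> \<one>)" by (intro smult_comm fc[OF M] R.one_closed)
      then show ?thesis using cg_trans[OF W[OF M] EM(1)[OF M]] cg_sym[OF W[OF M] EM(2)[OF M]] by simp
    qed
    then have dM: "f M \<beta> \<odot> mon \<alpha> \<ominus> f M \<alpha> \<odot> mon \<beta> \<in> M" by (rule cgD(3))
    have c: "f M \<beta> \<odot> mon \<alpha> \<in> carrier R" "f M \<alpha> \<odot> mon \<beta> \<in> carrier R" using fc[OF M] by auto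
    have "E z (deg \<beta>)" if z: "z \<in> supp (f M \<beta> \<odot> mon \<alpha> \<ominus> f M \<alpha> \<odot> mon \<beta>)" for z
    proof -
      have "z \<in> supp (mon \<alpha>) \<union> supp (mon \<beta>)"
        using z supp_minus[OF c] supp_smult[OF fc[OF M] mon_closed] by blast
      then have "z = deg \<alpha> \<or> z = deg \<beta>" using supp_homog[OF deg_closed mon_homog] by blast
      then show ?thesis using E E_refl by blast
    qed
    then have "f M \<beta> \<odot> mon \<alpha> \<ominus> f M \<alpha> \<odot> mon \<beta> \<in> core M" by (rule class_core[OF spec[OF M] dM deg_closed])
    then have "f M \<beta> \<odot> mon \<alpha> \<ominus> f M \<alpha> \<odot> mon \<beta> \<in> N" using eq core_subset[OF spec[OF N]] by blast
    then have "cg N (f M \<beta> \<odot> mon \<alpha>) (f M \<alpha> \<odot> mon \<beta>)" unfolding cg_def using c by blast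
    then have 1: "cg N (f M \<beta> \<odot> mon \<alpha>) ((f M \<alpha> \<otimes>\<^bsub>K\<^esub> f N \<beta>) \<odot> \<one>)"
      using cg_trans[OF W[OF N] _ EM(2)[OF N]] as[OF M N] by simp
    have 2: "cg N (f M \<beta> \<odot> mon \<alpha>) ((f M \<beta> \<otimes>\<^bsub>K\<^esub> f N \<alpha>) \<odot> \<one>)" using EM(1)[OF N] as[OF M N] by simp
    have "f M \<beta> \<otimes>\<^bsub>K\<^esub> f N \<alpha> = f M \<alpha> \<otimes>\<^bsub>K\<^esub> f N \<beta>" using fc[OF M] fc[OF N] by (intro unique[OF N 2 1]) auto
    then show ?thesis unfolding v_def by (rule K.ratio_eq[OF fU[OF M a] fU[OF M b] fc[OF N] fc[OF N]])
  qed
  have vU: "v \<alpha> \<in> Units K" if "\<alpha> \<in> off" for \<alpha> unfolding v_def using fU[OF M that] fU[OF N that] by simp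
  have vmult: "v (\<lambda>i. \<alpha> i + \<beta> i) = v \<alpha> \<otimes>\<^bsub>K\<^esub> v \<beta>" if a: "\<alpha> \<in> off" and b: "\<beta> \<in> off" for \<alpha> \<beta>
    unfolding v_def fmult[OF M] fmult[OF N] K.inv_mult_Units[OF fU[OF M a] fU[OF M b]]
    using fc[OF N] K.Units_inv_closed[OF fU[OF M a]] K.Units_inv_closed[OF fU[OF M b]] by (simp only: K.m_ac K.m_closed)
  have v0: "v (\<lambda>_. 0) = \<one>\<^bsub>K\<^esub>" unfolding v_def f0[OF M] f0[OF N] by simp
  let ?Z = "(\<lambda>\<alpha>. (deg \<alpha>, v \<alpha>)) ` off"
  have pf: "pairs_functional G (units_of K) ?Z"
    unfolding pairs_functional_def units_of_carrier units_of_mult units_of_one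
  proof (intro conjI allI impI)
    show "?Z \<subseteq> carrier G \<times> Units K" using vU by auto
    show "(\<one>\<^bsub>G\<^esub>, \<one>\<^bsub>K\<^esub>) \<in> ?Z" using off_zero v0 deg_zero by (metis (no_types, lifting) image_eqI)
    fix x y x' y' assume "(x, y) \<in> ?Z" "(x', y') \<in> ?Z"
    then obtain \<alpha> \<beta> where ab: "\<alpha> \<in> off" "\<beta> \<in> off" "x = deg \<alpha>" "y = v \<alpha>" "x' = deg \<beta>" "y' = v \<beta>" by blast
    have "(x \<otimes>\<^bsub>G\<^esub> x', y \<otimes>\<^bsub>K\<^esub> y') = (deg (\<lambda>i. \<alpha> i + \<beta> i), v (\<lambda>i. \<alpha> i + \<beta> i))"
      using ab by (simp add: deg_add vmult)
    then show "(x \<otimes>\<^bsub>G\<^esub> x', y \<otimes>\<^bsub>K\<^esub> y') \<in> ?Z" using off_add[OF ab(1,2)] by blast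
  next
    fix x y y' assume "(x, y) \<in> ?Z" "(x, y') \<in> ?Z"
    then obtain \<alpha> \<beta> where "\<alpha> \<in> off" "\<beta> \<in> off" "deg \<alpha> = deg \<beta>" "y = v \<alpha>" "y' = v \<beta>" by auto
    then show "y = y'" using v_deg E_refl by metis
  qed
  have div: "\<exists>a\<in>carrier (units_of K). a [^]\<^bsub>units_of K\<^esub> k = b" if b: "b \<in> carrier (units_of K)" and k: "0 < k" for b and k :: nat
  proof -
    have bK: "b \<in> carrier K" "b \<noteq> \<zero>\<^bsub>K\<^esub>" using b Units_K unfolding units_of_carrier by auto
    obtain a where a: "a \<in> carrier K" "a \<noteq> \<zero>\<^bsub>K\<^esub>" "a [^]\<^bsub>K\<^esub> k = b" using K.exists_nth_root[OF bK k] by blast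
    have "a [^]\<^bsub>units_of K\<^esub> k = a [^]\<^bsub>K\<^esub> k" by (simp add: nat_pow_def units_of_mult units_of_one)
    then show ?thesis using a Units_K unfolding units_of_carrier by auto
  qed
  obtain h where h: "h \<in> hom G (units_of K)" "\<forall>(x, y)\<in>?Z. h x = y"
    using hom_extension_divisible[OF grp K.units_comm_group div pf] by blast
  have hc: "h \<in> chars G K" using h(1) unfolding chars_def .
  have hv: "h (deg \<alpha>) = v \<alpha>" if a: "\<alpha> \<in> off" for \<alpha>
    using bspec[OF h(2) imageI[OF a]] by simp
  have hperp: "h \<in> perp G K (stratum_rad G K c n \<delta> w)"
    unfolding perp_def
  proof (intro CollectI conjI ballI hc)
    fix x assume "x \<in> stratum_rad G K c n \<delta> w"
    then have x: "x \<in> S" "\<And>z. z \<in> S \<Longrightarrow> c x z = \<one>\<^bsub>K\<^esub>" unfolding stratum_rad_def by auto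
    have xG: "x \<in> carrier G" using S_closed[OF x(1)] .
    obtain \<alpha> \<beta> where ab: "\<alpha> \<in> off" "\<beta> \<in> off" "x \<otimes>\<^bsub>G\<^esub> deg \<beta> = deg \<alpha>" using S_quotient[OF x(1)] by blast
    have "E (deg \<alpha>) (deg \<beta>)"
      unfolding E_def ab(3)[symmetric] using x(2) xG S_closed by (simp add: c_mult_left)
    then have "v \<alpha> = v \<beta>" using v_deg ab(1,2) by blast
    then have "h x \<otimes>\<^bsub>K\<^esub> h (deg \<beta>) = h (deg \<beta>)" using chars_mult[OF hc xG deg_closed, of \<beta>] ab hv by simp
    then show "h x = \<one>\<^bsub>K\<^esub>"
      using chars_Units[OF hc xG] chars_Units[OF hc deg_closed, of \<beta>] Units_K K.m_rcancel[of "h (deg \<beta>)" "h x" "\<one>\<^bsub>K\<^esub>"] by simp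
  qed
  let ?h = "\<lambda>x. inv\<^bsub>K\<^esub> h x"
  note kh = chars_kfun[OF chars_inverse[OF hc]]
  \<comment> \<open>The elements whose residue modulo M equals the residue modulo N after applying
    the inverse of h. Once monomials are known to belong to it, M is the translate of N by
    h.\<close>
  let ?W = "{m \<in> carrier R. \<exists>k\<in>carrier K. cg M m (k \<odot> \<one>) \<and> cg N (sg ?h m) (k \<odot> \<one>)}"
  have "?W = carrier R"
  proof (rule monomials_span)
    show "subspace ?W"
      unfolding subspace_def
    proof (intro conjI ballI)
      have "cg P \<zero> (\<zero>\<^bsub>K\<^esub> \<odot> \<one>)" if "P \<in> max_stratum R n r w" for P
        using cg_refl[OF W[OF that] R.zero_closed] by (simp add: Alg.smult_l_null)
      then have "cg M \<zero> (\<zero>\<^bsub>K\<^esub> \<odot> \<one>) \<and> cg N (sg ?h \<zero>) (\<zero>\<^bsub>K\<^esub> \<odot> \<one>)"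
        unfolding sg_zero[OF kh] using M N by blast
      then show "\<zero> \<in> ?W" using K.zero_closed R.zero_closed by blast
      show "a \<oplus> b \<in> ?W" if ab: "a \<in> ?W" "b \<in> ?W" for a b
      proof -
        obtain k l where kl: "k \<in> carrier K" "cg M a (k \<odot> \<one>)" "cg N (sg ?h a) (k \<odot> \<one>)"
          "l \<in> carrier K" "cg M b (l \<odot> \<one>)" "cg N (sg ?h b) (l \<odot> \<one>)" using ab by blast
        have c: "a \<in> carrier R" "b \<in> carrier R" using ab by auto
        have "(k \<oplus>\<^bsub>K\<^esub> l) \<odot> \<one> = k \<odot> \<one> \<oplus> l \<odot> \<one>" using kl by (simp add: Alg.smult_l_distr)
        moreover have "sg ?h (a \<oplus> b) = sg ?h a \<oplus> sg ?h b" using kh c by (rule sg_add)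
        ultimately have "cg M (a \<oplus> b) ((k \<oplus>\<^bsub>K\<^esub> l) \<odot> \<one>)" "cg N (sg ?h (a \<oplus> b)) ((k \<oplus>\<^bsub>K\<^esub> l) \<odot> \<one>)"
          using cg_add[OF W[OF M] kl(2,5)] cg_add[OF W[OF N] kl(3,6)] by simp_all
        then show ?thesis using c kl K.a_closed by blast
      qed
      show "l \<odot> a \<in> ?W" if l: "l \<in> carrier K" and a: "a \<in> ?W" for l a
      proof -
        obtain k where k: "k \<in> carrier K" "cg M a (k \<odot> \<one>)" "cg N (sg ?h a) (k \<odot> \<one>)" using a by blast
        have c: "a \<in> carrier R" using a by auto
        have "l \<odot> (k \<odot> \<one>) = (l \<otimes>\<^bsub>K\<^esub> k) \<odot> \<one>" using Alg.smult_assoc1[OF l k(1) R.one_closed] by simp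
        moreover have "sg ?h (l \<odot> a) = l \<odot> sg ?h a" using kh l c by (intro sg_smult)
        ultimately have "cg M (l \<odot> a) ((l \<otimes>\<^bsub>K\<^esub> k) \<odot> \<one>)" "cg N (sg ?h (l \<odot> a)) ((l \<otimes>\<^bsub>K\<^esub> k) \<odot> \<one>)"
          using cg_smult[OF W[OF M] l k(2)] cg_smult[OF W[OF N] l k(3)] by simp_all
        then show ?thesis using c l k K.m_closed by blast
      qed
    qed auto
    fix \<alpha> assume al: "\<alpha> \<in> exps n"
    have hd: "?h (deg \<alpha>) \<in> carrier K" using kfunD[OF kh deg_closed] .
    have sh: "sg ?h (mon \<alpha>) = ?h (deg \<alpha>) \<odot> mon \<alpha>" using sg_homog[OF kh deg_closed mon_homog] .
    show "mon \<alpha> \<in> ?W"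
    proof (cases "\<alpha> \<in> off")
      case True
      have hU: "h (deg \<alpha>) \<in> Units K" using chars_Units[OF hc deg_closed] .
      have "h (deg \<alpha>) \<otimes>\<^bsub>K\<^esub> f M \<alpha> = f N \<alpha> \<otimes>\<^bsub>K\<^esub> (inv\<^bsub>K\<^esub> f M \<alpha> \<otimes>\<^bsub>K\<^esub> f M \<alpha>)"
        unfolding hv[OF True] v_def
        by (rule K.m_assoc[OF fc[OF N] K.Units_inv_closed[OF fU[OF M True]] fc[OF M]])
      then have "f N \<alpha> = h (deg \<alpha>) \<otimes>\<^bsub>K\<^esub> f M \<alpha>" using fU[OF M True] fc[OF N] by simp
      then have "?h (deg \<alpha>) \<otimes>\<^bsub>K\<^esub> f N \<alpha> = (?h (deg \<alpha>) \<otimes>\<^bsub>K\<^esub> h (deg \<alpha>)) \<otimes>\<^bsub>K\<^esub> f M \<alpha>"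
        using K.m_assoc[OF hd K.Units_closed[OF hU] fc[OF M, of \<alpha>]] by simp
      then have "?h (deg \<alpha>) \<otimes>\<^bsub>K\<^esub> f N \<alpha> = f M \<alpha>" using hU fc[OF M] by simp
      then have "?h (deg \<alpha>) \<odot> (f N \<alpha> \<odot> \<one>) = f M \<alpha> \<odot> \<one>"
        using Alg.smult_assoc1[OF hd fc[OF N, of \<alpha>] R.one_closed] by simp
      then have "cg N (sg ?h (mon \<alpha>)) (f M \<alpha> \<odot> \<one>)"
        unfolding sh using cg_smult[OF W[OF N] hd fcg[OF N, of \<alpha>]] by simp
      then show ?thesis using fc[OF M, of \<alpha>] fcg[OF M, of \<alpha>] mon_closed by blast
    next
      case False
      \<comment> \<open>A monomial with some factor \<open>r i\<close>, i in w, lies in every ideal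
        of the stratum, so both residues are 0.\<close>
      have "cg P (k \<odot> mon \<alpha>) (\<zero>\<^bsub>K\<^esub> \<odot> \<one>)" if P: "P \<in> max_stratum R n r w" and k: "k \<in> carrier K" for P k
        using stratum_mon_in[OF spec[OF P] al False] subspaceD(4)[OF W[OF P] k] cg_zero[OF W[OF P]] k
        by (simp add: Alg.smult_l_null)
      then have "cg M (\<one>\<^bsub>K\<^esub> \<odot> mon \<alpha>) (\<zero>\<^bsub>K\<^esub> \<odot> \<one>)" "cg N (sg ?h (mon \<alpha>)) (\<zero>\<^bsub>K\<^esub> \<odot> \<one>)"
        unfolding sh using M N hd K.one_closed by blast+
      then have "cg M (mon \<alpha>) (\<zero>\<^bsub>K\<^esub> \<odot> \<one>) \<and> cg N (sg ?h (mon \<alpha>)) (\<zero>\<^bsub>K\<^esub> \<odot> \<one>)" by simp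
      then show ?thesis using K.zero_closed mon_closed by blast
    qed
  qed
  then have W': "\<exists>k\<in>carrier K. cg M m (k \<odot> \<one>) \<and> cg N (sg ?h m) (k \<odot> \<one>)" if "m \<in> carrier R" for m
    using that by blast
  have scalar0: "k \<odot> \<one> \<in> P \<longleftrightarrow> k = \<zero>\<^bsub>K\<^esub>" if P: "P \<in> max_stratum R n r w" and k: "k \<in> carrier K" for P k
    using subspace_cancel[OF W[OF P] R.one_closed k] one[OF P] subspaceD(2)[OF W[OF P]] by (auto simp: Alg.smult_l_null)
  have "m \<in> M \<longleftrightarrow> sg ?h m \<in> N" if m: "m \<in> carrier R" for m
  proof -
    obtain k where k: "k \<in> carrier K" "cg M m (k \<odot> \<one>)" "cg N (sg ?h m) (k \<odot> \<one>)" using W'[OF m] by blast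
    show ?thesis
      using cg_mem[OF W[OF M] k(2)] cg_mem[OF W[OF N] k(3)] scalar0[OF M k(1)] scalar0[OF N k(1)] by blast
  qed
  then have "M = {m \<in> carrier R. sg ?h m \<in> N}" using subspaceD(1)[OF W[OF M]] by blast
  also have "\<dots> = sg h ` N" by (rule sg_image[OF hc subspaceD(1)[OF W[OF N]], symmetric])
  finally show ?thesis using hperp by blast
qed

end

section \<open>The quotient maps\<close>

lemma (in ring) topspace_zariski_subset:
  "Z \<subseteq> spec R \<Longrightarrow> topspace (subtopology (zariski R) Z) = Z"
  by (simp add: topspace_zariski Int_absorb1)

lemma (in ring) closedin_zariski_subset:
  assumes "Z \<subseteq> spec R"
  shows "closedin (subtopology (zariski R) Z) C \<longleftrightarrow> (\<exists>I. ideal I R \<and> C = {P \<in> Z. I \<subseteq> P})"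
proof -
  have "{P \<in> spec R. I \<subseteq> P} \<inter> Z = {P \<in> Z. I \<subseteq> P}" for I using assms by blast
  then show ?thesis unfolding closedin_subtopology closedin_zariski by auto
qed

text \<open>Intersecting with the carrier gives the empty family the right value; a bare
  intersection over it would be the whole type.\<close>

lemma (in ring) carrier_Inter_ideal:
  assumes "\<And>w. w \<in> F \<Longrightarrow> ideal (I w) R" shows "ideal (carrier R \<inter> (\<Inter>w\<in>F. I w)) R"
proof -
  have "carrier R \<inter> (\<Inter>w\<in>F. I w) = \<Inter>(insert (carrier R) (I ` F))" by auto
  then show ?thesis using assms oneideal i_Intersect[of "insert (carrier R) (I ` F)"] by auto
qed

text \<open>The product of two ideals lies in their intersection, so primality passes to finite
  intersections. For the empty family the intersection is the carrier, which a prime does not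
  contain.\<close>

lemma (in ring) prime_ideal_Inter:
  assumes Q: "prime_ideal Q R" and "finite F" "\<And>w. w \<in> F \<Longrightarrow> ideal (I w) R"
    "carrier R \<inter> (\<Inter>w\<in>F. I w) \<subseteq> Q"
  shows "\<exists>w\<in>F. I w \<subseteq> Q"
  using assms(2-)
proof (induction F)
  case empty
  interpret Q: ideal Q R using Q unfolding prime_ideal_def by blast
  show ?case using empty Q Q.a_subset unfolding prime_ideal_def by auto
next
  case (insert w F)
  let ?J = "carrier R \<inter> (\<Inter>w\<in>F. I w)"
  have J: "ideal ?J R" using insert.prems(1) by (intro carrier_Inter_ideal) blast
  have I: "ideal (I w) R" using insert.prems(1) by blast
  have "ideal_prod R (I w) ?J \<subseteq> I w \<inter> ?J" using I J by (rule ideal_prod_inter)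
  also have "\<dots> \<subseteq> Q" using insert.prems(2) by auto
  finally have "I w \<subseteq> Q \<or> ?J \<subseteq> Q" using Q I J unfolding prime_ideal_def by blast
  then show ?case using insert.IH insert.prems(1) by blast
qed

locale twisted_spectra = twisted_algebra R K G \<G> n r \<delta> c A \<tau>
    for R :: "('k, 'r, 'd) module_scheme" (structure)
    and K :: "('k, 'l) ring_scheme"
    and G :: "('g, 'h) monoid_scheme"
    and \<G> :: "'g \<Rightarrow> 'r set"
    and n :: nat and r :: "nat \<Rightarrow> 'r" and \<delta> :: "nat \<Rightarrow> 'g"
    and c :: "'g \<Rightarrow> 'g \<Rightarrow> 'k" and A :: "('k, 'a, 'e) module_scheme" and \<tau> :: "'r \<Rightarrow> 'a" +
  assumes minus_one: "\<ominus>\<^bsub>K\<^esub> \<one>\<^bsub>K\<^esub> \<notin> generate (units_of K) {c x y | x y. x \<in> carrier G \<and> y \<in> carrier G}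
        \<or> ring_char K = 2"
begin

lemma stratum: "w \<subseteq> {1..n} \<Longrightarrow> stratum_algebra R K G \<G> n r \<delta> c A \<tau> w"
  by (intro stratum_algebra.intro stratum_algebra_axioms.intro twisted_algebra_axioms minus_one)

abbreviation T :: "nat set \<Rightarrow> ('g \<Rightarrow> 'k) set" where
  "T w \<equiv> perp G K (stratum_rad G K c n \<delta> w)"

definition stratum_of :: "'r set \<Rightarrow> nat set" where
  "stratum_of P = {i \<in> {1..n}. r i \<in> P}"

text \<open>The stratum is read off from P, so one formula covers all strata. The same map serves
  for both maps of the theorem, restricted to maximal ideals in the second case.\<close>

definition \<Phi> :: "'r set \<Rightarrow> 'a set" where
  "\<Phi> P = \<tau> ` char_core G R \<G> P (T (stratum_of P))"

lemma stratum_of_subset: "stratum_of P \<subseteq> {1..n}"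
  unfolding stratum_of_def by blast

lemma stratum_of_spec: "P \<in> spec R \<Longrightarrow> P \<in> spec_stratum R n r (stratum_of P)"
  unfolding spec_stratum_def stratum_of_def by blast

lemma stratum_of_eq: "P \<in> spec_stratum R n r w \<Longrightarrow> w \<subseteq> {1..n} \<Longrightarrow> stratum_of P = w"
  unfolding spec_stratum_def stratum_of_def by blast

lemma spec_stratum_spec: "P \<in> spec_stratum R n r w \<Longrightarrow> P \<in> spec R"
  unfolding spec_stratum_def by blast

lemma max_in_spec: "P \<in> max_spec R \<Longrightarrow> P \<in> spec R"
  unfolding max_spec_def R.spec_commutative using R.maximalideal_prime by blast

lemma spec_subset: "P \<in> spec R \<Longrightarrow> P \<subseteq> carrier R"
  unfolding R.spec_commutative using ideal_subspace[OF primeideal.axioms(1)] subspaceD(1) by blast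

context
  fixes P w assumes P: "P \<in> spec_stratum R n r w" and w: "w \<subseteq> {1..n}"
begin

interpretation S: stratum_algebra R K G \<G> n r \<delta> c A \<tau> w by (rule stratum[OF w])

lemma Phi_core: "\<Phi> P = \<tau> ` S.core P"
  unfolding \<Phi>_def stratum_of_eq[OF P w] S.core_eq_char_core[OF P] ..

lemma Phi_spec: "\<Phi> P \<in> spec A"
  unfolding Phi_core spec_def using S.core_prime[OF P] by blast

lemma Phi_r: "i \<in> {1..n} \<Longrightarrow> \<tau> (r i) \<in> \<Phi> P \<longleftrightarrow> i \<in> w"
  unfolding Phi_core using tau_mem[OF S.core_carrier[OF P] r_closed] S.core_r[OF P] by blast

lemma Phi_subset: "\<Phi> P \<subseteq> \<tau> ` P"
  unfolding Phi_core using S.core_subset[OF P] by blast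

lemma Phi_largest:
  assumes I: "ideal I A" and IP: "I \<subseteq> \<tau> ` P" shows "I \<subseteq> \<Phi> P"
proof -
  let ?I = "{a \<in> carrier R. \<tau> a \<in> I}"
  note tI = tideal_preimage[OF I]
  have "?I \<subseteq> P" using IP tau_mem[OF S.stratum_subset[OF P]] by blast
  then have "?I \<subseteq> S.core P" by (rule S.core_largest[OF P tI(1)])
  then show ?thesis unfolding Phi_core using tI(2) by blast
qed

lemma Phi_orbit: "t \<in> T w \<Longrightarrow> \<Phi> (sg t ` P) = \<Phi> P"
proof -
  assume t: "t \<in> T w"
  then have "t \<in> chars G K" unfolding perp_def by blast
  then have "sg t ` P \<in> spec_stratum R n r w" using P by (rule S.image_spec_stratum)
  then have "\<Phi> (sg t ` P) = \<tau> ` S.core (sg t ` P)"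
    unfolding \<Phi>_def using stratum_of_eq[OF _ w] S.core_eq_char_core by simp
  then show ?thesis unfolding Phi_core S.core_orbit[OF t P] .
qed

lemma Phi_equivariant:
  assumes h: "h \<in> chars G K"
  shows "\<Phi> (sg h ` P) = char_act G A (\<lambda>x. \<tau> ` \<G> x) h ` \<Phi> P"
proof -
  have "sg h ` P \<in> spec_stratum R n r w" using h P by (rule S.image_spec_stratum)
  then have "\<Phi> (sg h ` P) = \<tau> ` S.core (sg h ` P)"
    unfolding \<Phi>_def using stratum_of_eq[OF _ w] S.core_eq_char_core by simp
  also have "\<dots> = \<tau> ` sg h ` S.core P" unfolding S.core_image[OF h P] ..
  also have "\<dots> = char_act G A (\<lambda>x. \<tau> ` \<G> x) h ` \<tau> ` S.core P"
    unfolding image_image using char_act_twist[OF h] S.core_carrier[OF P] by (intro image_cong) auto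
  finally show ?thesis unfolding Phi_core .
qed

end

lemma image_spec: "h \<in> chars G K \<Longrightarrow> P \<in> spec R \<Longrightarrow> sg h ` P \<in> spec R"
  unfolding R.spec_commutative using image_prime by blast

lemma image_max_spec: "h \<in> chars G K \<Longrightarrow> P \<in> max_spec R \<Longrightarrow> sg h ` P \<in> max_spec R"
  unfolding max_spec_def using image_maximal by blast

text \<open>The stratum of a preimage is dictated by which generators the given prime contains;
  \<open>exists_prime_above\<close> then works within that stratum.\<close>

lemma Phi_surj_spec:
  assumes Q: "Q \<in> spec A" shows "\<exists>P\<in>spec R. \<Phi> P = Q"
proof -
  let ?Q = "{a \<in> carrier R. \<tau> a \<in> Q}"
  define w where "w = {i \<in> {1..n}. r i \<in> ?Q}"
  have w: "w \<subseteq> {1..n}" unfolding w_def by blast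
  have pr: "prime_ideal Q A" using Q unfolding spec_def by blast
  have Qt: "\<tau> ` ?Q = Q" using pr tideal_preimage(2) unfolding prime_ideal_def by blast
  interpret S: stratum_algebra R K G \<G> n r \<delta> c A \<tau> w by (rule stratum[OF w])
  have tQ: "tprime ?Q" unfolding tprime_def Qt using pr by blast
  have Qr: "r i \<in> ?Q \<longleftrightarrow> i \<in> w" if "i \<in> {1..n}" for i unfolding w_def using that by blast
  have "\<exists>P\<in>spec_stratum R n r w. S.core P = ?Q" by (rule S.exists_prime_above[OF tQ Qr])
  then obtain P where P: "P \<in> spec_stratum R n r w" "S.core P = ?Q" by blast
  have "\<Phi> P = Q" unfolding Phi_core[OF P(1) w] P(2) by (rule Qt)
  then show ?thesis using spec_stratum_spec[OF P(1)] by blast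
qed

lemma max_stratum_of: "P \<in> max_spec R \<Longrightarrow> P \<in> max_stratum R n r (stratum_of P)"
  unfolding max_stratum_def using stratum_of_spec[OF max_in_spec] by blast

lemma Phi_prim:
  assumes P: "P \<in> max_spec R" shows "\<Phi> P \<in> prim A"
proof -
  note w = stratum_of_subset[of P]
  interpret S: stratum_algebra R K G \<G> n r \<delta> c A \<tau> "stratum_of P" by (rule stratum[OF w])
  show ?thesis
    unfolding Phi_core[OF stratum_of_spec[OF max_in_spec[OF P]] w]
    by (rule S.core_primitive[OF max_stratum_of[OF P]])
qed

lemma Phi_surj_prim:
  assumes Q: "Q \<in> prim A" shows "\<exists>P\<in>max_spec R. \<Phi> P = Q"
proof -
  obtain V :: "('a, 'a set) module" where V: "irreducible_module A V" "Q = annihilator A V"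
    using Q unfolding prim_def by blast
  have sV: "simple_module A V" using V(1) irreducible_module_iff by blast
  let ?Q = "{a \<in> carrier R. \<tau> a \<in> annihilator A V}"
  define w where "w = {i \<in> {1..n}. r i \<in> ?Q}"
  have w: "w \<subseteq> {1..n}" unfolding w_def by blast
  interpret S: stratum_algebra R K G \<G> n r \<delta> c A \<tau> w by (rule stratum[OF w])
  have Qr: "r i \<in> ?Q \<longleftrightarrow> i \<in> w" if "i \<in> {1..n}" for i unfolding w_def using that by blast
  have "\<exists>M\<in>max_stratum R n r w. S.core M = ?Q" by (rule S.exists_maximal_above[OF sV refl Qr])
  then obtain M where M: "M \<in> max_stratum R n r w" "S.core M = ?Q" by blast
  have MP: "M \<in> spec_stratum R n r w" using M(1) unfolding max_stratum_def by blast
  have "\<tau> ` ?Q = annihilator A V" by (rule S.annihilator_image[OF sV refl Qr])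
  then have "\<Phi> M = Q" unfolding Phi_core[OF MP w] M(2) V(2) .
  then show ?thesis using M(1) unfolding max_stratum_def by blast
qed

lemma Phi_stratum_of:
  assumes P: "P \<in> spec R" and N: "N \<in> spec R" and eq: "\<Phi> P = \<Phi> N" shows "stratum_of P = stratum_of N"
  using Phi_r[OF stratum_of_spec[OF P] stratum_of_subset] Phi_r[OF stratum_of_spec[OF N] stratum_of_subset] eq
    stratum_of_subset[of P] stratum_of_subset[of N] by blast

text \<open>The image determines the stratum by \<open>Phi_r\<close> and then the core, since
  \<open>\<tau>\<close> is injective. Maximal ideals with equal cores lie in one orbit by
  \<open>same_core_orbit\<close>, and \<open>Phi_orbit\<close> is the converse.\<close>

lemma Phi_fibre:
  assumes P: "P \<in> max_stratum R n r w" and w: "w \<subseteq> {1..n}"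
  shows "{N \<in> max_spec R. \<Phi> N = \<Phi> P} = char_orbit G R \<G> (T w) P"
proof (intro equalityI subsetI)
  have PS: "P \<in> spec_stratum R n r w" and PM: "P \<in> max_spec R" using P unfolding max_stratum_def by auto
  interpret S: stratum_algebra R K G \<G> n r \<delta> c A \<tau> w by (rule stratum[OF w])
  fix N
  show "N \<in> char_orbit G R \<G> (T w) P" if "N \<in> {N \<in> max_spec R. \<Phi> N = \<Phi> P}"
  proof -
    have N: "N \<in> max_spec R" "\<Phi> N = \<Phi> P" using that by auto
    have "stratum_of N = w"
      using Phi_stratum_of[OF max_in_spec[OF N(1)] max_in_spec[OF PM] N(2)] stratum_of_eq[OF PS w] by simp
    then have NM: "N \<in> max_stratum R n r w" using max_stratum_of[OF N(1)] by simp
    then have NS: "N \<in> spec_stratum R n r w" unfolding max_stratum_def by blast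
    have im: "\<tau> ` S.core N = \<tau> ` S.core P" using N(2) unfolding Phi_core[OF NS w] Phi_core[OF PS w] .
    have "S.core N = S.core P"
      using inj_on_image_eq_iff[OF bij_betw_imp_inj_on[OF tau_bij] S.core_carrier[OF NS] S.core_carrier[OF PS]] im by blast
    then show ?thesis unfolding char_orbit_def using S.same_core_orbit[OF NM P] by blast
  qed
  show "N \<in> {N \<in> max_spec R. \<Phi> N = \<Phi> P}" if N: "N \<in> char_orbit G R \<G> (T w) P"
  proof -
    obtain t where t: "t \<in> T w" "N = sg t ` P" using N unfolding char_orbit_def by blast
    have "t \<in> chars G K" using t(1) unfolding perp_def by blast
    then show ?thesis using image_max_spec[OF _ PM] Phi_orbit[OF PS w t(1)] t(2) by blast
  qed
qed

text \<open>The pull-back of a closed set is \<open>V(J)\<close> for an ideal \<open>J\<close>, so the orbits that it contains lie in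
  \<open>V(J)\<close> as well. Hence \<open>J\<close> is contained in each \<open>\<Phi>(P)\<close> with \<open>P \<in> V(J)\<close>. A prime \<open>Q\<close> containing the
  intersection of these \<open>\<Phi>(P)\<close> contains the intersection over one of the finitely many strata,
  hence contains \<open>J\<close>.\<close>

lemma quotient_map_Phi:
  assumes Z: "Z \<subseteq> spec R" and Y: "Y \<subseteq> spec A" and image: "\<Phi> ` Z = Y"
    and stable: "\<And>h P. h \<in> chars G K \<Longrightarrow> P \<in> Z \<Longrightarrow> sg h ` P \<in> Z"
  shows "quotient_map (subtopology (zariski R) Z) (subtopology (zariski A) Y) \<Phi>"
  unfolding quotient_map_closedin R.topspace_zariski_subset[OF Z] A.topspace_zariski_subset[OF Y]
    R.closedin_zariski_subset[OF Z] A.closedin_zariski_subset[OF Y]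
proof (intro conjI allI impI iffI)
  show "\<Phi> ` Z = Y" by (rule image)
  have ZS: "P \<in> spec_stratum R n r (stratum_of P)" if "P \<in> Z" for P using that Z stratum_of_spec by blast
  have sub: "\<Phi> P \<subseteq> \<tau> ` P" if "P \<in> Z" for P using Phi_subset[OF ZS[OF that] stratum_of_subset] .
  have id: "ideal (\<Phi> P) A" if "P \<in> Z" for P
    using Phi_spec[OF ZS[OF that] stratum_of_subset] unfolding spec_def prime_ideal_def by blast
  fix C assume CY: "C \<subseteq> Y"
  {
    assume "\<exists>J. ideal J R \<and> {P. P \<in> Z \<and> \<Phi> P \<in> C} = {P \<in> Z. J \<subseteq> P}"
    then obtain J where J: "ideal J R" and JC: "\<And>P. P \<in> Z \<Longrightarrow> \<Phi> P \<in> C \<longleftrightarrow> J \<subseteq> P" by blast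
    have Jc: "J \<subseteq> carrier R" using subspaceD(1)[OF ideal_subspace[OF J]] .
    \<comment> \<open>The candidate ideal \<open>D\<close> is cut up by strata because the group
      \<open>T w\<close>, and with it the orbit through P, depends on w.\<close>
    define I where "I w = carrier A \<inter> (\<Inter>P\<in>{P \<in> Z. J \<subseteq> P \<and> stratum_of P = w}. \<Phi> P)" for w
    define D where "D = carrier A \<inter> (\<Inter>P\<in>{P \<in> Z. J \<subseteq> P}. \<Phi> P)"
    have idI: "ideal (I w) A" for w unfolding I_def using id by (intro A.carrier_Inter_ideal) blast
    have idD: "ideal D A" unfolding D_def using id by (intro A.carrier_Inter_ideal) blast
    have JI: "\<tau> ` J \<subseteq> I w" for w
      unfolding I_def
    proof (intro Int_greatest INT_greatest)
      show "\<tau> ` J \<subseteq> carrier A" using Jc by auto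
      fix P assume "P \<in> {P \<in> Z. J \<subseteq> P \<and> stratum_of P = w}"
      then have P: "P \<in> Z" "J \<subseteq> P" "stratum_of P = w" by auto
      have PC: "\<Phi> P \<in> C" using JC[OF P(1)] P(2) by blast
      have "J \<subseteq> sg t ` P" if t: "t \<in> T w" for t
      proof -
        have tc: "t \<in> chars G K" using t unfolding perp_def by blast
        have "\<Phi> (sg t ` P) = \<Phi> P"
          by (rule Phi_orbit[OF ZS[OF P(1)] stratum_of_subset]) (use t P(3) in simp)
        then show ?thesis using JC[OF stable[OF tc P(1)]] PC by simp
      qed
      then show "\<tau> ` J \<subseteq> \<Phi> P" unfolding \<Phi>_def P(3) char_core_def by blast
    qed
    have "C = {Q \<in> Y. D \<subseteq> Q}"
    proof (intro equalityI subsetI)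
      fix Q assume Q: "Q \<in> C"
      then obtain P where P: "P \<in> Z" "Q = \<Phi> P" using CY image by blast
      then have "J \<subseteq> P" using JC[OF P(1)] Q by blast
      then have "D \<subseteq> Q" unfolding D_def P(2) using P(1) by blast
      then show "Q \<in> {Q \<in> Y. D \<subseteq> Q}" using Q CY by blast
    next
      fix Q assume "Q \<in> {Q \<in> Y. D \<subseteq> Q}"
      then have Q: "Q \<in> Y" "D \<subseteq> Q" by auto
      have pr: "prime_ideal Q A" using Q(1) Y unfolding spec_def by blast
      have "carrier A \<inter> (\<Inter>w\<in>Pow {1..n}. I w) \<subseteq> D"
      proof
        fix a assume a: "a \<in> carrier A \<inter> (\<Inter>w\<in>Pow {1..n}. I w)"
        have "a \<in> \<Phi> P" if P: "P \<in> Z" "J \<subseteq> P" for P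
        proof -
          have "a \<in> I (stratum_of P)" using a stratum_of_subset by blast
          then show ?thesis unfolding I_def using P by blast
        qed
        then show "a \<in> D" unfolding D_def using a by blast
      qed
      then have "carrier A \<inter> (\<Inter>w\<in>Pow {1..n}. I w) \<subseteq> Q" using Q(2) by blast
      then have "\<exists>w\<in>Pow {1..n}. I w \<subseteq> Q" using idI by (intro A.prime_ideal_Inter[OF pr]) auto
      then have JQ: "\<tau> ` J \<subseteq> Q" using JI by blast
      obtain P where P: "P \<in> Z" "Q = \<Phi> P" using Q(1) image by blast
      have "\<tau> ` J \<subseteq> \<tau> ` P" using JQ sub[OF P(1)] unfolding P(2) by blast
      then have "J \<subseteq> P" using tau_mem[OF spec_subset] P(1) Z Jc by blast
      then show "Q \<in> C" using JC[OF P(1)] P(2) by blast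
    qed
    then show "\<exists>I. ideal I A \<and> C = {Q \<in> Y. I \<subseteq> Q}" using idD by blast
  next
    assume "\<exists>I. ideal I A \<and> C = {Q \<in> Y. I \<subseteq> Q}"
    then obtain I where I: "ideal I A" and C: "C = {Q \<in> Y. I \<subseteq> Q}" by blast
    let ?I = "{a \<in> carrier R. \<tau> a \<in> I}"
    have Ic: "?I \<subseteq> carrier R" by blast
    have idI: "ideal (genideal R ?I) R" using Ic by (rule R.genideal_ideal)
    have "\<Phi> P \<in> C \<longleftrightarrow> genideal R ?I \<subseteq> P" if P: "P \<in> Z" for P
    proof -
      have PR: "P \<in> spec R" using P Z by blast
      have idP: "ideal P R" using PR unfolding R.spec_commutative using primeideal.axioms(1) by blast
      have "\<Phi> P \<in> C \<longleftrightarrow> I \<subseteq> \<Phi> P" unfolding C using image P by blast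
      also have "\<dots> \<longleftrightarrow> I \<subseteq> \<tau> ` P"
        using sub[OF P] Phi_largest[OF ZS[OF P] stratum_of_subset I] by blast
      also have "\<dots> \<longleftrightarrow> ?I \<subseteq> P"
        using tideal_preimage(2)[OF I] tau_mem[OF spec_subset[OF PR]] by blast
      also have "\<dots> \<longleftrightarrow> genideal R ?I \<subseteq> P" using R.Idl_subset_ideal[OF idP Ic] by blast
      finally show ?thesis .
    qed
    then have "{P. P \<in> Z \<and> \<Phi> P \<in> C} = {P \<in> Z. genideal R ?I \<subseteq> P}" by blast
    then show "\<exists>J. ideal J R \<and> {P. P \<in> Z \<and> \<Phi> P \<in> C} = {P \<in> Z. J \<subseteq> P}" using idI by blast
  }
qed

lemma quotient_map_spec: "quotient_map (zariski R) (zariski A) \<Phi>"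
proof -
  have "\<Phi> ` spec R = spec A"
    using Phi_spec[OF stratum_of_spec stratum_of_subset] Phi_surj_spec by blast
  then have "quotient_map (subtopology (zariski R) (spec R)) (subtopology (zariski A) (spec A)) \<Phi>"
    by (intro quotient_map_Phi image_spec subset_refl)
  then show ?thesis
    using subtopology_topspace[of "zariski R"] subtopology_topspace[of "zariski A"]
    unfolding R.topspace_zariski A.topspace_zariski by simp
qed

lemma quotient_map_max: "quotient_map (zariski_max R) (zariski_prim A) \<Phi>"
  unfolding zariski_max_def zariski_prim_def
proof (rule quotient_map_Phi)
  show "\<Phi> ` max_spec R = prim A" using Phi_prim Phi_surj_prim by blast
  show "max_spec R \<subseteq> spec R" using max_in_spec by blast
  show "prim A \<subseteq> spec A" using prim_imp_spec by blast
  show "sg h ` P \<in> max_spec R" if "h \<in> chars G K" "P \<in> max_spec R" for h P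
    using that by (rule image_max_spec)
qed

text \<open>\<open>Phi_fibre\<close> identifies single fibres with orbits; \<open>Phi_r\<close>
  matches the strata on the two sides, and surjectivity onto primitive ideals makes every fibre
  nonempty.\<close>

lemma fibres:
  assumes w: "w \<subseteq> {1..n}"
  shows "{{P \<in> max_spec R. \<Phi> P = Q} | Q. Q \<in> prim_stratum A n (\<lambda>i. \<tau> (r i)) w}
    = {char_orbit G R \<G> (T w) P | P. P \<in> max_stratum R n r w}"
proof (intro equalityI subsetI)
  fix F assume "F \<in> {{P \<in> max_spec R. \<Phi> P = Q} | Q. Q \<in> prim_stratum A n (\<lambda>i. \<tau> (r i)) w}"
  then obtain Q where Q: "Q \<in> prim A" "\<And>i. i \<in> {1..n} \<Longrightarrow> \<tau> (r i) \<in> Q \<longleftrightarrow> i \<in> w" and F: "F = {P \<in> max_spec R. \<Phi> P = Q}"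
    unfolding prim_stratum_def spec_stratum_def by blast
  obtain P where P: "P \<in> max_spec R" "\<Phi> P = Q" using Phi_surj_prim[OF Q(1)] by blast
  have "stratum_of P = w"
    using Phi_r[OF stratum_of_spec[OF max_in_spec[OF P(1)]] stratum_of_subset] Q(2) w stratum_of_subset[of P]
    unfolding P(2) by blast
  then have PM: "P \<in> max_stratum R n r w" using max_stratum_of[OF P(1)] by simp
  have "F = char_orbit G R \<G> (T w) P" unfolding F P(2)[symmetric] by (rule Phi_fibre[OF PM w])
  then show "F \<in> {char_orbit G R \<G> (T w) P | P. P \<in> max_stratum R n r w}" using PM by blast
next
  fix F assume "F \<in> {char_orbit G R \<G> (T w) P | P. P \<in> max_stratum R n r w}"
  then obtain P where P: "P \<in> max_stratum R n r w" and F: "F = char_orbit G R \<G> (T w) P" by blast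
  have PS: "P \<in> spec_stratum R n r w" and PM: "P \<in> max_spec R" using P unfolding max_stratum_def by auto
  have "\<Phi> P \<in> prim_stratum A n (\<lambda>i. \<tau> (r i)) w"
    unfolding prim_stratum_def spec_stratum_def using Phi_prim[OF PM] Phi_spec[OF PS w] Phi_r[OF PS w] by blast
  moreover have "F = {N \<in> max_spec R. \<Phi> N = \<Phi> P}" unfolding F by (rule Phi_fibre[OF P w, symmetric])
  ultimately show "F \<in> {{P \<in> max_spec R. \<Phi> P = Q} | Q. Q \<in> prim_stratum A n (\<lambda>i. \<tau> (r i)) w}" by blast
qed

end

theorem theorem4p5:
  fixes K :: "('k, 'l) ring_scheme"
    and G :: "('g, 'h) monoid_scheme"
    and R :: "('k, 'r, 'd) module_scheme"
    and A :: "('k, 'a, 'e) module_scheme"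
    and \<G> :: "'g \<Rightarrow> 'r set"
    and c :: "'g \<Rightarrow> 'g \<Rightarrow> 'k"
    and \<tau> :: "'r \<Rightarrow> 'a"
    and n :: nat
    and r :: "nat \<Rightarrow> 'r"
    and \<delta> :: "nat \<Rightarrow> 'g"
  assumes K: "algebraically_closed K"
    and G: "comm_group G"
    and R: "algebra K R"
    and grading: "graded_by G K R \<G>"
    and c: "alternating_bicharacter G K c"
    and A: "is_twist G K R \<G> c A \<tau>"
    and minus_one:
      "\<ominus>\<^bsub>K\<^esub> \<one>\<^bsub>K\<^esub> \<notin> generate (units_of K) {c x y | x y. x \<in> carrier G \<and> y \<in> carrier G}
        \<or> ring_char K = 2"
    and degrees: "\<forall>i\<in>{1..n}. \<delta> i \<in> carrier G \<and> r i \<in> \<G> (\<delta> i)"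
    and generators: "algebra_generated K R (r ` {1..n}) = carrier R"
  shows "\<exists>\<phi>\<^sub>s \<phi>\<^sub>m.
    quotient_map (zariski R) (zariski A) \<phi>\<^sub>s \<and>
    quotient_map (zariski_max R) (zariski_prim A) \<phi>\<^sub>m \<and>
    (\<forall>h\<in>chars G K. \<forall>P\<in>spec R.
       \<phi>\<^sub>s (char_act G R \<G> h ` P) = char_act G A (\<lambda>x. \<tau> ` \<G> x) h ` \<phi>\<^sub>s P) \<and>
    (\<forall>h\<in>chars G K. \<forall>P\<in>max_spec R.
       \<phi>\<^sub>m (char_act G R \<G> h ` P) = char_act G A (\<lambda>x. \<tau> ` \<G> x) h ` \<phi>\<^sub>m P) \<and>
    (\<forall>w\<subseteq>{1..n}.
       (\<forall>P\<in>spec_stratum R n r w.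
          \<phi>\<^sub>s P = \<tau> ` char_core G R \<G> P (perp G K (stratum_rad G K c n \<delta> w))) \<and>
       (\<forall>P\<in>max_stratum R n r w.
          \<phi>\<^sub>m P = \<tau> ` char_core G R \<G> P (perp G K (stratum_rad G K c n \<delta> w)))) \<and>
    (\<forall>P\<in>spec R. ideal (\<phi>\<^sub>s P) A \<and> \<phi>\<^sub>s P \<subseteq> \<tau> ` P \<and>
       (\<forall>I. ideal I A \<and> I \<subseteq> \<tau> ` P \<longrightarrow> I \<subseteq> \<phi>\<^sub>s P)) \<and>
    (\<forall>w\<subseteq>{1..n}.
       {{P \<in> max_spec R. \<phi>\<^sub>m P = Q} | Q. Q \<in> prim_stratum A n (\<lambda>i. \<tau> (r i)) w}
       = {char_orbit G R \<G> (perp G K (stratum_rad G K c n \<delta> w)) P | P. P \<in> max_stratum R n r w})"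
proof -
  interpret twisted_spectra R K G \<G> n r \<delta> c A \<tau>
    using K G R grading c A minus_one degrees generators
    by (intro twisted_spectra.intro twisted_spectra_axioms.intro twisted_algebra.intro twisted_algebra_axioms.intro
        generated_algebra.intro generated_algebra_axioms.intro graded_algebra.intro)
  have spec: "P \<in> spec_stratum R n r (stratum_of P)" if "P \<in> spec R" for P
    using that by (rule stratum_of_spec)
  have equivariant: "\<Phi> (char_act G R \<G> h ` P) = char_act G A (\<lambda>x. \<tau> ` \<G> x) h ` \<Phi> P"
    if "h \<in> chars G K" "P \<in> spec R" for h P
    using Phi_equivariant[OF spec[OF that(2)] stratum_of_subset that(1)] .
  have formula: "\<Phi> P = \<tau> ` char_core G R \<G> P (perp G K (stratum_rad G K c n \<delta> w))"
    if "w \<subseteq> {1..n}" "P \<in> spec_stratum R n r w" for w P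
    unfolding \<Phi>_def stratum_of_eq[OF that(2,1)] ..
  have largest: "ideal (\<Phi> P) A \<and> \<Phi> P \<subseteq> \<tau> ` P \<and> (\<forall>I. ideal I A \<and> I \<subseteq> \<tau> ` P \<longrightarrow> I \<subseteq> \<Phi> P)"
    if "P \<in> spec R" for P
    using Phi_spec[OF spec[OF that] stratum_of_subset] Phi_subset[OF spec[OF that] stratum_of_subset]
      Phi_largest[OF spec[OF that] stratum_of_subset] unfolding spec_def prime_ideal_def by blast
  show ?thesis
  proof (rule exI[of _ \<Phi>], rule exI[of _ \<Phi>], intro conjI)
    show "quotient_map (zariski R) (zariski A) \<Phi>" by (rule quotient_map_spec)
    show "quotient_map (zariski_max R) (zariski_prim A) \<Phi>" by (rule quotient_map_max)
    show "\<forall>h\<in>chars G K. \<forall>P\<in>max_spec R.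
      \<Phi> (char_act G R \<G> h ` P) = char_act G A (\<lambda>x. \<tau> ` \<G> x) h ` \<Phi> P"
      using equivariant max_in_spec by blast
    show "\<forall>w\<subseteq>{1..n}.
       (\<forall>P\<in>spec_stratum R n r w. \<Phi> P = \<tau> ` char_core G R \<G> P (perp G K (stratum_rad G K c n \<delta> w))) \<and>
       (\<forall>P\<in>max_stratum R n r w. \<Phi> P = \<tau> ` char_core G R \<G> P (perp G K (stratum_rad G K c n \<delta> w)))"
      using formula unfolding max_stratum_def by blast
    show "\<forall>w\<subseteq>{1..n}.
       {{P \<in> max_spec R. \<Phi> P = Q} | Q. Q \<in> prim_stratum A n (\<lambda>i. \<tau> (r i)) w}
       = {char_orbit G R \<G> (perp G K (stratum_rad G K c n \<delta> w)) P | P. P \<in> max_stratum R n r w}"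
      using fibres by blast
    show "\<forall>h\<in>chars G K. \<forall>P\<in>spec R.
      \<Phi> (char_act G R \<G> h ` P) = char_act G A (\<lambda>x. \<tau> ` \<G> x) h ` \<Phi> P"
      using equivariant by blast
    show "\<forall>P\<in>spec R. ideal (\<Phi> P) A \<and> \<Phi> P \<subseteq> \<tau> ` P \<and>
       (\<forall>I. ideal I A \<and> I \<subseteq> \<tau> ` P \<longrightarrow> I \<subseteq> \<Phi> P)"
      using largest by (rule ballI)
  qed
qed

end
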